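(* Let $T>0$, let $\mathfrak{L}$ be a family of LPV systems, $\Phi$ a set of scheduling maps, and $\mathfrak{S}$ a family of nonlinear systems embedded into $\mathfrak{L}$ via $\Phi$, all as defined in the context. Assume: (1) There exists $\lambda\ge n_p$ such that for every $\Sigma\in\mathfrak{L}$, with matrices $(A_i,B_i,C_i)_{i=0}^{n_p}$, there exists $Q\succ0$ with $$A_0^TQ+QA_0+\sum_{i=1}^{n_p}A_i^TQA_i+\sum_{i=1}^{n_p}C_i^TC_i+C_0^TC_0\prec-\lambda Q .$$ (2) The loss $\ell:\mathbb{R}\times\mathbb{R}\to\mathbb{R}$ is $K_\ell$-Lipschitz continuous and $\ell(y,y)=0$ for all $y\in\mathbb{R}$. (3) There exist constants $L_{\mathbf u},K_{\mathbf u},c_1,c_2>0$ such that $\sup_{\Sigma\in\mathfrak{L}}\|\Sigma\|_{\lambda,H_2}=c_1$ and, for almost every sample $(\mathbf u,y)$ from the data distribution, $\sup_{t\in[0,T]}\|\mathbf u(t)\|_2\le K_{\mathbf u}$, $\|\mathbf u\|_{L_2([0,T],\mathbb{R}^{n_{in}})}\le L_{\mathbf u}$ and $|y|<c_2$. (4) Either $\Phi$ is finite, or for any $T>0$ the set $\Phi_T=\{(\mathbf u,\phi(\mathbf u))\mid\mathbf u\in L_2([0,T],\mathbb{R}^{n_{in}}),\ \phi\in\Phi\}$ has a finite VC dimension $d_T$. Then for every $\delta\in(0,1)$ and every sample size $N\ge1$, with $\mathbf S=\{(\mathbf u_i,y_i)\}_{i=1}^N$ an i.i.d. sample from the data distribution,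 $$\mathbb{P}_{\mathbf S}\Big(\forall\,\mathcal{S}\in\mathfrak{S}:\ \mathcal{L}(\mathcal{S})-\mathcal{L}_N(\mathcal{S})\le\bar R(T,N,\delta)\Big)\ge1-\delta,$$ where $\bar R(T,N,\delta)$ is defined as follows. If $\Phi$ is finite, then $$\bar R(T,N,\delta)=\frac{2\,\mathrm{card}(\Phi)\,K_\ell c_1L_{\mathbf u}(n_p+1)}{\sqrt N}+B(T)\sqrt{\frac{2\ln(2/\delta)}{N}} .$$ If $\Phi$ is possibly infinite, but $\Phi_T$ has finite VC dimension $d_T$, then (whenever the expression is defined) $$\bar R(T,N,\delta)=\sqrt2\,B(T)\Big(2+\sqrt{\log(2eN/d_T)\,d_T}\Big)+\frac{2K_\ell c_1L_{\mathbf u}(n_p+1)}{\sqrt N}+B(T)\sqrt{\frac{2\ln(2/\delta)}{\sqrt N}} .$$ Here $B(T)$ is an upper bound on the (absolute value of the) loss at time $T$, i.e. on $|\ell(y,y_\Sigma(\mathbf u,\phi(\mathbf u))(T))|$ for all $\Sigma\in\mathfrak{L}$, $\phi\in\Phi$ and almost every sample $(\mathbf u,y)$, with $B(T)\le2K_\ell\max\{c_2,c_1L_{\mathbf u}\}$.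
   Context: LPV systems. An LPV system $\Sigma$ with scalar output is given by constant matrices $A_i\in\mathbb{R}^{n_x\times n_x}$, $B_i\in\mathbb{R}^{n_x\times n_{in}}$, $C_i\in\mathbb{R}^{1\times n_x}$, $i=0,\dots,n_p$. For an input $\mathbf u:[0,T]\to\mathbb{R}^{n_{in}}$ and a piecewise continuous scheduling signal $\mathbf p=(p_1,\dots,p_{n_p})^T:[0,T]\to[-1,1]^{n_p}$, its output is $$\dot{\mathbf x}(t)=A(\mathbf p(t))\mathbf x(t)+B(\mathbf p(t))\mathbf u(t),\quad \mathbf x(0)=0,\quad y_\Sigma(\mathbf u,\mathbf p)(t)=C(\mathbf p(t))\mathbf x(t),$$ where $A(\mathbf p(t))=A_0+\sum_{i=1}^{n_p}p_i(t)A_i$, $B(\mathbf p(t))=B_0+\sum_{i=1}^{n_p}p_i(t)B_i$, $C(\mathbf p(t))=C_0+\sum_{i=1}^{n_p}p_i(t)C_i$; $\mathbf x$ is absolutely continuous. Weighted $H_2$ norm. For $i_u,i_y\in\{0,\dots,n_p\}$, $k\ge1$, $i_1,\dots,i_k\in\{1,\dots,n_p\}$ and $t\ge\tau_k\ge\dots\ge\tau_1\ge0$ put $$w_{i_u,i_y}(t)=C_{i_y}e^{A_0t}B_{i_u},$$ $$w_{i_1,\dots,i_k,i_u,i_y}(t,\tau_1,\dots,\tau_k)=C_{i_y}e^{A_0(t-\tau_k)}A_{i_k}e^{A_0(\tau_k-\tau_{k-1})}\cdots A_{i_1}e^{A_0\tau_1}B_{i_u}.$$ Then $\|\Sigma\|_{\lambda,H_2}\ge0$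 is defined by $$\|\Sigma\|_{\lambda,H_2}^2=\sum_{i_y,i_u=0}^{n_p}\Big(\int_0^\infty\|w_{i_u,i_y}(t)\|_2^2e^{\lambda t}dt+\sum_{k=1}^\infty\sum_{i_1,\dots,i_k=1}^{n_p}\int_0^\infty\int_0^t\int_0^{\tau_k}\cdots\int_0^{\tau_2}\|w_{i_1,\dots,i_k,i_u,i_y}(t,\tau_1,\dots,\tau_k)\|_2^2\,e^{\lambda t}\,d\tau_1\cdots d\tau_k\,dt\Big).$$ Nonlinear systems and embedding. $\Phi$ is a set of maps $\phi:L_2([0,+\infty),\mathbb{R}^{n_{in}})\to PC([0,+\infty),[-1,1]^{n_p})$, where $PC$ denotes piecewise continuous functions; an input on $[0,T]$ is identified with its extension by $0$ to $[0,+\infty)$. $\mathfrak{S}$ is a family of systems $\mathcal{S}$ of the form $\dot{\mathbf x}(t)=f(\mathbf x(t),\mathbf u(t))$, $\mathbf x(0)=0$, $y_{\mathcal S}(\mathbf u)(t)=h(\mathbf x(t))$, with scalar output, such that for every $\mathcal{S}\in\mathfrak{S}$ there exist $\Sigma_{\mathcal S}\in\mathfrak{L}$ and $\phi\in\Phi$ with $y_{\mathcal S}(\mathbf u)=y_{\Sigma_{\mathcal S}}(\mathbf u,\phi(\mathbf u))$ on $[0,T]$ for every $\mathbf u\in L_2([0,T],\mathbb{R}^{n_{in}})$. The VC dimension of $\Phi_T$ is understood as the VC dimension of the class of graphs $\{(\mathbf u,\phi(\mathbf u)):\mathbf u\in L_2([0,T],\mathbb{R}^{n_{in}})\}$, indexed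 by $\phi\in\Phi$. Learning problem. The data distribution is an unknown probability distribution of pairs $(\mathbf u,y)$ of an input and a label $y\in\mathbb{R}$. For an i.i.d. sample $\{(\mathbf u_i,y_i)\}_{i=1}^N$, $\mathcal{L}_N(\mathcal{S})=\frac1N\sum_{i=1}^N\ell(y_i,y_{\mathcal S}(\mathbf u_i)(T))$ and $\mathcal{L}(\mathcal{S})=\mathbb{E}[\ell(y,y_{\mathcal S}(\mathbf u)(T))]$, the expectation being over $(\mathbf u,y)$ drawn from the data distribution. Measurability of the quantities involved is implicitly assumed. Lipschitz continuity on $\mathbb{R}\times\mathbb{R}$ is with respect to the Euclidean norm.
   Formalization: An upper bound B(T) on the loss with B(T) ≤ 2K_ℓ max{c2, c1 L_u} need not exist under (1)–(4) (the output is only bounded by (n_p+1)c1 L_u), so its existence is assumed: the result is stated for every number B(T) with both properties. *)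

theory Defs
  imports
    "HOL-Probability.Probability"
    "Jordan_Normal_Form.Matrix"
begin

text \<open>
  The state dimension may differ from system to system inside one family, so matrices and
  vectors are the dimension-carrying ones of \<^theory>\<open>Jordan_Normal_Form.Matrix\<close>. Their entries
  are numbered from 0: the scheduling coordinate written $p_i$, $1 \le i \le n_p$, is entry
  $i - 1$ of the vector $p$.
\<close>

type_synonym rvec = "real Matrix.vec"
type_synonym rmat = "real Matrix.mat"
type_synonym signal = "real \<Rightarrow> rvec"


section \<open>Matrices\<close>

definition mat_sum :: "nat \<Rightarrow> nat \<Rightarrow> 'i set \<Rightarrow> ('i \<Rightarrow> rmat) \<Rightarrow> rmat" where
  "mat_sum r c I M = Matrix.mat r c (\<lambda>(a, b). \<Sum>i\<in>I. M i $$ (a, b))"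

definition mat_exp :: "rmat \<Rightarrow> rmat" where
  "mat_exp M = Matrix.mat (dim_row M) (dim_col M)
     (\<lambda>(a, b). \<Sum>k. (M ^\<^sub>m k) $$ (a, b) / fact k)"

definition pos_def :: "nat \<Rightarrow> rmat \<Rightarrow> bool" where
  "pos_def n Q \<longleftrightarrow> Q \<in> carrier_mat n n \<and> transpose_mat Q = Q \<and>
     (\<forall>v\<in>carrier_vec n. v \<noteq> 0\<^sub>v n \<longrightarrow> 0 < scalar_prod v (Q *\<^sub>v v))"

text \<open>The strict Loewner order $X \prec Y$.\<close>

definition loewner_less :: "nat \<Rightarrow> rmat \<Rightarrow> rmat \<Rightarrow> bool" where
  "loewner_less n X Y \<longleftrightarrow>
     X \<in> carrier_mat n n \<and> Y \<in> carrier_mat n n \<and> pos_def n (Y - X)"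

definition vnorm :: "rvec \<Rightarrow> real" where
  "vnorm v = sqrt (scalar_prod v v)"


section \<open>Signals\<close>

text \<open>
  Square-integrable signals on $S$ are represented by functions on the whole line that vanish
  outside $S$. In this way a signal on $[0,T]$ is literally the same object as its extension by
  0 to $[0,\infty)$.
\<close>

definition L2_on :: "nat \<Rightarrow> real set \<Rightarrow> signal set" where
  "L2_on n S = {u.
     (\<forall>t. u t \<in> carrier_vec n) \<and> (\<forall>t. t \<notin> S \<longrightarrow> u t = 0\<^sub>v n) \<and>
     (\<forall>i<n. (\<lambda>t. vec_index (u t) i) \<in> borel_measurable lebesgue) \<and>
     integrable lebesgue (\<lambda>t. (vnorm (u t))\<^sup>2)}"

definition L2_norm_on :: "real set \<Rightarrow> signal \<Rightarrow> real" where
  "L2_norm_on S u = sqrt (LINT t:S|lebesgue. (vnorm (u t))\<^sup>2)"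

text \<open>
  Piecewise continuous on $[0,\infty)$: finitely many discontinuities on bounded intervals, and
  one-sided limits everywhere.
\<close>

definition piecewise_continuous :: "(real \<Rightarrow> real) \<Rightarrow> bool" where
  "piecewise_continuous f \<longleftrightarrow>
     (\<forall>b. finite {t\<in>{0..b}. \<not> continuous (at t within {0..}) f}) \<and>
     (\<forall>t\<ge>0. \<exists>l. (f \<longlongrightarrow> l) (at_right t)) \<and>
     (\<forall>t>0. \<exists>l. (f \<longlongrightarrow> l) (at_left t))"

definition sched_cube :: "nat \<Rightarrow> rvec set" where
  "sched_cube np = {v\<in>carrier_vec np. \<forall>i<np. vec_index v i \<in> {-1..1}}"

definition PC_sched :: "nat \<Rightarrow> signal set" where
  "PC_sched np = {p \<in> {0..} \<rightarrow>\<^sub>E sched_cube np.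
     \<forall>i<np. piecewise_continuous (\<lambda>t. vec_index (p t) i)}"

text \<open>
  Maps from $L_2([0,\infty))$ to piecewise continuous signals. Elements of $L_2$ are classes
  modulo equality almost everywhere, so the map must not depend on the representative. The
  extensional function spaces make two maps equal iff they agree on $L_2$, which matters for
  cardinalities.
\<close>

definition sched_maps :: "nat \<Rightarrow> nat \<Rightarrow> (signal \<Rightarrow> signal) set" where
  "sched_maps np nin = {\<phi> \<in> L2_on nin {0..} \<rightarrow>\<^sub>E PC_sched np.
     \<forall>u\<in>L2_on nin {0..}. \<forall>v\<in>L2_on nin {0..}.
       (AE t in lebesgue. u t = v t) \<longrightarrow> \<phi> u = \<phi> v}"


section \<open>Caratheodory solutions\<close>

definition abs_continuous_on :: "real \<Rightarrow> real \<Rightarrow> (real \<Rightarrow> real) \<Rightarrow> bool" where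
  "abs_continuous_on a b f \<longleftrightarrow>
     (\<forall>\<epsilon>>0. \<exists>\<delta>>0. \<forall>(m::nat) l r.
        (\<forall>j<m. a \<le> l j \<and> l j \<le> r j \<and> r j \<le> b) \<longrightarrow>
        disjoint_family_on (\<lambda>j. {l j<..<r j}) {..<m} \<longrightarrow>
        (\<Sum>j<m. r j - l j) < \<delta> \<longrightarrow>
        (\<Sum>j<m. \<bar>f (r j) - f (l j)\<bar>) < \<epsilon>)"

definition ode_solution :: "nat \<Rightarrow> real \<Rightarrow> (real \<Rightarrow> rvec \<Rightarrow> rvec) \<Rightarrow> signal \<Rightarrow> bool" where
  "ode_solution n T F x \<longleftrightarrow>
     (\<forall>t\<in>{0..T}. x t \<in> carrier_vec n) \<and>
     (\<forall>i<n. abs_continuous_on 0 T (\<lambda>t. vec_index (x t) i)) \<and>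
     x 0 = 0\<^sub>v n \<and>
     (AE t in lebesgue. t \<in> {0..T} \<longrightarrow>
        (\<forall>i<n. ((\<lambda>s. vec_index (x s) i) has_real_derivative vec_index (F t (x t)) i)
                 (at t within {0..T})))"


section \<open>LPV systems\<close>

record lpv =
  nx :: nat
  lA :: "nat \<Rightarrow> rmat"
  lB :: "nat \<Rightarrow> rmat"
  lC :: "nat \<Rightarrow> rmat"

definition lpv_system :: "nat \<Rightarrow> nat \<Rightarrow> lpv \<Rightarrow> bool" where
  "lpv_system np nin \<Sigma> \<longleftrightarrow> (\<forall>i\<le>np.
     lA \<Sigma> i \<in> carrier_mat (nx \<Sigma>) (nx \<Sigma>) \<and>
     lB \<Sigma> i \<in> carrier_mat (nx \<Sigma>) nin \<and>
     lC \<Sigma> i \<in> carrier_mat 1 (nx \<Sigma>))"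

text \<open>$M(p) = M_0 + \sum_{i=1}^{n_p} p_i M_i$.\<close>

definition affine_mat :: "nat \<Rightarrow> (nat \<Rightarrow> rmat) \<Rightarrow> rvec \<Rightarrow> rmat" where
  "affine_mat np M p =
     M 0 + mat_sum (dim_row (M 0)) (dim_col (M 0)) {1..np} (\<lambda>i. vec_index p (i - 1) \<cdot>\<^sub>m M i)"

definition lpv_solution :: "nat \<Rightarrow> real \<Rightarrow> lpv \<Rightarrow> signal \<Rightarrow> signal \<Rightarrow> signal \<Rightarrow> bool" where
  "lpv_solution np T \<Sigma> u p = ode_solution (nx \<Sigma>) T
     (\<lambda>t \<xi>. affine_mat np (lA \<Sigma>) (p t) *\<^sub>v \<xi> + affine_mat np (lB \<Sigma>) (p t) *\<^sub>v u t)"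

text \<open>The output at time $t \in [0,T]$; the solution on $[0,T]$ exists and is unique.\<close>

definition lpv_output :: "nat \<Rightarrow> real \<Rightarrow> lpv \<Rightarrow> signal \<Rightarrow> signal \<Rightarrow> real \<Rightarrow> real" where
  "lpv_output np T \<Sigma> u p t = (THE y. \<exists>x. lpv_solution np T \<Sigma> u p x \<and>
     y = vec_index (affine_mat np (lC \<Sigma>) (p t) *\<^sub>v x t) 0)"

definition lpv_lmi :: "nat \<Rightarrow> real \<Rightarrow> lpv \<Rightarrow> bool" where
  "lpv_lmi np lam \<Sigma> \<longleftrightarrow> (\<exists>Q. pos_def (nx \<Sigma>) Q \<and>
     loewner_less (nx \<Sigma>)
       (transpose_mat (lA \<Sigma> 0) * Q + Q * lA \<Sigma> 0
        + mat_sum (nx \<Sigma>) (nx \<Sigma>) {1..np} (\<lambda>i. transpose_mat (lA \<Sigma> i) * Q * lA \<Sigma> i)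
        + mat_sum (nx \<Sigma>) (nx \<Sigma>) {1..np} (\<lambda>i. transpose_mat (lC \<Sigma> i) * lC \<Sigma> i)
        + transpose_mat (lC \<Sigma> 0) * lC \<Sigma> 0)
       ((- lam) \<cdot>\<^sub>m Q))"


section \<open>The weighted $H_2$ norm\<close>

text \<open>
  The indices and times $(i_k, \tau_k), \dots, (i_1, \tau_1)$ are listed with the highest
  subscript first, which is the order both of the matrix product and of the nested integrals.
  \<^term>\<open>lpv_state_kernel\<close> is the part of the kernel to the right of $C_{i_y}$; the empty list is
  the case without $\tau$.
\<close>

fun lpv_state_kernel :: "lpv \<Rightarrow> nat \<Rightarrow> real \<Rightarrow> (nat \<times> real) list \<Rightarrow> rmat" where
  "lpv_state_kernel \<Sigma> iu t [] = mat_exp (t \<cdot>\<^sub>m lA \<Sigma> 0) * lB \<Sigma> iu"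
| "lpv_state_kernel \<Sigma> iu t ((i, \<tau>) # rest) =
     mat_exp ((t - \<tau>) \<cdot>\<^sub>m lA \<Sigma> 0) * lA \<Sigma> i * lpv_state_kernel \<Sigma> iu \<tau> rest"

definition lpv_kernel :: "lpv \<Rightarrow> nat \<Rightarrow> nat \<Rightarrow> real \<Rightarrow> (nat \<times> real) list \<Rightarrow> rmat" where
  "lpv_kernel \<Sigma> iu iy t its = lC \<Sigma> iy * lpv_state_kernel \<Sigma> iu t its"

text \<open>
  $\int_0^t \int_0^{\tau_k} \cdots \int_0^{\tau_2} F\,[\tau_k,\dots,\tau_1]\,
  d\tau_1 \cdots d\tau_k$
\<close>

fun nested_integral :: "nat \<Rightarrow> (real list \<Rightarrow> ennreal) \<Rightarrow> real \<Rightarrow> ennreal" where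
  "nested_integral 0 F t = F []"
| "nested_integral (Suc k) F t =
     (\<integral>\<^sup>+\<tau>\<in>{0..t}. nested_integral k (\<lambda>\<tau>s. F (\<tau> # \<tau>s)) \<tau> \<partial>lborel)"

text \<open>The kernel is a row vector, so its 2-norm is the norm of its row 0.\<close>

definition h2_norm_sq :: "nat \<Rightarrow> real \<Rightarrow> lpv \<Rightarrow> ennreal" where
  "h2_norm_sq np lam \<Sigma> = (\<Sum>iy\<le>np. \<Sum>iu\<le>np.
     (\<integral>\<^sup>+t\<in>{0..}. ennreal ((vnorm (row (lpv_kernel \<Sigma> iu iy t []) 0))\<^sup>2 * exp (lam * t)) \<partial>lborel)
     + (\<Sum>k. \<Sum>is | set is \<subseteq> {1..np} \<and> length is = Suc k.
         (\<integral>\<^sup>+t\<in>{0..}. nested_integral (Suc k)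
            (\<lambda>\<tau>s. ennreal ((vnorm (row (lpv_kernel \<Sigma> iu iy t (zip is \<tau>s)) 0))\<^sup>2 * exp (lam * t))) t
          \<partial>lborel)))"

definition h2_norm :: "nat \<Rightarrow> real \<Rightarrow> lpv \<Rightarrow> ennreal" where
  "h2_norm np lam \<Sigma> = (if h2_norm_sq np lam \<Sigma> = \<infinity> then \<infinity>
     else ennreal (sqrt (enn2real (h2_norm_sq np lam \<Sigma>))))"


section \<open>Nonlinear systems\<close>

record nlsys =
  ndim :: nat
  nf :: "rvec \<Rightarrow> rvec \<Rightarrow> rvec"
  nh :: "rvec \<Rightarrow> real"

definition nl_system :: "nat \<Rightarrow> nlsys \<Rightarrow> bool" where
  "nl_system nin \<S> \<longleftrightarrow>
     (\<forall>\<xi>\<in>carrier_vec (ndim \<S>). \<forall>v\<in>carrier_vec nin. nf \<S> \<xi> v \<in> carrier_vec (ndim \<S>))"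

definition nl_solution :: "real \<Rightarrow> nlsys \<Rightarrow> signal \<Rightarrow> signal \<Rightarrow> bool" where
  "nl_solution T \<S> u = ode_solution (ndim \<S>) T (\<lambda>t \<xi>. nf \<S> \<xi> (u t))"

definition nl_output :: "real \<Rightarrow> nlsys \<Rightarrow> signal \<Rightarrow> real \<Rightarrow> real" where
  "nl_output T \<S> u t = (THE y. \<exists>x. nl_solution T \<S> u x \<and> y = nh \<S> (x t))"

definition embedded ::
  "nat \<Rightarrow> nat \<Rightarrow> real \<Rightarrow> nlsys set \<Rightarrow> lpv set \<Rightarrow> (signal \<Rightarrow> signal) set \<Rightarrow> bool" where
  "embedded np nin T \<SS> \<LL> \<Phi> \<longleftrightarrow>
     (\<forall>\<S>\<in>\<SS>. \<exists>\<Sigma>\<in>\<LL>. \<exists>\<phi>\<in>\<Phi>. \<forall>u\<in>L2_on nin {0..T}. \<forall>t\<in>{0..T}.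
        nl_output T \<S> u t = lpv_output np T \<Sigma> u (\<phi> u) t)"


section \<open>VC dimension\<close>

definition shatters :: "'a set set \<Rightarrow> 'a set \<Rightarrow> bool" where
  "shatters \<C> A \<longleftrightarrow> (\<forall>B\<subseteq>A. \<exists>X\<in>\<C>. A \<inter> X = B)"

definition has_vc_dim :: "'a set set \<Rightarrow> nat \<Rightarrow> bool" where
  "has_vc_dim \<C> d \<longleftrightarrow>
     (\<exists>A. finite A \<and> card A = d \<and> shatters \<C> A) \<and>
     (\<forall>A. finite A \<and> shatters \<C> A \<longrightarrow> card A \<le> d)"

definition sched_graphs ::
  "nat \<Rightarrow> real \<Rightarrow> (signal \<Rightarrow> signal) set \<Rightarrow> (signal \<times> signal) set set" where
  "sched_graphs nin T \<Phi> = (\<lambda>\<phi>. {(u, \<phi> u) |u. u \<in> L2_on nin {0..T}}) ` \<Phi>"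


section \<open>Risks and bounds\<close>

definition loss_at :: "(real \<Rightarrow> real \<Rightarrow> real) \<Rightarrow> real \<Rightarrow> nlsys \<Rightarrow> signal \<times> real \<Rightarrow> real" where
  "loss_at loss T \<S> = (\<lambda>(u, y). loss y (nl_output T \<S> u T))"

definition true_risk ::
  "(signal \<times> real) measure \<Rightarrow> (real \<Rightarrow> real \<Rightarrow> real) \<Rightarrow> real \<Rightarrow> nlsys \<Rightarrow> real" where
  "true_risk D loss T \<S> = integral\<^sup>L D (loss_at loss T \<S>)"

definition emp_risk ::
  "nat \<Rightarrow> (real \<Rightarrow> real \<Rightarrow> real) \<Rightarrow> real \<Rightarrow> (nat \<Rightarrow> signal \<times> real) \<Rightarrow> nlsys \<Rightarrow> real" where
  "emp_risk N loss T \<omega> \<S> = (\<Sum>i<N. loss_at loss T \<S> (\<omega> i)) / real N"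

definition iid_sample ::
  "(signal \<times> real) measure \<Rightarrow> nat \<Rightarrow> (nat \<Rightarrow> signal \<times> real) measure" where
  "iid_sample D N = Pi\<^sub>M {..<N} (\<lambda>_. D)"

text \<open>The samples on which the generalization gap is at most $r$ uniformly over $\SS$.\<close>

definition gap_event ::
  "(signal \<times> real) measure \<Rightarrow> nat \<Rightarrow> (real \<Rightarrow> real \<Rightarrow> real) \<Rightarrow> real \<Rightarrow> nlsys set \<Rightarrow> real
     \<Rightarrow> (nat \<Rightarrow> signal \<times> real) set" where
  "gap_event D N loss T \<SS> r =
     {\<omega> \<in> space (iid_sample D N). \<forall>\<S>\<in>\<SS>. true_risk D loss T \<S> - emp_risk N loss T \<omega> \<S> \<le> r}"

definition Rbar_finite ::
  "nat \<Rightarrow> nat \<Rightarrow> real \<Rightarrow> real \<Rightarrow> real \<Rightarrow> real \<Rightarrow> nat \<Rightarrow> real \<Rightarrow> real" where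
  "Rbar_finite card\<Phi> np K c\<^sub>1 L\<^sub>u B N \<delta> =
     2 * real card\<Phi> * K * c\<^sub>1 * L\<^sub>u * (real np + 1) / sqrt (real N)
     + B * sqrt (2 * ln (2 / \<delta>) / real N)"

definition Rbar_vc ::
  "nat \<Rightarrow> nat \<Rightarrow> real \<Rightarrow> real \<Rightarrow> real \<Rightarrow> real \<Rightarrow> nat \<Rightarrow> real \<Rightarrow> real" where
  "Rbar_vc d np K c\<^sub>1 L\<^sub>u B N \<delta> =
     sqrt 2 * B * (2 + sqrt (ln (2 * exp 1 * real N / real d) * real d))
     + 2 * K * c\<^sub>1 * L\<^sub>u * (real np + 1) / sqrt (real N)
     + B * sqrt (2 * ln (2 / \<delta>) / sqrt (real N))"

end

theory Submission imports Defs begin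

text \<open>
  The output at time T of a sample under a scheduling map is a Dyson series over words, hence formally an
  inner product of the system's weighted impulse responses, of norm at most c_1, with a vector built from
  the sample alone, whose squared norm is at most ((n_p + 1) L_u)^2 because lam is at least n_p. No Hilbert
  space is constructed: the Cauchy-Schwarz inequality is obtained from the positive semidefiniteness of a
  block Lyapunov recursion, and averaging the resulting quadratic form over signs leaves its trace.
  This bounds Rademacher averages by card \<Phi> * c_1 * L_u * (n_p + 1) * sqrt N.

  For finite classes the risk bound follows by contraction, symmetrization and McDiarmid's inequality.
  Since the output is continuous in the matrices of the system, finitely many scheduling maps leave a
  countable dense subfamily, and the bound passes to the limit along finite subfamilies.

  In the case of finite VC dimension the claimed bound is at least 2 * B, so the gap never exceeds it.
\<close>

text \<open>Inputs are only measurable, so trajectories are Caratheodory solutions, and outputs are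
  given by a definite description: existence of solutions needs Lebesgue differentiation, and the
  passage from the differential to an integral equation needs the fundamental theorem for absolutely
  continuous functions. Cauchy-Schwarz is used with a free scalar, as
  \<open>s * c^2 / 2 + Q / (2 * s)\<close>: this is linear in the quadratic form, so the sign
  average is computed exactly, without Jensen's inequality, and \<open>s\<close> is tuned last. The
  factor n_p + 1 of the bound is the root of a square with two sources: the n_p + 1 output channels,
  and a factor n_p + 1 in the energy bound of one sample. The leading 2 K_l comes from
  symmetrization and from a contraction without absolute values. Loss bounds hold only almost
  surely, and suprema over uncountable families need not be measurable; hence the clipped losses,
  the finite maxima and one full-measure set of \<open>good\<close> samples for all systems.\<close>

section \<open>Lebesgue differentiation and the fundamental theorem of calculus\<close>

text \<open>The bad increments [x, x + h] form a Vitali cover of the exceptional set by intervals that are fine for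
  a Henstock gauge, so the Henstock lemma bounds the total length of disjoint ones.\<close>

lemma negligible_bad_difference_quotients:
  fixes f :: "real \<Rightarrow> real"
  assumes f: "f integrable_on {a..b}" and e: "e > 0"
  defines "F \<equiv> \<lambda>x. integral {a..x} f"
  shows "negligible {t\<in>{a..b}. \<forall>d>0. \<exists>h. h \<noteq> 0 \<and> \<bar>h\<bar> < d \<and> t + h \<in> {a..b} \<and> e * \<bar>h\<bar> < \<bar>F (t + h) - F t - h * f t\<bar>}"
    (is "negligible ?S")
  unfolding negligible_outer_le
proof (intro allI impI)
  fix \<eta> :: real assume \<eta>: "\<eta> > 0"
  \<comment> \<open>The tolerance is \<open>e * \<eta>\<close> because a bad increment of length l
    has a Henstock defect above \<open>e\<close> times l, so that disjoint bad intervals have total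
    length below \<open>\<eta>\<close>.\<close>
  obtain \<gamma> where \<gamma>: "gauge \<gamma>"
    and H: "\<And>p. \<lbrakk>p tagged_partial_division_of (cbox a b); \<gamma> fine p\<rbrakk> \<Longrightarrow>
             sum (\<lambda>(x,k). norm(measure lborel k *\<^sub>R f x - integral k f)) p < e * \<eta>"
    using Henstock_lemma[of f a b "e * \<eta>"] f e \<eta> by (auto simp: box_real)
  define S where "S = ?S"
  have SD: "x \<in> {a..b}" "\<And>d. d > 0 \<Longrightarrow> \<exists>h. h \<noteq> 0 \<and> \<bar>h\<bar> < d \<and> x + h \<in> {a..b} \<and> e * \<bar>h\<bar> < \<bar>F (x + h) - F x - h * f x\<bar>"
    if "x \<in> S" for x using that unfolding S_def by blast+
  \<comment> \<open>An index is a point with one of its bad increments, positive or negative. The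
    ball with centre \<open>x + h/2\<close> and radius \<open>\<bar>h\<bar>/2\<close> is the closed
    interval between \<open>x\<close> and \<open>x + h\<close>, tagged by its endpoint
    \<open>x\<close>.\<close>
  define K where "K = {(x,h). x \<in> S \<and> h \<noteq> 0 \<and> x + h \<in> {a..b} \<and> cball (x + h/2) (\<bar>h\<bar>/2) \<subseteq> \<gamma> x
     \<and> e * \<bar>h\<bar> < \<bar>F (x + h) - F x - h * f x\<bar>}"
  define c where "c = (\<lambda>(x::real,h::real). x + h/2)"
  define r where "r = (\<lambda>(x::real,h::real). \<bar>h\<bar>/2)"
  have r: "0 < r i" if "i \<in> K" for i using that by (auto simp: K_def r_def)
  have cov: "\<exists>i. i \<in> K \<and> x \<in> cball (c i) (r i) \<and> r i < d" if x: "x \<in> S" and d: "d > 0" for x d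
  proof -
    obtain \<delta> where \<delta>: "\<delta> > 0" "ball x \<delta> \<subseteq> \<gamma> x"
      using \<gamma> by (meson gaugeD openE)
    have "min \<delta> d > 0" using \<delta> d by auto
    then obtain h where h: "h \<noteq> 0" "\<bar>h\<bar> < min \<delta> d" "x + h \<in> {a..b}" "e * \<bar>h\<bar> < \<bar>F (x + h) - F x - h * f x\<bar>"
      using SD(2)[OF x] by blast
    have "cball (x + h/2) (\<bar>h\<bar>/2) \<subseteq> ball x \<delta>"
    proof
      fix y assume "y \<in> cball (x + h/2) (\<bar>h\<bar>/2)"
      then have "\<bar>x + h/2 - y\<bar> \<le> \<bar>h\<bar>/2" by (simp add: dist_real_def)
      then have "\<bar>x - y\<bar> \<le> \<bar>h\<bar>" by linarith
      then show "y \<in> ball x \<delta>" using h by (simp add: dist_real_def)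
    qed
    then have "(x,h) \<in> K" using x h \<delta> unfolding K_def by blast
    moreover have "x \<in> cball (c (x,h)) (r (x,h))" "r (x,h) < d"
      using h by (auto simp: c_def r_def dist_real_def)
    ultimately show ?thesis by blast
  qed
  obtain C where C: "countable C" "C \<subseteq> K"
     "pairwise (\<lambda>i j. disjnt (cball (c i) (r i)) (cball (c j) (r j))) C"
     "negligible(S - (\<Union>i \<in> C. cball (c i) (r i)))"
  proof (rule Vitali_covering_theorem_cballs[of K r S c])
    show "\<And>i. i \<in> K \<Longrightarrow> 0 < r i" by (rule r)
    show "\<And>x d. x \<in> S \<Longrightarrow> 0 < d \<Longrightarrow> \<exists>i. i \<in> K \<and> x \<in> cball (c i) (r i) \<and> r i < d" by (rule cov)
  qed (rule that)
  have cb: "cball (c (x,h)) (r (x,h)) = cbox (min x (x+h)) (max x (x+h))" for x h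
    unfolding c_def r_def by (cases "h \<ge> 0") (auto simp: cball_eq_atLeastAtMost min_def max_def)
  have bound: "measure lebesgue (\<Union>i\<in>I. cball (c i) (r i)) \<le> \<eta>" if I: "I \<subseteq> C" "finite I" for I
  proof -
    define p where "p = (\<lambda>i. (fst i, cball (c i) (r i))) ` I"
    have IK: "I \<subseteq> K" using I C by auto
    have disj: "cball (c i) (r i) \<inter> cball (c j) (r j) = {}" if "i \<in> I" "j \<in> I" "i \<noteq> j" for i j
      using C(3) that I unfolding pairwise_def disjnt_def by blast
    have part: "p tagged_partial_division_of (cbox a b)"
      unfolding tagged_partial_division_of_def
    proof (intro conjI allI impI)
      show "finite p" using I by (simp add: p_def)
      fix x k assume "(x,k) \<in> p"
      then obtain h where h: "(x,h) \<in> I" "k = cball (c (x,h)) (r (x,h))" by (auto simp: p_def)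
      have "(x,h) \<in> K" using h IK by auto
      then show "x \<in> k" "k \<subseteq> cbox a b" "\<exists>a b. k = cbox a b"
        unfolding h(2) cb using SD(1)[of x] by (auto simp: K_def min_def max_def)
    next
      fix x1 k1 x2 k2 assume "(x1, k1) \<in> p \<and> (x2, k2) \<in> p \<and> (x1, k1) \<noteq> (x2, k2)"
      then obtain i j where ij: "i \<in> I" "j \<in> I" "i \<noteq> j" "k1 = cball (c i) (r i)" "k2 = cball (c j) (r j)"
        by (auto simp: p_def)
      have "interior k1 \<inter> interior k2 \<subseteq> k1 \<inter> k2" using interior_subset by blast
      then show "interior k1 \<inter> interior k2 = {}" using disj ij by auto
    qed
    have fine: "\<gamma> fine p"
      unfolding fine_def p_def
    proof clarify
      fix x k x' h y assume "(x',h) \<in> I" "y \<in> cball (c (x',h)) (r (x',h))"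
      then have "cball (c (x',h)) (r (x',h)) \<subseteq> \<gamma> x'" using IK unfolding K_def c_def r_def by auto
      then show "y \<in> \<gamma> (fst (x',h))" using \<open>y \<in> _\<close> by auto
    qed
    have inj: "inj_on (\<lambda>i. (fst i, cball (c i) (r i))) I"
    proof (rule inj_onI)
      fix i j assume ij: "i \<in> I" "j \<in> I" "(fst i, cball (c i) (r i)) = (fst j, cball (c j) (r j))"
      have "0 < r i" using r ij IK by blast
      then have "c i \<in> cball (c i) (r i)" by simp
      then show "i = j" using disj[of i j] ij by (metis IntI emptyE prod.inject)
    qed
    have "e * (\<Sum>i\<in>I. measure lebesgue (cball (c i) (r i))) = (\<Sum>i\<in>I. e * \<bar>snd i\<bar>)"
      unfolding sum_distrib_left
    proof (intro sum.cong refl)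
      fix i assume "i \<in> I"
      obtain x h where i: "i = (x,h)" by force
      show "e * measure lebesgue (cball (c i) (r i)) = e * \<bar>snd i\<bar>"
        unfolding i cb by (cases "h \<ge> 0") (auto simp: min_def max_def)
    qed
    also have "\<dots> \<le> (\<Sum>i\<in>I. norm (measure lborel (cball (c i) (r i)) *\<^sub>R f (fst i) - integral (cball (c i) (r i)) f))"
    proof (rule sum_mono)
      fix i assume i: "i \<in> I"
      obtain x h where xh: "i = (x,h)" by force
      have K: "x \<in> {a..b}" "h \<noteq> 0" "x + h \<in> {a..b}" "e * \<bar>h\<bar> < \<bar>F (x + h) - F x - h * f x\<bar>"
        using i IK SD(1)[of x] unfolding xh K_def by blast+
      have int: "integral {a..y} f - integral {a..x} f = integral {x..y} f" if "a \<le> x" "x \<le> y" "y \<le> b" for x y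
        using Henstock_Kurzweil_Integration.integral_combine[of a x y f] integrable_on_subinterval[OF f, of a y] that by auto
      show "e * \<bar>snd i\<bar> \<le> norm (measure lborel (cball (c i) (r i)) *\<^sub>R f (fst i) - integral (cball (c i) (r i)) f)"
      proof (cases "h > 0")
        case True
        have "integral {x..x+h} f = F (x+h) - F x" unfolding F_def using int[of x "x+h"] K(1,3) True by simp
        moreover have "cbox (min x (x+h)) (max x (x+h)) = {x..x+h}" using True by (simp add: min_def max_def)
        ultimately show ?thesis using K(4) True unfolding xh cb by (simp add: abs_minus_commute)
      next
        case False
        then have h: "h < 0" using K by auto
        have "integral {x+h..x} f = F x - F (x+h)" unfolding F_def using int[of "x+h" x] K(1,3) h by simp
        moreover have "cbox (min x (x+h)) (max x (x+h)) = {x+h..x}" using h by (simp add: min_def max_def)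
        moreover have "\<bar>F (x + h) - F x - h * f x\<bar> = \<bar>(- h) * f x - (F x - F (x+h))\<bar>" by simp
        ultimately show ?thesis using K(4) h unfolding xh cb by simp
      qed
    qed
    also have "\<dots> = sum (\<lambda>(x,k). norm(measure lborel k *\<^sub>R f x - integral k f)) p"
      unfolding p_def by (subst sum.reindex[OF inj]) simp
    also have "\<dots> < e * \<eta>" by (rule H[OF part fine])
    finally have "(\<Sum>i\<in>I. measure lebesgue (cball (c i) (r i))) < \<eta>" using e by simp
    moreover have "measure lebesgue (\<Union>i\<in>I. cball (c i) (r i)) \<le> (\<Sum>i\<in>I. measure lebesgue (cball (c i) (r i)))"
      using I by (intro measure_UNION_le) auto
    ultimately show ?thesis by linarith
  qed
  let ?U = "\<Union>i\<in>C. cball (c i) (r i)"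
  let ?N = "S - ?U"
  have U: "?U \<in> lmeasurable" "measure lebesgue ?U \<le> \<eta>"
    by (rule fmeasurable_UN_bound[OF C(1)], simp, rule bound, assumption, assumption)
       (rule measure_UN_bound[OF C(1)], simp, rule bound, assumption, assumption)
  have N: "?N \<in> lmeasurable" "measure lebesgue ?N = 0"
    using C(4) negligible_imp_measurable negligible_imp_measure0 by blast+
  show "\<exists>T. ?S \<subseteq> T \<and> T \<in> lmeasurable \<and> measure lebesgue T \<le> \<eta>"
  proof (intro exI conjI)
    show "?S \<subseteq> ?U \<union> ?N" unfolding S_def by auto
    show "?U \<union> ?N \<in> lmeasurable" using U N by (intro fmeasurable.Un)
    show "measure lebesgue (?U \<union> ?N) \<le> \<eta>"
      using measure_Un_le[of ?U lebesgue ?N] U N by (auto simp: fmeasurable_def)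
  qed
qed

text \<open>Where the derivative fails, the point is bad for some tolerance
  \<open>1 / real (Suc n)\<close>; the exceptional set thus lies in a countable union of negligible
  sets.\<close>

theorem AE_indefinite_integral_has_derivative:
  fixes f :: "real \<Rightarrow> real"
  assumes f: "f integrable_on {a..b}"
  shows "AE t in lebesgue. t \<in> {a..b} \<longrightarrow>
    ((\<lambda>x. integral {a..x} f) has_real_derivative f t) (at t within {a..b})"
proof -
  define F where "F = (\<lambda>x. integral {a..x} f)"
  define S where "S e = {t\<in>{a..b}. \<forall>d>0. \<exists>h. h \<noteq> 0 \<and> \<bar>h\<bar> < d \<and> t + h \<in> {a..b}
       \<and> e * \<bar>h\<bar> < \<bar>F (t + h) - F t - h * f t\<bar>}" for e
  have "negligible (\<Union>n. S (1 / real (Suc n)))"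
  proof (rule negligible_countable_Union)
    have "negligible (S (1 / real (Suc n)))" for n
      unfolding S_def F_def
      by (rule negligible_bad_difference_quotients[OF f]) simp
    then show "\<And>s. s \<in> range (\<lambda>n. S (1 / real (Suc n))) \<Longrightarrow> negligible s" by blast
  qed auto
  then have "AE t in lebesgue. t \<notin> (\<Union>n. S (1 / real (Suc n)))"
    unfolding negligible_iff_null_sets by (rule AE_not_in)
  then show ?thesis
  proof (rule eventually_mono, intro impI)
    fix t assume t: "t \<notin> (\<Union>n. S (1 / real (Suc n)))" "t \<in> {a..b}"
    have "(F has_derivative (\<lambda>h. f t * h)) (at t within {a..b})"
      unfolding has_derivative_within_alt
    proof (intro conjI allI impI)
      show "bounded_linear ((*) (f t))" by (rule bounded_linear_mult_right)
      fix e :: real assume "e > 0"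
      then obtain n where n: "1 / real (Suc n) < e" using nat_approx_posE by blast
      have "t \<notin> S (1 / real (Suc n))" using t by blast
      then have "\<exists>d>0. \<forall>h. h \<noteq> 0 \<longrightarrow> \<bar>h\<bar> < d \<longrightarrow> t + h \<in> {a..b}
          \<longrightarrow> \<bar>F (t + h) - F t - h * f t\<bar> \<le> 1 / real (Suc n) * \<bar>h\<bar>"
        using t(2) unfolding S_def mem_Collect_eq not_less[symmetric] by blast
      then obtain d where d: "d > 0" "\<And>h. h \<noteq> 0 \<Longrightarrow> \<bar>h\<bar> < d \<Longrightarrow> t + h \<in> {a..b}
          \<Longrightarrow> \<bar>F (t + h) - F t - h * f t\<bar> \<le> 1 / real (Suc n) * \<bar>h\<bar>"
        by blast
      show "\<exists>d>0. \<forall>y\<in>{a..b}. norm (y - t) < d \<longrightarrow> norm (F y - F t - f t * (y - t)) \<le> e * norm (y - t)"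
      proof (intro exI conjI ballI impI)
        show "d > 0" by fact
        fix y assume y: "y \<in> {a..b}" "norm (y - t) < d"
        show "norm (F y - F t - f t * (y - t)) \<le> e * norm (y - t)"
        proof (cases "y = t")
          case False
          have "norm (F y - F t - f t * (y - t)) \<le> 1 / real (Suc n) * \<bar>y - t\<bar>"
            using d(2)[of "y - t"] False y by (simp add: mult.commute)
          also have "\<dots> \<le> e * \<bar>y - t\<bar>" using n by (intro mult_right_mono) auto
          finally show ?thesis by simp
        qed simp
      qed
    qed
    then show "((\<lambda>x. integral {a..x} f) has_real_derivative f t) (at t within {a..b})"
      by (simp add: has_field_derivative_def F_def)
  qed
qed

text \<open>The gauge treats two kinds of tags. On the null set where the derivative fails it forces
  the intervals into an open set of small measure, where absolute continuity bounds the total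
  increment of \<open>F\<close>; elsewhere differentiability compares each increment with its
  Riemann term.\<close>

lemma fundamental_theorem_of_calculus_abs_continuous:
  fixes F g :: "real \<Rightarrow> real"
  assumes ab: "a \<le> b" and ac: "abs_continuous_on a b F"
    and der: "AE t in lebesgue. t \<in> {a..b} \<longrightarrow> (F has_real_derivative g t) (at t within {a..b})"
  shows "(g has_integral F b - F a) {a..b}"
proof (cases "a = b")
  case True
  then show ?thesis by auto
next
  case False
  then have ab: "a < b" using ab by simp
  define E where "E = {t \<in> {a..b}. \<not> (F has_real_derivative g t) (at t within {a..b})}"
  have "\<exists>N\<in>null_sets lebesgue. E \<subseteq> N"
    using der unfolding E_def eventually_ae_filter by auto
  then have E0: "negligible E"
    using negligible_iff_null_sets negligible_subset by blast
  \<comment> \<open>With the value 0 on \<open>E\<close>, tags in \<open>E\<close> add nothing to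
    the Riemann sum and leave only increments of \<open>F\<close>. The original integrand is
    restored at the end, since \<open>E\<close> is negligible.\<close>
  define h where "h t = (if t \<in> E then 0 else g t)" for t
  have "(h has_integral F b - F a) (cbox a b)"
    unfolding has_integral
  proof (intro allI impI)
    fix e :: real assume e: "e > 0"
    have "\<exists>\<delta>>0. \<forall>(m::nat) l r. (\<forall>j<m. a \<le> l j \<and> l j \<le> r j \<and> r j \<le> b) \<longrightarrow>
        disjoint_family_on (\<lambda>j. {l j<..<r j}) {..<m} \<longrightarrow>
        (\<Sum>j<m. r j - l j) < \<delta> \<longrightarrow> (\<Sum>j<m. \<bar>F (r j) - F (l j)\<bar>) < e / 2"
      using ac[unfolded abs_continuous_on_def, THEN spec, THEN mp, of "e / 2"] e by simp
    then obtain \<delta> where \<delta>: "\<delta> > 0" and AC: "\<forall>(m::nat) l r.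
        (\<forall>j<m. a \<le> l j \<and> l j \<le> r j \<and> r j \<le> b) \<longrightarrow>
        disjoint_family_on (\<lambda>j. {l j<..<r j}) {..<m} \<longrightarrow>
        (\<Sum>j<m. r j - l j) < \<delta> \<longrightarrow> (\<Sum>j<m. \<bar>F (r j) - F (l j)\<bar>) < e / 2"
      by (elim exE conjE)
    obtain U where U: "open U" "E \<subseteq> U" "U - E \<in> lmeasurable" "emeasure lebesgue (U - E) < ennreal \<delta>"
      by (rule sets_lebesgue_outer_open[OF negligible_imp_sets[OF E0] \<delta>])
    have Um: "emeasure lebesgue U < ennreal \<delta>"
    proof -
      have "U \<in> sets lebesgue" using U(1) by (simp add: borel_open)
      then have "emeasure lebesgue U = emeasure lebesgue (U - E)"
        using E0 by (intro emeasure_Diff_null_set[symmetric]) (auto simp: negligible_iff_null_sets)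
      then show ?thesis using U by simp
    qed
    \<comment> \<open>Tags outside \<open>E\<close> cause an error of at most
      \<open>\<epsilon> * (b - a)\<close>, half of \<open>e\<close>; the other half is reserved for
      the tags in \<open>E\<close>.\<close>
    define \<epsilon> where "\<epsilon> = e / (2 * (b - a))"
    have \<epsilon>: "\<epsilon> > 0" using e ab by (simp add: \<epsilon>_def)
    have "\<exists>d>0. \<forall>y\<in>{a..b}. \<bar>y - t\<bar> < d \<longrightarrow> \<bar>F y - F t - g t * (y - t)\<bar> \<le> \<epsilon> * \<bar>y - t\<bar>"
      if "t \<in> {a..b}" "t \<notin> E" for t
    proof -
      have "(F has_derivative (*) (g t)) (at t within {a..b})"
        using that by (simp add: E_def has_field_derivative_def)
      then show ?thesis using \<epsilon> unfolding has_derivative_within_alt real_norm_def by blast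
    qed
    then obtain d where d: "\<And>t. t \<in> {a..b} \<Longrightarrow> t \<notin> E \<Longrightarrow> d t > 0"
      "\<And>t y. t \<in> {a..b} \<Longrightarrow> t \<notin> E \<Longrightarrow> y\<in>{a..b} \<Longrightarrow> \<bar>y - t\<bar> < d t \<Longrightarrow> \<bar>F y - F t - g t * (y - t)\<bar> \<le> \<epsilon> * \<bar>y - t\<bar>"
      by (metis (no_types, lifting))
    define \<gamma> where "\<gamma> t = (if t \<in> E then U else if t \<in> {a..b} then ball t (d t) else UNIV)" for t
    have gauge: "gauge \<gamma>" using U d by (auto simp: gauge_def \<gamma>_def)
    have fine_le: "norm ((\<Sum>(x,k)\<in>p. measure lborel k *\<^sub>R h x) - (F b - F a)) < e"
      if p: "p tagged_division_of (cbox a b)" and fine: "\<gamma> fine p" for p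
    proof -
      note tp = tagged_division_ofD[OF p]
      have kk: "k = {Inf k..Sup k}" "Inf k \<le> x" "x \<le> Sup k" "a \<le> Inf k" "Sup k \<le> b" "measure lborel k = Sup k - Inf k"
        if "(x,k) \<in> p" for x k
      proof -
        obtain u v where uv: "k = cbox u v" using tp(4)[OF \<open>(x,k) \<in> p\<close>] by auto
        have "x \<in> k" "k \<subseteq> cbox a b" using tp(2,3) that by auto
        then show "k = {Inf k..Sup k}" "Inf k \<le> x" "x \<le> Sup k" "a \<le> Inf k" "Sup k \<le> b"
           "measure lborel k = Sup k - Inf k"
          by (auto simp: uv)
      qed
      define P where "P = {z\<in>p. fst z \<in> E}"
      have P: "P \<subseteq> p" "finite P" "finite (p - P)" using tp(1) by (auto simp: P_def)
      have "(\<Sum>(x,k)\<in>p. F (Sup k) - F (Inf k)) = F b - F a"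
        using additive_tagged_division_1[of a b p F] ab p by (simp add: box_real)
      then have "(\<Sum>(x,k)\<in>p. measure lborel k *\<^sub>R h x) - (F b - F a)
          = (\<Sum>(x,k)\<in>p. measure lborel k * h x - (F (Sup k) - F (Inf k)))"
        by (simp add: sum_subtractf split_def)
      also have "norm \<dots> \<le> (\<Sum>(x,k)\<in>p. \<bar>measure lborel k * h x - (F (Sup k) - F (Inf k))\<bar>)"
        by (simp add: split_def sum_abs)
      also have "\<dots> = (\<Sum>(x,k)\<in>P. \<bar>measure lborel k * h x - (F (Sup k) - F (Inf k))\<bar>)
          + (\<Sum>(x,k)\<in>p - P. \<bar>measure lborel k * h x - (F (Sup k) - F (Inf k))\<bar>)"
        using sum.subset_diff[OF P(1) tp(1)] by (simp add: add.commute)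
      also have "\<dots> < e / 2 + e / 2"
      proof (rule add_less_le_mono)
        \<comment> \<open>The pieces tagged in \<open>E\<close> are numbered because absolute
          continuity is stated for finite sequences of intervals.\<close>
        obtain q where q: "bij_betw q {..<card P} P"
          using ex_bij_betw_nat_finite[OF P(2)] by (metis atLeast0LessThan)
        have qP: "q j \<in> P" if "j < card P" for j using q that by (auto simp: bij_betw_def)
        define l where "l j = Inf (snd (q j))" for j
        define r where "r j = Sup (snd (q j))" for j
        have lr: "a \<le> l j \<and> l j \<le> r j \<and> r j \<le> b" if "j < card P" for j
          using kk[of "fst (q j)" "snd (q j)"] qP[OF that] unfolding l_def r_def by (auto simp: split_def P_def)
        have dis: "{l i<..<r i} \<inter> {l j<..<r j} = {}" if "i < card P" "j < card P" "i \<noteq> j" for i j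
        proof -
          have "q i \<noteq> q j" using q that by (auto simp: bij_betw_def inj_on_def)
          moreover have "(fst (q i), snd (q i)) \<in> p" "(fst (q j), snd (q j)) \<in> p"
            using qP that by (auto simp: split_def P_def)
          ultimately have "interior (snd (q i)) \<inter> interior (snd (q j)) = {}"
            using tp(5)[of "fst (q i)" "snd (q i)" "fst (q j)" "snd (q j)"] by (auto simp: prod_eq_iff)
          moreover have "interior (snd (q i)) = {l i<..<r i}" if "i < card P" for i
            using kk(1)[of "fst (q i)" "snd (q i)"] qP[OF that] unfolding l_def r_def
            by (metis (no_types, lifting) P_def interior_atLeastAtMost_real mem_Collect_eq prod.collapse)
          ultimately show ?thesis using that by metis
        qed
        have "(\<Sum>j<card P. r j - l j) = (\<Sum>j<card P. measure lebesgue {l j<..<r j})"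
          using lr by (intro sum.cong) auto
        also have "\<dots> = measure lebesgue (\<Union>j<card P. {l j<..<r j})"
          using dis lr by (intro measure_finite_Union[symmetric]) (auto simp: disjoint_family_on_def emeasure_lborel_Ioo)
        also have "\<dots> \<le> measure lebesgue U"
        proof (rule measure_mono_fmeasurable)
          show "(\<Union>j<card P. {l j<..<r j}) \<subseteq> U"
          proof (rule UN_least)
            fix j assume "j \<in> {..<card P}"
            then have j: "j < card P" by simp
            have "snd (q j) \<subseteq> \<gamma> (fst (q j))" using fine qP[OF j] P(1) by (auto simp: fine_def split_def)
            moreover have "fst (q j) \<in> E" using qP[OF j] by (auto simp: split_def P_def)
            moreover have "snd (q j) = {l j..r j}"
              unfolding l_def r_def using kk(1)[of "fst (q j)" "snd (q j)"] qP[OF j] by (auto simp: split_def P_def)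
            ultimately show "{l j<..<r j} \<subseteq> U" by (auto simp: \<gamma>_def)
          qed
          show "U \<in> lmeasurable" using Um U(1) by (intro fmeasurableI) (auto intro: borel_open order_less_trans)
        qed auto
        also have "\<dots> < \<delta>"
        proof -
          have "emeasure lebesgue U = ennreal (measure lebesgue U)"
            using Um by (intro emeasure_eq_ennreal_measure) auto
          then show ?thesis using Um by (simp add: ennreal_less_iff)
        qed
        finally have "(\<Sum>j<card P. \<bar>F (r j) - F (l j)\<bar>) < e / 2"
          using lr dis by (intro AC[rule_format]) (auto simp: disjoint_family_on_def)
        also have "(\<Sum>j<card P. \<bar>F (r j) - F (l j)\<bar>) = (\<Sum>z\<in>P. \<bar>F (Sup (snd z)) - F (Inf (snd z))\<bar>)"
          unfolding l_def r_def by (rule sum.reindex_bij_betw[OF q])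
        also have "\<dots> = (\<Sum>(x,k)\<in>P. \<bar>measure lborel k * h x - (F (Sup k) - F (Inf k))\<bar>)"
          by (intro sum.cong) (auto simp: h_def abs_minus_commute P_def)
        finally show "(\<Sum>(x,k)\<in>P. \<bar>measure lborel k * h x - (F (Sup k) - F (Inf k))\<bar>) < e / 2" .
      next
        have "(\<Sum>(x,k)\<in>p - P. \<bar>measure lborel k * h x - (F (Sup k) - F (Inf k))\<bar>)
            \<le> (\<Sum>(x,k)\<in>p - P. \<epsilon> * measure lborel k)"
        proof (rule sum_mono, clarify)
          fix x k assume "(x,k) \<in> p" "(x,k) \<notin> P"
          then have xk: "(x,k) \<in> p" "x \<notin> E" by (auto simp: P_def)
          have x: "x \<in> {a..b}" using kk[OF xk(1)] by auto
          have "k \<subseteq> \<gamma> x" using fine xk(1) unfolding fine_def by blast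
          then have kb: "k \<subseteq> ball x (d x)" using xk(2) x by (simp add: \<gamma>_def)
          have "Inf k \<in> k" "Sup k \<in> k" using kk[OF xk(1)] by (metis atLeastAtMost_iff order.trans order_refl)+
          then have "\<bar>Inf k - x\<bar> < d x" "\<bar>Sup k - x\<bar> < d x"
            using kb by (auto simp: dist_real_def abs_minus_commute)
          then have "\<bar>F (Inf k) - F x - g x * (Inf k - x)\<bar> \<le> \<epsilon> * \<bar>Inf k - x\<bar>"
             "\<bar>F (Sup k) - F x - g x * (Sup k - x)\<bar> \<le> \<epsilon> * \<bar>Sup k - x\<bar>"
            using d(2)[OF x xk(2), of "Inf k"] d(2)[OF x xk(2), of "Sup k"] kk[OF xk(1)] by auto
          \<comment> \<open>The tag lies inside its interval, so the errors on its two sides add up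
            to \<open>\<epsilon>\<close> times the length.\<close>
          moreover have "\<epsilon> * \<bar>Inf k - x\<bar> + \<epsilon> * \<bar>Sup k - x\<bar> = \<epsilon> * (Sup k - Inf k)"
            using kk[OF xk(1)] by (simp add: algebra_simps)
          moreover have "(Sup k - Inf k) * h x = g x * (Sup k - x) - g x * (Inf k - x)"
          proof -
            have "h x = g x" using xk(2) by (simp add: h_def)
            then show ?thesis by (simp add: left_diff_distrib right_diff_distrib)
          qed
          ultimately show "\<bar>measure lborel k * h x - (F (Sup k) - F (Inf k))\<bar> \<le> \<epsilon> * measure lborel k"
            unfolding kk(6)[OF xk(1)] by linarith
        qed
        also have "\<dots> \<le> (\<Sum>(x,k)\<in>p. \<epsilon> * measure lborel k)"
          using tp(1) \<epsilon> by (intro sum_mono2) auto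
        also have "\<dots> = \<epsilon> * (b - a)"
          using additive_content_tagged_division[OF p] ab by (simp add: sum_distrib_left[symmetric] split_def)
        also have "\<dots> = e / 2"
        proof -
          have *: "e / (2 * d) * d = e / 2" if "d \<noteq> 0" for d using that by simp
          have "b - a \<noteq> 0" using ab by simp
          then show ?thesis unfolding \<epsilon>_def by (rule *)
        qed
        finally show "(\<Sum>(x,k)\<in>p - P. \<bar>measure lborel k * h x - (F (Sup k) - F (Inf k))\<bar>) \<le> e / 2" .
      qed
      finally show ?thesis by simp
    qed
    show "\<exists>\<gamma>. gauge \<gamma> \<and> (\<forall>\<D>. \<D> tagged_division_of cbox a b \<and> \<gamma> fine \<D> \<longrightarrow>
        norm ((\<Sum>(x,k)\<in>\<D>. measure lborel k *\<^sub>R h x) - (F b - F a)) < e)"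
      by (intro exI[of _ \<gamma>] conjI allI impI gauge, elim conjE, rule fine_le)
  qed
  then have "(h has_integral F b - F a) {a..b}" by simp
  then show ?thesis
    by (rule has_integral_spike[OF E0, rotated]) (auto simp: h_def)
qed

section \<open>Averages over sign vectors\<close>

text \<open>Expectation over independent uniform signs in the coordinates below \<open>N\<close>,
  all other coordinates being 0. The recursion makes splitting off one sign definitional and avoids
  a product probability space.\<close>

fun sign_mean :: "nat \<Rightarrow> ((nat \<Rightarrow> real) \<Rightarrow> real) \<Rightarrow> real" where
  "sign_mean 0 g = g (\<lambda>_. 0)"
| "sign_mean (Suc N) g = (sign_mean N (\<lambda>\<sigma>. g (\<sigma>(N := 1))) + sign_mean N (\<lambda>\<sigma>. g (\<sigma>(N := - 1)))) / 2"

lemma sign_mean_mono: "(\<And>\<sigma>. g \<sigma> \<le> h \<sigma>) \<Longrightarrow> sign_mean N g \<le> sign_mean N h"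
proof (induction N arbitrary: g h)
  case (Suc N)
  show ?case using Suc.IH[of "\<lambda>\<sigma>. g (\<sigma>(N := 1))" "\<lambda>\<sigma>. h (\<sigma>(N := 1))"]
      Suc.IH[of "\<lambda>\<sigma>. g (\<sigma>(N := - 1))" "\<lambda>\<sigma>. h (\<sigma>(N := - 1))"] Suc.prems by simp
qed simp

lemma sign_mean_const [simp]: "sign_mean N (\<lambda>_. a) = a"
  by (induction N) auto

lemma sign_mean_add: "sign_mean N (\<lambda>\<sigma>. g \<sigma> + h \<sigma>) = sign_mean N g + sign_mean N h"
  by (induction N arbitrary: g h) (auto simp: field_simps)

lemma sign_mean_cmult: "sign_mean N (\<lambda>\<sigma>. a * g \<sigma>) = a * sign_mean N g"
  by (induction N arbitrary: g) (auto simp: field_simps)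

lemma sign_mean_sum: "sign_mean N (\<lambda>\<sigma>. \<Sum>x\<in>A. g x \<sigma>) = (\<Sum>x\<in>A. sign_mean N (g x))"
  by (induction A rule: infinite_finite_induct) (auto simp: sign_mean_add)

lemma sign_mean_tendsto:
  "(\<And>\<sigma>. (\<lambda>k. g k \<sigma>) \<longlonglongrightarrow> h \<sigma>) \<Longrightarrow> (\<lambda>k. sign_mean N (g k)) \<longlonglongrightarrow> sign_mean N h"
  by (induction N arbitrary: g h) (auto intro!: tendsto_intros)

lemma sign_mean_measurable:
  "(\<And>\<sigma>. (\<lambda>\<omega>. g \<omega> \<sigma>) \<in> borel_measurable X) \<Longrightarrow> (\<lambda>\<omega>. sign_mean N (g \<omega>)) \<in> borel_measurable X"
  by (induction N arbitrary: g) auto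

lemma sign_mean_abs_le: "(\<And>\<sigma>. \<bar>g \<sigma>\<bar> \<le> h \<sigma>) \<Longrightarrow> \<bar>sign_mean N g\<bar> \<le> sign_mean N h"
proof -
  assume le: "\<And>\<sigma>. \<bar>g \<sigma>\<bar> \<le> h \<sigma>"
  have "sign_mean N g \<le> sign_mean N h" "sign_mean N (\<lambda>\<sigma>. (- 1) * h \<sigma>) \<le> sign_mean N g"
    using le by (auto intro!: sign_mean_mono simp: abs_le_iff minus_le_iff)
  then show ?thesis unfolding sign_mean_cmult by simp
qed

lemma sign_mean_linear: "sign_mean N (\<lambda>\<sigma>. \<Sum>i<N. \<sigma> i * a i) = 0"
proof (induction N)
  case (Suc N)
  have "sign_mean N (\<lambda>\<sigma>. (\<Sum>i<N. \<sigma> i * a i) + s) = s" for s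
    using sign_mean_add[of N "\<lambda>\<sigma>. \<Sum>i<N. \<sigma> i * a i" "\<lambda>_. s"] Suc by simp
  from this[of "a N"] this[of "- a N"] show ?case by simp
qed simp

text \<open>Distinct signs are uncorrelated and every sign has square 1. This removes the
  interaction between different samples from the Gram form.\<close>

lemma sign_mean_quadratic:
  "sign_mean N (\<lambda>\<sigma>. \<Sum>i<N. \<Sum>j<N. \<sigma> i * \<sigma> j * q i j) = (\<Sum>i<N. q i i)"
proof (induction N)
  case (Suc N)
  have upd: "(\<Sum>i<Suc N. \<Sum>j<Suc N. (\<sigma>(N := s)) i * (\<sigma>(N := s)) j * q i j)
      = (\<Sum>i<N. \<Sum>j<N. \<sigma> i * \<sigma> j * q i j) + ((\<Sum>i<N. \<sigma> i * (s * (q i N + q N i))) + s * s * q N N)"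
    for \<sigma> :: "nat \<Rightarrow> real" and s
    by (simp add: sum.distrib algebra_simps sum_distrib_left)
  have "sign_mean N (\<lambda>\<sigma>. \<Sum>i<Suc N. \<Sum>j<Suc N. (\<sigma>(N := s)) i * (\<sigma>(N := s)) j * q i j)
      = (\<Sum>i<N. q i i) + s * s * q N N" for s
    unfolding upd sign_mean_add sign_mean_linear by (simp add: Suc)
  from this[of 1] this[of "- 1"] show ?case by simp
qed simp

text \<open>For maximizers \<open>S\<close> and \<open>S'\<close> of the two maxima on the left,
  \<open>\<phi> S - \<phi> S'\<close> is at most \<open>\<bar>f S - f S'\<bar>\<close>. Depending on
  the sign of \<open>f S - f S'\<close>, they are inserted into the maxima on the right in this
  order or exchanged.\<close>

lemma Max_two_point_contraction:
  fixes a \<phi> f :: "'s \<Rightarrow> real"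
  assumes F: "finite F" "F \<noteq> {}"
    and lip: "\<And>S S'. S \<in> F \<Longrightarrow> S' \<in> F \<Longrightarrow> \<bar>\<phi> S - \<phi> S'\<bar> \<le> \<bar>f S - f S'\<bar>"
  shows "Max ((\<lambda>S. a S + \<phi> S) ` F) + Max ((\<lambda>S. a S - \<phi> S) ` F)
       \<le> Max ((\<lambda>S. a S + f S) ` F) + Max ((\<lambda>S. a S - f S) ` F)"
proof -
  have "Max ((\<lambda>S. a S + \<phi> S) ` F) \<in> (\<lambda>S. a S + \<phi> S) ` F" "Max ((\<lambda>S. a S - \<phi> S) ` F) \<in> (\<lambda>S. a S - \<phi> S) ` F"
    using F by (auto intro!: Max_in)
  then obtain S S' where S: "S \<in> F" "S' \<in> F" "Max ((\<lambda>S. a S + \<phi> S) ` F) = a S + \<phi> S"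
     "Max ((\<lambda>S. a S - \<phi> S) ` F) = a S' - \<phi> S'" by auto
  have le: "a x + f x \<le> Max ((\<lambda>S. a S + f S) ` F)" "a x - f x \<le> Max ((\<lambda>S. a S - f S) ` F)" if "x \<in> F" for x
    using F that by (auto intro!: Max_ge)
  show ?thesis
    using le[OF S(1)] le[OF S(2)] lip[OF S(1,2)] unfolding S(3,4) by linarith
qed

text \<open>The coordinates are exchanged one at a time, and those already exchanged are stored in
  the offset \<open>c\<close>, hence its generality. The maxima carry no absolute value, so
  contraction costs no factor 2.\<close>

lemma sign_mean_contraction:
  fixes \<phi> f :: "nat \<Rightarrow> 's \<Rightarrow> real"
  assumes F: "finite F" "F \<noteq> {}"
    and lip: "\<And>i S S'. i < N \<Longrightarrow> S \<in> F \<Longrightarrow> S' \<in> F \<Longrightarrow> \<bar>\<phi> i S - \<phi> i S'\<bar> \<le> \<bar>f i S - f i S'\<bar>"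
  shows "sign_mean N (\<lambda>\<sigma>. Max ((\<lambda>S. c S + (\<Sum>i<N. \<sigma> i * \<phi> i S)) ` F))
       \<le> sign_mean N (\<lambda>\<sigma>. Max ((\<lambda>S. c S + (\<Sum>i<N. \<sigma> i * f i S)) ` F))"
  using lip
proof (induction N arbitrary: c)
  case (Suc N)
  define G where "G c \<phi> \<sigma> = Max ((\<lambda>S. c S + (\<Sum>i<N. \<sigma> i * \<phi> i S)) ` F)" for c \<phi> and \<sigma> :: "nat \<Rightarrow> real"
  have IH: "sign_mean N (G c \<phi>) \<le> sign_mean N (G c f)" for c
    unfolding G_def using Suc by auto
  have upd: "Max ((\<lambda>S. c S + (\<Sum>i<Suc N. (\<sigma>(N := s)) i * \<phi> i S)) ` F) = G (\<lambda>S. c S + s * \<phi> N S) \<phi> \<sigma>"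
    for \<sigma> :: "nat \<Rightarrow> real" and s and \<phi>
    unfolding G_def by (simp add: algebra_simps)
  have two: "G (\<lambda>S. c S + 1 * \<phi> N S) \<phi> \<sigma> + G (\<lambda>S. c S + (- 1) * \<phi> N S) \<phi> \<sigma>
      \<le> G (\<lambda>S. c S + 1 * f N S) \<phi> \<sigma> + G (\<lambda>S. c S + (- 1) * f N S) \<phi> \<sigma>" for \<sigma>
    using Max_two_point_contraction[OF F, of "\<phi> N" "f N" "\<lambda>S. c S + (\<Sum>i<N. \<sigma> i * \<phi> i S)"] Suc.prems[of N]
    unfolding G_def by (simp add: algebra_simps)
  have "sign_mean N (G (\<lambda>S. c S + 1 * \<phi> N S) \<phi>) + sign_mean N (G (\<lambda>S. c S + (- 1) * \<phi> N S) \<phi>)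
      \<le> sign_mean N (G (\<lambda>S. c S + 1 * f N S) \<phi>) + sign_mean N (G (\<lambda>S. c S + (- 1) * f N S) \<phi>)"
    unfolding sign_mean_add[symmetric] by (rule sign_mean_mono) (rule two)
  also have "\<dots> \<le> sign_mean N (G (\<lambda>S. c S + 1 * f N S) f) + sign_mean N (G (\<lambda>S. c S + (- 1) * f N S) f)"
    by (intro add_mono IH)
  finally show ?case unfolding sign_mean.simps upd by simp
qed simp

section \<open>Bounded differences and symmetrization\<close>

lemma (in prob_space) product_sigma_finite_const: "product_sigma_finite (\<lambda>_. M)"
  by unfold_locales

lemma (in prob_space) prob_space_PiM_const: "prob_space (Pi\<^sub>M I (\<lambda>_. M))"
  by (intro prob_space_PiM) (rule prob_space_axioms)

lemma (in prob_space) fun_upd_measurable_PiM_Suc: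
  "(\<lambda>(w, z). w(N := z)) \<in> measurable (Pi\<^sub>M {..<N} (\<lambda>_. M) \<Otimes>\<^sub>M M) (Pi\<^sub>M {..<Suc N} (\<lambda>_. M))"
  unfolding split_def by (rule measurable_fun_upd[where J = "{..<N}"]) (auto simp: lessThan_Suc)

text \<open>Both orders of integration serve symmetrization: the last sample is treated with the
  others fixed, and then the others with the last one fixed.\<close>

lemma (in prob_space) integral_PiM_Suc:
  fixes g :: "(nat \<Rightarrow> 'a) \<Rightarrow> real"
  assumes g[measurable]: "g \<in> borel_measurable (Pi\<^sub>M {..<Suc N} (\<lambda>_. M))"
    and C: "\<And>w. w \<in> space (Pi\<^sub>M {..<Suc N} (\<lambda>_. M)) \<Longrightarrow> \<bar>g w\<bar> \<le> C"
  shows "(\<integral>w. g w \<partial>Pi\<^sub>M {..<Suc N} (\<lambda>_. M)) = (\<integral>w. \<integral>z. g (w(N := z)) \<partial>M \<partial>Pi\<^sub>M {..<N} (\<lambda>_. M))"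
    and "(\<integral>w. g w \<partial>Pi\<^sub>M {..<Suc N} (\<lambda>_. M)) = (\<integral>z. \<integral>w. g (w(N := z)) \<partial>Pi\<^sub>M {..<N} (\<lambda>_. M) \<partial>M)"
proof -
  interpret PP: prob_space "Pi\<^sub>M {..<Suc N} (\<lambda>_. M)" by (rule prob_space_PiM_const)
  interpret QQ: prob_space "Pi\<^sub>M {..<N} (\<lambda>_. M)" by (rule prob_space_PiM_const)
  interpret QM: pair_prob_space "Pi\<^sub>M {..<N} (\<lambda>_. M)" M ..
  have "integrable (Pi\<^sub>M {..<Suc N} (\<lambda>_. M)) g"
    by (rule PP.integrable_const_bound[where B = C]) (auto intro!: AE_I2 C)
  then show 1: "(\<integral>w. g w \<partial>Pi\<^sub>M {..<Suc N} (\<lambda>_. M)) = (\<integral>w. \<integral>z. g (w(N := z)) \<partial>M \<partial>Pi\<^sub>M {..<N} (\<lambda>_. M))"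
    using product_sigma_finite.product_integral_insert[OF product_sigma_finite_const, of "{..<N}" N g] by (simp add: lessThan_Suc)
  have m: "(\<lambda>x. g ((fst x)(N := snd x))) \<in> borel_measurable (Pi\<^sub>M {..<N} (\<lambda>_. M) \<Otimes>\<^sub>M M)"
    using measurable_comp[OF fun_upd_measurable_PiM_Suc g] by (simp add: comp_def split_def)
  have sp: "x(N := z) \<in> space (Pi\<^sub>M {..<Suc N} (\<lambda>_. M))" if "x \<in> space (Pi\<^sub>M {..<N} (\<lambda>_. M))" "z \<in> space M" for x z
    using that by (auto simp: space_PiM PiE_iff extensional_def less_Suc_eq)
  have "integrable (Pi\<^sub>M {..<N} (\<lambda>_. M) \<Otimes>\<^sub>M M) (\<lambda>(x, z). g (x(N := z)))"
    by (rule QM.P.integrable_const_bound[where B = C])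
      (use m in \<open>auto intro!: AE_I2 C sp simp: space_pair_measure split_def\<close>)
  from QM.Fubini_integral[OF this] 1
  show "(\<integral>w. g w \<partial>Pi\<^sub>M {..<Suc N} (\<lambda>_. M)) = (\<integral>z. \<integral>w. g (w(N := z)) \<partial>Pi\<^sub>M {..<N} (\<lambda>_. M) \<partial>M)"
    by simp
qed

lemma (in prob_space) fun_upd_space_PiM_Suc:
  "w \<in> space (Pi\<^sub>M {..<N} (\<lambda>_. M)) \<Longrightarrow> z \<in> space M \<Longrightarrow> w(N := z) \<in> space (Pi\<^sub>M {..<Suc N} (\<lambda>_. M))"
  by (auto simp: space_PiM PiE_iff extensional_def less_Suc_eq)

lemma (in prob_space) integral_PiM_empty:
  fixes g :: "('i \<Rightarrow> 'a) \<Rightarrow> real" and f :: "('i \<Rightarrow> 'a) \<Rightarrow> ennreal"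
  shows "(\<integral>w. g w \<partial>Pi\<^sub>M {} (\<lambda>_. M)) = g (\<lambda>_. undefined)"
    and "(\<integral>\<^sup>+w. f w \<partial>Pi\<^sub>M {} (\<lambda>_. M)) = f (\<lambda>_. undefined)"
proof -
  interpret PE: prob_space "Pi\<^sub>M {} (\<lambda>_. M) :: ('i \<Rightarrow> 'a) measure" by (rule prob_space_PiM_const)
  have "(\<integral>w. g w \<partial>Pi\<^sub>M {} (\<lambda>_. M)) = integral\<^sup>L (Pi\<^sub>M {} (\<lambda>_. M)) (\<lambda>_::'i \<Rightarrow> 'a. g (\<lambda>_. undefined))"
    by (intro Bochner_Integration.integral_cong) (auto simp: space_PiM_empty)
  then show "(\<integral>w. g w \<partial>Pi\<^sub>M {} (\<lambda>_. M)) = g (\<lambda>_. undefined)" by (simp add: PE.prob_space)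
  have "(\<integral>\<^sup>+w. f w \<partial>Pi\<^sub>M {} (\<lambda>_. M)) = integral\<^sup>N (Pi\<^sub>M {} (\<lambda>_. M)) (\<lambda>_::'i \<Rightarrow> 'a. f (\<lambda>_. undefined))"
    by (intro nn_integral_cong) (auto simp: space_PiM_empty)
  then show "(\<integral>\<^sup>+w. f w \<partial>Pi\<^sub>M {} (\<lambda>_. M)) = f (\<lambda>_. undefined)" by (simp add: PE.emeasure_space_1)
qed

text \<open>Integrating out the last coordinate yields a function with the same bound and the same
  differences, to which the induction hypothesis applies. With the other coordinates fixed, the
  values range in an interval of length \<open>c\<close>, and Hoeffding's lemma contributes one
  factor \<open>exp (l\<^sup>2 * c\<^sup>2 / 8)\<close>.\<close>

lemma (in prob_space) nn_integral_exp_bounded_differences: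
  fixes g :: "(nat \<Rightarrow> 'a) \<Rightarrow> real"
  assumes l: "l > 0" and c: "c \<ge> 0"
    and g: "g \<in> borel_measurable (Pi\<^sub>M {..<N} (\<lambda>_. M))"
    and C: "\<And>w. w \<in> space (Pi\<^sub>M {..<N} (\<lambda>_. M)) \<Longrightarrow> \<bar>g w\<bar> \<le> C"
    and diff: "\<And>i w z. i < N \<Longrightarrow> w \<in> space (Pi\<^sub>M {..<N} (\<lambda>_. M)) \<Longrightarrow> z \<in> space M \<Longrightarrow> \<bar>g (w(i := z)) - g w\<bar> \<le> c"
  shows "(\<integral>\<^sup>+w. ennreal (exp (l * (g w - integral\<^sup>L (Pi\<^sub>M {..<N} (\<lambda>_. M)) g))) \<partial>Pi\<^sub>M {..<N} (\<lambda>_. M))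
      \<le> ennreal (exp (l\<^sup>2 * real N * c\<^sup>2 / 8))"
  using g C diff
proof (induction N arbitrary: g)
  case 0
  show ?case by (simp add: integral_PiM_empty)
next
  case (Suc N)
  let ?P = "\<lambda>N. Pi\<^sub>M {..<N} (\<lambda>_. M)"
  note [measurable] = Suc.prems(1)
  interpret QQ: prob_space "?P N" by (rule prob_space_PiM_const)
  define h where "h w = (\<integral>z. g (w(N := z)) \<partial>M)" for w
  define m where "m = integral\<^sup>L (?P (Suc N)) g"
  have m: "m = integral\<^sup>L (?P N) h"
    unfolding m_def h_def by (rule integral_PiM_Suc(1)[OF Suc.prems(1) Suc.prems(2)])
  have gm: "(\<lambda>(w, z). g (w(N := z))) \<in> borel_measurable (?P N \<Otimes>\<^sub>M M)"
    using measurable_comp[OF fun_upd_measurable_PiM_Suc Suc.prems(1)] by (simp add: comp_def split_def)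
  have hm: "h \<in> borel_measurable (?P N)"
    unfolding h_def using gm by (rule borel_measurable_lebesgue_integral)
  have gz: "(\<lambda>z. g (w(N := z))) \<in> borel_measurable M" if "w \<in> space (?P N)" for w
    using measurable_Pair_compose_split[OF gm, of "\<lambda>_. w" M "\<lambda>z. z"] that by simp
  have gi: "integrable M (\<lambda>z. g (w(N := z)))" if "w \<in> space (?P N)" for w
    by (rule integrable_const_bound[where B = C])
       (use gz that in \<open>auto intro!: AE_I2 Suc.prems(2) fun_upd_space_PiM_Suc\<close>)
  have hC: "\<bar>h w\<bar> \<le> C" if "w \<in> space (?P N)" for w
  proof -
    have "\<bar>h w\<bar> \<le> (\<integral>z. \<bar>g (w(N := z))\<bar> \<partial>M)"
      unfolding h_def by (rule integral_abs_bound)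
    also have "\<dots> \<le> (\<integral>z. C \<partial>M)"
      by (intro integral_mono integrable_abs gi that integrable_const Suc.prems(2) fun_upd_space_PiM_Suc)
    finally show ?thesis by (simp add: prob_space)
  qed
  have hdiff: "\<bar>h (w(i := z)) - h w\<bar> \<le> c" if i: "i < N" and w: "w \<in> space (?P N)" and z: "z \<in> space M" for i w z
  proof -
    have w': "w(i := z) \<in> space (?P N)"
      using i w z by (auto simp: space_PiM PiE_iff extensional_def)
    have "h (w(i := z)) - h w = (\<integral>x. g (w(i := z, N := x)) - g (w(N := x)) \<partial>M)"
      unfolding h_def using gi[OF w] gi[OF w'] by simp
    also have "\<bar>\<dots>\<bar> \<le> (\<integral>x. \<bar>g (w(i := z, N := x)) - g (w(N := x))\<bar> \<partial>M)"
      by (rule integral_abs_bound)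
    also have "\<dots> \<le> (\<integral>x. c \<partial>M)"
    proof (intro integral_mono)
      fix x assume x: "x \<in> space M"
      have "w(i := z, N := x) = w(N := x, i := z)" using i by (simp add: fun_upd_twist)
      then show "\<bar>g (w(i := z, N := x)) - g (w(N := x))\<bar> \<le> c"
        using Suc.prems(3)[OF less_SucI[OF i] fun_upd_space_PiM_Suc[OF w x] z] by (simp only:)
    qed (use gi[OF w] gi[OF w'] in auto)
    finally show ?thesis by (simp add: prob_space)
  qed
  have inner: "(\<integral>\<^sup>+z. ennreal (exp (l * (g (w(N := z)) - h w))) \<partial>M) \<le> ennreal (exp (l\<^sup>2 * c\<^sup>2 / 8))"
    if w: "w \<in> space (?P N)" for w
  proof -
    define f where "f z = g (w(N := z))" for z
    have fC: "\<bar>f z\<bar> \<le> C" if "z \<in> space M" for z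
      unfolding f_def by (intro Suc.prems(2) fun_upd_space_PiM_Suc w that)
    have fd: "f z - f z' \<le> c" if "z \<in> space M" "z' \<in> space M" for z z'
    proof -
      have "w(N := z', N := z) = w(N := z)" by (rule fun_upd_upd)
      then have "\<bar>g (w(N := z)) - g (w(N := z'))\<bar> \<le> c"
        using Suc.prems(3)[OF lessI fun_upd_space_PiM_Suc[OF w that(2)] that(1)] by (simp only:)
      then show ?thesis unfolding f_def by linarith
    qed
    \<comment> \<open>Hoeffding's lemma asks for an explicit interval; it starts at the infimum of
      the section and has length \<open>c\<close>.\<close>
    define a where "a = (INF z\<in>space M. f z)"
    have bdd: "bdd_below (f ` space M)" "bdd_above (f ` space M)"
      using fC by (auto intro!: bdd_belowI2[where m = "- C"] bdd_aboveI2[where M = C] simp: abs_le_iff minus_le_iff)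
    have "a \<le> f z" if "z \<in> space M" for z
      unfolding a_def using bdd that by (intro cINF_lower)
    moreover have "f z \<le> a + c" if "z \<in> space M" for z
    proof -
      have "f z - c \<le> a" unfolding a_def
        using not_empty fd[OF that] by (intro cINF_greatest) (auto simp: diff_le_eq add.commute)
      then show ?thesis by simp
    qed
    ultimately interpret I: interval_bounded_random_variable M f a "a + c"
      using gz[OF w] by unfold_locales (auto simp: f_def[symmetric])
    show ?thesis
      using I.Hoeffdings_lemma_nn_integral[OF l] unfolding h_def f_def by simp
  qed
  have gm2: "(\<lambda>w. ennreal (exp (l * (g w - m)))) \<in> borel_measurable (Pi\<^sub>M (insert N {..<N}) (\<lambda>_. M))"
    using Suc.prems(1) by (simp add: lessThan_Suc)
  have "(\<integral>\<^sup>+w. ennreal (exp (l * (g w - m))) \<partial>?P (Suc N))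
      = (\<integral>\<^sup>+w. \<integral>\<^sup>+z. ennreal (exp (l * (g (w(N := z)) - m))) \<partial>M \<partial>?P N)"
    using product_sigma_finite.product_nn_integral_insert[OF product_sigma_finite_const _ _ gm2] by (simp add: lessThan_Suc)
  also have "\<dots> = (\<integral>\<^sup>+w. ennreal (exp (l * (h w - m))) * (\<integral>\<^sup>+z. ennreal (exp (l * (g (w(N := z)) - h w))) \<partial>M) \<partial>?P N)"
  proof (rule nn_integral_cong)
    fix w assume w: "w \<in> space (?P N)"
    have [measurable]: "(\<lambda>z. g (w(N := z))) \<in> borel_measurable M" by (rule gz[OF w])
    have "ennreal (exp (l * (g (w(N := z)) - m))) = ennreal (exp (l * (h w - m))) * ennreal (exp (l * (g (w(N := z)) - h w)))" for z
      by (simp add: ennreal_mult[symmetric] exp_add[symmetric] algebra_simps)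
    then show "(\<integral>\<^sup>+z. ennreal (exp (l * (g (w(N := z)) - m))) \<partial>M)
        = ennreal (exp (l * (h w - m))) * (\<integral>\<^sup>+z. ennreal (exp (l * (g (w(N := z)) - h w))) \<partial>M)"
      by (simp add: nn_integral_cmult)
  qed
  also have "\<dots> \<le> (\<integral>\<^sup>+w. ennreal (exp (l * (h w - m))) * ennreal (exp (l\<^sup>2 * c\<^sup>2 / 8)) \<partial>?P N)"
    by (intro nn_integral_mono mult_left_mono inner) auto
  also have "\<dots> = (\<integral>\<^sup>+w. ennreal (exp (l * (h w - m))) \<partial>?P N) * ennreal (exp (l\<^sup>2 * c\<^sup>2 / 8))"
    using hm by (intro nn_integral_multc) auto
  also have "\<dots> \<le> ennreal (exp (l\<^sup>2 * real N * c\<^sup>2 / 8)) * ennreal (exp (l\<^sup>2 * c\<^sup>2 / 8))"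
    unfolding m by (intro mult_right_mono Suc.IH hm hC hdiff) auto
  also have "\<dots> = ennreal (exp (l\<^sup>2 * real (Suc N) * c\<^sup>2 / 8))"
    by (simp add: ennreal_mult[symmetric] exp_add[symmetric] field_simps)
  finally show ?case unfolding m_def .
qed

theorem (in prob_space) McDiarmid_inequality:
  fixes g :: "(nat \<Rightarrow> 'a) \<Rightarrow> real"
  assumes c: "c > 0" and N: "N > 0" and \<epsilon>: "\<epsilon> > 0"
    and g: "g \<in> borel_measurable (Pi\<^sub>M {..<N} (\<lambda>_. M))"
    and C: "\<And>w. w \<in> space (Pi\<^sub>M {..<N} (\<lambda>_. M)) \<Longrightarrow> \<bar>g w\<bar> \<le> C"
    and diff: "\<And>i w z. i < N \<Longrightarrow> w \<in> space (Pi\<^sub>M {..<N} (\<lambda>_. M)) \<Longrightarrow> z \<in> space M \<Longrightarrow> \<bar>g (w(i := z)) - g w\<bar> \<le> c"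
  shows "measure (Pi\<^sub>M {..<N} (\<lambda>_. M))
      {w \<in> space (Pi\<^sub>M {..<N} (\<lambda>_. M)). \<epsilon> \<le> g w - integral\<^sup>L (Pi\<^sub>M {..<N} (\<lambda>_. M)) g}
      \<le> exp (- 2 * \<epsilon>\<^sup>2 / (real N * c\<^sup>2))"
proof -
  let ?P = "Pi\<^sub>M {..<N} (\<lambda>_. M)"
  let ?m = "integral\<^sup>L ?P g"
  let ?A = "{w \<in> space ?P. \<epsilon> \<le> g w - ?m}"
  interpret PP: prob_space ?P by (rule prob_space_PiM_const)
  note [measurable] = g
  \<comment> \<open>This value minimizes the Chernoff exponent
    \<open>- l * \<epsilon> + l\<^sup>2 * real N * c\<^sup>2 / 8\<close>.\<close>
  define l where "l = 4 * \<epsilon> / (real N * c\<^sup>2)"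
  have l: "l > 0" using c N \<epsilon> by (simp add: l_def)
  have "emeasure ?P ?A = (\<integral>\<^sup>+w. indicator ?A w \<partial>?P)" by simp
  also have "\<dots> \<le> (\<integral>\<^sup>+w. ennreal (exp (- l * \<epsilon>)) * ennreal (exp (l * (g w - ?m))) \<partial>?P)"
  proof (rule nn_integral_mono)
    fix w assume "w \<in> space ?P"
    have "l * \<epsilon> \<le> l * (g w - ?m)" if "w \<in> ?A" using that l by (intro mult_left_mono) auto
    then show "indicator ?A w \<le> ennreal (exp (- l * \<epsilon>)) * ennreal (exp (l * (g w - ?m)))"
      by (auto simp: indicator_def ennreal_mult[symmetric] exp_add[symmetric] simp flip: ennreal_1 intro!: ennreal_leI)
  qed
  also have "\<dots> = ennreal (exp (- l * \<epsilon>)) * (\<integral>\<^sup>+w. ennreal (exp (l * (g w - ?m))) \<partial>?P)"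
    by (intro nn_integral_cmult) auto
  also have "\<dots> \<le> ennreal (exp (- l * \<epsilon>)) * ennreal (exp (l\<^sup>2 * real N * c\<^sup>2 / 8))"
    using c by (intro mult_left_mono nn_integral_exp_bounded_differences[where C = C] l g C diff) auto
  also have "\<dots> = ennreal (exp (- l * \<epsilon> + l\<^sup>2 * real N * c\<^sup>2 / 8))"
    by (simp add: ennreal_mult[symmetric] exp_add[symmetric])
  also have "- l * \<epsilon> + l\<^sup>2 * real N * c\<^sup>2 / 8 = - 2 * \<epsilon>\<^sup>2 / (real N * c\<^sup>2)"
    using c N by (simp add: l_def field_simps power2_eq_square)
  finally show ?thesis by (simp add: PP.emeasure_eq_measure)
qed

section \<open>Maxima over finite families and symmetrization\<close>

lemma borel_measurable_Max_image:
  fixes g :: "'s \<Rightarrow> 'a \<Rightarrow> real"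
  assumes "finite F" "F \<noteq> {}" "\<And>S. S \<in> F \<Longrightarrow> g S \<in> borel_measurable X"
  shows "(\<lambda>w. Max ((\<lambda>S. g S w) ` F)) \<in> borel_measurable X"
  using assms by (induction F rule: finite_ne_induct) (auto simp: Max_insert)

lemma abs_Max_image_le:
  fixes g :: "'s \<Rightarrow> real"
  assumes F: "finite F" "F \<noteq> {}" and "\<And>S. S \<in> F \<Longrightarrow> \<bar>g S\<bar> \<le> C"
  shows "\<bar>Max (g ` F)\<bar> \<le> C"
proof -
  have "Max (g ` F) \<in> g ` F" using F by (intro Max_in) auto
  then obtain S where "S \<in> F" "Max (g ` F) = g S" by auto
  then show ?thesis using assms(3)[of S] by simp
qed

lemma abs_Max_image_diff_le:
  fixes g h :: "'s \<Rightarrow> real"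
  assumes F: "finite F" "F \<noteq> {}" and "\<And>S. S \<in> F \<Longrightarrow> \<bar>g S - h S\<bar> \<le> C"
  shows "\<bar>Max (g ` F) - Max (h ` F)\<bar> \<le> C"
proof -
  have *: "Max (g ` F) \<le> Max (h ` F) + C" if "\<And>S. S \<in> F \<Longrightarrow> \<bar>g S - h S\<bar> \<le> C" for g h :: "'s \<Rightarrow> real"
  proof -
    have "Max (g ` F) \<in> g ` F" using F by (intro Max_in) auto
    then obtain S where S: "S \<in> F" "Max (g ` F) = g S" by auto
    have "h S \<le> Max (h ` F)" using F S by (intro Max_ge) auto
    then show ?thesis using that[OF S(1)] S(2) by linarith
  qed
  show ?thesis using *[of g h] *[of h g] assms(3) by (simp add: abs_minus_commute abs_le_iff)
qed

lemma (in prob_space) abs_expectation_le: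
  fixes f :: "'a \<Rightarrow> real"
  assumes f: "f \<in> borel_measurable M" and B: "\<And>z. z \<in> space M \<Longrightarrow> \<bar>f z\<bar> \<le> B"
  shows "\<bar>expectation f\<bar> \<le> B"
proof -
  have fi: "integrable M f"
    by (rule integrable_const_bound[where B = B]) (use f B in \<open>auto intro!: AE_I2\<close>)
  have "\<bar>expectation f\<bar> \<le> (\<integral>z. \<bar>f z\<bar> \<partial>M)" by (rule integral_abs_bound)
  also have "\<dots> \<le> (\<integral>z. B \<partial>M)" by (intro integral_mono) (use fi B in auto)
  finally show ?thesis by (simp add: prob_space)
qed

text \<open>No ghost sample is needed: expectation (f S) - f S z is the mean of 2 * expectation (f S) and
  - 2 * f S z, and Max is convex, so Jensen's inequality applies to the first half.\<close>

lemma (in prob_space) symmetrization_step: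
  fixes f :: "'s \<Rightarrow> 'a \<Rightarrow> real"
  assumes F: "finite F" "F \<noteq> {}"
    and f: "\<And>S. S \<in> F \<Longrightarrow> f S \<in> borel_measurable M"
    and B: "\<And>S z. S \<in> F \<Longrightarrow> z \<in> space M \<Longrightarrow> \<bar>f S z\<bar> \<le> B"
  shows "(\<integral>z. Max ((\<lambda>S. a S + (expectation (f S) - f S z)) ` F) \<partial>M)
     \<le> (\<integral>z. (Max ((\<lambda>S. a S + 2 * f S z) ` F) + Max ((\<lambda>S. a S - 2 * f S z) ` F)) / 2 \<partial>M)"
proof -
  have B0: "B \<ge> 0" using B F not_empty by fastforce
  define A where "A = Max ((\<lambda>S. \<bar>a S\<bar>) ` F)"
  have A: "\<bar>a S\<bar> \<le> A" if "S \<in> F" for S unfolding A_def using F that by (intro Max_ge) auto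
  have fi: "integrable M (f S)" if "S \<in> F" for S
    by (rule integrable_const_bound[where B = B]) (use that f B in \<open>auto intro!: AE_I2\<close>)
  have mB: "\<bar>expectation (f S)\<bar> \<le> B" if S: "S \<in> F" for S
    by (rule abs_expectation_le[OF f[OF S] B[OF S]])
  \<comment> \<open>The two parameters cover all integrands below at once: \<open>s\<close> and
    \<open>t\<close> are 2 and 0, or -2 and 0, or -1 and 1.\<close>
  have int: "integrable M (\<lambda>z. Max ((\<lambda>S. a S + s * f S z + t * expectation (f S)) ` F))" for s t
  proof (rule integrable_const_bound[where B = "A + \<bar>s\<bar> * B + \<bar>t\<bar> * B"])
    show "(\<lambda>z. Max ((\<lambda>S. a S + s * f S z + t * expectation (f S)) ` F)) \<in> borel_measurable M"
      using f by (intro borel_measurable_Max_image[OF F]) auto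
    show "AE z in M. norm (Max ((\<lambda>S. a S + s * f S z + t * expectation (f S)) ` F)) \<le> A + \<bar>s\<bar> * B + \<bar>t\<bar> * B"
    proof (intro AE_I2)
      fix z assume z: "z \<in> space M"
      show "norm (Max ((\<lambda>S. a S + s * f S z + t * expectation (f S)) ` F)) \<le> A + \<bar>s\<bar> * B + \<bar>t\<bar> * B"
        unfolding real_norm_def
      proof (rule abs_Max_image_le[OF F])
        fix S assume S: "S \<in> F"
        have "\<bar>s * f S z\<bar> \<le> \<bar>s\<bar> * B" "\<bar>t * expectation (f S)\<bar> \<le> \<bar>t\<bar> * B"
          using B[OF S z] mB[OF S] by (auto simp: abs_mult intro!: mult_left_mono)
        then show "\<bar>a S + s * f S z + t * expectation (f S)\<bar> \<le> A + \<bar>s\<bar> * B + \<bar>t\<bar> * B"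
          using A[OF S] by linarith
      qed
    qed
  qed
  have ge: "a S + s * f S z + t * expectation (f S) \<le> Max ((\<lambda>S. a S + s * f S z + t * expectation (f S)) ` F)" if "S \<in> F" for S z s t
    using F that by (intro Max_ge) auto
  have le1: "Max ((\<lambda>S. a S + 2 * expectation (f S)) ` F) \<le> (\<integral>z. Max ((\<lambda>S. a S + 2 * f S z) ` F) \<partial>M)"
  proof (subst Max_le_iff)
    show "\<forall>x\<in>(\<lambda>S. a S + 2 * expectation (f S)) ` F. x \<le> (\<integral>z. Max ((\<lambda>S. a S + 2 * f S z) ` F) \<partial>M)"
    proof clarify
      fix S assume S: "S \<in> F"
      have "a S + 2 * expectation (f S) = (\<integral>z. a S + 2 * f S z \<partial>M)"
        using fi[OF S] by (simp add: prob_space)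
      also have "\<dots> \<le> (\<integral>z. Max ((\<lambda>S. a S + 2 * f S z) ` F) \<partial>M)"
        by (intro integral_mono) (use fi[OF S] int[of 2 0] ge[OF S, of 2 _ 0] in auto)
      finally show "a S + 2 * expectation (f S) \<le> (\<integral>z. Max ((\<lambda>S. a S + 2 * f S z) ` F) \<partial>M)" .
    qed
  qed (use F in auto)
  have "(\<integral>z. Max ((\<lambda>S. a S + (expectation (f S) - f S z)) ` F) \<partial>M)
      \<le> (\<integral>z. (Max ((\<lambda>S. a S + 2 * expectation (f S)) ` F) + Max ((\<lambda>S. a S - 2 * f S z) ` F)) / 2 \<partial>M)"
  proof (intro integral_mono)
    fix z
    show "Max ((\<lambda>S. a S + (expectation (f S) - f S z)) ` F)
       \<le> (Max ((\<lambda>S. a S + 2 * expectation (f S)) ` F) + Max ((\<lambda>S. a S - 2 * f S z) ` F)) / 2"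
    proof (subst Max_le_iff)
      show "\<forall>x\<in>(\<lambda>S. a S + (expectation (f S) - f S z)) ` F.
          x \<le> (Max ((\<lambda>S. a S + 2 * expectation (f S)) ` F) + Max ((\<lambda>S. a S - 2 * f S z) ` F)) / 2"
      proof clarify
        fix S assume S: "S \<in> F"
        show "a S + (expectation (f S) - f S z)
          \<le> (Max ((\<lambda>S. a S + 2 * expectation (f S)) ` F) + Max ((\<lambda>S. a S - 2 * f S z) ` F)) / 2"
          using ge[OF S, of 0 z 2] ge[OF S, of "- 2" z 0] by (simp add: field_simps)
      qed
    qed (use F in auto)
  qed (use int[of "-1" 1] int[of "-2" 0] in \<open>auto simp: algebra_simps\<close>)
  also have "\<dots> = (Max ((\<lambda>S. a S + 2 * expectation (f S)) ` F) + (\<integral>z. Max ((\<lambda>S. a S - 2 * f S z) ` F) \<partial>M)) / 2"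
    using int[of "-2" 0] by (simp add: prob_space)
  also have "\<dots> \<le> ((\<integral>z. Max ((\<lambda>S. a S + 2 * f S z) ` F) \<partial>M) + (\<integral>z. Max ((\<lambda>S. a S - 2 * f S z) ` F) \<partial>M)) / 2"
    using le1 by simp
  also have "\<dots> = (\<integral>z. (Max ((\<lambda>S. a S + 2 * f S z) ` F) + Max ((\<lambda>S. a S - 2 * f S z) ` F)) / 2 \<partial>M)"
    using int[of "-2" 0] int[of 2 0] by simp
  finally show ?thesis .
qed

text \<open>The offset \<open>c\<close> makes the induction work. With the first \<open>N\<close>
  samples fixed, the one-sample step turns the last deviation into a signed term; after exchanging
  the integrals this term is part of the offset, and the induction hypothesis handles the other
  samples.\<close>

lemma (in prob_space) symmetrization:
  fixes f :: "'s \<Rightarrow> 'a \<Rightarrow> real"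
  assumes F: "finite F" "F \<noteq> {}"
    and f: "\<And>S. S \<in> F \<Longrightarrow> f S \<in> borel_measurable M"
    and B: "\<And>S z. S \<in> F \<Longrightarrow> z \<in> space M \<Longrightarrow> \<bar>f S z\<bar> \<le> B"
  shows "(\<integral>w. Max ((\<lambda>S. c S + (\<Sum>i<N. expectation (f S) - f S (w i))) ` F) \<partial>Pi\<^sub>M {..<N} (\<lambda>_. M))
     \<le> (\<integral>w. sign_mean N (\<lambda>\<sigma>. Max ((\<lambda>S. c S + (\<Sum>i<N. \<sigma> i * (2 * f S (w i)))) ` F)) \<partial>Pi\<^sub>M {..<N} (\<lambda>_. M))"
proof (induction N arbitrary: c)
  case 0
  then show ?case by (simp add: integral_PiM_empty)
next
  case (Suc N)
  let ?P = "\<lambda>N. Pi\<^sub>M {..<N} (\<lambda>_. M)"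
  have psP: "prob_space (?P n)" for n :: nat by (rule prob_space_PiM_const)
  have B0: "B \<ge> 0" using B F not_empty by fastforce
  have mB: "\<bar>expectation (f S)\<bar> \<le> B" if S: "S \<in> F" for S
    by (rule abs_expectation_le[OF f[OF S] B[OF S]])
  have fw: "(\<lambda>w. f S (w i)) \<in> borel_measurable (?P n)" if "S \<in> F" "i < n" for S i and n :: nat
    by (rule measurable_compose[OF _ f[OF that(1)]], rule measurable_component_singleton) (use that in auto)
  have fwB: "\<bar>f S (w i)\<bar> \<le> B" if "S \<in> F" "i < n" "w \<in> space (?P n)" for S i w and n :: nat
    by (rule B) (use that in \<open>auto simp: space_PiM PiE_iff\<close>)
  define A where "A c = Max ((\<lambda>S. \<bar>c S\<bar>) ` F)" for c :: "'s \<Rightarrow> real"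
  have A: "\<bar>c S\<bar> \<le> A c" if "S \<in> F" for S c unfolding A_def using F that by (intro Max_ge) auto
  define L where "L n c w = Max ((\<lambda>S. c S + (\<Sum>i<n. expectation (f S) - f S (w i))) ` F)" for n :: nat and c and w :: "nat \<Rightarrow> 'a"
  define R where "R n c w = sign_mean n (\<lambda>\<sigma>. Max ((\<lambda>S. c S + (\<Sum>i<n. \<sigma> i * (2 * f S (w i)))) ` F))" for n :: nat and c and w :: "nat \<Rightarrow> 'a"
  have Lm: "L n c \<in> borel_measurable (?P n)" for n c
    unfolding L_def by (intro borel_measurable_Max_image[OF F] borel_measurable_add borel_measurable_sum borel_measurable_diff fw) auto
  have Rm: "R n c \<in> borel_measurable (?P n)" for n c
    unfolding R_def by (intro sign_mean_measurable borel_measurable_Max_image[OF F] borel_measurable_add borel_measurable_sum borel_measurable_times fw) auto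
  have LB: "\<bar>L n c w\<bar> \<le> A c + real n * (2 * B)" if w: "w \<in> space (?P n)" for n c w
    unfolding L_def
  proof (rule abs_Max_image_le[OF F])
    fix S assume S: "S \<in> F"
    have "\<bar>\<Sum>i<n. expectation (f S) - f S (w i)\<bar> \<le> (\<Sum>i<n. 2 * B)"
    proof (rule order_trans[OF sum_abs], rule sum_mono)
      fix i assume "i \<in> {..<n}"
      then have "\<bar>f S (w i)\<bar> \<le> B" using fwB[OF S _ w] by auto
      then show "\<bar>expectation (f S) - f S (w i)\<bar> \<le> 2 * B" using mB[OF S] by linarith
    qed
    then show "\<bar>c S + (\<Sum>i<n. expectation (f S) - f S (w i))\<bar> \<le> A c + real n * (2 * B)"
      using A[OF S, of c] by simp
  qed
  \<comment> \<open>Estimates under \<open>sign_mean\<close> are required for all real vectors and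
    not only for signs, so the bound keeps the factors
    \<open>\<bar>\<sigma> i\<bar>\<close>.\<close>
  have RB: "\<bar>R n c w\<bar> \<le> sign_mean n (\<lambda>\<sigma>. A c + (\<Sum>i<n. \<bar>\<sigma> i\<bar> * (2 * B)))" if w: "w \<in> space (?P n)" for n c w
    unfolding R_def
  proof (rule sign_mean_abs_le, rule abs_Max_image_le[OF F])
    fix \<sigma> :: "nat \<Rightarrow> real" and S assume S: "S \<in> F"
    have "\<bar>\<Sum>i<n. \<sigma> i * (2 * f S (w i))\<bar> \<le> (\<Sum>i<n. \<bar>\<sigma> i\<bar> * (2 * B))"
    proof (rule order_trans[OF sum_abs], rule sum_mono)
      fix i assume "i \<in> {..<n}"
      then have "\<bar>2 * f S (w i)\<bar> \<le> 2 * B" using fwB[OF S _ w, of i] by (simp add: abs_mult)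
      then show "\<bar>\<sigma> i * (2 * f S (w i))\<bar> \<le> \<bar>\<sigma> i\<bar> * (2 * B)"
        unfolding abs_mult[of "\<sigma> i"] by (intro mult_left_mono) auto
    qed
    then show "\<bar>c S + (\<Sum>i<n. \<sigma> i * (2 * f S (w i)))\<bar> \<le> A c + (\<Sum>i<n. \<bar>\<sigma> i\<bar> * (2 * B))"
      using A[OF S, of c] by linarith
  qed
  have Li: "integrable (?P n) (L n c)" for n c
    by (rule finite_measure.integrable_const_bound[OF prob_space.finite_measure[OF psP] _ Lm]) (use LB in \<open>auto intro!: AE_I2\<close>)
  have Ri: "integrable (?P n) (R n c)" for n c
    by (rule finite_measure.integrable_const_bound[OF prob_space.finite_measure[OF psP] _ Rm]) (use RB in \<open>auto intro!: AE_I2\<close>)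
  have IH: "integral\<^sup>L (?P N) (L N c) \<le> integral\<^sup>L (?P N) (R N c)" for c
    using Suc.IH[of c] unfolding L_def R_def .
  \<comment> \<open>The intermediate integrand: the last sample is symmetrized, the first
    \<open>N\<close> are still centred.\<close>
  define G where "G w = (Max ((\<lambda>S. c S + 2 * f S (w N) + (\<Sum>i<N. expectation (f S) - f S (w i))) ` F)
      + Max ((\<lambda>S. c S - 2 * f S (w N) + (\<Sum>i<N. expectation (f S) - f S (w i))) ` F)) / 2" for w
  have Gm: "G \<in> borel_measurable (?P (Suc N))"
    unfolding G_def by (intro borel_measurable_divide borel_measurable_Max_image[OF F] borel_measurable_add borel_measurable_sum borel_measurable_diff borel_measurable_times fw) auto
  have LS: "L (Suc N) c (w(N := z)) = Max ((\<lambda>S. (c S + (\<Sum>i<N. expectation (f S) - f S (w i))) + (expectation (f S) - f S z)) ` F)" for w z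
    unfolding L_def by (simp add: algebra_simps)
  have GS: "G (w(N := z)) = (L N (\<lambda>S. c S + 2 * f S z) w + L N (\<lambda>S. c S - 2 * f S z) w) / 2" for w z
    unfolding L_def G_def by simp
  have GS': "G (w(N := z)) = (Max ((\<lambda>S. (c S + (\<Sum>i<N. expectation (f S) - f S (w i))) + 2 * f S z) ` F)
      + Max ((\<lambda>S. (c S + (\<Sum>i<N. expectation (f S) - f S (w i))) - 2 * f S z) ` F)) / 2" for w z
    unfolding G_def by (simp add: algebra_simps)
  have RS: "R (Suc N) c (w(N := z)) = (R N (\<lambda>S. c S + 2 * f S z) w + R N (\<lambda>S. c S - 2 * f S z) w) / 2" for w z
    unfolding R_def by (simp add: algebra_simps)
  have GB: "\<bar>G w\<bar> \<le> A c + (2 * B + real N * (2 * B))" if w: "w \<in> space (?P (Suc N))" for w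
  proof -
    have *: "\<bar>c S + s * (2 * f S (w N)) + (\<Sum>i<N. expectation (f S) - f S (w i))\<bar> \<le> A c + (2 * B + real N * (2 * B))"
      if S: "S \<in> F" and s: "s = 1 \<or> s = - 1" for S s
    proof -
      have "\<bar>\<Sum>i<N. expectation (f S) - f S (w i)\<bar> \<le> (\<Sum>i<N. 2 * B)"
      proof (rule order_trans[OF sum_abs], rule sum_mono)
        fix i assume "i \<in> {..<N}"
        then have "\<bar>f S (w i)\<bar> \<le> B" using fwB[OF S _ w, of i] by auto
        then show "\<bar>expectation (f S) - f S (w i)\<bar> \<le> 2 * B" using mB[OF S] by linarith
      qed
      moreover have "\<bar>f S (w N)\<bar> \<le> B" using fwB[OF S _ w, of N] by auto
      ultimately show ?thesis using s A[OF S, of c] by auto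
    qed
    have "\<bar>Max ((\<lambda>S. c S + 2 * f S (w N) + (\<Sum>i<N. expectation (f S) - f S (w i))) ` F)\<bar> \<le> A c + (2 * B + real N * (2 * B))"
      using *[of _ 1] by (intro abs_Max_image_le[OF F]) auto
    moreover have "\<bar>Max ((\<lambda>S. c S - 2 * f S (w N) + (\<Sum>i<N. expectation (f S) - f S (w i))) ` F)\<bar> \<le> A c + (2 * B + real N * (2 * B))"
      using *[of _ "- 1"] by (intro abs_Max_image_le[OF F]) auto
    ultimately show ?thesis unfolding G_def by simp
  qed
  have upd: "w(N := z) \<in> space (?P (Suc N))" if "w \<in> space (?P N)" "z \<in> space M" for w z
    by (rule fun_upd_space_PiM_Suc[OF that])
  have sw: "(\<lambda>w. integral\<^sup>L M (\<lambda>z. g (w(N := z)))) \<in> borel_measurable (?P N)"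
    "(\<lambda>z. integral\<^sup>L (?P N) (\<lambda>w. g (w(N := z)))) \<in> borel_measurable M"
    if g: "g \<in> borel_measurable (?P (Suc N))" for g :: "(nat \<Rightarrow> 'a) \<Rightarrow> real"
  proof -
    have m: "(\<lambda>x. g ((fst x)(N := snd x))) \<in> borel_measurable (?P N \<Otimes>\<^sub>M M)"
      using measurable_comp[OF fun_upd_measurable_PiM_Suc g] by (simp add: comp_def split_def)
    show "(\<lambda>w. integral\<^sup>L M (\<lambda>z. g (w(N := z)))) \<in> borel_measurable (?P N)"
      using m by (intro borel_measurable_lebesgue_integral) (simp add: split_def)
    interpret PN: prob_space "?P N" by (rule psP)
    have "(\<lambda>x. g ((snd x)(N := fst x))) \<in> borel_measurable (M \<Otimes>\<^sub>M ?P N)"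
      using measurable_comp[OF measurable_pair_swap' m] by (simp add: comp_def split_def)
    then show "(\<lambda>z. integral\<^sup>L (?P N) (\<lambda>w. g (w(N := z)))) \<in> borel_measurable M"
      by (intro PN.borel_measurable_lebesgue_integral) (simp add: split_def)
  qed
  have zm: "(\<lambda>z. g (w(N := z))) \<in> borel_measurable M" if g: "g \<in> borel_measurable (?P (Suc N))" and w: "w \<in> space (?P N)" for g :: "(nat \<Rightarrow> 'a) \<Rightarrow> real" and w
    using measurable_comp[OF measurable_component_update[of w "{..<N}" "\<lambda>_. M" N] g[unfolded lessThan_Suc]] w by (simp add: comp_def)
  have bi: "\<bar>integral\<^sup>L X h\<bar> \<le> C" if "prob_space X" "C \<ge> 0" "\<And>x. x \<in> space X \<Longrightarrow> \<bar>h x\<bar> \<le> C" "h \<in> borel_measurable X" for h :: "'b \<Rightarrow> real" and C and X :: "'b measure"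
  proof -
    interpret X: prob_space X by fact
    have "integrable X h" by (rule X.integrable_const_bound[where B = C]) (use that in \<open>auto intro!: AE_I2\<close>)
    then have "\<bar>integral\<^sup>L X h\<bar> \<le> (\<integral>x. C \<partial>X)"
      by (intro order_trans[OF integral_abs_bound] integral_mono) (use that in auto)
    then show ?thesis by (simp add: X.prob_space)
  qed
  have A0: "A c \<ge> 0"
  proof -
    obtain S where "S \<in> F" using F by auto
    then show ?thesis using A[of S c] by linarith
  qed
  have "integral\<^sup>L (?P (Suc N)) (L (Suc N) c) = (\<integral>w. \<integral>z. L (Suc N) c (w(N := z)) \<partial>M \<partial>?P N)"
    by (rule integral_PiM_Suc(1)[OF Lm LB])
  also have "\<dots> \<le> (\<integral>w. \<integral>z. G (w(N := z)) \<partial>M \<partial>?P N)"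
  proof (rule integral_mono)
    interpret PN: prob_space "?P N" by (rule psP)
    show "integrable (?P N) (\<lambda>w. \<integral>z. L (Suc N) c (w(N := z)) \<partial>M)"
      using A0 B0 by (intro PN.integrable_const_bound[where B = "A c + real (Suc N) * (2 * B)"] sw Lm AE_I2, unfold real_norm_def,
          intro bi prob_space_axioms LB upd zm Lm) auto
    show "integrable (?P N) (\<lambda>w. \<integral>z. G (w(N := z)) \<partial>M)"
      using A0 B0 by (intro PN.integrable_const_bound[where B = "A c + (2 * B + real N * (2 * B))"] sw Gm AE_I2, unfold real_norm_def,
          intro bi prob_space_axioms GB upd zm Gm) auto
    fix w
    show "(\<integral>z. L (Suc N) c (w(N := z)) \<partial>M) \<le> (\<integral>z. G (w(N := z)) \<partial>M)"
      unfolding LS GS' by (rule symmetrization_step[OF F f B])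
  qed
  also have "\<dots> = (\<integral>z. \<integral>w. G (w(N := z)) \<partial>?P N \<partial>M)"
    using integral_PiM_Suc[OF Gm GB] by simp
  also have "\<dots> \<le> (\<integral>z. \<integral>w. R (Suc N) c (w(N := z)) \<partial>?P N \<partial>M)"
  proof (rule integral_mono)
    let ?C = "\<bar>sign_mean (Suc N) (\<lambda>\<sigma>. A c + (\<Sum>i<Suc N. \<bar>\<sigma> i\<bar> * (2 * B)))\<bar>"
    have RB': "\<bar>R (Suc N) c w\<bar> \<le> ?C" if "w \<in> space (?P (Suc N))" for w
      using RB[OF that, of c] by linarith
    have wm: "(\<lambda>w. g (w(N := z))) \<in> borel_measurable (?P N)" if g: "g \<in> borel_measurable (?P (Suc N))" and z: "z \<in> space M" for g :: "(nat \<Rightarrow> 'a) \<Rightarrow> real" and z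
      using measurable_comp[OF measurable_fun_upd[where J = "{..<N}" and i = N and f = "\<lambda>w. w" and h = "\<lambda>_. z" and N = "?P N" and M = "\<lambda>_. M"] g[unfolded lessThan_Suc]] z
      by (simp add: comp_def)
    show "integrable M (\<lambda>z. \<integral>w. G (w(N := z)) \<partial>?P N)"
      using A0 B0 by (intro integrable_const_bound[where B = "A c + (2 * B + real N * (2 * B))"] sw Gm AE_I2, unfold real_norm_def,
          intro bi psP GB upd wm Gm) auto
    show "integrable M (\<lambda>z. \<integral>w. R (Suc N) c (w(N := z)) \<partial>?P N)"
      by (intro integrable_const_bound[where B = ?C] sw Rm AE_I2, unfold real_norm_def,
          intro bi psP RB' upd wm Rm) auto
    fix z
    have "(\<integral>w. G (w(N := z)) \<partial>?P N) = (integral\<^sup>L (?P N) (L N (\<lambda>S. c S + 2 * f S z)) + integral\<^sup>L (?P N) (L N (\<lambda>S. c S - 2 * f S z))) / 2"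
      unfolding GS using Li[of N] by simp
    also have "\<dots> \<le> (integral\<^sup>L (?P N) (R N (\<lambda>S. c S + 2 * f S z)) + integral\<^sup>L (?P N) (R N (\<lambda>S. c S - 2 * f S z))) / 2"
      using IH[of "\<lambda>S. c S + 2 * f S z"] IH[of "\<lambda>S. c S - 2 * f S z"] by simp
    also have "\<dots> = (\<integral>w. R (Suc N) c (w(N := z)) \<partial>?P N)"
      unfolding RS using Ri[of N] by simp
    finally show "(\<integral>w. G (w(N := z)) \<partial>?P N) \<le> (\<integral>w. R (Suc N) c (w(N := z)) \<partial>?P N)" .
  qed
  also have "\<dots> = integral\<^sup>L (?P (Suc N)) (R (Suc N) c)"
    by (rule integral_PiM_Suc(2)[OF Rm RB, symmetric])
  finally show ?case unfolding L_def R_def .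
qed

section \<open>Positive semidefinite Lyapunov recursions\<close>

text \<open>The class in which all integrands along trajectories stay: it contains continuous
  functions and bounded measurable inputs, is closed under sums and products, and its members are
  integrable on every \<open>{0..t}\<close> with \<open>t \<le> T\<close>.\<close>

definition bdd_meas :: "real \<Rightarrow> (real \<Rightarrow> real) \<Rightarrow> bool" where
  "bdd_meas T g \<longleftrightarrow> g \<in> borel_measurable (lebesgue_on {0..T}) \<and> (\<exists>C. \<forall>t\<in>{0..T}. \<bar>g t\<bar> \<le> C)"

lemma bdd_meas_const [simp, intro]: "bdd_meas T (\<lambda>_. a)"
  unfolding bdd_meas_def by auto

lemma bdd_meas_add [intro]: "bdd_meas T f \<Longrightarrow> bdd_meas T g \<Longrightarrow> bdd_meas T (\<lambda>t. f t + g t)"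
proof -
  assume "bdd_meas T f" "bdd_meas T g"
  then obtain C D where m: "f \<in> borel_measurable (lebesgue_on {0..T})" "g \<in> borel_measurable (lebesgue_on {0..T})"
    and C: "\<And>t. t\<in>{0..T} \<Longrightarrow> \<bar>f t\<bar> \<le> C" and D: "\<And>t. t\<in>{0..T} \<Longrightarrow> \<bar>g t\<bar> \<le> D"
    unfolding bdd_meas_def by blast
  have "\<bar>f t + g t\<bar> \<le> C + D" if "t \<in> {0..T}" for t using C[OF that] D[OF that] by linarith
  then show ?thesis unfolding bdd_meas_def using borel_measurable_add[OF m] by blast
qed

lemma bdd_meas_mult [intro]:
  assumes "bdd_meas T f" "bdd_meas T g" shows "bdd_meas T (\<lambda>t. f t * g t)"
proof -
  obtain C D where C: "\<forall>t\<in>{0..T}. \<bar>f t\<bar> \<le> C" and D: "\<forall>t\<in>{0..T}. \<bar>g t\<bar> \<le> D"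
    using assms unfolding bdd_meas_def by auto
  have "\<bar>f t * g t\<bar> \<le> C * D" if "t \<in> {0..T}" for t
    unfolding abs_mult using C D that by (intro mult_mono) (auto intro: order_trans[OF abs_ge_zero])
  moreover have "(\<lambda>t. f t * g t) \<in> borel_measurable (lebesgue_on {0..T})"
    using assms unfolding bdd_meas_def by (intro borel_measurable_times) auto
  ultimately show ?thesis unfolding bdd_meas_def by blast
qed

lemma bdd_meas_minus [intro]: "bdd_meas T f \<Longrightarrow> bdd_meas T (\<lambda>t. - f t)"
  using bdd_meas_mult[of T "\<lambda>_. - 1" f] by simp

lemma bdd_meas_diff [intro]: "bdd_meas T f \<Longrightarrow> bdd_meas T g \<Longrightarrow> bdd_meas T (\<lambda>t. f t - g t)"
  using bdd_meas_add[of T f "\<lambda>t. - g t"] by auto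

lemma bdd_meas_sum [intro]: "(\<And>i. i \<in> I \<Longrightarrow> bdd_meas T (f i)) \<Longrightarrow> bdd_meas T (\<lambda>t. \<Sum>i\<in>I. f i t)"
  by (induction I rule: infinite_finite_induct) auto

lemma bdd_meas_continuous:
  assumes "continuous_on {0..T} g" shows "bdd_meas T g"
proof -
  have "bounded (g ` {0..T})" using assms by (intro compact_imp_bounded compact_continuous_image) auto
  then obtain C where "\<forall>x\<in>g ` {0..T}. norm x \<le> C" unfolding bounded_iff by blast
  then show ?thesis unfolding bdd_meas_def
    using assms by (auto intro!: continuous_imp_measurable_on_sets_lebesgue exI[of _ C])
qed

lemma bdd_meas_mono: "bdd_meas T g \<Longrightarrow> t \<le> T \<Longrightarrow> bdd_meas t g"
  unfolding bdd_meas_def using measurable_restrict_mono[of g "lebesgue" "{0..T}" borel "{0..t}"] by fastforce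

lemma bdd_meas_integrable:
  assumes "bdd_meas T g" shows "g integrable_on {0..T}"
proof -
  obtain C where C: "\<forall>t\<in>{0..T}. \<bar>g t\<bar> \<le> C" using assms unfolding bdd_meas_def by auto
  have "g absolutely_integrable_on {0..T}"
    by (rule measurable_bounded_by_integrable_imp_absolutely_integrable[of g "{0..T}" "\<lambda>_. C"])
      (use assms C in \<open>auto simp: bdd_meas_def\<close>)
  then show ?thesis using set_lebesgue_integral_eq_integral by blast
qed

lemma bdd_meas_integrable': "bdd_meas T g \<Longrightarrow> t \<le> T \<Longrightarrow> g integrable_on {0..t}"
  using bdd_meas_integrable bdd_meas_mono by blast

lemma bdd_meas_reflect:
  assumes h: "continuous_on {0..T} h" and t: "t \<le> T"
  shows "bdd_meas t (\<lambda>s. h (t - s))"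
  by (rule bdd_meas_continuous, rule continuous_on_compose2[OF h]) (use t in \<open>auto intro!: continuous_intros\<close>)

text \<open>Dominated convergence wants a fixed domain. Extending \<open>h\<close> by constants to
  the whole line allows integration over all of \<open>{0..T}\<close>; beyond \<open>t\<close> the
  extension equals \<open>h 0\<close>, and this excess is subtracted.\<close>

lemma continuous_on_convolution:
  assumes h: "continuous_on {0..T} h" and g: "bdd_meas T g"
  shows "continuous_on {0..T} (\<lambda>t. integral {0..t} (\<lambda>s. h (t - s) * g s))"
proof (cases "T < 0")
  case False
  then have T: "T \<ge> 0" by simp
  define H where "H x = h (max 0 (min T x))" for x
  have H: "continuous_on UNIV H" unfolding H_def
    by (rule continuous_on_compose2[OF h]) (use T in \<open>auto intro!: continuous_intros\<close>)
  obtain Ch where Ch: "\<forall>t\<in>{0..T}. \<bar>h t\<bar> \<le> Ch" using bdd_meas_continuous[OF h] unfolding bdd_meas_def by auto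
  have HC: "\<bar>H x\<bar> \<le> Ch" for x unfolding H_def using Ch T by auto
  obtain C where C: "\<forall>t\<in>{0..T}. \<bar>g t\<bar> \<le> C" using g unfolding bdd_meas_def by auto
  have C0: "C \<ge> 0" using C T by (meson abs_ge_zero atLeastAtMost_iff order_refl order_trans)
  have Hb: "bdd_meas T (\<lambda>s. H (t - s) * g s)" for t
    by (intro bdd_meas_mult g bdd_meas_continuous continuous_on_compose2[OF H]) (auto intro!: continuous_intros)
  have 1: "continuous_on {0..T} (\<lambda>t. integral {0..T} (\<lambda>s. H (t - s) * g s))"
    unfolding continuous_on_sequentially
  proof (intro allI ballI impI, elim conjE, unfold comp_def)
    fix x :: "nat \<Rightarrow> real" and a assume x: "x \<longlonglongrightarrow> a"
    show "(\<lambda>k. integral {0..T} (\<lambda>s. H (x k - s) * g s)) \<longlonglongrightarrow> integral {0..T} (\<lambda>s. H (a - s) * g s)"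
    proof (rule dominated_convergence(2)[where h = "\<lambda>_. Ch * C"])
      show "(\<lambda>s. H (x k - s) * g s) integrable_on {0..T}" for k by (rule bdd_meas_integrable[OF Hb])
      show "norm (H (x k - s) * g s) \<le> Ch * C" if "s \<in> {0..T}" for k s
        unfolding real_norm_def abs_mult using HC C that C0 by (intro mult_mono) (auto intro: order_trans[OF abs_ge_zero])
      show "(\<lambda>k. H (x k - s) * g s) \<longlonglongrightarrow> H (a - s) * g s" for s
        by (intro tendsto_mult tendsto_const continuous_on_tendsto_compose[OF H] tendsto_diff x) auto
    qed auto
  qed
  have 2: "continuous_on {0..T} (\<lambda>t. integral {0..t} g)"
    by (rule indefinite_integral_continuous_1[OF bdd_meas_integrable[OF g]])
  have "continuous_on {0..T} (\<lambda>t. integral {0..T} (\<lambda>s. H (t - s) * g s) - H 0 * (integral {0..T} g - integral {0..t} g))"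
    by (intro continuous_intros 1 2)
  then show ?thesis
  proof (rule continuous_on_eq)
    fix t assume t: "t \<in> {0..T}"
    have "integral {0..T} (\<lambda>s. H (t - s) * g s) = integral {0..t} (\<lambda>s. H (t - s) * g s) + integral {t..T} (\<lambda>s. H (t - s) * g s)"
      using t by (intro Henstock_Kurzweil_Integration.integral_combine[symmetric] bdd_meas_integrable[OF Hb]) auto
    also have "integral {t..T} (\<lambda>s. H (t - s) * g s) = integral {t..T} (\<lambda>s. H 0 * g s)"
      by (rule Henstock_Kurzweil_Integration.integral_cong) (use t in \<open>auto simp: H_def max_def min_def\<close>)
    also have "\<dots> = H 0 * integral {t..T} g" by simp
    also have "integral {t..T} g = integral {0..T} g - integral {0..t} g"
      using Henstock_Kurzweil_Integration.integral_combine[of 0 t T g] t bdd_meas_integrable[OF g] by simp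
    also have "integral {0..t} (\<lambda>s. H (t - s) * g s) = integral {0..t} (\<lambda>s. h (t - s) * g s)"
      by (rule Henstock_Kurzweil_Integration.integral_cong) (use t in \<open>auto simp: H_def\<close>)
    finally show "integral {0..T} (\<lambda>s. H (t - s) * g s) - H 0 * (integral {0..T} g - integral {0..t} g)
        = integral {0..t} (\<lambda>s. h (t - s) * g s)" by simp
  qed
qed simp

text \<open>In matrix notation, v^T (P S P^T) v = (P^T v)^T S (P^T v): a congruence is moved from
  the form to the vector, which is how positivity is inherited.\<close>

lemma quadratic_form_congruence:
  fixes v :: "'i \<Rightarrow> real"
  shows "(\<Sum>\<alpha>\<in>I. \<Sum>\<beta>\<in>I. v \<alpha> * v \<beta> * (\<Sum>\<gamma>\<in>J. P \<alpha> \<gamma> * (\<Sum>\<delta>\<in>J. P \<beta> \<delta> * S \<gamma> \<delta>)))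
    = (\<Sum>\<gamma>\<in>J. \<Sum>\<delta>\<in>J. (\<Sum>\<alpha>\<in>I. v \<alpha> * P \<alpha> \<gamma>) * (\<Sum>\<beta>\<in>I. v \<beta> * P \<beta> \<delta>) * S \<gamma> \<delta>)"
proof -
  have "(\<Sum>\<alpha>\<in>I. \<Sum>\<beta>\<in>I. v \<alpha> * v \<beta> * (\<Sum>\<gamma>\<in>J. P \<alpha> \<gamma> * (\<Sum>\<delta>\<in>J. P \<beta> \<delta> * S \<gamma> \<delta>)))
     = (\<Sum>x\<in>I\<times>I. \<Sum>y\<in>J\<times>J. v (fst x) * P (fst x) (fst y) * (v (snd x) * P (snd x) (snd y)) * S (fst y) (snd y))"
    by (simp add: sum.cartesian_product' sum_distrib_left mult_ac)
  also have "\<dots> = (\<Sum>y\<in>J\<times>J. \<Sum>x\<in>I\<times>I. v (fst x) * P (fst x) (fst y) * (v (snd x) * P (snd x) (snd y)) * S (fst y) (snd y))"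
    by (rule sum.swap)
  also have "\<dots> = (\<Sum>\<gamma>\<in>J. \<Sum>\<delta>\<in>J. (\<Sum>\<alpha>\<in>I. v \<alpha> * P \<alpha> \<gamma>) * (\<Sum>\<beta>\<in>I. v \<beta> * P \<beta> \<delta>) * S \<gamma> \<delta>)"
  proof -
    have "(\<Sum>\<alpha>\<in>I. v \<alpha> * P \<alpha> \<gamma>) * (\<Sum>\<beta>\<in>I. v \<beta> * P \<beta> \<delta>) * S \<gamma> \<delta>
       = (\<Sum>\<alpha>\<in>I. \<Sum>\<beta>\<in>I. v \<alpha> * P \<alpha> \<gamma> * (v \<beta> * P \<beta> \<delta>) * S \<gamma> \<delta>)" for \<gamma> \<delta>
      by (subst sum_product) (simp add: sum_distrib_right)
    then show ?thesis by (simp add: sum.cartesian_product')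
  qed
  finally show ?thesis .
qed

lemma quadratic_form_outer:
  fixes v :: "'i \<Rightarrow> real"
  shows "(\<Sum>\<gamma>\<in>J. \<Sum>\<delta>\<in>J. v \<gamma> * v \<delta> * (\<Sum>w\<in>W. b w \<gamma> * b w \<delta>)) = (\<Sum>w\<in>W. (\<Sum>\<gamma>\<in>J. v \<gamma> * b w \<gamma>)\<^sup>2)"
proof -
  have "(\<Sum>w\<in>W. (\<Sum>\<gamma>\<in>J. v \<gamma> * b w \<gamma>)\<^sup>2) = (\<Sum>w\<in>W. \<Sum>x\<in>J\<times>J. v (fst x) * v (snd x) * (b w (fst x) * b w (snd x)))"
    by (simp add: power2_eq_square sum_product sum.cartesian_product' mult_ac)
  also have "\<dots> = (\<Sum>x\<in>J\<times>J. \<Sum>w\<in>W. v (fst x) * v (snd x) * (b w (fst x) * b w (snd x)))"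
    by (rule sum.swap)
  also have "\<dots> = (\<Sum>\<gamma>\<in>J. \<Sum>\<delta>\<in>J. v \<gamma> * v \<delta> * (\<Sum>w\<in>W. b w \<gamma> * b w \<delta>))"
    by (simp add: sum.cartesian_product' sum_distrib_left)
  finally show ?thesis by simp
qed

lemma sum_rotate3: "(\<Sum>x\<in>I. \<Sum>y\<in>J. \<Sum>k\<in>K. h k x y) = (\<Sum>k\<in>K. \<Sum>x\<in>I. \<Sum>y\<in>J. h k x y)"
proof -
  have "(\<Sum>x\<in>I. \<Sum>y\<in>J. \<Sum>k\<in>K. h k x y) = (\<Sum>x\<in>I. \<Sum>k\<in>K. \<Sum>y\<in>J. h k x y)"
    by (intro sum.cong refl sum.swap)
  also have "\<dots> = (\<Sum>k\<in>K. \<Sum>x\<in>I. \<Sum>y\<in>J. h k x y)" by (rule sum.swap)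
  finally show ?thesis .
qed

lemma integral_double_sum:
  fixes f :: "'i \<Rightarrow> 'i \<Rightarrow> real \<Rightarrow> real"
  assumes "finite I" "\<And>\<alpha> \<beta>. \<alpha> \<in> I \<Longrightarrow> \<beta> \<in> I \<Longrightarrow> f \<alpha> \<beta> integrable_on S"
  shows "integral S (\<lambda>x. \<Sum>\<alpha>\<in>I. \<Sum>\<beta>\<in>I. f \<alpha> \<beta> x) = (\<Sum>\<alpha>\<in>I. \<Sum>\<beta>\<in>I. integral S (f \<alpha> \<beta>))"
  using assms by (simp add: integral_sum integrable_sum)

text \<open>Z m is the m-th Picard iterate of a Lyapunov equation with initial value 0. Each step integrates
  congruence transforms of Z m plus rank-one terms, so positive semidefiniteness is inherited.\<close>

locale lyapunov_recursion =
  fixes I :: "'i set" and Ks :: "'k set" and W :: "'w set" and T :: real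
    and E :: "real \<Rightarrow> 'i \<Rightarrow> 'i \<Rightarrow> real" and D :: "'k \<Rightarrow> real \<Rightarrow> 'i \<Rightarrow> 'i \<Rightarrow> real"
    and b :: "'w \<Rightarrow> real \<Rightarrow> 'i \<Rightarrow> real"
  assumes fin: "finite I" "finite Ks" "finite W"
    and E_cont: "\<And>\<alpha> \<beta>. \<alpha> \<in> I \<Longrightarrow> \<beta> \<in> I \<Longrightarrow> continuous_on {0..T} (\<lambda>t. E t \<alpha> \<beta>)"
    and D_bdd_meas: "\<And>k \<alpha> \<beta>. k \<in> Ks \<Longrightarrow> \<alpha> \<in> I \<Longrightarrow> \<beta> \<in> I \<Longrightarrow> bdd_meas T (\<lambda>t. D k t \<alpha> \<beta>)"
    and b_bdd_meas: "\<And>w \<alpha>. w \<in> W \<Longrightarrow> \<alpha> \<in> I \<Longrightarrow> bdd_meas T (\<lambda>t. b w t \<alpha>)"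
begin

primrec Z :: "nat \<Rightarrow> real \<Rightarrow> 'i \<Rightarrow> 'i \<Rightarrow> real" where
  "Z 0 = (\<lambda>t \<alpha> \<beta>. 0)"
| "Z (Suc m) = (\<lambda>t \<alpha> \<beta>. integral {0..t} (\<lambda>\<tau>. \<Sum>\<gamma>\<in>I. E (t - \<tau>) \<alpha> \<gamma> * (\<Sum>\<delta>\<in>I. E (t - \<tau>) \<beta> \<delta> *
     ((\<Sum>w\<in>W. b w \<tau> \<gamma> * b w \<tau> \<delta>)
      + (\<Sum>k\<in>Ks. \<Sum>\<epsilon>\<in>I. D k \<tau> \<gamma> \<epsilon> * (\<Sum>\<zeta>\<in>I. D k \<tau> \<delta> \<zeta> * Z m \<tau> \<epsilon> \<zeta>))))))"

declare Z.simps(2) [simp del]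

text \<open>The inhomogeneity b b^T + sum of D Z D^T of the Lyapunov equation, named so that its
  measurability and symmetry can be stated apart from the propagators.\<close>

definition forcing :: "nat \<Rightarrow> real \<Rightarrow> 'i \<Rightarrow> 'i \<Rightarrow> real" where
  "forcing m \<tau> \<gamma> \<delta> = (\<Sum>w\<in>W. b w \<tau> \<gamma> * b w \<tau> \<delta>)
      + (\<Sum>k\<in>Ks. \<Sum>\<epsilon>\<in>I. D k \<tau> \<gamma> \<epsilon> * (\<Sum>\<zeta>\<in>I. D k \<tau> \<delta> \<zeta> * Z m \<tau> \<epsilon> \<zeta>))"

lemma Z_Suc: "Z (Suc m) t \<alpha> \<beta> = integral {0..t} (\<lambda>\<tau>. \<Sum>\<gamma>\<in>I. E (t - \<tau>) \<alpha> \<gamma> * (\<Sum>\<delta>\<in>I. E (t - \<tau>) \<beta> \<delta> * forcing m \<tau> \<gamma> \<delta>))"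
  by (simp add: forcing_def Z.simps)

lemma forcing_bdd_meas:
  assumes "\<And>\<alpha> \<beta>. \<alpha> \<in> I \<Longrightarrow> \<beta> \<in> I \<Longrightarrow> bdd_meas T (\<lambda>t. Z m t \<alpha> \<beta>)" "\<alpha> \<in> I" "\<beta> \<in> I"
  shows "bdd_meas T (\<lambda>t. forcing m t \<alpha> \<beta>)"
  unfolding forcing_def using assms D_bdd_meas b_bdd_meas by (intro bdd_meas_add bdd_meas_sum bdd_meas_mult) auto

lemma integrand_bdd_meas:
  assumes "\<And>\<alpha> \<beta>. \<alpha> \<in> I \<Longrightarrow> \<beta> \<in> I \<Longrightarrow> bdd_meas T (\<lambda>t. Z m t \<alpha> \<beta>)" "\<alpha> \<in> I" "\<beta> \<in> I" "t \<le> T"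
  shows "bdd_meas t (\<lambda>\<tau>. \<Sum>\<gamma>\<in>I. E (t - \<tau>) \<alpha> \<gamma> * (\<Sum>\<delta>\<in>I. E (t - \<tau>) \<beta> \<delta> * forcing m \<tau> \<gamma> \<delta>))"
  using assms(2-4) by (intro bdd_meas_sum bdd_meas_mult bdd_meas_reflect[OF E_cont] bdd_meas_mono[OF forcing_bdd_meas[OF assms(1)]]) auto

lemma Z_bdd_meas:
  "\<alpha> \<in> I \<Longrightarrow> \<beta> \<in> I \<Longrightarrow> bdd_meas T (\<lambda>t. Z m t \<alpha> \<beta>)"
proof (induction m arbitrary: \<alpha> \<beta>)
  case (Suc m)
  \<comment> \<open>Multiplying out the congruence turns every entry into a finite sum of
    convolutions with kernels \<open>E s \<alpha> \<gamma> * E s \<beta> \<delta>\<close>.\<close>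
  have "continuous_on {0..T} (\<lambda>t. \<Sum>\<gamma>\<in>I. \<Sum>\<delta>\<in>I. integral {0..t} (\<lambda>\<tau>. E (t - \<tau>) \<alpha> \<gamma> * E (t - \<tau>) \<beta> \<delta> * forcing m \<tau> \<gamma> \<delta>))"
    using Suc by (intro continuous_on_sum continuous_on_convolution[of T "\<lambda>s. E s \<alpha> _ * E s \<beta> _"] continuous_on_mult E_cont forcing_bdd_meas) auto
  then show ?case
  proof (rule bdd_meas_continuous[OF continuous_on_eq])
    fix t assume t: "t \<in> {0..T}"
    show "(\<Sum>\<gamma>\<in>I. \<Sum>\<delta>\<in>I. integral {0..t} (\<lambda>\<tau>. E (t - \<tau>) \<alpha> \<gamma> * E (t - \<tau>) \<beta> \<delta> * forcing m \<tau> \<gamma> \<delta>)) = Z (Suc m) t \<alpha> \<beta>"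
  proof -
    have int: "(\<lambda>\<tau>. E (t - \<tau>) \<alpha> \<gamma> * E (t - \<tau>) \<beta> \<delta> * forcing m \<tau> \<gamma> \<delta>) integrable_on {0..t}"
      if "\<gamma> \<in> I" "\<delta> \<in> I" for \<gamma> \<delta>
      using that Suc t by (intro bdd_meas_integrable bdd_meas_mult bdd_meas_reflect[OF E_cont] bdd_meas_mono[OF forcing_bdd_meas]) auto
    have "(\<Sum>\<gamma>\<in>I. \<Sum>\<delta>\<in>I. integral {0..t} (\<lambda>\<tau>. E (t - \<tau>) \<alpha> \<gamma> * E (t - \<tau>) \<beta> \<delta> * forcing m \<tau> \<gamma> \<delta>))
       = integral {0..t} (\<lambda>\<tau>. \<Sum>\<gamma>\<in>I. \<Sum>\<delta>\<in>I. E (t - \<tau>) \<alpha> \<gamma> * E (t - \<tau>) \<beta> \<delta> * forcing m \<tau> \<gamma> \<delta>)"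
      using fin(1) int by (simp add: integral_sum integrable_sum)
    then show ?thesis unfolding Z_Suc by (simp add: sum_distrib_left mult.assoc)
  qed
  qed
qed simp

text \<open>Everything acts on the pulled-back vector \<open>v'\<close>: squares from the rank-one
  terms, and forms of the previous iterate. Positivity of the iterates and the recursion for the
  state block are both read off from this.\<close>

lemma quadratic_form_Suc:
  fixes v :: "'i \<Rightarrow> real"
  assumes t: "t \<le> T"
  defines "v' \<equiv> \<lambda>\<tau> \<gamma>. \<Sum>\<alpha>\<in>I. v \<alpha> * E (t - \<tau>) \<alpha> \<gamma>"
  shows "(\<Sum>\<alpha>\<in>I. \<Sum>\<beta>\<in>I. v \<alpha> * v \<beta> * Z (Suc m) t \<alpha> \<beta>)
    = integral {0..t} (\<lambda>\<tau>. (\<Sum>w\<in>W. (\<Sum>\<gamma>\<in>I. v' \<tau> \<gamma> * b w \<tau> \<gamma>)\<^sup>2)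
        + (\<Sum>k\<in>Ks. \<Sum>\<epsilon>\<in>I. \<Sum>\<zeta>\<in>I. (\<Sum>\<gamma>\<in>I. v' \<tau> \<gamma> * D k \<tau> \<gamma> \<epsilon>) * (\<Sum>\<delta>\<in>I. v' \<tau> \<delta> * D k \<tau> \<delta> \<zeta>) * Z m \<tau> \<epsilon> \<zeta>))"
    (is "_ = integral {0..t} ?g")
    and "bdd_meas t (\<lambda>\<tau>. (\<Sum>w\<in>W. (\<Sum>\<gamma>\<in>I. v' \<tau> \<gamma> * b w \<tau> \<gamma>)\<^sup>2)
        + (\<Sum>k\<in>Ks. \<Sum>\<epsilon>\<in>I. \<Sum>\<zeta>\<in>I. (\<Sum>\<gamma>\<in>I. v' \<tau> \<gamma> * D k \<tau> \<gamma> \<epsilon>) * (\<Sum>\<delta>\<in>I. v' \<tau> \<delta> * D k \<tau> \<delta> \<zeta>) * Z m \<tau> \<epsilon> \<zeta>))"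
proof -
  have int: "bdd_meas t (\<lambda>\<tau>. v \<alpha> * v \<beta> * (\<Sum>\<gamma>\<in>I. E (t - \<tau>) \<alpha> \<gamma> * (\<Sum>\<delta>\<in>I. E (t - \<tau>) \<beta> \<delta> * forcing m \<tau> \<gamma> \<delta>)))"
    if "\<alpha> \<in> I" "\<beta> \<in> I" for \<alpha> \<beta>
    by (intro bdd_meas_mult bdd_meas_const integrand_bdd_meas Z_bdd_meas that t)
  have "(\<Sum>\<alpha>\<in>I. \<Sum>\<beta>\<in>I. v \<alpha> * v \<beta> * Z (Suc m) t \<alpha> \<beta>)
    = (\<Sum>\<alpha>\<in>I. \<Sum>\<beta>\<in>I. integral {0..t} (\<lambda>\<tau>. v \<alpha> * v \<beta> * (\<Sum>\<gamma>\<in>I. E (t - \<tau>) \<alpha> \<gamma> * (\<Sum>\<delta>\<in>I. E (t - \<tau>) \<beta> \<delta> * forcing m \<tau> \<gamma> \<delta>))))"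
    unfolding Z_Suc by simp
  also have "\<dots> = integral {0..t} (\<lambda>\<tau>. \<Sum>\<alpha>\<in>I. \<Sum>\<beta>\<in>I. v \<alpha> * v \<beta> * (\<Sum>\<gamma>\<in>I. E (t - \<tau>) \<alpha> \<gamma> * (\<Sum>\<delta>\<in>I. E (t - \<tau>) \<beta> \<delta> * forcing m \<tau> \<gamma> \<delta>)))"
    by (rule integral_double_sum[OF fin(1) bdd_meas_integrable[OF int], symmetric])
  also have "(\<lambda>\<tau>. \<Sum>\<alpha>\<in>I. \<Sum>\<beta>\<in>I. v \<alpha> * v \<beta> * (\<Sum>\<gamma>\<in>I. E (t - \<tau>) \<alpha> \<gamma> * (\<Sum>\<delta>\<in>I. E (t - \<tau>) \<beta> \<delta> * forcing m \<tau> \<gamma> \<delta>))) = ?g"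
  proof
    fix \<tau>
    have v': "(\<Sum>\<alpha>\<in>I. v \<alpha> * E (t - \<tau>) \<alpha> \<gamma>) = v' \<tau> \<gamma>" for \<gamma> by (simp add: v'_def)
    have "(\<Sum>\<gamma>\<in>I. \<Sum>\<delta>\<in>I. v' \<tau> \<gamma> * v' \<tau> \<delta> * (\<Sum>k\<in>Ks. \<Sum>\<epsilon>\<in>I. D k \<tau> \<gamma> \<epsilon> * (\<Sum>\<zeta>\<in>I. D k \<tau> \<delta> \<zeta> * Z m \<tau> \<epsilon> \<zeta>)))
       = (\<Sum>k\<in>Ks. \<Sum>\<gamma>\<in>I. \<Sum>\<delta>\<in>I. v' \<tau> \<gamma> * v' \<tau> \<delta> * (\<Sum>\<epsilon>\<in>I. D k \<tau> \<gamma> \<epsilon> * (\<Sum>\<zeta>\<in>I. D k \<tau> \<delta> \<zeta> * Z m \<tau> \<epsilon> \<zeta>)))"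
      unfolding sum_distrib_left[of _ _ Ks] by (rule sum_rotate3)
    then show "(\<Sum>\<alpha>\<in>I. \<Sum>\<beta>\<in>I. v \<alpha> * v \<beta> * (\<Sum>\<gamma>\<in>I. E (t - \<tau>) \<alpha> \<gamma> * (\<Sum>\<delta>\<in>I. E (t - \<tau>) \<beta> \<delta> * forcing m \<tau> \<gamma> \<delta>))) = ?g \<tau>"
      unfolding quadratic_form_congruence v' forcing_def
      by (simp only: distrib_left sum.distrib quadratic_form_outer quadratic_form_congruence)
  qed
  finally show "(\<Sum>\<alpha>\<in>I. \<Sum>\<beta>\<in>I. v \<alpha> * v \<beta> * Z (Suc m) t \<alpha> \<beta>) = integral {0..t} ?g" .
  show "bdd_meas t ?g"
    unfolding v'_def power2_eq_square using t
    by (intro bdd_meas_add bdd_meas_sum bdd_meas_mult bdd_meas_const bdd_meas_reflect[OF E_cont] bdd_meas_mono[OF b_bdd_meas] bdd_meas_mono[OF D_bdd_meas] bdd_meas_mono[OF Z_bdd_meas]) auto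
qed

lemma Z_pos_semidef:
  "t \<le> T \<Longrightarrow> 0 \<le> (\<Sum>\<alpha>\<in>I. \<Sum>\<beta>\<in>I. v \<alpha> * v \<beta> * Z m t \<alpha> \<beta>)"
proof (induction m arbitrary: v t)
  case (Suc m)
  show ?case unfolding quadratic_form_Suc(1)[OF Suc.prems]
  proof (rule Henstock_Kurzweil_Integration.integral_nonneg)
    fix \<tau> assume "\<tau> \<in> {0..t}"
    then have "\<tau> \<le> T" using Suc.prems by auto
    then show "0 \<le> (\<Sum>w\<in>W. (\<Sum>\<gamma>\<in>I. (\<Sum>\<alpha>\<in>I. v \<alpha> * E (t - \<tau>) \<alpha> \<gamma>) * b w \<tau> \<gamma>)\<^sup>2)
        + (\<Sum>k\<in>Ks. \<Sum>\<epsilon>\<in>I. \<Sum>\<zeta>\<in>I. (\<Sum>\<gamma>\<in>I. (\<Sum>\<alpha>\<in>I. v \<alpha> * E (t - \<tau>) \<alpha> \<gamma>) * D k \<tau> \<gamma> \<epsilon>)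
            * (\<Sum>\<delta>\<in>I. (\<Sum>\<alpha>\<in>I. v \<alpha> * E (t - \<tau>) \<alpha> \<delta>) * D k \<tau> \<delta> \<zeta>) * Z m \<tau> \<epsilon> \<zeta>)"
      by (intro add_nonneg_nonneg sum_nonneg Suc.IH) auto
  qed (rule bdd_meas_integrable[OF quadratic_form_Suc(2)[OF Suc.prems]])
qed simp

end

section \<open>Absolutely continuous functions and linear integral equations\<close>

lemma abs_continuous_onD:
  assumes "abs_continuous_on a b f" "e > 0"
  obtains d where "d > 0" "\<And>(m::nat) l r. (\<And>j. j < m \<Longrightarrow> a \<le> l j \<and> l j \<le> r j \<and> r j \<le> b) \<Longrightarrow>
        disjoint_family_on (\<lambda>j. {l j<..<r j}) {..<m} \<Longrightarrow>
        (\<Sum>j<m. r j - l j) < d \<Longrightarrow> (\<Sum>j<m. \<bar>f (r j) - f (l j)\<bar>) < e"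
proof -
  have "\<exists>d>0. \<forall>(m::nat) l r. (\<forall>j<m. a \<le> l j \<and> l j \<le> r j \<and> r j \<le> b) \<longrightarrow>
        disjoint_family_on (\<lambda>j. {l j<..<r j}) {..<m} \<longrightarrow>
        (\<Sum>j<m. r j - l j) < d \<longrightarrow> (\<Sum>j<m. \<bar>f (r j) - f (l j)\<bar>) < e"
    using assms(1)[unfolded abs_continuous_on_def, THEN spec, THEN mp, OF assms(2)] .
  then show ?thesis by (elim exE conjE) (rule that, assumption, simp)
qed

lemma abs_continuous_onI:
  assumes "\<And>e. e > 0 \<Longrightarrow> \<exists>d>0. \<forall>(m::nat) l r. (\<forall>j<m. a \<le> l j \<and> l j \<le> r j \<and> r j \<le> b) \<longrightarrow>
        disjoint_family_on (\<lambda>j. {l j<..<r j}) {..<m} \<longrightarrow>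
        (\<Sum>j<m. r j - l j) < d \<longrightarrow> (\<Sum>j<m. \<bar>f (r j) - f (l j)\<bar>) < e"
  shows "abs_continuous_on a b f"
  unfolding abs_continuous_on_def using assms by (intro allI impI)

lemma abs_continuous_on_subinterval:
  assumes f: "abs_continuous_on a b f" and "a \<le> a'" "b' \<le> b"
  shows "abs_continuous_on a' b' f"
proof (rule abs_continuous_onI)
  fix e :: real assume "e > 0"
  from abs_continuous_onD[OF f this] obtain d where d: "d > 0"
    "\<And>(m::nat) l r. (\<And>j. j < m \<Longrightarrow> a \<le> l j \<and> l j \<le> r j \<and> r j \<le> b) \<Longrightarrow>
        disjoint_family_on (\<lambda>j. {l j<..<r j}) {..<m} \<Longrightarrow>
        (\<Sum>j<m. r j - l j) < d \<Longrightarrow> (\<Sum>j<m. \<bar>f (r j) - f (l j)\<bar>) < e" by blast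
  show "\<exists>d>0. \<forall>(m::nat) l r. (\<forall>j<m. a' \<le> l j \<and> l j \<le> r j \<and> r j \<le> b') \<longrightarrow>
        disjoint_family_on (\<lambda>j. {l j<..<r j}) {..<m} \<longrightarrow>
        (\<Sum>j<m. r j - l j) < d \<longrightarrow> (\<Sum>j<m. \<bar>f (r j) - f (l j)\<bar>) < e"
    using d(1) assms(2,3) by (intro exI[of _ d] conjI allI impI d(2)) force+
qed

lemma lipschitz_imp_abs_continuous_on:
  assumes "\<And>s t. a \<le> s \<Longrightarrow> s \<le> t \<Longrightarrow> t \<le> b \<Longrightarrow> \<bar>f t - f s\<bar> \<le> C * (t - s)"
  shows "abs_continuous_on a b f"
proof (rule abs_continuous_onI)
  fix e :: real assume e: "e > 0"
  define D where "D = \<bar>C\<bar> + 1"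
  have D: "D > 0" "C \<le> D" by (auto simp: D_def)
  show "\<exists>d>0. \<forall>(m::nat) l r. (\<forall>j<m. a \<le> l j \<and> l j \<le> r j \<and> r j \<le> b) \<longrightarrow>
        disjoint_family_on (\<lambda>j. {l j<..<r j}) {..<m} \<longrightarrow>
        (\<Sum>j<m. r j - l j) < d \<longrightarrow> (\<Sum>j<m. \<bar>f (r j) - f (l j)\<bar>) < e"
  proof (intro exI[of _ "e / D"] conjI allI impI)
    show "e / D > 0" using e D by simp
    fix m :: nat and l r
    assume lr: "\<forall>j<m. a \<le> l j \<and> l j \<le> r j \<and> r j \<le> b" and s: "(\<Sum>j<m. r j - l j) < e / D"
    have "(\<Sum>j<m. \<bar>f (r j) - f (l j)\<bar>) \<le> (\<Sum>j<m. D * (r j - l j))"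
    proof (rule sum_mono)
      fix j assume "j \<in> {..<m}"
      then have j: "a \<le> l j" "l j \<le> r j" "r j \<le> b" using lr by auto
      have "C * (r j - l j) \<le> D * (r j - l j)" using D j by (intro mult_right_mono) auto
      then show "\<bar>f (r j) - f (l j)\<bar> \<le> D * (r j - l j)" using assms[OF j] by linarith
    qed
    also have "\<dots> = D * (\<Sum>j<m. r j - l j)" by (simp add: sum_distrib_left)
    also have "\<dots> < e" using s D by (simp add: field_simps)
    finally show "(\<Sum>j<m. \<bar>f (r j) - f (l j)\<bar>) < e" .
  qed
qed

lemma abs_continuous_on_imp_continuous_on:
  assumes f: "abs_continuous_on a b f"
  shows "continuous_on {a..b} f"
  unfolding continuous_on_iff
proof (intro ballI allI impI)
  fix x e :: real assume x: "x \<in> {a..b}" and e: "e > 0"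
  from abs_continuous_onD[OF f e] obtain d where d: "d > 0"
    "\<And>(m::nat) l r. (\<And>j. j < m \<Longrightarrow> a \<le> l j \<and> l j \<le> r j \<and> r j \<le> b) \<Longrightarrow>
        disjoint_family_on (\<lambda>j. {l j<..<r j}) {..<m} \<Longrightarrow>
        (\<Sum>j<m. r j - l j) < d \<Longrightarrow> (\<Sum>j<m. \<bar>f (r j) - f (l j)\<bar>) < e" by blast
  show "\<exists>d>0. \<forall>x'\<in>{a..b}. dist x' x < d \<longrightarrow> dist (f x') (f x) < e"
  proof (intro exI[of _ d] conjI d(1) ballI impI)
    fix y assume y: "y \<in> {a..b}" "dist y x < d"
    have "(\<Sum>j<Suc 0. \<bar>f (max x y) - f (min x y)\<bar>) < e"
      by (rule d(2)[where m = "Suc 0" and l = "\<lambda>_. min x y" and r = "\<lambda>_. max x y"])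
        (use x y in \<open>auto simp: dist_real_def disjoint_family_on_def max_def min_def\<close>)
    then show "dist (f y) (f x) < e" by (auto simp: dist_real_def max_def min_def split: if_splits)
  qed
qed

lemma abs_continuous_on_const: "abs_continuous_on a b (\<lambda>_. c)"
  by (rule lipschitz_imp_abs_continuous_on[where C = 0]) auto

text \<open>This one domination of increments serves sums, products and, with \<open>g\<close>
  constant, the transfer to a function that agrees with \<open>f\<close> on the interval.\<close>

lemma abs_continuous_on_combine:
  assumes f: "abs_continuous_on a b f" and g: "abs_continuous_on a b g" and C: "C > 0"
    and le: "\<And>s t. a \<le> s \<Longrightarrow> s \<le> t \<Longrightarrow> t \<le> b \<Longrightarrow> \<bar>h t - h s\<bar> \<le> C * (\<bar>f t - f s\<bar> + \<bar>g t - g s\<bar>)"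
  shows "abs_continuous_on a b h"
proof (rule abs_continuous_onI)
  fix e :: real assume "e > 0"
  then have e: "e / (2 * C) > 0" using C by simp
  obtain d where d: "d > 0"
    "\<And>(m::nat) l r. (\<And>j. j < m \<Longrightarrow> a \<le> l j \<and> l j \<le> r j \<and> r j \<le> b) \<Longrightarrow>
        disjoint_family_on (\<lambda>j. {l j<..<r j}) {..<m} \<Longrightarrow>
        (\<Sum>j<m. r j - l j) < d \<Longrightarrow> (\<Sum>j<m. \<bar>f (r j) - f (l j)\<bar>) < e / (2 * C)"
    using abs_continuous_onD[OF f e] by blast
  obtain d' where d': "d' > 0"
    "\<And>(m::nat) l r. (\<And>j. j < m \<Longrightarrow> a \<le> l j \<and> l j \<le> r j \<and> r j \<le> b) \<Longrightarrow>
        disjoint_family_on (\<lambda>j. {l j<..<r j}) {..<m} \<Longrightarrow>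
        (\<Sum>j<m. r j - l j) < d' \<Longrightarrow> (\<Sum>j<m. \<bar>g (r j) - g (l j)\<bar>) < e / (2 * C)"
    using abs_continuous_onD[OF g e] by blast
  show "\<exists>d>0. \<forall>(m::nat) l r. (\<forall>j<m. a \<le> l j \<and> l j \<le> r j \<and> r j \<le> b) \<longrightarrow>
        disjoint_family_on (\<lambda>j. {l j<..<r j}) {..<m} \<longrightarrow>
        (\<Sum>j<m. r j - l j) < d \<longrightarrow> (\<Sum>j<m. \<bar>h (r j) - h (l j)\<bar>) < e"
  proof (intro exI[of _ "min d d'"] conjI allI impI)
    show "min d d' > 0" using d d' by simp
    fix m :: nat and l r
    assume lr: "\<forall>j<m. a \<le> l j \<and> l j \<le> r j \<and> r j \<le> b" and s: "(\<Sum>j<m. r j - l j) < min d d'"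
      and dis: "disjoint_family_on (\<lambda>j. {l j<..<r j}) {..<m}"
    have "(\<Sum>j<m. \<bar>h (r j) - h (l j)\<bar>) \<le> (\<Sum>j<m. C * (\<bar>f (r j) - f (l j)\<bar> + \<bar>g (r j) - g (l j)\<bar>))"
      using lr by (intro sum_mono le) auto
    also have "\<dots> = C * ((\<Sum>j<m. \<bar>f (r j) - f (l j)\<bar>) + (\<Sum>j<m. \<bar>g (r j) - g (l j)\<bar>))"
      by (simp add: sum_distrib_left[symmetric] sum.distrib)
    also have "\<dots> < C * (e / (2 * C) + e / (2 * C))"
      using C s lr dis by (intro mult_strict_left_mono add_strict_mono d(2) d'(2)) auto
    also have "\<dots> = e" using C by simp
    finally show "(\<Sum>j<m. \<bar>h (r j) - h (l j)\<bar>) < e" .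
  qed
qed

lemma abs_continuous_on_add:
  assumes "abs_continuous_on a b f" "abs_continuous_on a b g"
  shows "abs_continuous_on a b (\<lambda>t. f t + g t)"
  by (rule abs_continuous_on_combine[OF assms, of 1]) auto

lemma abs_continuous_on_sum:
  "(\<And>i. i \<in> I \<Longrightarrow> abs_continuous_on a b (f i)) \<Longrightarrow> abs_continuous_on a b (\<lambda>t. \<Sum>i\<in>I. f i t)"
  by (induction I rule: infinite_finite_induct) (auto intro: abs_continuous_on_add abs_continuous_on_const)

lemma abs_continuous_on_mult:
  assumes f: "abs_continuous_on a b f" and g: "abs_continuous_on a b g"
  shows "abs_continuous_on a b (\<lambda>t. f t * g t)"
proof -
  have bd: "\<exists>C. \<forall>t\<in>{a..b}. \<bar>f t\<bar> \<le> C" if "abs_continuous_on a b f" for f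
  proof -
    have "bounded (f ` {a..b})"
      by (intro compact_imp_bounded compact_continuous_image abs_continuous_on_imp_continuous_on that) auto
    then show ?thesis unfolding bounded_iff by auto
  qed
  obtain C where C: "\<forall>t\<in>{a..b}. \<bar>f t\<bar> \<le> C" using bd[OF f] by auto
  obtain D where D: "\<forall>t\<in>{a..b}. \<bar>g t\<bar> \<le> D" using bd[OF g] by auto
  define K where "K = \<bar>C\<bar> + \<bar>D\<bar> + 1"
  show ?thesis
  proof (rule abs_continuous_on_combine[OF f g, of K])
    show "K > 0" by (simp add: K_def)
    fix s t assume st: "a \<le> s" "s \<le> t" "t \<le> b"
    have "\<bar>f t * (g t - g s)\<bar> \<le> K * \<bar>g t - g s\<bar>" "\<bar>g s * (f t - f s)\<bar> \<le> K * \<bar>f t - f s\<bar>"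
      unfolding abs_mult using C[THEN bspec, of t] D[THEN bspec, of s] st by (auto intro!: mult_right_mono simp: K_def)
    moreover have "f t * g t - f s * g s = f t * (g t - g s) + g s * (f t - f s)" by (simp add: algebra_simps)
    ultimately show "\<bar>f t * g t - f s * g s\<bar> \<le> K * (\<bar>f t - f s\<bar> + \<bar>g t - g s\<bar>)"
      by (simp only: distrib_left)
  qed
qed

lemma abs_continuous_on_indefinite_integral:
  assumes "bdd_meas T f"
  shows "abs_continuous_on 0 T (\<lambda>t. integral {0..t} f)"
proof -
  obtain C where C: "\<forall>t\<in>{0..T}. \<bar>f t\<bar> \<le> C" using assms unfolding bdd_meas_def by auto
  show ?thesis
  proof (rule lipschitz_imp_abs_continuous_on[where C = C])
    fix s t assume st: "0 \<le> s" "s \<le> t" "t \<le> T"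
    have i: "f integrable_on {0..t}" using bdd_meas_integrable'[OF assms] st by blast
    have "integral {0..t} f - integral {0..s} f = integral {s..t} f"
      using Henstock_Kurzweil_Integration.integral_combine[OF st(1,2) i] by simp
    moreover have "norm (integral {s..t} f) \<le> integral {s..t} (\<lambda>_. C)"
      using i st C by (intro integral_norm_bound_integral) (auto intro: integrable_on_subinterval)
    ultimately show "\<bar>integral {0..t} f - integral {0..s} f\<bar> \<le> C * (t - s)" using st by (simp add: mult.commute)
  qed
qed

section \<open>Volterra iterations and linear integral equations\<close>

lemma integral_power_fact:
  fixes M c t :: real
  assumes t: "t \<ge> 0"
  shows "((\<lambda>\<tau>. c * (M * (c * \<tau>) ^ k / fact k)) has_integral M * (c * t) ^ Suc k / fact (Suc k)) {0..t}"
proof -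
  have d: "((\<lambda>\<tau>. M * (c * \<tau>) ^ Suc k / fact (Suc k)) has_real_derivative
       c * (M * (c * \<tau>) ^ k / fact k)) (at \<tau> within {0..t})" for \<tau>
    by (rule derivative_eq_intros refl | simp del: power_Suc)+
  have "((\<lambda>\<tau>. c * (M * (c * \<tau>) ^ k / fact k)) has_integral M * (c * t) ^ Suc k / fact (Suc k) - M * (c * 0) ^ Suc k / fact (Suc k)) {0..t}"
    by (rule fundamental_theorem_of_calculus[OF t]) (use d in \<open>auto simp: has_real_derivative_iff_has_vector_derivative[symmetric]\<close>)
  then show ?thesis by simp
qed

text \<open>Each iteration integrates the previous power of \<open>t\<close> once more, which
  produces the factorial. The bound controls both the Picard increments and the error of the
  truncated Dyson series.\<close>

lemma iterated_Volterra_bound: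
  fixes e :: "nat \<Rightarrow> nat \<Rightarrow> real \<Rightarrow> real"
  assumes H: "\<And>t \<tau> a b. 0 \<le> \<tau> \<Longrightarrow> \<tau> \<le> t \<Longrightarrow> t \<le> T \<Longrightarrow> a < n \<Longrightarrow> b < n \<Longrightarrow> \<bar>H t \<tau> a b\<bar> \<le> h"
    and h: "h \<ge> 0"
    and e0: "\<And>a t. a < n \<Longrightarrow> 0 \<le> t \<Longrightarrow> t \<le> T \<Longrightarrow> \<bar>e 0 a t\<bar> \<le> M"
    and step: "\<And>k a t. a < n \<Longrightarrow> 0 \<le> t \<Longrightarrow> t \<le> T \<Longrightarrow> e (Suc k) a t = integral {0..t} (\<lambda>\<tau>. \<Sum>b<n. H t \<tau> a b * e k b \<tau>)"
    and a: "a < n" and t: "0 \<le> t" "t \<le> T"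
  shows "\<bar>e k a t\<bar> \<le> M * (real n * h * t) ^ k / fact k"
  using a t
proof (induction k arbitrary: a t)
  case (Suc k)
  have M: "M \<ge> 0" using e0[OF Suc.prems] by linarith
  let ?g = "\<lambda>\<tau>. real n * h * (M * (real n * h * \<tau>) ^ k / fact k)"
  let ?f = "\<lambda>\<tau>. \<Sum>b<n. H t \<tau> a b * e k b \<tau>"
  have int: "(?g has_integral M * (real n * h * t) ^ Suc k / fact (Suc k)) {0..t}"
    by (rule integral_power_fact) (use Suc in auto)
  show ?case
  proof (cases "?f integrable_on {0..t}")
    case True
    have "norm (integral {0..t} ?f) \<le> integral {0..t} ?g"
    proof (rule integral_norm_bound_integral[OF True has_integral_integrable[OF int]])
      fix \<tau> assume \<tau>: "\<tau> \<in> {0..t}"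
      have "norm (?f \<tau>) \<le> (\<Sum>b<n. \<bar>H t \<tau> a b\<bar> * \<bar>e k b \<tau>\<bar>)"
        unfolding real_norm_def by (rule order_trans[OF sum_abs]) (simp add: abs_mult)
      also have "\<dots> \<le> (\<Sum>b<n. h * (M * (real n * h * \<tau>) ^ k / fact k))"
        by (intro sum_mono mult_mono H Suc.IH) (use \<tau> Suc.prems h in auto)
      finally show "norm (?f \<tau>) \<le> ?g \<tau>" by (simp add: mult_ac)
    qed
    then show ?thesis unfolding step[OF Suc.prems] integral_unique[OF int] by simp
  next
    \<comment> \<open>The integral of a non-integrable function is 0 by convention, and 0 satisfies
      the bound.\<close>
    case False
    then have "e (Suc k) a t = 0" unfolding step[OF Suc.prems] by (rule not_integrable_integral)
    then show ?thesis using M h Suc.prems by simp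
  qed
qed (use e0 in simp)

lemma Volterra_bound_summable: "summable (\<lambda>k. M * (x::real) ^ k / fact k)"
  using summable_mult[OF summable_exp[of x], of M] by (simp add: divide_inverse mult_ac)

primrec picard :: "nat \<Rightarrow> (real \<Rightarrow> nat \<Rightarrow> nat \<Rightarrow> real) \<Rightarrow> (real \<Rightarrow> nat \<Rightarrow> real) \<Rightarrow> nat \<Rightarrow> nat \<Rightarrow> real \<Rightarrow> real" where
  "picard n L f 0 = (\<lambda>a t. 0)"
| "picard n L f (Suc k) = (\<lambda>a t. integral {0..t} (\<lambda>\<tau>. (\<Sum>b<n. L \<tau> a b * picard n L f k b \<tau>) + f \<tau> a))"

text \<open>Successive Picard iterates differ by factorially small amounts, uniformly on
  \<open>{0..T}\<close>; their limit passes under the integral by dominated convergence.\<close>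

theorem linear_integral_equation_solution:
  fixes L :: "real \<Rightarrow> nat \<Rightarrow> nat \<Rightarrow> real" and f :: "real \<Rightarrow> nat \<Rightarrow> real"
  assumes T: "T \<ge> 0"
    and L: "\<And>a b. a < n \<Longrightarrow> b < n \<Longrightarrow> bdd_meas T (\<lambda>t. L t a b)"
    and f: "\<And>a. a < n \<Longrightarrow> bdd_meas T (\<lambda>t. f t a)"
  obtains x :: "nat \<Rightarrow> real \<Rightarrow> real" where
    "\<And>a. a < n \<Longrightarrow> bdd_meas T (x a)"
    "\<And>a t. a < n \<Longrightarrow> t \<in> {0..T} \<Longrightarrow> x a t = integral {0..t} (\<lambda>\<tau>. (\<Sum>b<n. L \<tau> a b * x b \<tau>) + f \<tau> a)"
proof -
  define P where "P = picard n L f"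
  have P0: "P 0 a t = 0" and PS: "P (Suc k) a t = integral {0..t} (\<lambda>\<tau>. (\<Sum>b<n. L \<tau> a b * P k b \<tau>) + f \<tau> a)" for k a t
    unfolding P_def by simp_all
  have Pbm: "bdd_meas T (P k a)" if "a < n" for k a
    using that
  proof (induction k arbitrary: a)
    case 0 then show ?case by (simp add: P_def)
  next
    case (Suc k)
    have "bdd_meas T (\<lambda>\<tau>. (\<Sum>b<n. L \<tau> a b * P k b \<tau>) + f \<tau> a)"
      using Suc by (intro bdd_meas_add bdd_meas_sum bdd_meas_mult L f) auto
    from indefinite_integral_continuous_1[OF bdd_meas_integrable[OF this]] show ?case
      unfolding PS[abs_def] by (rule bdd_meas_continuous)
  qed
  have gbm: "bdd_meas T (\<lambda>\<tau>. (\<Sum>b<n. L \<tau> a b * P k b \<tau>) + f \<tau> a)" if "a < n" for k a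
    using that by (intro bdd_meas_add bdd_meas_sum bdd_meas_mult L f Pbm) auto
  define D where "D k a t = P (Suc k) a t - P k a t" for k a t
  have "\<exists>l. \<forall>a<n. \<forall>b<n. \<forall>t\<in>{0..T}. \<bar>L t a b\<bar> \<le> l"
  proof -
    obtain C where C: "\<And>a b. a < n \<Longrightarrow> b < n \<Longrightarrow> \<forall>t\<in>{0..T}. \<bar>L t a b\<bar> \<le> C a b"
      using L unfolding bdd_meas_def by metis
    show ?thesis
    proof (intro exI allI impI ballI)
      fix a b t assume ab: "a < n" "b < n" "t \<in> {0..T}"
      have "\<bar>L t a b\<bar> \<le> C a b" using C ab by blast
      also have "C a b \<le> (\<Sum>(a,b)\<in>{..<n}\<times>{..<n}. \<bar>C a b\<bar>)"
        using ab member_le_sum[of "(a,b)" "{..<n}\<times>{..<n}" "\<lambda>(a,b). \<bar>C a b\<bar>"] by force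
      finally show "\<bar>L t a b\<bar> \<le> (\<Sum>(a,b)\<in>{..<n}\<times>{..<n}. \<bar>C a b\<bar>)" .
    qed
  qed
  then obtain l0 where l0: "\<And>a b t. a < n \<Longrightarrow> b < n \<Longrightarrow> t \<in> {0..T} \<Longrightarrow> \<bar>L t a b\<bar> \<le> l0" by blast
  define l where "l = \<bar>l0\<bar>"
  have l: "\<bar>L t a b\<bar> \<le> l" if "a < n" "b < n" "t \<in> {0..T}" for a b t using l0[OF that] unfolding l_def by linarith
  have "\<exists>M. \<forall>a<n. \<forall>t\<in>{0..T}. \<bar>D 0 a t\<bar> \<le> M"
  proof -
    have "bdd_meas T (D 0 a)" if "a < n" for a unfolding D_def[abs_def] by (intro bdd_meas_diff Pbm that)
    then obtain C where C: "\<And>a. a < n \<Longrightarrow> \<forall>t\<in>{0..T}. \<bar>D 0 a t\<bar> \<le> C a"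
      unfolding bdd_meas_def by metis
    show ?thesis
    proof (intro exI allI impI ballI)
      fix a t assume a: "a < n" "t \<in> {0..T}"
      have "\<bar>D 0 a t\<bar> \<le> C a" using C a by blast
      also have "C a \<le> (\<Sum>a<n. \<bar>C a\<bar>)" using a member_le_sum[of a "{..<n}" "\<lambda>a. \<bar>C a\<bar>"] by force
      finally show "\<bar>D 0 a t\<bar> \<le> (\<Sum>a<n. \<bar>C a\<bar>)" .
    qed
  qed
  then obtain M where M: "\<And>a t. a < n \<Longrightarrow> t \<in> {0..T} \<Longrightarrow> \<bar>D 0 a t\<bar> \<le> M" by blast
  have DS: "D (Suc k) a t = integral {0..t} (\<lambda>\<tau>. \<Sum>b<n. L \<tau> a b * D k b \<tau>)" if a: "a < n" and t: "0 \<le> t" "t \<le> T" for k a t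
  proof -
    have "D (Suc k) a t = integral {0..t} (\<lambda>\<tau>. ((\<Sum>b<n. L \<tau> a b * P (Suc k) b \<tau>) + f \<tau> a) - ((\<Sum>b<n. L \<tau> a b * P k b \<tau>) + f \<tau> a))"
      unfolding D_def PS[of "Suc k"] PS[of k a]
      by (rule Henstock_Kurzweil_Integration.integral_diff[symmetric]) (use bdd_meas_integrable'[OF gbm[OF a] t(2)] in auto)
    then show ?thesis by (simp add: D_def sum_subtractf[symmetric] right_diff_distrib[symmetric])
  qed
  define s where "s k = M * (real n * l * T) ^ k / fact k" for k
  have sum_s: "summable s" unfolding s_def by (rule Volterra_bound_summable)
  have Ds: "\<bar>D k a t\<bar> \<le> s k" if a: "a < n" and t: "t \<in> {0..T}" for k a t
  proof -
    have M0: "M \<ge> 0" using M[OF a t] by linarith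
    have "\<bar>D k a t\<bar> \<le> M * (real n * l * t) ^ k / fact k"
      by (rule iterated_Volterra_bound[where T = T and H = "\<lambda>t \<tau> a b. L \<tau> a b"])
        (use l M DS a t in \<open>auto simp: l_def\<close>)
    also have "\<dots> \<le> s k" unfolding s_def using t M0
      by (intro divide_right_mono mult_left_mono power_mono) (auto simp: l_def)
    finally show ?thesis .
  qed
  have sumD: "summable (\<lambda>k. D k a t)" if "a < n" "t \<in> {0..T}" for a t
    by (rule summable_comparison_test'[OF sum_s, of 0]) (use Ds that in auto)
  define x where "x a t = (\<Sum>k. D k a t)" for a t
  have Psum: "P k a t = (\<Sum>j<k. D j a t)" for k a t
    by (induction k) (auto simp: P0 D_def)
  have Plim: "(\<lambda>k. P k a t) \<longlonglongrightarrow> x a t" if "a < n" "t \<in> {0..T}" for a t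
    unfolding Psum x_def by (rule summable_LIMSEQ[OF sumD[OF that]])
  \<comment> \<open>For \<open>n = 0\<close> nothing constrains \<open>M\<close>, which may then be
    negative; the sign of \<open>s\<close> is claimed only if there is a coordinate.\<close>
  have s0: "s k \<ge> 0" if "n > 0" for k using Ds[OF that, of 0 k] T by (simp add: order_trans[OF abs_ge_zero])
  have Pb: "\<bar>P k a t\<bar> \<le> suminf s" if "a < n" "t \<in> {0..T}" for k a t
  proof -
    have "\<bar>P k a t\<bar> \<le> (\<Sum>j<k. s j)" unfolding Psum
      by (rule order_trans[OF sum_abs], rule sum_mono) (use Ds that in auto)
    also have "\<dots> \<le> suminf s" using s0 that by (intro sum_le_suminf sum_s) auto
    finally show ?thesis .
  qed
  have fx: "\<exists>C. \<forall>t\<in>{0..T}. \<bar>f t a\<bar> \<le> C" if "a < n" for a using f[OF that] unfolding bdd_meas_def by auto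
  have eq: "(\<lambda>\<tau>. (\<Sum>b<n. L \<tau> a b * x b \<tau>) + f \<tau> a) integrable_on {0..t} \<and>
      x a t = integral {0..t} (\<lambda>\<tau>. (\<Sum>b<n. L \<tau> a b * x b \<tau>) + f \<tau> a)" if a: "a < n" and t: "t \<in> {0..T}" for a t
  proof -
    obtain C where C: "\<And>t. t\<in>{0..T} \<Longrightarrow> \<bar>f t a\<bar> \<le> C" using fx[OF a] by blast
    have *: "(\<lambda>\<tau>. (\<Sum>b<n. L \<tau> a b * P k b \<tau>) + f \<tau> a) integrable_on {0..t}" for k
      using bdd_meas_integrable'[OF gbm[OF a]] t by auto
    have b: "norm ((\<Sum>b<n. L \<tau> a b * P k b \<tau>) + f \<tau> a) \<le> real n * (l * suminf s) + C" if \<tau>: "\<tau> \<in> {0..t}" for k \<tau>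
    proof -
      have \<tau>: "\<tau> \<in> {0..T}" using \<tau> t by auto
      have "\<bar>\<Sum>b<n. L \<tau> a b * P k b \<tau>\<bar> \<le> (\<Sum>b<n. l * suminf s)"
        by (rule order_trans[OF sum_abs], rule sum_mono, unfold abs_mult, rule mult_mono) (use l Pb \<tau> a in \<open>auto simp: l_def\<close>)
      then show ?thesis using C[OF \<tau>] by simp
    qed
    have c: "(\<lambda>k. (\<Sum>b<n. L \<tau> a b * P k b \<tau>) + f \<tau> a) \<longlonglongrightarrow> (\<Sum>b<n. L \<tau> a b * x b \<tau>) + f \<tau> a" if "\<tau> \<in> {0..t}" for \<tau>
      using that t by (intro tendsto_intros Plim) auto
    have 1: "(\<lambda>\<tau>. (\<Sum>b<n. L \<tau> a b * x b \<tau>) + f \<tau> a) integrable_on {0..t}"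
      and 2: "(\<lambda>k. P (Suc k) a t) \<longlonglongrightarrow> integral {0..t} (\<lambda>\<tau>. (\<Sum>b<n. L \<tau> a b * x b \<tau>) + f \<tau> a)"
      unfolding PS using dominated_convergence[OF * _ b c] by auto
    show ?thesis using 1 LIMSEQ_unique[OF LIMSEQ_Suc[OF Plim[OF a t]] 2] by blast
  qed
  show ?thesis
  proof (rule that)
    fix a assume a: "a < n"
    have "continuous_on {0..T} (\<lambda>t. integral {0..t} (\<lambda>\<tau>. (\<Sum>b<n. L \<tau> a b * x b \<tau>) + f \<tau> a))"
      using eq[OF a, of T] T by (intro indefinite_integral_continuous_1) auto
    then have "continuous_on {0..T} (x a)" by (rule continuous_on_eq) (use eq[OF a] in auto)
    then show "bdd_meas T (x a)" by (rule bdd_meas_continuous)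
  qed (use eq in blast)
qed

text \<open>In the derivative of \<open>F \<tau>\<close>, the term - E A x from the propagator
  cancels E A x from the differential equation and leaves the forcing. \<open>F\<close> runs from 0
  at time 0 to \<open>x a t\<close> at time \<open>t\<close>, where the propagator is the
  identity.\<close>

theorem variation_of_constants:
  fixes x v :: "nat \<Rightarrow> real \<Rightarrow> real"
  assumes E0: "\<And>c. c < n \<Longrightarrow> E 0 a c = (if a = c then 1 else 0)" and a: "a < n"
    and E': "\<And>c t. c < n \<Longrightarrow> ((\<lambda>t. E t a c) has_real_derivative (\<Sum>d<n. E t a d * A d c)) (at t)"
    and ac: "\<And>c. c < n \<Longrightarrow> abs_continuous_on 0 T (x c)" and x0: "\<And>c. c < n \<Longrightarrow> x c 0 = 0"
    and der: "AE t in lebesgue. t \<in> {0..T} \<longrightarrow> (\<forall>c<n. (x c has_real_derivative ((\<Sum>d<n. A c d * x d t) + v c t)) (at t within {0..T}))"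
    and t: "t \<in> {0..T}"
  shows "((\<lambda>\<tau>. \<Sum>c<n. E (t - \<tau>) a c * v c \<tau>) has_integral x a t) {0..t}"
proof -
  have Ecd: "((\<lambda>\<tau>. E (t - \<tau>) a c) has_real_derivative - (\<Sum>d<n. E (t - \<tau>) a d * A d c)) (at \<tau> within S)" if "c < n" for \<tau> c S
  proof -
    have "((\<lambda>\<tau>. E (t - \<tau>) a c) has_real_derivative (\<Sum>d<n. E (t - \<tau>) a d * A d c) * (- 1)) (at \<tau> within S)"
      by (rule DERIV_chain2[OF E'[OF that]]) (auto intro!: derivative_eq_intros)
    then show ?thesis by simp
  qed
  have Ec: "continuous_on UNIV (\<lambda>t. E t a c)" if "c < n" for c
    using E'[OF that] by (intro continuous_at_imp_continuous_on) (auto intro: DERIV_isCont)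
  have Eac: "abs_continuous_on 0 t (\<lambda>\<tau>. E (t - \<tau>) a c)" if c: "c < n" for c
  proof -
    have "continuous_on {0..t} (\<lambda>\<tau>. - (\<Sum>d<n. E (t - \<tau>) a d * A d c))"
      by (intro continuous_intros continuous_on_compose2[OF Ec]) auto
    from bdd_meas_continuous[OF this] obtain C where C: "\<forall>\<tau>\<in>{0..t}. \<bar>- (\<Sum>d<n. E (t - \<tau>) a d * A d c)\<bar> \<le> C" unfolding bdd_meas_def by blast
    show ?thesis
    proof (rule lipschitz_imp_abs_continuous_on[where C = C])
      fix s s' assume s: "0 \<le> s" "s \<le> s'" "s' \<le> t"
      have "norm (E (t - s') a c - E (t - s) a c) \<le> C * norm (s' - s)"
        by (rule field_differentiable_bound[where S = "{0..t}" and f' = "\<lambda>\<tau>. - (\<Sum>d<n. E (t - \<tau>) a d * A d c)"])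
          (use C Ecd[OF c] s in auto)
      then show "\<bar>E (t - s') a c - E (t - s) a c\<bar> \<le> C * (s' - s)" using s by simp
    qed
  qed
  define F where "F \<tau> = (\<Sum>c<n. E (t - \<tau>) a c * x c \<tau>)" for \<tau>
  have "((\<lambda>\<tau>. \<Sum>c<n. E (t - \<tau>) a c * v c \<tau>) has_integral F t - F 0) {0..t}"
  proof (rule fundamental_theorem_of_calculus_abs_continuous)
    show "0 \<le> t" using t by simp
    show "abs_continuous_on 0 t F" unfolding F_def
      using t by (intro abs_continuous_on_sum abs_continuous_on_mult Eac abs_continuous_on_subinterval[OF ac]) auto
    show "AE \<tau> in lebesgue. \<tau> \<in> {0..t} \<longrightarrow> (F has_real_derivative (\<Sum>c<n. E (t - \<tau>) a c * v c \<tau>)) (at \<tau> within {0..t})"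
      using der
    proof (rule eventually_mono, intro impI)
      fix \<tau> assume d: "\<tau> \<in> {0..T} \<longrightarrow> (\<forall>c<n. (x c has_real_derivative ((\<Sum>d<n. A c d * x d \<tau>) + v c \<tau>)) (at \<tau> within {0..T}))"
        and \<tau>: "\<tau> \<in> {0..t}"
      have xd: "(x c has_real_derivative ((\<Sum>d<n. A c d * x d \<tau>) + v c \<tau>)) (at \<tau> within {0..t})" if "c < n" for c
        by (rule DERIV_subset[of _ _ _ "{0..T}"]) (use d \<tau> t that in auto)
      have "(F has_real_derivative (\<Sum>c<n. - (\<Sum>d<n. E (t - \<tau>) a d * A d c) * x c \<tau> + ((\<Sum>d<n. A c d * x d \<tau>) + v c \<tau>) * E (t - \<tau>) a c)) (at \<tau> within {0..t})"
        unfolding F_def by (intro DERIV_sum DERIV_mult Ecd xd) auto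
      also have "(\<Sum>c<n. - (\<Sum>d<n. E (t - \<tau>) a d * A d c) * x c \<tau> + ((\<Sum>d<n. A c d * x d \<tau>) + v c \<tau>) * E (t - \<tau>) a c)
        = - (\<Sum>c<n. \<Sum>d<n. E (t - \<tau>) a d * A d c * x c \<tau>) + (\<Sum>c<n. \<Sum>d<n. E (t - \<tau>) a c * A c d * x d \<tau>) + (\<Sum>c<n. E (t - \<tau>) a c * v c \<tau>)"
      proof -
        have "- (\<Sum>d<n. E (t - \<tau>) a d * A d c) * x c \<tau> + ((\<Sum>d<n. A c d * x d \<tau>) + v c \<tau>) * E (t - \<tau>) a c
          = - (\<Sum>d<n. E (t - \<tau>) a d * A d c * x c \<tau>) + (\<Sum>d<n. E (t - \<tau>) a c * A c d * x d \<tau>) + E (t - \<tau>) a c * v c \<tau>" for c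
          by (simp add: sum_distrib_left sum_distrib_right algebra_simps)
        then show ?thesis by (simp add: sum.distrib sum_negf sum_subtractf)
      qed
      also have "(\<Sum>c<n. \<Sum>d<n. E (t - \<tau>) a d * A d c * x c \<tau>) = (\<Sum>c<n. \<Sum>d<n. E (t - \<tau>) a c * A c d * x d \<tau>)"
        by (rule sum.swap)
      finally show "(F has_real_derivative (\<Sum>c<n. E (t - \<tau>) a c * v c \<tau>)) (at \<tau> within {0..t})" by simp
    qed
  qed
  moreover have "F 0 = 0" unfolding F_def by (simp add: x0)
  moreover have "F t = x a t"
    unfolding F_def using a by (simp add: E0 if_distrib[of "\<lambda>z. z * _"] cong: if_cong)
  ultimately show ?thesis by simp
qed

section \<open>The matrix exponential\<close>

lemma smult_pow_mat:
  fixes A :: rmat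
  assumes A: "A \<in> carrier_mat n n"
  shows "(t \<cdot>\<^sub>m A) ^\<^sub>m k = t ^ k \<cdot>\<^sub>m (A ^\<^sub>m k)"
proof (induction k)
  case 0
  show ?case using A by (intro eq_matI) auto
next
  case (Suc k)
  have P: "A ^\<^sub>m k \<in> carrier_mat n n" by (rule pow_carrier_mat[OF A])
  have "(t ^ k \<cdot>\<^sub>m A ^\<^sub>m k) * (t \<cdot>\<^sub>m A) = t ^ k \<cdot>\<^sub>m (A ^\<^sub>m k * (t \<cdot>\<^sub>m A))"
    by (rule mult_smult_assoc_mat[OF P, of _ n]) (use A in simp)
  also have "A ^\<^sub>m k * (t \<cdot>\<^sub>m A) = t \<cdot>\<^sub>m (A ^\<^sub>m k * A)"
    by (rule mult_smult_distrib[OF P A])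
  also have "t ^ k \<cdot>\<^sub>m (t \<cdot>\<^sub>m (A ^\<^sub>m k * A)) = (t ^ k * t) \<cdot>\<^sub>m (A ^\<^sub>m k * A)"
    by (intro eq_matI) auto
  finally have "(t ^ k \<cdot>\<^sub>m A ^\<^sub>m k) * (t \<cdot>\<^sub>m A) = (t ^ k * t) \<cdot>\<^sub>m (A ^\<^sub>m k * A)" .
  then show ?case using Suc by (simp add: mult.commute)
qed

lemma mat_exp_carrier: "A \<in> carrier_mat n n \<Longrightarrow> mat_exp (t \<cdot>\<^sub>m A) \<in> carrier_mat n n"
  unfolding mat_exp_def by auto

context
  fixes A :: rmat and n :: nat
  assumes A: "A \<in> carrier_mat n n"
begin

lemma pow_mat_index_Suc:
  assumes "a < n" "b < n"
  shows "(A ^\<^sub>m Suc k) $$ (a, b) = (\<Sum>c<n. (A ^\<^sub>m k) $$ (a, c) * A $$ (c, b))"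
proof -
  have "dim_row (A ^\<^sub>m k) = n" "dim_col (A ^\<^sub>m k) = n" "dim_row A = n" "dim_col A = n"
    using pow_carrier_mat[OF A, of k] A by auto
  then show ?thesis using assms
    by (simp add: scalar_prod_def atLeast0LessThan)
qed

lemma mat_exp_index:
  assumes "a < n" "b < n"
  shows "mat_exp (t \<cdot>\<^sub>m A) $$ (a, b) = (\<Sum>k. (A ^\<^sub>m k) $$ (a, b) / fact k * t ^ k)"
proof -
  have "(t ^ k \<cdot>\<^sub>m A ^\<^sub>m k) $$ (a, b) = t ^ k * (A ^\<^sub>m k) $$ (a, b)" for k
  proof -
    have "a < dim_row (A ^\<^sub>m k)" "b < dim_col (A ^\<^sub>m k)"
      using pow_carrier_mat[OF A, of k] assms by auto
    then show ?thesis by (rule index_smult_mat(1))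
  qed
  then show ?thesis using A assms by (simp add: mat_exp_def smult_pow_mat[OF A] mult_ac)
qed

text \<open>Geometric growth of the powers suffices: after division by factorials the series of
  every entry converges for all times.\<close>

lemma abs_pow_mat_le:
  "\<exists>C. \<forall>a<n. \<forall>b<n. \<forall>k. \<bar>(A ^\<^sub>m k) $$ (a, b)\<bar> \<le> C ^ k"
proof -
  define m where "m = (\<Sum>(a,b)\<in>{..<n}\<times>{..<n}. \<bar>A $$ (a, b)\<bar>)"
  have m: "\<bar>A $$ (a, b)\<bar> \<le> m" if "a < n" "b < n" for a b
    unfolding m_def using that member_le_sum[of "(a,b)" "{..<n}\<times>{..<n}" "\<lambda>(a,b). \<bar>A $$ (a, b)\<bar>"] by force
  have m0: "m \<ge> 0" unfolding m_def by (intro sum_nonneg) auto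
  define C where "C = real n * m"
  have "\<bar>(A ^\<^sub>m k) $$ (a, b)\<bar> \<le> C ^ k" if "a < n" "b < n" for a b k
    using that
  proof (induction k arbitrary: a b)
    case 0
    then show ?case using A by simp
  next
    case (Suc k)
    have "\<bar>(A ^\<^sub>m Suc k) $$ (a, b)\<bar> \<le> (\<Sum>c<n. \<bar>(A ^\<^sub>m k) $$ (a, c)\<bar> * \<bar>A $$ (c, b)\<bar>)"
      unfolding pow_mat_index_Suc[OF Suc.prems] by (rule order_trans[OF sum_abs]) (simp add: abs_mult)
    also have "\<dots> \<le> (\<Sum>c<n. C ^ k * m)"
      by (intro sum_mono mult_mono Suc.IH m) (use Suc.prems m0 in \<open>auto simp: C_def\<close>)
    also have "\<dots> = C ^ Suc k" by (simp add: C_def mult_ac)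
    finally show ?case .
  qed
  then show ?thesis by blast
qed

lemma mat_exp_summable:
  assumes "a < n" "b < n"
  shows "summable (\<lambda>k. (A ^\<^sub>m k) $$ (a, b) / fact k * t ^ k)"
proof -
  obtain C where C: "\<And>a b k. a < n \<Longrightarrow> b < n \<Longrightarrow> \<bar>(A ^\<^sub>m k) $$ (a, b)\<bar> \<le> C ^ k" using abs_pow_mat_le by blast
  have "summable (\<lambda>k. inverse (fact k) * (C * \<bar>t\<bar>) ^ k)" by (rule summable_exp)
  then show ?thesis
  proof (rule summable_comparison_test'[of _ 0])
    fix k
    have "\<bar>(A ^\<^sub>m k) $$ (a, b)\<bar> * \<bar>t\<bar> ^ k \<le> C ^ k * \<bar>t\<bar> ^ k" by (intro mult_right_mono C assms) auto
    then show "norm ((A ^\<^sub>m k) $$ (a, b) / fact k * t ^ k) \<le> inverse (fact k) * (C * \<bar>t\<bar>) ^ k"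
      by (simp add: abs_mult power_abs power_mult_distrib divide_simps)
  qed
qed

lemma mat_exp_0:
  assumes "a < n" "b < n"
  shows "mat_exp (0 \<cdot>\<^sub>m A) $$ (a, b) = (if a = b then 1 else 0)"
  unfolding mat_exp_index[OF assms] powser_zero using assms A by simp

text \<open>Termwise differentiation shifts the power by one. Splitting off the last factor of
  \<open>A ^\<^sub>m Suc k\<close> puts \<open>A\<close> on the right, the side that variation of
  constants requires.\<close>

lemma mat_exp_has_derivative:
  assumes ab: "a < n" "b < n"
  shows "((\<lambda>t. mat_exp (t \<cdot>\<^sub>m A) $$ (a, b)) has_real_derivative (\<Sum>c<n. mat_exp (t \<cdot>\<^sub>m A) $$ (a, c) * A $$ (c, b))) (at t)"
proof -
  have "((\<lambda>t. \<Sum>k. (A ^\<^sub>m k) $$ (a, b) / fact k * t ^ k) has_real_derivative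
      (\<Sum>k. diffs (\<lambda>k. (A ^\<^sub>m k) $$ (a, b) / fact k) k * t ^ k)) (at t)"
    by (rule termdiffs_strong_converges_everywhere) (rule mat_exp_summable[OF ab])
  also have "(\<lambda>k. diffs (\<lambda>k. (A ^\<^sub>m k) $$ (a, b) / fact k) k * t ^ k)
     = (\<lambda>k. \<Sum>c<n. (A ^\<^sub>m k) $$ (a, c) / fact k * t ^ k * A $$ (c, b))"
  proof
    fix k
    have "diffs (\<lambda>k. (A ^\<^sub>m k) $$ (a, b) / fact k) k = (A ^\<^sub>m Suc k) $$ (a, b) / fact k"
      by (simp add: diffs_def del: pow_mat.simps of_nat_Suc)
    then show "diffs (\<lambda>k. (A ^\<^sub>m k) $$ (a, b) / fact k) k * t ^ k
      = (\<Sum>c<n. (A ^\<^sub>m k) $$ (a, c) / fact k * t ^ k * A $$ (c, b))"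
      unfolding pow_mat_index_Suc[OF ab] by (simp add: sum_divide_distrib sum_distrib_left sum_distrib_right mult_ac)
  qed
  also have "(\<Sum>k. \<Sum>c<n. (A ^\<^sub>m k) $$ (a, c) / fact k * t ^ k * A $$ (c, b))
     = (\<Sum>c<n. \<Sum>k. (A ^\<^sub>m k) $$ (a, c) / fact k * t ^ k * A $$ (c, b))"
    by (rule suminf_sum) (intro summable_mult2 mat_exp_summable ab, auto)
  also have "\<dots> = (\<Sum>c<n. mat_exp (t \<cdot>\<^sub>m A) $$ (a, c) * A $$ (c, b))"
  proof (intro sum.cong refl)
    fix c assume "c \<in> {..<n}"
    then have c: "c < n" by simp
    show "(\<Sum>k. (A ^\<^sub>m k) $$ (a, c) / fact k * t ^ k * A $$ (c, b)) = mat_exp (t \<cdot>\<^sub>m A) $$ (a, c) * A $$ (c, b)"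
      unfolding mat_exp_index[OF ab(1) c] by (rule suminf_mult2[OF mat_exp_summable[OF ab(1) c], symmetric])
  qed
  finally show ?thesis by (simp add: mat_exp_index[OF ab])
qed

lemma mat_exp_continuous:
  assumes "a < n" "b < n"
  shows "continuous_on S (\<lambda>t. mat_exp (t \<cdot>\<^sub>m A) $$ (a, b))"
  by (rule continuous_at_imp_continuous_on) (use mat_exp_has_derivative[OF assms] in \<open>auto intro: DERIV_isCont\<close>)

end

section \<open>Iterated integrals over words\<close>

lemma nn_integral_reflect:
  fixes g :: "real \<Rightarrow> ennreal"
  assumes [measurable]: "g \<in> borel_measurable borel"
  shows "(\<integral>\<^sup>+x\<in>{a..b}. g (a + b - x) \<partial>lborel) = (\<integral>\<^sup>+x\<in>{a..b}. g x \<partial>lborel)"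
proof -
  have "(\<integral>\<^sup>+x\<in>{a..b}. g x \<partial>lborel) = (\<integral>\<^sup>+x. g ((a + b) + (- 1) * x) * indicator {a..b} ((a + b) + (- 1) * x) \<partial>lborel)"
    using nn_integral_real_affine[of "\<lambda>x. g x * indicator {a..b} x" "- 1" "a + b"] by simp
  also have "\<dots> = (\<integral>\<^sup>+x\<in>{a..b}. g (a + b - x) \<partial>lborel)"
    by (simp, intro nn_integral_cong) (auto simp: indicator_def)
  finally show ?thesis by simp
qed

lemma nn_integral_triangle_swap:
  fixes h :: "real \<Rightarrow> real \<Rightarrow> ennreal"
  assumes [measurable]: "(\<lambda>(\<tau>, \<sigma>). h \<tau> \<sigma>) \<in> borel_measurable (borel \<Otimes>\<^sub>M borel)"
  shows "(\<integral>\<^sup>+\<tau>\<in>{0..t}. (\<integral>\<^sup>+\<sigma>\<in>{0..\<tau>}. h \<tau> \<sigma> \<partial>lborel) \<partial>lborel)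
      = (\<integral>\<^sup>+\<sigma>\<in>{0..t}. (\<integral>\<^sup>+\<tau>\<in>{\<sigma>..t}. h \<tau> \<sigma> \<partial>lborel) \<partial>lborel)"
proof -
  define H where "H \<tau> \<sigma> = h \<tau> \<sigma> * indicator {(\<tau>, \<sigma>). 0 \<le> \<sigma> \<and> \<sigma> \<le> \<tau> \<and> \<tau> \<le> t} (\<tau>, \<sigma>)" for \<tau> \<sigma>
  have [measurable]: "{x::real\<times>real. 0 \<le> snd x \<and> snd x \<le> fst x \<and> fst x \<le> t} \<in> sets (borel \<Otimes>\<^sub>M borel)"
  proof -
    have "{x \<in> space (borel \<Otimes>\<^sub>M borel). 0 \<le> snd x \<and> snd x \<le> fst x \<and> fst x \<le> t} \<in> sets (borel \<Otimes>\<^sub>M (borel :: real measure))"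
      by measurable
    then show ?thesis by (simp add: space_pair_measure)
  qed
  have Hm: "(\<lambda>(\<tau>, \<sigma>). H \<tau> \<sigma>) \<in> borel_measurable (lborel \<Otimes>\<^sub>M lborel)"
  proof -
    have "(\<lambda>x. (\<lambda>(\<tau>, \<sigma>). h \<tau> \<sigma>) x * indicator {x. 0 \<le> snd x \<and> snd x \<le> fst x \<and> fst x \<le> t} x) \<in> borel_measurable (borel \<Otimes>\<^sub>M borel)"
      by measurable
    also have "(\<lambda>x. (\<lambda>(\<tau>, \<sigma>). h \<tau> \<sigma>) x * indicator {x. 0 \<le> snd x \<and> snd x \<le> fst x \<and> fst x \<le> t} x) = (\<lambda>(\<tau>, \<sigma>). H \<tau> \<sigma>)"
      by (auto simp: H_def indicator_def fun_eq_iff)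
    finally show ?thesis by (simp cong: measurable_cong_sets sets_pair_measure_cong)
  qed
  have hm1: "(\<lambda>\<sigma>. h \<tau> \<sigma>) \<in> borel_measurable borel" for \<tau>
    using measurable_Pair2[OF assms, of \<tau>] by (simp add: split_def)
  have hm2: "(\<lambda>\<tau>. h \<tau> \<sigma>) \<in> borel_measurable borel" for \<sigma>
    using measurable_Pair1[OF assms, of \<sigma>] by (simp add: split_def)
  have "(\<integral>\<^sup>+\<tau>\<in>{0..t}. (\<integral>\<^sup>+\<sigma>\<in>{0..\<tau>}. h \<tau> \<sigma> \<partial>lborel) \<partial>lborel) = (\<integral>\<^sup>+\<tau>. (\<integral>\<^sup>+\<sigma>. H \<tau> \<sigma> \<partial>lborel) \<partial>lborel)"
  proof (intro nn_integral_cong)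
    fix \<tau>
    have "H \<tau> \<sigma> = h \<tau> \<sigma> * indicator {0..\<tau>} \<sigma> * indicator {0..t} \<tau>" for \<sigma>
      by (auto simp: H_def indicator_def)
    then show "(\<integral>\<^sup>+\<sigma>\<in>{0..\<tau>}. h \<tau> \<sigma> \<partial>lborel) * indicator {0..t} \<tau> = (\<integral>\<^sup>+\<sigma>. H \<tau> \<sigma> \<partial>lborel)"
      using hm1 by (simp add: nn_integral_multc)
  qed
  also have "\<dots> = (\<integral>\<^sup>+\<sigma>. (\<integral>\<^sup>+\<tau>. H \<tau> \<sigma> \<partial>lborel) \<partial>lborel)"
    by (rule lborel_pair.Fubini'[OF Hm, symmetric])
  also have "\<dots> = (\<integral>\<^sup>+\<sigma>\<in>{0..t}. (\<integral>\<^sup>+\<tau>\<in>{\<sigma>..t}. h \<tau> \<sigma> \<partial>lborel) \<partial>lborel)"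
  proof (intro nn_integral_cong)
    fix \<sigma>
    have "H \<tau> \<sigma> = h \<tau> \<sigma> * indicator {\<sigma>..t} \<tau> * indicator {0..t} \<sigma>" for \<tau>
      by (auto simp: H_def indicator_def)
    then show "(\<integral>\<^sup>+\<tau>. H \<tau> \<sigma> \<partial>lborel) = (\<integral>\<^sup>+\<tau>\<in>{\<sigma>..t}. h \<tau> \<sigma> \<partial>lborel) * indicator {0..t} \<sigma>"
      using hm2 by (simp add: nn_integral_multc)
  qed
  finally show ?thesis .
qed

lemma borel_measurable_indicator_interval:
  fixes f g :: "'a \<Rightarrow> real"
  assumes [measurable]: "f \<in> borel_measurable X" "g \<in> borel_measurable X"
  shows "(\<lambda>x. indicator {0..f x} (g x) :: ennreal) \<in> borel_measurable X"
proof -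
  have "{x \<in> space X. 0 \<le> g x \<and> g x \<le> f x} \<in> sets X" by measurable
  from borel_measurable_indicator[OF this]
  show ?thesis by (rule measurable_cong[THEN iffD1, rotated]) (auto simp: indicator_def)
qed

text \<open>The row vector r E(s) A_i.\<close>

definition push_row :: "nat \<Rightarrow> (real \<Rightarrow> nat \<Rightarrow> nat \<Rightarrow> real) \<Rightarrow> (nat \<Rightarrow> nat \<Rightarrow> nat \<Rightarrow> real) \<Rightarrow> real \<Rightarrow> nat \<Rightarrow> (nat \<Rightarrow> real) \<Rightarrow> nat \<Rightarrow> real" where
  "push_row n E A s i r = (\<lambda>e. \<Sum>c<n. (\<Sum>a<n. r a * E s a c) * A i c e)"

text \<open>For a row vector r, word_norm iu [i_k, ..., i_1] t r is the integral over the simplex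
  t >= tau_k >= ... >= tau_1 >= 0 of the squared norm of r E(t - tau_k) A_{i_k} ... A_{i_1} E(tau_1) B_{iu};
  the recursion absorbs the leading factor E(t - tau_k) A_{i_k} into the row.\<close>

locale word_kernel =
  fixes n nin np :: nat and E :: "real \<Rightarrow> nat \<Rightarrow> nat \<Rightarrow> real"
    and A :: "nat \<Rightarrow> nat \<Rightarrow> nat \<Rightarrow> real" and B :: "nat \<Rightarrow> nat \<Rightarrow> nat \<Rightarrow> real"
  assumes E_meas [measurable]: "\<And>a c. a < n \<Longrightarrow> c < n \<Longrightarrow> (\<lambda>t. E t a c) \<in> borel_measurable borel"
begin

abbreviation "push \<equiv> push_row n E A"

primrec word_norm :: "nat \<Rightarrow> nat list \<Rightarrow> real \<Rightarrow> (nat \<Rightarrow> real) \<Rightarrow> ennreal" where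
  "word_norm iu [] = (\<lambda>t r. ennreal (\<Sum>l<nin. (\<Sum>c<n. (\<Sum>a<n. r a * E t a c) * B iu c l)\<^sup>2))"
| "word_norm iu (i # is) = (\<lambda>t r. \<integral>\<^sup>+\<tau>\<in>{0..t}. word_norm iu is \<tau> (push (t - \<tau>) i r) \<partial>lborel)"

abbreviation "row_space \<equiv> Pi\<^sub>M UNIV (\<lambda>_::nat. borel :: real measure)"

lemma push_measurable:
  assumes [measurable]: "f \<in> borel_measurable X" "g \<in> measurable X row_space"
  shows "(\<lambda>x. push (f x) i (g x)) \<in> measurable X row_space"
proof (rule measurable_PiM_single')
  fix e
  have [measurable]: "(\<lambda>x. g x a) \<in> borel_measurable X" for a
    by (rule measurable_compose[OF assms(2)]) (rule measurable_component_singleton, simp)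
  have [measurable]: "(\<lambda>x. E (f x) a c) \<in> borel_measurable X" if "a < n" "c < n" for a c
    by (rule measurable_compose[OF assms(1) E_meas[OF that]])
  show "(\<lambda>x. push (f x) i (g x) e) \<in> borel_measurable X"
    unfolding push_row_def by (intro borel_measurable_sum borel_measurable_times) auto
qed auto

text \<open>Measurability has to be joint in time and row, because in the recursion the row depends
  on the integration variable; rows therefore live in a countable product of Borel lines.\<close>

lemma word_norm_measurable:
  "(\<lambda>x. word_norm iu is (fst x) (snd x)) \<in> borel_measurable (borel \<Otimes>\<^sub>M row_space)"
proof (induction "is")
  case Nil
  have [measurable]: "(\<lambda>x. snd x a) \<in> borel_measurable (borel \<Otimes>\<^sub>M row_space)" for a
    by (rule measurable_compose[OF measurable_snd]) (rule measurable_component_singleton, simp)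
  have [measurable]: "(\<lambda>x. E (fst x) a c) \<in> borel_measurable (borel \<Otimes>\<^sub>M row_space)" if "a < n" "c < n" for a c
    by (rule measurable_compose[OF measurable_fst E_meas[OF that]])
  show ?case unfolding word_norm.simps by (intro measurable_compose[OF _ measurable_ennreal] borel_measurable_sum borel_measurable_power borel_measurable_times) auto
next
  case (Cons i "is")
  have p: "(\<lambda>x. (snd x, push (fst (fst x) - snd x) i (snd (fst x)))) \<in> measurable ((borel \<Otimes>\<^sub>M row_space) \<Otimes>\<^sub>M lborel) (borel \<Otimes>\<^sub>M row_space)"
    by (intro measurable_Pair push_measurable) measurable
  have q: "(\<lambda>x. word_norm iu is (snd x) (push (fst (fst x) - snd x) i (snd (fst x)))) \<in> borel_measurable ((borel \<Otimes>\<^sub>M row_space) \<Otimes>\<^sub>M lborel)"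
    using measurable_compose[OF p Cons] by simp
  have r: "(\<lambda>x. indicator {0..fst (fst x)} (snd x :: real) :: ennreal) \<in> borel_measurable ((borel \<Otimes>\<^sub>M row_space) \<Otimes>\<^sub>M lborel)"
    by (rule borel_measurable_indicator_interval) simp_all
  show ?case
    using lborel.borel_measurable_nn_integral[of "\<lambda>x \<tau>. word_norm iu is \<tau> (push (fst x - \<tau>) i (snd x)) * indicator {0..fst x} \<tau>" "borel \<Otimes>\<^sub>M row_space"]
      borel_measurable_times_ennreal[OF q r] by (simp add: split_def)
qed

lemma word_norm_measurable':
  assumes "f \<in> borel_measurable X" "g \<in> measurable X row_space"
  shows "(\<lambda>x. word_norm iu is (f x) (g x)) \<in> borel_measurable X"
  using measurable_compose[OF measurable_Pair[OF assms] word_norm_measurable] by simp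

lemma const_row_measurable: "(\<lambda>x. r) \<in> measurable X row_space"
  by (rule measurable_const) (simp add: space_PiM)

text \<open>Exchanging the integrals over the triangle, reflecting the final time in
  \<open>{\<sigma>..t}\<close> and exchanging back replaces the running final time by the fixed
  \<open>t\<close>. Only then does the recursion over words have the shape of the Lyapunov iterates,
  whose propagator is taken at \<open>t - \<tau>\<close>.\<close>

lemma word_norm_Cons_integral:
  "(\<integral>\<^sup>+t'\<in>{0..t}. word_norm iu (i # is) t' r \<partial>lborel)
     = (\<integral>\<^sup>+\<tau>\<in>{0..t}. (\<integral>\<^sup>+\<sigma>\<in>{0..\<tau>}. word_norm iu is \<sigma> (push (t - \<tau>) i r) \<partial>lborel) \<partial>lborel)"
proof -
  have "(\<integral>\<^sup>+t'\<in>{0..t}. word_norm iu (i # is) t' r \<partial>lborel)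
     = (\<integral>\<^sup>+\<sigma>\<in>{0..t}. (\<integral>\<^sup>+\<tau>\<in>{\<sigma>..t}. word_norm iu is \<sigma> (push (\<tau> - \<sigma>) i r) \<partial>lborel) \<partial>lborel)"
    unfolding word_norm.simps
    by (rule nn_integral_triangle_swap, unfold split_def, intro word_norm_measurable' push_measurable const_row_measurable) measurable
  also have "\<dots> = (\<integral>\<^sup>+\<sigma>\<in>{0..t}. (\<integral>\<^sup>+\<tau>\<in>{\<sigma>..t}. word_norm iu is \<sigma> (push (t - \<tau>) i r) \<partial>lborel) \<partial>lborel)"
  proof (rule nn_integral_cong)
    fix \<sigma> :: real
    have "(\<integral>\<^sup>+\<tau>\<in>{\<sigma>..t}. word_norm iu is \<sigma> (push ((\<sigma> + t - \<tau>) - \<sigma>) i r) \<partial>lborel) = (\<integral>\<^sup>+\<tau>\<in>{\<sigma>..t}. word_norm iu is \<sigma> (push (\<tau> - \<sigma>) i r) \<partial>lborel)"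
      by (rule nn_integral_reflect, intro word_norm_measurable' push_measurable const_row_measurable) measurable
    then show "(\<integral>\<^sup>+\<tau>\<in>{\<sigma>..t}. word_norm iu is \<sigma> (push (\<tau> - \<sigma>) i r) \<partial>lborel) * indicator {0..t} \<sigma>
       = (\<integral>\<^sup>+\<tau>\<in>{\<sigma>..t}. word_norm iu is \<sigma> (push (t - \<tau>) i r) \<partial>lborel) * indicator {0..t} \<sigma>"
      by simp
  qed
  also have "\<dots> = (\<integral>\<^sup>+\<tau>\<in>{0..t}. (\<integral>\<^sup>+\<sigma>\<in>{0..\<tau>}. word_norm iu is \<sigma> (push (t - \<tau>) i r) \<partial>lborel) \<partial>lborel)"
    by (rule nn_integral_triangle_swap[symmetric], unfold split_def, intro word_norm_measurable' push_measurable const_row_measurable) measurable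
  finally show ?thesis .
qed

text \<open>For a weighted propagator: the part of the squared norm due to words of length
  \<open>j\<close>, with output row \<open>r\<close> and the final time cut off at
  \<open>t\<close>.\<close>

definition level :: "nat \<Rightarrow> nat \<Rightarrow> real \<Rightarrow> (nat \<Rightarrow> real) \<Rightarrow> ennreal" where
  "level iu j t r = (\<Sum>is | set is \<subseteq> {1..np} \<and> length is = j. \<integral>\<^sup>+\<sigma>\<in>{0..t}. word_norm iu is \<sigma> r \<partial>lborel)"

lemma words_Suc: "{is. set is \<subseteq> {1..np} \<and> length is = Suc j} = (\<lambda>(i, is). i # is) ` ({1..np} \<times> {is. set is \<subseteq> {1..np} \<and> length is = j})"
proof (rule equalityI; rule subsetI)
  fix xs assume "xs \<in> {is. set is \<subseteq> {1..np} \<and> length is = Suc j}"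
  then show "xs \<in> (\<lambda>(i, is). i # is) ` ({1..np} \<times> {is. set is \<subseteq> {1..np} \<and> length is = j})"
    by (cases xs) (auto intro!: image_eqI[where x = "(hd xs, tl xs)"])
qed auto

lemma level_measurable:
  assumes [measurable]: "g \<in> measurable borel row_space"
  shows "(\<lambda>\<tau>. level iu j \<tau> (g \<tau>)) \<in> borel_measurable borel"
  unfolding level_def
proof (rule borel_measurable_sum)
  fix "is" :: "nat list"
  have q: "(\<lambda>x. word_norm iu is (snd x) (g (fst x))) \<in> borel_measurable (borel \<Otimes>\<^sub>M lborel)"
    by (intro word_norm_measurable') measurable
  have r: "(\<lambda>x. indicator {0..fst x} (snd x :: real) :: ennreal) \<in> borel_measurable (borel \<Otimes>\<^sub>M lborel)"
    by (rule borel_measurable_indicator_interval) simp_all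
  show "(\<lambda>\<tau>. \<integral>\<^sup>+\<sigma>\<in>{0..\<tau>}. word_norm iu is \<sigma> (g \<tau>) \<partial>lborel) \<in> borel_measurable borel"
    using lborel.borel_measurable_nn_integral[of "\<lambda>\<tau> \<sigma>. word_norm iu is \<sigma> (g \<tau>) * indicator {0..\<tau>} \<sigma>" borel]
      borel_measurable_times_ennreal[OF q r] by (simp add: split_def)
qed

lemma push_reflect_measurable: "(\<lambda>\<tau>. push (t - \<tau>) i r) \<in> measurable borel row_space"
  by (intro push_measurable const_row_measurable) measurable

lemma level_0: "level iu 0 t r = (\<integral>\<^sup>+\<tau>\<in>{0..t}. word_norm iu [] (t - \<tau>) r \<partial>lborel)"
proof -
  have e: "{is. set is \<subseteq> {1..np} \<and> length is = 0} = {[]}" by auto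
  have "(\<integral>\<^sup>+\<tau>\<in>{0..t}. word_norm iu [] (0 + t - \<tau>) r \<partial>lborel) = (\<integral>\<^sup>+\<tau>\<in>{0..t}. word_norm iu [] \<tau> r \<partial>lborel)"
    by (rule nn_integral_reflect, intro word_norm_measurable' const_row_measurable) measurable
  then show ?thesis unfolding level_def e by simp
qed

lemma level_Suc: "level iu (Suc j) t r = (\<integral>\<^sup>+\<tau>\<in>{0..t}. (\<Sum>i\<in>{1..np}. level iu j \<tau> (push (t - \<tau>) i r)) \<partial>lborel)"
proof -
  let ?L = "{is. set is \<subseteq> {1..np} \<and> length is = j}"
  have inj: "inj_on (\<lambda>(i, is). i # is) ({1..np} \<times> ?L)" by (auto simp: inj_on_def)
  have m: "(\<lambda>\<tau>. \<integral>\<^sup>+\<sigma>\<in>{0..\<tau>}. word_norm iu is \<sigma> (push (t - \<tau>) i r) \<partial>lborel) \<in> borel_measurable borel" for i "is"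
  proof -
    have q: "(\<lambda>x. word_norm iu is (snd x) (push (t - fst x) i r)) \<in> borel_measurable (borel \<Otimes>\<^sub>M lborel)"
      by (intro word_norm_measurable' push_measurable const_row_measurable) measurable
    have r: "(\<lambda>x. indicator {0..fst x} (snd x :: real) :: ennreal) \<in> borel_measurable (borel \<Otimes>\<^sub>M lborel)"
      by (rule borel_measurable_indicator_interval) simp_all
    show ?thesis
      using lborel.borel_measurable_nn_integral[of "\<lambda>\<tau> \<sigma>. word_norm iu is \<sigma> (push (t - \<tau>) i r) * indicator {0..\<tau>} \<sigma>" borel]
        borel_measurable_times_ennreal[OF q r] by (simp add: split_def)
  qed
  have "level iu (Suc j) t r = (\<Sum>x\<in>{1..np} \<times> ?L. \<integral>\<^sup>+\<sigma>\<in>{0..t}. word_norm iu (fst x # snd x) \<sigma> r \<partial>lborel)"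
    unfolding level_def words_Suc by (subst sum.reindex[OF inj]) (simp add: split_def comp_def)
  also have "\<dots> = (\<Sum>x\<in>{1..np} \<times> ?L. \<integral>\<^sup>+\<tau>\<in>{0..t}. (\<integral>\<^sup>+\<sigma>\<in>{0..\<tau>}. word_norm iu (snd x) \<sigma> (push (t - \<tau>) (fst x) r) \<partial>lborel) \<partial>lborel)"
    by (intro sum.cong refl word_norm_Cons_integral)
  also have "\<dots> = (\<integral>\<^sup>+\<tau>. (\<Sum>x\<in>{1..np} \<times> ?L. (\<integral>\<^sup>+\<sigma>\<in>{0..\<tau>}. word_norm iu (snd x) \<sigma> (push (t - \<tau>) (fst x) r) \<partial>lborel) * indicator {0..t} \<tau>) \<partial>lborel)"
    by (rule nn_integral_sum[symmetric]) (intro borel_measurable_times_ennreal, use m in auto)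
  also have "\<dots> = (\<integral>\<^sup>+\<tau>\<in>{0..t}. (\<Sum>i\<in>{1..np}. level iu j \<tau> (push (t - \<tau>) i r)) \<partial>lborel)"
    by (simp add: level_def sum_distrib_right[symmetric] sum.cartesian_product')
  finally show ?thesis .
qed

text \<open>\<open>q\<close> and the partial sums of the levels obey the same recursion; the
  \<open>k\<close>-th iterate collects the words of length below \<open>k\<close>. The comparison
  takes place in the extended nonnegative reals, where the norm is defined.\<close>

lemma quadratic_form_le_levels:
  fixes q :: "nat \<Rightarrow> real \<Rightarrow> (nat \<Rightarrow> real) \<Rightarrow> real"
  defines "g \<equiv> \<lambda>k t r \<tau>. (\<Sum>iu\<le>np. \<Sum>l<nin. (\<Sum>c<n. (\<Sum>a<n. r a * E (t - \<tau>) a c) * B iu c l)\<^sup>2) + (\<Sum>i\<in>{1..np}. q k \<tau> (push (t - \<tau>) i r))"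
  assumes q0: "\<And>t r. q 0 t r = 0"
    and qS: "\<And>k t r. 0 \<le> t \<Longrightarrow> t \<le> T \<Longrightarrow> q (Suc k) t r = integral {0..t} (g k t r)"
    and int: "\<And>k t r. 0 \<le> t \<Longrightarrow> t \<le> T \<Longrightarrow> g k t r integrable_on {0..t}"
    and nonneg: "\<And>k t r. 0 \<le> t \<Longrightarrow> t \<le> T \<Longrightarrow> 0 \<le> q k t r"
    and t: "0 \<le> t" "t \<le> T"
  shows "ennreal (q k t r) \<le> (\<Sum>iu\<le>np. \<Sum>j<k. level iu j t r)"
  using t
proof (induction k arbitrary: t r)
  case (Suc k)
  have g0: "0 \<le> g k t r \<tau>" if "\<tau> \<in> {0..t}" for \<tau>
    unfolding g_def using that Suc.prems by (intro add_nonneg_nonneg sum_nonneg nonneg) auto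
  have "ennreal (q (Suc k) t r) = (\<integral>\<^sup>+\<tau>. indicator {0..t} \<tau> * ennreal (g k t r \<tau>) \<partial>lborel)"
  proof -
    have "(\<integral>\<^sup>+\<tau>. ennreal (indicator {0..t} \<tau> * g k t r \<tau>) \<partial>lborel) = ennreal (integral {0..t} (g k t r))"
      by (rule nn_integral_has_integral_lebesgue[OF g0 integrable_integral[OF int[OF Suc.prems]]])
    moreover have "ennreal (indicator {0..t} \<tau> * g k t r \<tau>) = indicator {0..t} \<tau> * ennreal (g k t r \<tau>)" for \<tau>
      by (auto simp: indicator_def)
    ultimately show ?thesis unfolding qS[OF Suc.prems] by simp
  qed
  also have "\<dots> \<le> (\<integral>\<^sup>+\<tau>. (\<Sum>iu\<le>np. word_norm iu [] (t - \<tau>) r * indicator {0..t} \<tau>)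
      + (\<Sum>iu\<le>np. \<Sum>j<k. (\<Sum>i\<in>{1..np}. level iu j \<tau> (push (t - \<tau>) i r)) * indicator {0..t} \<tau>) \<partial>lborel)"
  proof (rule nn_integral_mono)
    fix \<tau>
    show "indicator {0..t} \<tau> * ennreal (g k t r \<tau>) \<le> (\<Sum>iu\<le>np. word_norm iu [] (t - \<tau>) r * indicator {0..t} \<tau>)
      + (\<Sum>iu\<le>np. \<Sum>j<k. (\<Sum>i\<in>{1..np}. level iu j \<tau> (push (t - \<tau>) i r)) * indicator {0..t} \<tau>)"
    proof (cases "\<tau> \<in> {0..t}")
      case True
      then have \<tau>: "0 \<le> \<tau>" "\<tau> \<le> T" using Suc.prems by auto
      have "ennreal (g k t r \<tau>) = (\<Sum>iu\<le>np. word_norm iu [] (t - \<tau>) r) + (\<Sum>i\<in>{1..np}. ennreal (q k \<tau> (push (t - \<tau>) i r)))"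
        unfolding g_def using nonneg[OF \<tau>] by (simp add: ennreal_plus sum_nonneg sum_ennreal)
      also have "\<dots> \<le> (\<Sum>iu\<le>np. word_norm iu [] (t - \<tau>) r) + (\<Sum>i\<in>{1..np}. \<Sum>iu\<le>np. \<Sum>j<k. level iu j \<tau> (push (t - \<tau>) i r))"
        by (intro add_left_mono sum_mono Suc.IH \<tau>)
      also have "(\<Sum>i\<in>{1..np}. \<Sum>iu\<le>np. \<Sum>j<k. level iu j \<tau> (push (t - \<tau>) i r)) = (\<Sum>iu\<le>np. \<Sum>j<k. \<Sum>i\<in>{1..np}. level iu j \<tau> (push (t - \<tau>) i r))"
        by (rule sum_rotate3[symmetric])
      finally show ?thesis using True by simp
    qed simp
  qed
  also have "\<dots> = (\<Sum>iu\<le>np. level iu 0 t r) + (\<Sum>iu\<le>np. \<Sum>j<k. level iu (Suc j) t r)"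
  proof -
    have [measurable]: "(\<lambda>\<tau>. word_norm iu [] (t - \<tau>) r) \<in> borel_measurable borel" for iu
      by (intro word_norm_measurable' const_row_measurable) measurable
    have [measurable]: "(\<lambda>\<tau>. level iu j \<tau> (push (t - \<tau>) i r)) \<in> borel_measurable borel" for iu j i
      by (rule level_measurable[OF push_reflect_measurable])
    have gen: "(\<integral>\<^sup>+\<tau>. (\<Sum>iu\<le>np. F iu \<tau>) + (\<Sum>iu\<le>np. \<Sum>j<k. G iu j \<tau>) \<partial>lborel)
        = (\<Sum>iu\<le>np. \<integral>\<^sup>+\<tau>. F iu \<tau> \<partial>lborel) + (\<Sum>iu\<le>np. \<Sum>j<k. \<integral>\<^sup>+\<tau>. G iu j \<tau> \<partial>lborel)"
      if [measurable]: "\<And>iu. F iu \<in> borel_measurable borel" "\<And>iu j. G iu j \<in> borel_measurable borel"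
      for F :: "nat \<Rightarrow> real \<Rightarrow> ennreal" and G :: "nat \<Rightarrow> nat \<Rightarrow> real \<Rightarrow> ennreal"
      by (subst nn_integral_add) (simp_all add: nn_integral_sum)
    show ?thesis unfolding level_0 level_Suc by (rule gen) measurable
  qed
  also have "\<dots> = (\<Sum>iu\<le>np. \<Sum>j<Suc k. level iu j t r)"
    unfolding sum.lessThan_Suc_shift by (simp add: sum.distrib)
  finally show ?case .
qed (simp add: q0)

end

section \<open>Gram forms of sampled trajectories\<close>

context lyapunov_recursion begin

text \<open>Symmetry lets the two off-diagonal blocks combine into a single cross term.\<close>

lemma Z_sym: "Z m t \<alpha> \<beta> = Z m t \<beta> \<alpha>"
proof (induction m arbitrary: t \<alpha> \<beta>)
  case (Suc m)
  have f: "forcing m \<tau> \<gamma> \<delta> = forcing m \<tau> \<delta> \<gamma>" for \<tau> \<gamma> \<delta>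
  proof -
    have "(\<Sum>\<epsilon>\<in>I. D k \<tau> \<gamma> \<epsilon> * (\<Sum>\<zeta>\<in>I. D k \<tau> \<delta> \<zeta> * Z m \<tau> \<epsilon> \<zeta>)) = (\<Sum>\<epsilon>\<in>I. D k \<tau> \<delta> \<epsilon> * (\<Sum>\<zeta>\<in>I. D k \<tau> \<gamma> \<zeta> * Z m \<tau> \<epsilon> \<zeta>))" for k
    proof -
      have "(\<Sum>\<epsilon>\<in>I. D k \<tau> \<gamma> \<epsilon> * (\<Sum>\<zeta>\<in>I. D k \<tau> \<delta> \<zeta> * Z m \<tau> \<epsilon> \<zeta>)) = (\<Sum>\<epsilon>\<in>I. \<Sum>\<zeta>\<in>I. D k \<tau> \<delta> \<zeta> * (D k \<tau> \<gamma> \<epsilon> * Z m \<tau> \<zeta> \<epsilon>))"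
        by (simp add: sum_distrib_left mult_ac Suc.IH[of \<tau>])
      also have "\<dots> = (\<Sum>\<zeta>\<in>I. \<Sum>\<epsilon>\<in>I. D k \<tau> \<delta> \<zeta> * (D k \<tau> \<gamma> \<epsilon> * Z m \<tau> \<zeta> \<epsilon>))" by (rule sum.swap)
      finally show ?thesis by (simp add: sum_distrib_left)
    qed
    then show ?thesis unfolding forcing_def by (simp add: mult.commute)
  qed
  have "(\<Sum>\<gamma>\<in>I. E (t - \<tau>) \<alpha> \<gamma> * (\<Sum>\<delta>\<in>I. E (t - \<tau>) \<beta> \<delta> * forcing m \<tau> \<gamma> \<delta>))
      = (\<Sum>\<gamma>\<in>I. E (t - \<tau>) \<beta> \<gamma> * (\<Sum>\<delta>\<in>I. E (t - \<tau>) \<alpha> \<delta> * forcing m \<tau> \<gamma> \<delta>))" for \<tau>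
  proof -
    have "(\<Sum>\<gamma>\<in>I. E (t - \<tau>) \<alpha> \<gamma> * (\<Sum>\<delta>\<in>I. E (t - \<tau>) \<beta> \<delta> * forcing m \<tau> \<gamma> \<delta>))
       = (\<Sum>\<gamma>\<in>I. \<Sum>\<delta>\<in>I. E (t - \<tau>) \<beta> \<delta> * (E (t - \<tau>) \<alpha> \<gamma> * forcing m \<tau> \<delta> \<gamma>))"
      unfolding sum_distrib_left by (intro sum.cong refl) (subst f, simp add: mult_ac)
    also have "\<dots> = (\<Sum>\<delta>\<in>I. \<Sum>\<gamma>\<in>I. E (t - \<tau>) \<beta> \<delta> * (E (t - \<tau>) \<alpha> \<gamma> * forcing m \<tau> \<delta> \<gamma>))" by (rule sum.swap)
    finally show ?thesis by (simp add: sum_distrib_left)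
  qed
  then show ?case unfolding Z_Suc by simp
qed simp

end

text \<open>The recursion runs on n state coordinates (Inl) and one scalar coordinate per sample (Inr): its
  three blocks are the controllability Gramian, the truncated Dyson series X of the sampled states, and a
  Gram matrix G of the samples which does not depend on A, B or E. Positive semidefiniteness of the whole
  is thus a Cauchy-Schwarz inequality for the outputs. The weight e^(lam t) of the norm is split as
  e^(lam t / 2) on the state block and e^(- lam t / 2) on the sample block, so that it cancels in X.\<close>

locale lpv_samples =
  fixes n nin np N :: nat and T lam :: real
    and A :: "nat \<Rightarrow> nat \<Rightarrow> nat \<Rightarrow> real" and B :: "nat \<Rightarrow> nat \<Rightarrow> nat \<Rightarrow> real"
    and E :: "real \<Rightarrow> nat \<Rightarrow> nat \<Rightarrow> real"
    and p u :: "nat \<Rightarrow> nat \<Rightarrow> real \<Rightarrow> real"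
  assumes T: "T \<ge> 0" and lam: "lam \<ge> real np"
    and E_cont: "\<And>a c. a < n \<Longrightarrow> c < n \<Longrightarrow> continuous_on UNIV (\<lambda>t. E t a c)"
    and p_bdd_meas: "\<And>j i. j < N \<Longrightarrow> i \<le> np \<Longrightarrow> bdd_meas T (p j i)"
    and p_le: "\<And>j i t. j < N \<Longrightarrow> i \<le> np \<Longrightarrow> t \<in> {0..T} \<Longrightarrow> \<bar>p j i t\<bar> \<le> 1"
    and u_bdd_meas: "\<And>j l. j < N \<Longrightarrow> l < nin \<Longrightarrow> bdd_meas T (u j l)"
begin

declare One_nat_def [simp del]

definition E\<^sub>w :: "real \<Rightarrow> nat \<Rightarrow> nat \<Rightarrow> real" where "E\<^sub>w s a c = exp (lam * s / 2) * E s a c"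

definition blockE :: "real \<Rightarrow> nat + nat \<Rightarrow> nat + nat \<Rightarrow> real" where
  "blockE s \<alpha> \<beta> = (case \<alpha> of Inl a \<Rightarrow> (case \<beta> of Inl c \<Rightarrow> E\<^sub>w s a c | Inr _ \<Rightarrow> 0)
     | Inr j \<Rightarrow> (case \<beta> of Inl _ \<Rightarrow> 0 | Inr j' \<Rightarrow> if j = j' then exp (- (lam * s / 2)) else 0))"

definition blockD :: "nat \<Rightarrow> real \<Rightarrow> nat + nat \<Rightarrow> nat + nat \<Rightarrow> real" where
  "blockD i \<tau> \<alpha> \<beta> = (case \<alpha> of Inl a \<Rightarrow> (case \<beta> of Inl c \<Rightarrow> A i a c | Inr _ \<Rightarrow> 0)
     | Inr j \<Rightarrow> (case \<beta> of Inl _ \<Rightarrow> 0 | Inr j' \<Rightarrow> if j = j' then p j i \<tau> else 0))"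

text \<open>Columns are indexed by a matrix index and an input coordinate. Summing products of
  entries over the columns gives B B^T for two states, the driving term B p u for a state and a
  sample, and the input energy for two samples.\<close>

definition blockB :: "nat \<times> nat \<Rightarrow> real \<Rightarrow> nat + nat \<Rightarrow> real" where
  "blockB w \<tau> \<alpha> = (case \<alpha> of Inl a \<Rightarrow> B (fst w) a (snd w) | Inr j \<Rightarrow> p j (fst w) \<tau> * u j (snd w) \<tau>)"

abbreviation "Ix \<equiv> {..<n} <+> {..<N}"

sublocale L: lyapunov_recursion Ix "{1..np}" "{..np} \<times> {..<nin}" T blockE blockD blockB
proof
  fix \<alpha> \<beta> assume "\<alpha> \<in> Ix" "\<beta> \<in> Ix"
  moreover have "continuous_on {0..T} (\<lambda>x. if y = ya then exp (- (lam * x / 2)) else 0)" for y ya :: nat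
    by (cases "y = ya") (auto intro!: continuous_intros)
  ultimately show "continuous_on {0..T} (\<lambda>t. blockE t \<alpha> \<beta>)"
    unfolding blockE_def E\<^sub>w_def
    by (auto split: sum.split intro!: continuous_intros continuous_on_subset[OF E_cont])
next
  fix k \<alpha> \<beta> assume "k \<in> {1..np}" "\<alpha> \<in> Ix" "\<beta> \<in> Ix"
  moreover have "bdd_meas T (\<lambda>t. if y = ya then p y k t else 0)" if "y < N" "k \<le> np" for y ya :: nat
    by (cases "y = ya") (use p_bdd_meas that in auto)
  ultimately show "bdd_meas T (\<lambda>t. blockD k t \<alpha> \<beta>)"
    unfolding blockD_def by (auto split: sum.split)
next
  fix w \<alpha> assume "w \<in> {..np} \<times> {..<nin}" "\<alpha> \<in> Ix"
  moreover have "bdd_meas T (\<lambda>t. p y i t * u y l t)" if "y < N" "i \<le> np" "l < nin" for y i l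
    by (intro bdd_meas_mult p_bdd_meas u_bdd_meas that)
  ultimately show "bdd_meas T (\<lambda>t. blockB w t \<alpha>)"
    unfolding blockB_def by (auto split: sum.split)
qed auto

lemma sum_Ix: "(\<Sum>\<alpha>\<in>Ix. f \<alpha>) = (\<Sum>a<n. f (Inl a)) + (\<Sum>j<N. f (Inr j))"
  by (simp add: sum.Plus)

lemma block_simps [simp]:
  "blockE s (Inl a) (Inl c) = E\<^sub>w s a c" "blockE s (Inl a) (Inr j) = 0" "blockE s (Inr j) (Inl a) = 0"
  "blockD i \<tau> (Inl a) (Inl c) = A i a c" "blockD i \<tau> (Inl a) (Inr j) = 0" "blockD i \<tau> (Inr j) (Inl a) = 0"
  "blockB (iu, l) \<tau> (Inl a) = B iu a l" "blockB (iu, l) \<tau> (Inr j) = p j iu \<tau> * u j l \<tau>"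
  by (auto simp: blockE_def blockD_def blockB_def)

lemma sum_blockE_Inl: "(\<Sum>\<gamma>\<in>Ix. blockE s (Inl a) \<gamma> * f \<gamma>) = (\<Sum>c<n. E\<^sub>w s a c * f (Inl c))"
  by (simp add: sum_Ix)

lemma sum_blockE_Inr: "j < N \<Longrightarrow> (\<Sum>\<gamma>\<in>Ix. blockE s (Inr j) \<gamma> * f \<gamma>) = exp (- (lam * s / 2)) * f (Inr j)"
  by (simp add: sum_Ix blockE_def if_distrib[of "\<lambda>z. z * _"] cong: if_cong)

lemma sum_blockD_Inl: "(\<Sum>\<gamma>\<in>Ix. blockD i \<tau> (Inl a) \<gamma> * f \<gamma>) = (\<Sum>c<n. A i a c * f (Inl c))"
  by (simp add: sum_Ix)

lemma sum_blockD_Inr: "j < N \<Longrightarrow> (\<Sum>\<gamma>\<in>Ix. blockD i \<tau> (Inr j) \<gamma> * f \<gamma>) = p j i \<tau> * f (Inr j)"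
  by (simp add: sum_Ix blockD_def if_distrib[of "\<lambda>z. z * _"] cong: if_cong)

definition X :: "nat \<Rightarrow> nat \<Rightarrow> real \<Rightarrow> nat \<Rightarrow> real" where "X k j t a = L.Z k t (Inl a) (Inr j)"
definition G :: "nat \<Rightarrow> nat \<Rightarrow> nat \<Rightarrow> real \<Rightarrow> real" where "G k j j' t = L.Z k t (Inr j) (Inr j')"
definition q :: "nat \<Rightarrow> real \<Rightarrow> (nat \<Rightarrow> real) \<Rightarrow> real" where
  "q k t r = (\<Sum>a<n. \<Sum>b<n. r a * r b * L.Z k t (Inl a) (Inl b))"

lemma X_0: "X 0 j t a = 0" by (simp add: X_def)

lemma X_Suc:
  assumes "j < N"
  shows "X (Suc k) j t a = integral {0..t} (\<lambda>\<tau>. \<Sum>c<n. E (t - \<tau>) a c *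
     ((\<Sum>iu\<le>np. \<Sum>l<nin. B iu c l * (p j iu \<tau> * u j l \<tau>)) + (\<Sum>i\<in>{1..np}. \<Sum>e<n. A i c e * (p j i \<tau> * X k j \<tau> e))))"
proof -
  have *: "E\<^sub>w s a c * (exp (- (lam * s / 2)) * f) = E s a c * f" for s c f
    by (simp add: E\<^sub>w_def mult_ac exp_minus field_simps)
  show ?thesis
    unfolding X_def L.Z_Suc sum_blockE_Inl sum_blockE_Inr[OF assms] L.forcing_def sum_blockD_Inl sum_blockD_Inr[OF assms] *
    by (simp add: sum.cartesian_product')
qed

lemma G_Suc:
  assumes "j < N" "j' < N"
  shows "G (Suc k) j j' t = integral {0..t} (\<lambda>\<tau>. exp (- (lam * (t - \<tau>))) *
     ((\<Sum>iu\<le>np. \<Sum>l<nin. (p j iu \<tau> * u j l \<tau>) * (p j' iu \<tau> * u j' l \<tau>)) + (\<Sum>i\<in>{1..np}. p j i \<tau> * (p j' i \<tau> * G k j j' \<tau>))))"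
proof -
  \<comment> \<open>Between two samples the half weights multiply to the full decay, instead of
    cancelling as they do between a state and a sample.\<close>
  have *: "exp (- (lam * s / 2)) * (exp (- (lam * s / 2)) * f) = exp (- (lam * s)) * f" for s f
    by (simp add: mult.assoc[symmetric] exp_add[symmetric])
  show ?thesis
    unfolding G_def L.Z_Suc sum_blockE_Inr[OF assms(1)] sum_blockE_Inr[OF assms(2)] L.forcing_def sum_blockD_Inr[OF assms(1)] sum_blockD_Inr[OF assms(2)] *
    by (simp add: sum.cartesian_product')
qed

lemma q_eq: "q k t r = (\<Sum>\<alpha>\<in>Ix. \<Sum>\<beta>\<in>Ix. case_sum r (\<lambda>_. 0) \<alpha> * case_sum r (\<lambda>_. 0) \<beta> * L.Z k t \<alpha> \<beta>)"
  unfolding q_def sum_Ix by simp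

lemma q_0: "q 0 t r = 0" by (simp add: q_def)

lemma q_nonneg: "t \<le> T \<Longrightarrow> 0 \<le> q k t r"
  unfolding q_eq by (rule L.Z_pos_semidef)

lemma q_Suc:
  assumes "t \<le> T"
  shows "q (Suc k) t r = integral {0..t} (\<lambda>\<tau>. (\<Sum>iu\<le>np. \<Sum>l<nin. (\<Sum>c<n. (\<Sum>a<n. r a * E\<^sub>w (t - \<tau>) a c) * B iu c l)\<^sup>2)
      + (\<Sum>i\<in>{1..np}. q k \<tau> (push_row n E\<^sub>w A (t - \<tau>) i r)))"
    and "bdd_meas t (\<lambda>\<tau>. (\<Sum>iu\<le>np. \<Sum>l<nin. (\<Sum>c<n. (\<Sum>a<n. r a * E\<^sub>w (t - \<tau>) a c) * B iu c l)\<^sup>2)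
      + (\<Sum>i\<in>{1..np}. q k \<tau> (push_row n E\<^sub>w A (t - \<tau>) i r)))"
proof -
  let ?v = "case_sum r (\<lambda>_. 0)"
  define v' where "v' \<tau> \<gamma> = (\<Sum>\<alpha>\<in>Ix. ?v \<alpha> * blockE (t - \<tau>) \<alpha> \<gamma>)" for \<tau> \<gamma>
  have v': "v' \<tau> (Inl c) = (\<Sum>a<n. r a * E\<^sub>w (t - \<tau>) a c)" "v' \<tau> (Inr j) = 0" for \<tau> c j
    unfolding v'_def sum_Ix by simp_all
  have 1: "(\<Sum>w\<in>{..np} \<times> {..<nin}. (\<Sum>\<gamma>\<in>Ix. v' \<tau> \<gamma> * blockB w \<tau> \<gamma>)\<^sup>2)
      = (\<Sum>iu\<le>np. \<Sum>l<nin. (\<Sum>c<n. (\<Sum>a<n. r a * E\<^sub>w (t - \<tau>) a c) * B iu c l)\<^sup>2)" for \<tau>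
    unfolding sum_Ix v' by (simp add: sum.cartesian_product')
  have d: "(\<Sum>\<gamma>\<in>Ix. v' \<tau> \<gamma> * blockD i \<tau> \<gamma> (Inl e)) = push_row n E\<^sub>w A (t - \<tau>) i r e" "(\<Sum>\<gamma>\<in>Ix. v' \<tau> \<gamma> * blockD i \<tau> \<gamma> (Inr j)) = 0" for i \<tau> e j
    unfolding sum_Ix v' push_row_def by simp_all
  have 2: "(\<Sum>\<epsilon>\<in>Ix. \<Sum>\<zeta>\<in>Ix. (\<Sum>\<gamma>\<in>Ix. v' \<tau> \<gamma> * blockD i \<tau> \<gamma> \<epsilon>) * (\<Sum>\<delta>\<in>Ix. v' \<tau> \<delta> * blockD i \<tau> \<delta> \<zeta>) * L.Z k \<tau> \<epsilon> \<zeta>)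
      = q k \<tau> (push_row n E\<^sub>w A (t - \<tau>) i r)" for \<tau> i
  proof -
    have sp: "(\<Sum>\<epsilon>\<in>Ix. \<Sum>\<zeta>\<in>Ix. f \<epsilon> * f \<zeta> * L.Z k \<tau> \<epsilon> \<zeta>) = (\<Sum>a<n. \<Sum>b<n. f (Inl a) * f (Inl b) * L.Z k \<tau> (Inl a) (Inl b))"
      if "\<And>j. f (Inr j) = 0" for f using that unfolding sum_Ix by simp
    show ?thesis unfolding q_def
      by (subst sp) (simp_all add: d)
  qed
  show "q (Suc k) t r = integral {0..t} (\<lambda>\<tau>. (\<Sum>iu\<le>np. \<Sum>l<nin. (\<Sum>c<n. (\<Sum>a<n. r a * E\<^sub>w (t - \<tau>) a c) * B iu c l)\<^sup>2)
      + (\<Sum>i\<in>{1..np}. q k \<tau> (push_row n E\<^sub>w A (t - \<tau>) i r)))"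
    using L.quadratic_form_Suc(1)[OF assms, of ?v k] unfolding q_eq[symmetric] v'_def[symmetric] 1 2 .
  show "bdd_meas t (\<lambda>\<tau>. (\<Sum>iu\<le>np. \<Sum>l<nin. (\<Sum>c<n. (\<Sum>a<n. r a * E\<^sub>w (t - \<tau>) a c) * B iu c l)\<^sup>2)
      + (\<Sum>i\<in>{1..np}. q k \<tau> (push_row n E\<^sub>w A (t - \<tau>) i r)))"
    using L.quadratic_form_Suc(2)[OF assms, of ?v k] unfolding v'_def[symmetric] 1 2 .
qed

text \<open>Positive semidefiniteness tested at the vector with state part \<open>s * r\<close> and
  sample part \<open>- d\<close>. The scalar stays free: 0 gives positivity of the Gram form, and
  positive values replace the square root in Cauchy-Schwarz.\<close>

lemma cross_term_bound:
  assumes t: "t \<le> T"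
  shows "2 * s * (\<Sum>j<N. d j * (\<Sum>a<n. r a * X k j t a)) \<le> s\<^sup>2 * q k t r + (\<Sum>j<N. \<Sum>j'<N. d j * d j' * G k j j' t)"
proof -
  define v where "v = case_sum (\<lambda>a. s * r a) (\<lambda>j. - d j)"
  have "0 \<le> (\<Sum>\<alpha>\<in>Ix. \<Sum>\<beta>\<in>Ix. v \<alpha> * v \<beta> * L.Z k t \<alpha> \<beta>)" by (rule L.Z_pos_semidef[OF t])
  also have "\<dots> = (\<Sum>a<n. \<Sum>b<n. (s * r a) * (s * r b) * L.Z k t (Inl a) (Inl b))
     + (\<Sum>a<n. \<Sum>j<N. (s * r a) * (- d j) * X k j t a) + (\<Sum>j<N. \<Sum>a<n. (- d j) * (s * r a) * X k j t a)
     + (\<Sum>j<N. \<Sum>j'<N. (- d j) * (- d j') * G k j j' t)"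
    unfolding sum_Ix v_def X_def G_def by (simp add: sum.distrib L.Z_sym[of _ _ "Inr _" "Inl _"])
  also have "(\<Sum>a<n. \<Sum>j<N. (s * r a) * (- d j) * X k j t a) = (\<Sum>j<N. \<Sum>a<n. (s * r a) * (- d j) * X k j t a)"
    by (rule sum.swap)
  also have "(\<Sum>j<N. \<Sum>a<n. (s * r a) * (- d j) * X k j t a) = - (s * (\<Sum>j<N. d j * (\<Sum>a<n. r a * X k j t a)))"
    by (simp add: sum_distrib_left sum_negf mult_ac)
  also have "(\<Sum>j<N. \<Sum>a<n. (- d j) * (s * r a) * X k j t a) = - (s * (\<Sum>j<N. d j * (\<Sum>a<n. r a * X k j t a)))"
    by (simp add: sum_distrib_left sum_negf mult_ac)
  also have "(\<Sum>a<n. \<Sum>b<n. (s * r a) * (s * r b) * L.Z k t (Inl a) (Inl b)) = s\<^sup>2 * q k t r"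
    by (simp add: q_def sum_distrib_left power2_eq_square mult_ac)
  also have "(\<Sum>j<N. \<Sum>j'<N. (- d j) * (- d j') * G k j j' t) = (\<Sum>j<N. \<Sum>j'<N. d j * d j' * G k j j' t)" by simp
  finally show ?thesis by simp
qed

text \<open>The decay e^(- lam t) with lam at least np compensates the np summands fed back at each step.\<close>

lemma G_diag_le:
  assumes j: "j < N" and t: "0 \<le> t" "t \<le> T"
  shows "G k j j t \<le> (real np + 1) * integral {0..t} (\<lambda>\<tau>. \<Sum>l<nin. (u j l \<tau>)\<^sup>2)"
  using t
proof (induction k arbitrary: t)
  case 0
  have "0 \<le> integral {0..t} (\<lambda>\<tau>. \<Sum>l<nin. (u j l \<tau>)\<^sup>2)"
    unfolding power2_eq_square
    by (intro Henstock_Kurzweil_Integration.integral_nonneg bdd_meas_integrable'[OF _ 0(2)] bdd_meas_sum bdd_meas_mult u_bdd_meas j sum_nonneg) auto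
  then show ?case by (simp add: G_def)
next
  case (Suc k)
  define w where "w \<tau> = (\<Sum>l<nin. (u j l \<tau>)\<^sup>2)" for \<tau>
  have w_bdd_meas: "bdd_meas T w" unfolding w_def[abs_def] power2_eq_square by (intro bdd_meas_sum bdd_meas_mult u_bdd_meas j) auto
  have w0: "0 \<le> w \<tau>" for \<tau> unfolding w_def by (intro sum_nonneg) auto
  \<comment> \<open>The claimed bound as a function of time; its factor \<open>real np + 1\<close>
    counts the indices \<open>iu\<close> from 0 to \<open>np\<close>.\<close>
  define U where "U \<tau> = (real np + 1) * integral {0..\<tau>} w" for \<tau>
  have Uc: "continuous_on {0..T} U" unfolding U_def
    by (intro continuous_intros indefinite_integral_continuous_1 bdd_meas_integrable w_bdd_meas)
  have U0: "0 \<le> U \<tau>" if "\<tau> \<le> T" for \<tau> unfolding U_def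
    by (intro mult_nonneg_nonneg Henstock_Kurzweil_Integration.integral_nonneg w0 bdd_meas_integrable'[OF w_bdd_meas that]) auto
  have Gbm: "bdd_meas T (G k j j)" unfolding G_def using j by (intro L.Z_bdd_meas) auto
  have G0: "0 \<le> G k j j \<tau>" if "\<tau> \<le> T" for \<tau>
  proof -
    \<comment> \<open>The form is tested at the unit vector of sample \<open>j\<close>.\<close>
    have eq: "(\<Sum>\<alpha>\<in>Ix. \<Sum>\<beta>\<in>Ix. case_sum (\<lambda>_. 0) (\<lambda>i. if i = j then 1 else 0) \<alpha> * case_sum (\<lambda>_. 0) (\<lambda>i. if i = j then 1 else 0) \<beta> * L.Z k \<tau> \<alpha> \<beta>)
       = L.Z k \<tau> (Inr j) (Inr j)"
    proof -
      have "(\<Sum>b<N. (if a = j then 1 else 0) * (if b = j then 1 else 0) * L.Z k \<tau> (Inr a) (Inr b)) = (if a = j then L.Z k \<tau> (Inr j) (Inr j) else 0)" for a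
        using j by (cases "a = j") (simp_all add: if_distrib[of "\<lambda>z. z * _"] cong: if_cong)
      then show ?thesis unfolding sum_Ix using j by simp
    qed
    show ?thesis unfolding G_def eq[symmetric] by (rule L.Z_pos_semidef[OF that])
  qed
  \<comment> \<open>An integrating factor: almost everywhere the derivative is the exponential times
    \<open>lam * U \<tau> + (real np + 1) * w \<tau>\<close>. This density dominates the integrand
    of the next iterate and integrates exactly to \<open>U t\<close>.\<close>
  define F where "F \<tau> = exp (- (lam * (t - \<tau>))) * U \<tau>" for \<tau>
  have "((\<lambda>\<tau>. exp (- (lam * (t - \<tau>))) * (lam * U \<tau> + (real np + 1) * w \<tau>)) has_integral F t - F 0) {0..t}"
  proof (rule fundamental_theorem_of_calculus_abs_continuous[OF Suc.prems(1)])
    have ed: "((\<lambda>\<tau>. exp (- (lam * (t - \<tau>)))) has_real_derivative lam * exp (- (lam * (t - \<tau>)))) (at \<tau> within S)" for \<tau> S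
      by (auto intro!: derivative_eq_intros)
    have eac: "abs_continuous_on 0 t (\<lambda>\<tau>. exp (- (lam * (t - \<tau>))))"
    proof (rule lipschitz_imp_abs_continuous_on[where C = "\<bar>lam\<bar>"])
      fix s s' assume s: "0 \<le> s" "s \<le> s'" "s' \<le> t"
      have "norm (exp (- (lam * (t - s'))) - exp (- (lam * (t - s)))) \<le> \<bar>lam\<bar> * norm (s' - s)"
      proof (rule field_differentiable_bound[where S = "{0..t}" and f' = "\<lambda>\<tau>. lam * exp (- (lam * (t - \<tau>)))"])
        fix z assume z: "z \<in> {0..t}"
        have "0 \<le> lam" using lam by linarith
        then have "exp (- (lam * (t - z))) \<le> 1" using z by simp
        then show "norm (lam * exp (- (lam * (t - z)))) \<le> \<bar>lam\<bar>" by (simp add: abs_mult mult_left_le)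
      qed (use ed s in auto)
      then show "\<bar>exp (- (lam * (t - s'))) - exp (- (lam * (t - s)))\<bar> \<le> \<bar>lam\<bar> * (s' - s)" using s by simp
    qed
    show "abs_continuous_on 0 t F" unfolding F_def U_def
      using bdd_meas_mono[OF w_bdd_meas Suc.prems(2)]
      by (intro abs_continuous_on_mult eac abs_continuous_on_const abs_continuous_on_indefinite_integral)
    show "AE \<tau> in lebesgue. \<tau> \<in> {0..t} \<longrightarrow> (F has_real_derivative exp (- (lam * (t - \<tau>))) * (lam * U \<tau> + (real np + 1) * w \<tau>)) (at \<tau> within {0..t})"
      using AE_indefinite_integral_has_derivative[OF bdd_meas_integrable'[OF w_bdd_meas Suc.prems(2)]]
    proof (rule eventually_mono, intro impI)
      fix \<tau> assume d: "\<tau> \<in> {0..t} \<longrightarrow> ((\<lambda>x. integral {0..x} w) has_real_derivative w \<tau>) (at \<tau> within {0..t})" and \<tau>: "\<tau> \<in> {0..t}"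
      have "(F has_real_derivative lam * exp (- (lam * (t - \<tau>))) * U \<tau> + (real np + 1) * w \<tau> * exp (- (lam * (t - \<tau>)))) (at \<tau> within {0..t})"
        unfolding F_def U_def using d \<tau> by (intro DERIV_mult ed DERIV_cmult) auto
      then show "(F has_real_derivative exp (- (lam * (t - \<tau>))) * (lam * U \<tau> + (real np + 1) * w \<tau>)) (at \<tau> within {0..t})"
        by (simp add: algebra_simps)
    qed
  qed
  moreover have "F t - F 0 = U t" by (simp add: F_def U_def)
  ultimately have FI: "((\<lambda>\<tau>. exp (- (lam * (t - \<tau>))) * (lam * U \<tau> + (real np + 1) * w \<tau>)) has_integral U t) {0..t}" by simp
  have "G (Suc k) j j t \<le> integral {0..t} (\<lambda>\<tau>. exp (- (lam * (t - \<tau>))) * (lam * U \<tau> + (real np + 1) * w \<tau>))"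
    unfolding G_Suc[OF j j]
  proof (rule integral_le)
    show "(\<lambda>\<tau>. exp (- (lam * (t - \<tau>))) * ((\<Sum>iu\<le>np. \<Sum>l<nin. (p j iu \<tau> * u j l \<tau>) * (p j iu \<tau> * u j l \<tau>)) + (\<Sum>i\<in>{1..np}. p j i \<tau> * (p j i \<tau> * G k j j \<tau>)))) integrable_on {0..t}"
      using j by (intro bdd_meas_integrable bdd_meas_mult bdd_meas_add bdd_meas_sum bdd_meas_mono[OF p_bdd_meas Suc.prems(2)] bdd_meas_mono[OF u_bdd_meas Suc.prems(2)] bdd_meas_mono[OF Gbm Suc.prems(2)] bdd_meas_continuous continuous_intros) auto
    show "(\<lambda>\<tau>. exp (- (lam * (t - \<tau>))) * (lam * U \<tau> + (real np + 1) * w \<tau>)) integrable_on {0..t}"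
      using FI by blast
    fix \<tau> assume "\<tau> \<in> {0..t}"
    then have \<tau>: "0 \<le> \<tau>" "\<tau> \<le> T" "\<tau> \<in> {0..T}" using Suc.prems by auto
    have p2: "(p j i \<tau>)\<^sup>2 \<le> 1" if "i \<le> np" for i using p_le[OF j that \<tau>(3)] by (simp add: abs_square_le_1)
    have "(\<Sum>iu\<le>np. \<Sum>l<nin. (p j iu \<tau> * u j l \<tau>) * (p j iu \<tau> * u j l \<tau>)) \<le> (\<Sum>iu\<le>np. w \<tau>)"
    proof (rule sum_mono)
      fix iu assume iu: "iu \<in> {..np}"
      have "(\<Sum>l<nin. (p j iu \<tau> * u j l \<tau>) * (p j iu \<tau> * u j l \<tau>)) = (p j iu \<tau>)\<^sup>2 * w \<tau>"
        by (simp add: w_def sum_distrib_left power2_eq_square mult_ac)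
      also have "\<dots> \<le> 1 * w \<tau>" using p2 iu w0 by (intro mult_right_mono) auto
      finally show "(\<Sum>l<nin. (p j iu \<tau> * u j l \<tau>) * (p j iu \<tau> * u j l \<tau>)) \<le> w \<tau>" by simp
    qed
    moreover have "(\<Sum>i\<in>{1..np}. p j i \<tau> * (p j i \<tau> * G k j j \<tau>)) \<le> (\<Sum>i\<in>{1..np}. U \<tau>)"
    proof (rule sum_mono)
      fix i assume i: "i \<in> {1..np}"
      have "p j i \<tau> * (p j i \<tau> * G k j j \<tau>) = (p j i \<tau>)\<^sup>2 * G k j j \<tau>" by (simp add: power2_eq_square)
      also have "\<dots> \<le> 1 * G k j j \<tau>" using p2 i G0[OF \<tau>(2)] by (intro mult_right_mono) auto
      also have "\<dots> \<le> U \<tau>" using Suc.IH[OF \<tau>(1,2)] by (simp add: U_def w_def[abs_def])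
      finally show "p j i \<tau> * (p j i \<tau> * G k j j \<tau>) \<le> U \<tau>" .
    qed
    moreover have "real np * U \<tau> \<le> lam * U \<tau>" using lam U0[OF \<tau>(2)] by (intro mult_right_mono) auto
    ultimately have "(\<Sum>iu\<le>np. \<Sum>l<nin. (p j iu \<tau> * u j l \<tau>) * (p j iu \<tau> * u j l \<tau>)) + (\<Sum>i\<in>{1..np}. p j i \<tau> * (p j i \<tau> * G k j j \<tau>))
       \<le> lam * U \<tau> + (real np + 1) * w \<tau>"
      by (simp add: algebra_simps)
    then show "exp (- (lam * (t - \<tau>))) * ((\<Sum>iu\<le>np. \<Sum>l<nin. (p j iu \<tau> * u j l \<tau>) * (p j iu \<tau> * u j l \<tau>)) + (\<Sum>i\<in>{1..np}. p j i \<tau> * (p j i \<tau> * G k j j \<tau>)))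
       \<le> exp (- (lam * (t - \<tau>))) * (lam * U \<tau> + (real np + 1) * w \<tau>)"
      by (intro mult_left_mono) auto
  qed
  also have "\<dots> = U t" by (rule integral_unique[OF FI])
  finally show ?case unfolding U_def w_def[abs_def] .
qed

text \<open>The errors obey a homogeneous Volterra iteration with kernel \<open>H\<close>, so they
  decay factorially whatever solution \<open>x\<close> of the fixed-point equation is taken.\<close>

lemma X_tendsto:
  assumes j: "j < N"
    and x_bdd_meas: "\<And>a. a < n \<Longrightarrow> bdd_meas T (x a)"
    and x: "\<And>a t. a < n \<Longrightarrow> t \<in> {0..T} \<Longrightarrow> x a t = integral {0..t} (\<lambda>\<tau>. \<Sum>c<n. E (t - \<tau>) a c *
     ((\<Sum>iu\<le>np. \<Sum>l<nin. B iu c l * (p j iu \<tau> * u j l \<tau>)) + (\<Sum>i\<in>{1..np}. \<Sum>e<n. A i c e * (p j i \<tau> * x e \<tau>))))"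
    and a: "a < n" and t: "t \<in> {0..T}"
  shows "(\<lambda>k. X k j t a) \<longlonglongrightarrow> x a t"
proof -
  define e where "e k a t = x a t - X k j t a" for k a t
  define H where "H t \<tau> a b = (\<Sum>c<n. E (t - \<tau>) a c * (\<Sum>i\<in>{1..np}. A i c b * p j i \<tau>))" for t \<tau> a b
  have Xbm: "bdd_meas T (\<lambda>t. X k j t a)" if "a < n" for k a
    unfolding X_def using that j by (intro L.Z_bdd_meas) auto
  have fbm: "bdd_meas t (\<lambda>\<tau>. \<Sum>c<n. E (t - \<tau>) a c * ((\<Sum>iu\<le>np. \<Sum>l<nin. B iu c l * (p j iu \<tau> * u j l \<tau>)) + (\<Sum>i\<in>{1..np}. \<Sum>e<n. A i c e * (p j i \<tau> * y e \<tau>))))"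
    if a: "a < n" and t: "t \<le> T" and y: "\<And>e. e < n \<Longrightarrow> bdd_meas T (y e)" for a t y
    using a j by (intro bdd_meas_sum bdd_meas_mult bdd_meas_add bdd_meas_const bdd_meas_reflect[OF continuous_on_subset[OF E_cont] t] bdd_meas_mono[OF p_bdd_meas t] bdd_meas_mono[OF u_bdd_meas t] bdd_meas_mono[OF y t]) auto
  have step: "e (Suc k) a t = integral {0..t} (\<lambda>\<tau>. \<Sum>b<n. H t \<tau> a b * e k b \<tau>)"
    if a: "a < n" and t: "0 \<le> t" "t \<le> T" for k a t
  proof -
    have tt: "t \<in> {0..T}" using t by simp
    let ?f = "\<lambda>y \<tau>. \<Sum>c<n. E (t - \<tau>) a c * ((\<Sum>iu\<le>np. \<Sum>l<nin. B iu c l * (p j iu \<tau> * u j l \<tau>)) + (\<Sum>i\<in>{1..np}. \<Sum>e<n. A i c e * (p j i \<tau> * y e \<tau>)))"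
    have "e (Suc k) a t = integral {0..t} (\<lambda>\<tau>. ?f x \<tau> - ?f (\<lambda>e \<tau>. X k j \<tau> e) \<tau>)"
      unfolding e_def x[OF a tt] X_Suc[OF j]
      by (rule Henstock_Kurzweil_Integration.integral_diff[symmetric]) (intro bdd_meas_integrable fbm a t x_bdd_meas Xbm; assumption)+
    also have "(\<lambda>\<tau>. ?f x \<tau> - ?f (\<lambda>e \<tau>. X k j \<tau> e) \<tau>) = (\<lambda>\<tau>. \<Sum>b<n. H t \<tau> a b * e k b \<tau>)"
    proof
      fix \<tau>
      have "?f x \<tau> - ?f (\<lambda>e \<tau>. X k j \<tau> e) \<tau> = (\<Sum>c<n. E (t - \<tau>) a c * (\<Sum>i\<in>{1..np}. \<Sum>b<n. A i c b * p j i \<tau> * e k b \<tau>))"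
        unfolding e_def by (simp add: sum_subtractf[symmetric] right_diff_distrib[symmetric] mult.assoc)
      also have "\<dots> = (\<Sum>c<n. \<Sum>b<n. E (t - \<tau>) a c * ((\<Sum>i\<in>{1..np}. A i c b * p j i \<tau>) * e k b \<tau>))"
      proof (intro sum.cong refl)
        fix c
        have "(\<Sum>i\<in>{1..np}. \<Sum>b<n. A i c b * p j i \<tau> * e k b \<tau>) = (\<Sum>b<n. \<Sum>i\<in>{1..np}. A i c b * p j i \<tau> * e k b \<tau>)"
          by (rule sum.swap)
        then show "E (t - \<tau>) a c * (\<Sum>i\<in>{1..np}. \<Sum>b<n. A i c b * p j i \<tau> * e k b \<tau>) = (\<Sum>b<n. E (t - \<tau>) a c * ((\<Sum>i\<in>{1..np}. A i c b * p j i \<tau>) * e k b \<tau>))"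
          by (simp add: sum_distrib_left sum_distrib_right)
      qed
      also have "\<dots> = (\<Sum>b<n. \<Sum>c<n. E (t - \<tau>) a c * ((\<Sum>i\<in>{1..np}. A i c b * p j i \<tau>) * e k b \<tau>))" by (rule sum.swap)
      also have "\<dots> = (\<Sum>b<n. H t \<tau> a b * e k b \<tau>)" unfolding H_def by (simp add: sum_distrib_right mult.assoc)
      finally show "?f x \<tau> - ?f (\<lambda>e \<tau>. X k j \<tau> e) \<tau> = (\<Sum>b<n. H t \<tau> a b * e k b \<tau>)" .
    qed
    finally show ?thesis .
  qed
  have "\<exists>C. \<forall>s\<in>{0..T}. \<bar>E s a c\<bar> \<le> C" if "a < n" "c < n" for a c
    using bdd_meas_continuous[OF continuous_on_subset[OF E_cont[OF that]]] unfolding bdd_meas_def by blast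
  then obtain Ce where Ce: "\<And>a c s. a < n \<Longrightarrow> c < n \<Longrightarrow> s\<in>{0..T} \<Longrightarrow> \<bar>E s a c\<bar> \<le> Ce a c" by metis
  define h where "h = (\<Sum>a<n. \<Sum>b<n. \<Sum>c<n. \<bar>Ce a c\<bar> * (\<Sum>i\<in>{1..np}. \<bar>A i c b\<bar>))"
  have H: "\<bar>H t \<tau> a b\<bar> \<le> h" if "0 \<le> \<tau>" "\<tau> \<le> t" "t \<le> T" "a < n" "b < n" for t \<tau> a b
  proof -
    have "\<bar>H t \<tau> a b\<bar> \<le> (\<Sum>c<n. \<bar>Ce a c\<bar> * (\<Sum>i\<in>{1..np}. \<bar>A i c b\<bar>))"
      unfolding H_def
    proof (rule order_trans[OF sum_abs], rule sum_mono, unfold abs_mult, rule mult_mono)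
      fix c assume c: "c \<in> {..<n}"
      show "\<bar>E (t - \<tau>) a c\<bar> \<le> \<bar>Ce a c\<bar>" using Ce[of a c "t - \<tau>"] c that by force
      show "\<bar>\<Sum>i\<in>{1..np}. A i c b * p j i \<tau>\<bar> \<le> (\<Sum>i\<in>{1..np}. \<bar>A i c b\<bar>)"
        by (rule order_trans[OF sum_abs], rule sum_mono) (use p_le[OF j, of _ \<tau>] that in \<open>auto simp: abs_mult mult_left_le\<close>)
    qed auto
    also have "\<dots> \<le> (\<Sum>b<n. \<Sum>c<n. \<bar>Ce a c\<bar> * (\<Sum>i\<in>{1..np}. \<bar>A i c b\<bar>))"
      by (rule member_le_sum[of b "{..<n}" "\<lambda>b. \<Sum>c<n. \<bar>Ce a c\<bar> * (\<Sum>i\<in>{1..np}. \<bar>A i c b\<bar>)"]) (use that in \<open>auto intro!: sum_nonneg mult_nonneg_nonneg\<close>)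
    also have "\<dots> \<le> h" unfolding h_def
      by (rule member_le_sum[of a "{..<n}" "\<lambda>a. \<Sum>b<n. \<Sum>c<n. \<bar>Ce a c\<bar> * (\<Sum>i\<in>{1..np}. \<bar>A i c b\<bar>)"]) (use that in \<open>auto intro!: sum_nonneg mult_nonneg_nonneg\<close>)
    finally show ?thesis .
  qed
  have h0: "h \<ge> 0" unfolding h_def by (intro sum_nonneg mult_nonneg_nonneg) auto
  have "\<exists>C. \<forall>s\<in>{0..T}. \<bar>x a s\<bar> \<le> C" if "a < n" for a using x_bdd_meas[OF that] unfolding bdd_meas_def by blast
  then obtain Cx where Cx: "\<And>a s. a < n \<Longrightarrow> s\<in>{0..T} \<Longrightarrow> \<bar>x a s\<bar> \<le> Cx a" by metis
  define M where "M = (\<Sum>a<n. \<bar>Cx a\<bar>)"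
  have M: "\<bar>e 0 a s\<bar> \<le> M" if "a < n" "0 \<le> s" "s \<le> T" for a s
  proof -
    have "\<bar>e 0 a s\<bar> \<le> \<bar>Cx a\<bar>" using Cx[of a s] that by (simp add: e_def X_0)
    also have "\<dots> \<le> M" unfolding M_def by (rule member_le_sum[of a "{..<n}" "\<lambda>a. \<bar>Cx a\<bar>"]) (use that in auto)
    finally show ?thesis .
  qed
  have le: "\<bar>e k a t\<bar> \<le> M * (real n * h * t) ^ k / fact k" for k
    by (rule iterated_Volterra_bound[where T = T and H = H]) (use H h0 M step a t in auto)
  have lim: "(\<lambda>k. M * (real n * h * t) ^ k / fact k) \<longlonglongrightarrow> 0"
    by (rule summable_LIMSEQ_zero[OF Volterra_bound_summable])
  have "(\<lambda>k. e k a t) \<longlonglongrightarrow> 0"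
    by (rule Lim_null_comparison[OF _ lim], rule always_eventually) (use le in simp)
  then have "(\<lambda>k. x a t - e k a t) \<longlonglongrightarrow> x a t - 0" by (intro tendsto_intros)
  then show ?thesis by (simp add: e_def)
qed

lemma q_le_levels:
  assumes "0 \<le> t" "t \<le> T"
  shows "ennreal (q k t r) \<le> (\<Sum>iu\<le>np. \<Sum>j<k. word_kernel.level n nin np E\<^sub>w A B iu j t r)"
proof -
  interpret word_kernel n nin np E\<^sub>w A B
  proof
    fix a c assume "a < n" "c < n"
    then have "continuous_on UNIV (\<lambda>t. E\<^sub>w t a c)" unfolding E\<^sub>w_def by (intro continuous_intros E_cont) auto
    then show "(\<lambda>t. E\<^sub>w t a c) \<in> borel_measurable borel" by (rule borel_measurable_continuous_onI)
  qed
  show ?thesis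
    by (rule quadratic_form_le_levels[where T = T]) (use assms q_0 q_Suc(1) bdd_meas_integrable[OF q_Suc(2)] q_nonneg in auto)
qed

end

section \<open>Trajectories of LPV systems\<close>

text \<open>A constant 1 is put in front of the scheduling vector, so that affine dependence becomes
  a linear combination over \<open>i \<le> np\<close>; the coordinate p_i is entry
  \<open>i - 1\<close>.\<close>

definition pcoord :: "rvec \<Rightarrow> nat \<Rightarrow> real" where
  "pcoord v i = (if i = 0 then 1 else vec_index v (i - 1))"

section \<open>Entrywise description of LPV matrices and signals\<close>

lemma mult_mat_vec_index:
  fixes M :: rmat
  assumes "M \<in> carrier_mat r c" "v \<in> carrier_vec c" "a < r"
  shows "vec_index (M *\<^sub>v v) a = (\<Sum>b<c. M $$ (a, b) * vec_index v b)"
  using assms by (auto simp: scalar_prod_def atLeast0LessThan intro!: sum.cong)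

lemma mult_mat_index:
  fixes M :: rmat
  assumes "M \<in> carrier_mat r n" "M' \<in> carrier_mat n c" "a < r" "b < c"
  shows "(M * M') $$ (a, b) = (\<Sum>i<n. M $$ (a, i) * M' $$ (i, b))"
  using assms by (auto simp: scalar_prod_def atLeast0LessThan intro!: sum.cong)

lemma affine_mat_carrier: "M 0 \<in> carrier_mat r c \<Longrightarrow> affine_mat np M v \<in> carrier_mat r c"
  unfolding affine_mat_def mat_sum_def by auto

lemma affine_mat_index:
  assumes M: "\<And>i. i \<le> np \<Longrightarrow> M i \<in> carrier_mat r c" and ab: "a < r" "b < c"
  shows "affine_mat np M v $$ (a, b) = (\<Sum>i\<le>np. pcoord v i * M i $$ (a, b))"
proof -
  have "{..np} = insert 0 {1..np}" by auto
  then have "(\<Sum>i\<le>np. pcoord v i * M i $$ (a, b)) = M 0 $$ (a, b) + (\<Sum>i\<in>{1..np}. pcoord v i * M i $$ (a, b))"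
    by (simp add: pcoord_def)
  also have "(\<Sum>i\<in>{1..np}. pcoord v i * M i $$ (a, b)) = (\<Sum>i\<in>{1..np}. (vec_index v (i - 1) \<cdot>\<^sub>m M i) $$ (a, b))"
  proof (intro sum.cong refl)
    fix i assume i: "i \<in> {1..np}"
    then have "M i \<in> carrier_mat r c" using M by auto
    then show "pcoord v i * M i $$ (a, b) = (vec_index v (i - 1) \<cdot>\<^sub>m M i) $$ (a, b)"
      using ab i by (auto simp: pcoord_def)
  qed
  finally show ?thesis
    using M[of 0] ab unfolding affine_mat_def mat_sum_def by auto
qed

lemma lpv_rhs_index:
  assumes sys: "lpv_system np nin \<Sigma>" and \<xi>: "\<xi> \<in> carrier_vec (nx \<Sigma>)" and v: "v \<in> carrier_vec nin" and a: "a < nx \<Sigma>"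
  shows "vec_index (affine_mat np (lA \<Sigma>) w *\<^sub>v \<xi> + affine_mat np (lB \<Sigma>) w *\<^sub>v v) a
    = (\<Sum>b<nx \<Sigma>. (\<Sum>i\<le>np. pcoord w i * lA \<Sigma> i $$ (a, b)) * vec_index \<xi> b)
      + (\<Sum>l<nin. (\<Sum>i\<le>np. pcoord w i * lB \<Sigma> i $$ (a, l)) * vec_index v l)"
proof -
  have c: "\<And>i. i \<le> np \<Longrightarrow> lA \<Sigma> i \<in> carrier_mat (nx \<Sigma>) (nx \<Sigma>)" "\<And>i. i \<le> np \<Longrightarrow> lB \<Sigma> i \<in> carrier_mat (nx \<Sigma>) nin"
    using sys by (auto simp: lpv_system_def)
  have cA: "affine_mat np (lA \<Sigma>) w \<in> carrier_mat (nx \<Sigma>) (nx \<Sigma>)" "affine_mat np (lB \<Sigma>) w \<in> carrier_mat (nx \<Sigma>) nin"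
    using c by (auto intro!: affine_mat_carrier)
  have "vec_index (affine_mat np (lA \<Sigma>) w *\<^sub>v \<xi> + affine_mat np (lB \<Sigma>) w *\<^sub>v v) a
    = vec_index (affine_mat np (lA \<Sigma>) w *\<^sub>v \<xi>) a + vec_index (affine_mat np (lB \<Sigma>) w *\<^sub>v v) a"
    by (rule index_add_vec(1)) (use cA a in auto)
  then show ?thesis
    unfolding mult_mat_vec_index[OF cA(1) \<xi> a] mult_mat_vec_index[OF cA(2) v a]
    using affine_mat_index[OF c(1) a, where v = w] affine_mat_index[OF c(2) a, where v = w] by simp
qed

lemma lpv_output_map_index:
  assumes sys: "lpv_system np nin \<Sigma>" and \<xi>: "\<xi> \<in> carrier_vec (nx \<Sigma>)"
  shows "vec_index (affine_mat np (lC \<Sigma>) w *\<^sub>v \<xi>) 0 = (\<Sum>i\<le>np. pcoord w i * (\<Sum>a<nx \<Sigma>. lC \<Sigma> i $$ (0, a) * vec_index \<xi> a))"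
proof -
  have c: "\<And>i. i \<le> np \<Longrightarrow> lC \<Sigma> i \<in> carrier_mat 1 (nx \<Sigma>)" using sys by (auto simp: lpv_system_def)
  have z: "(0::nat) < 1" by simp
  have cA: "affine_mat np (lC \<Sigma>) w \<in> carrier_mat 1 (nx \<Sigma>)" using c by (auto intro!: affine_mat_carrier)
  have "vec_index (affine_mat np (lC \<Sigma>) w *\<^sub>v \<xi>) 0 = (\<Sum>b<nx \<Sigma>. \<Sum>i\<le>np. pcoord w i * lC \<Sigma> i $$ (0, b) * vec_index \<xi> b)"
    unfolding mult_mat_vec_index[OF cA \<xi> z]
    using affine_mat_index[OF c z, where v = w] by (simp add: sum_distrib_right)
  also have "\<dots> = (\<Sum>i\<le>np. \<Sum>b<nx \<Sigma>. pcoord w i * lC \<Sigma> i $$ (0, b) * vec_index \<xi> b)" by (rule sum.swap)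
  finally show ?thesis by (simp add: sum_distrib_left mult.assoc)
qed

text \<open>Continuity gives measurability off the finite set of discontinuities; the values on that
  set form a combination of indicators of points.\<close>

lemma piecewise_continuous_bdd_meas:
  assumes f: "piecewise_continuous f" and le: "\<And>t. t \<in> {0..T} \<Longrightarrow> \<bar>f t\<bar> \<le> C"
  shows "bdd_meas T f"
proof -
  define D where "D = {t\<in>{0..T}. \<not> continuous (at t within {0..}) f}"
  have D: "finite D" using f unfolding piecewise_continuous_def D_def by blast
  have "continuous_on ({0..T} - D) f"
    unfolding continuous_on_eq_continuous_within
  proof
    fix t assume "t \<in> {0..T} - D"
    then have "continuous (at t within {0..}) f" by (auto simp: D_def)
    then show "continuous (at t within {0..T} - D) f" by (rule continuous_within_subset) auto
  qed
  moreover have S: "{0..T} - D \<in> sets lebesgue"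
    using D by (intro sets.Diff) (auto simp: finite_imp_closed borel_closed)
  ultimately have "(\<lambda>x. if x \<in> {0..T} - D then f x else 0) \<in> borel_measurable lebesgue"
    by (subst borel_measurable_if[OF S]) (rule continuous_imp_measurable_on_sets_lebesgue)
  moreover have "(\<lambda>x. \<Sum>d\<in>D. f d * indicator {d} x) \<in> borel_measurable lebesgue"
    by (intro borel_measurable_sum borel_measurable_times borel_measurable_const borel_measurable_indicator) auto
  ultimately have "(\<lambda>x. (if x \<in> {0..T} - D then f x else 0) + (\<Sum>d\<in>D. f d * indicator {d} x)) \<in> borel_measurable lebesgue"
    by (rule borel_measurable_add)
  then have "(\<lambda>x. (if x \<in> {0..T} - D then f x else 0) + (\<Sum>d\<in>D. f d * indicator {d} x)) \<in> borel_measurable (lebesgue_on {0..T})"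
    by (rule measurable_restrict_space1)
  moreover have "(if x \<in> {0..T} - D then f x else 0) + (\<Sum>d\<in>D. f d * indicator {d} x) = f x" if "x \<in> {0..T}" for x
  proof -
    have "(\<Sum>d\<in>D. f d * indicator {d} x) = (\<Sum>d\<in>D. if x = d then f d else 0)"
      by (intro sum.cong) (auto simp: indicator_def)
    also have "\<dots> = (if x \<in> D then f x else 0)" using D by simp
    finally show ?thesis using that by auto
  qed
  ultimately have "f \<in> borel_measurable (lebesgue_on {0..T})"
    by (rule measurable_cong[THEN iffD1, rotated]) auto
  then show ?thesis unfolding bdd_meas_def using le by blast
qed

section \<open>Impulse-response kernels and the weighted norm\<close>

lemma vnorm_sq: "(vnorm v)\<^sup>2 = (\<Sum>l<dim_vec v. (vec_index v l)\<^sup>2)"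
proof -
  have "scalar_prod v v = (\<Sum>l<dim_vec v. (vec_index v l)\<^sup>2)"
    by (simp add: scalar_prod_def atLeast0LessThan power2_eq_square)
  moreover have "\<dots> \<ge> 0" by (intro sum_nonneg) auto
  ultimately show ?thesis unfolding vnorm_def by simp
qed

lemma lpv_state_kernel_carrier:
  assumes sys: "lpv_system np nin \<Sigma>" and iu: "iu \<le> np" and "\<forall>x\<in>set its. fst x \<le> np"
  shows "lpv_state_kernel \<Sigma> iu t its \<in> carrier_mat (nx \<Sigma>) nin"
proof -
  have c: "\<And>i. i \<le> np \<Longrightarrow> lA \<Sigma> i \<in> carrier_mat (nx \<Sigma>) (nx \<Sigma>)" "\<And>i. i \<le> np \<Longrightarrow> lB \<Sigma> i \<in> carrier_mat (nx \<Sigma>) nin"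
    using sys by (auto simp: lpv_system_def)
  have e: "mat_exp (s \<cdot>\<^sub>m lA \<Sigma> 0) \<in> carrier_mat (nx \<Sigma>) (nx \<Sigma>)" for s
    by (rule mat_exp_carrier) (rule c(1), simp)
  show ?thesis using assms(3)
  proof (induction its arbitrary: t)
    case Nil
    then show ?case using mult_carrier_mat[OF e c(2)[OF iu]] by simp
  next
    case (Cons x rest)
    obtain i \<tau> where x: "x = (i, \<tau>)" by force
    have "i \<le> np" using Cons x by simp
    from mult_carrier_mat[OF mult_carrier_mat[OF e c(1)[OF this]] Cons.IH] show ?case using Cons x by simp
  qed
qed

text \<open>Matrices are replaced here by real functions of indices, the form in which the Lyapunov
  and word recursions are stated.\<close>

locale lpv_kernel_setup =
  fixes np nin :: nat and \<Sigma> :: lpv and lam :: real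
  assumes sys: "lpv_system np nin \<Sigma>"
begin

abbreviation "n \<equiv> nx \<Sigma>"
definition A :: "nat \<Rightarrow> nat \<Rightarrow> nat \<Rightarrow> real" where "A i a b = lA \<Sigma> i $$ (a, b)"
definition B :: "nat \<Rightarrow> nat \<Rightarrow> nat \<Rightarrow> real" where "B i a b = lB \<Sigma> i $$ (a, b)"
definition C :: "nat \<Rightarrow> nat \<Rightarrow> real" where "C i a = lC \<Sigma> i $$ (0, a)"
definition E :: "real \<Rightarrow> nat \<Rightarrow> nat \<Rightarrow> real" where "E t a b = mat_exp (t \<cdot>\<^sub>m lA \<Sigma> 0) $$ (a, b)"
definition Ew :: "real \<Rightarrow> nat \<Rightarrow> nat \<Rightarrow> real" where "Ew s a c = exp (lam * s / 2) * E s a c"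

lemma carriers:
  "i \<le> np \<Longrightarrow> lA \<Sigma> i \<in> carrier_mat n n" "i \<le> np \<Longrightarrow> lB \<Sigma> i \<in> carrier_mat n nin"
  "i \<le> np \<Longrightarrow> lC \<Sigma> i \<in> carrier_mat 1 n" "mat_exp (s \<cdot>\<^sub>m lA \<Sigma> 0) \<in> carrier_mat n n"
  using sys by (auto simp: lpv_system_def intro!: mat_exp_carrier)

lemma E_continuous: "a < n \<Longrightarrow> c < n \<Longrightarrow> continuous_on S (\<lambda>t. E t a c)"
  unfolding E_def by (rule mat_exp_continuous[OF carriers(1)]) auto

lemma E_0: "a < n \<Longrightarrow> c < n \<Longrightarrow> E 0 a c = (if a = c then 1 else 0)"
  unfolding E_def by (rule mat_exp_0[OF carriers(1)]) auto

lemma E_deriv: "a < n \<Longrightarrow> c < n \<Longrightarrow> ((\<lambda>t. E t a c) has_real_derivative (\<Sum>d<n. E t a d * A 0 d c)) (at t)"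
  unfolding E_def A_def by (rule mat_exp_has_derivative[OF carriers(1)]) auto

lemma Ew_measurable:
  assumes "a < n" "c < n"
  shows "(\<lambda>t. Ew t a c) \<in> borel_measurable borel"
proof -
  have "continuous_on UNIV (\<lambda>t. Ew t a c)" unfolding Ew_def by (intro continuous_intros E_continuous assms) auto
  then show ?thesis by (rule borel_measurable_continuous_onI)
qed

sublocale word_kernel n nin np Ew A B
  by unfold_locales (rule Ew_measurable)

definition row_norm_sq :: "nat \<Rightarrow> real \<Rightarrow> (nat \<times> real) list \<Rightarrow> (nat \<Rightarrow> real) \<Rightarrow> real" where
  "row_norm_sq iu t its r = (\<Sum>l<nin. (\<Sum>a<n. r a * lpv_state_kernel \<Sigma> iu t its $$ (a, l))\<^sup>2)"

lemma row_norm_sq_Nil: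
  assumes "iu \<le> np"
  shows "row_norm_sq iu t [] r = (\<Sum>l<nin. (\<Sum>c<n. (\<Sum>a<n. r a * E t a c) * B iu c l)\<^sup>2)"
  unfolding row_norm_sq_def
proof (rule sum.cong[OF refl], rule arg_cong[where f = "\<lambda>x. x\<^sup>2"])
  fix l assume "l \<in> {..<nin}"
  then have l: "l < nin" by simp
  have "(\<Sum>a<n. r a * lpv_state_kernel \<Sigma> iu t [] $$ (a, l)) = (\<Sum>a<n. \<Sum>c<n. r a * E t a c * B iu c l)"
    using mult_mat_index[OF carriers(4) carriers(2)[OF assms] _ l]
    by (simp add: E_def B_def sum_distrib_left mult.assoc)
  also have "\<dots> = (\<Sum>c<n. \<Sum>a<n. r a * E t a c * B iu c l)" by (rule sum.swap)
  finally show "(\<Sum>a<n. r a * lpv_state_kernel \<Sigma> iu t [] $$ (a, l)) = (\<Sum>c<n. (\<Sum>a<n. r a * E t a c) * B iu c l)"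
    by (simp add: sum_distrib_right)
qed

text \<open>By associativity the row absorbs the leading factor E(t - tau) A_i of the kernel, which
  is the recursion step of \<open>word_norm\<close>.\<close>

lemma row_norm_sq_Cons:
  assumes "iu \<le> np" "i \<le> np" "\<forall>x\<in>set rest. fst x \<le> np"
  shows "row_norm_sq iu t ((i, \<tau>) # rest) r = row_norm_sq iu \<tau> rest (push_row n E A (t - \<tau>) i r)"
  unfolding row_norm_sq_def
proof (rule sum.cong[OF refl], rule arg_cong[where f = "\<lambda>x. x\<^sup>2"])
  fix l assume "l \<in> {..<nin}"
  then have l: "l < nin" by simp
  define S where "S = lpv_state_kernel \<Sigma> iu \<tau> rest"
  have S: "S \<in> carrier_mat n nin" unfolding S_def by (rule lpv_state_kernel_carrier[OF sys assms(1,3)])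
  have EA: "mat_exp ((t - \<tau>) \<cdot>\<^sub>m lA \<Sigma> 0) * lA \<Sigma> i \<in> carrier_mat n n"
    by (rule mult_carrier_mat[OF carriers(4) carriers(1)[OF assms(2)]])
  have "(\<Sum>a<n. r a * lpv_state_kernel \<Sigma> iu t ((i, \<tau>) # rest) $$ (a, l))
      = (\<Sum>a<n. r a * (\<Sum>e<n. (\<Sum>c<n. E (t - \<tau>) a c * A i c e) * S $$ (e, l)))"
    using mult_mat_index[OF EA S _ l] mult_mat_index[OF carriers(4) carriers(1)[OF assms(2)]]
    by (simp add: S_def[symmetric] E_def A_def)
  also have "\<dots> = (\<Sum>a<n. \<Sum>e<n. r a * (\<Sum>c<n. E (t - \<tau>) a c * A i c e) * S $$ (e, l))"
  proof -
    have d: "r a * (\<Sum>e<n. F e * H e) = (\<Sum>e<n. r a * F e * H e)" for a and F H :: "nat \<Rightarrow> real"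
      by (simp add: sum_distrib_left mult.assoc)
    show ?thesis by (simp only: d)
  qed
  also have "\<dots> = (\<Sum>e<n. \<Sum>a<n. r a * (\<Sum>c<n. E (t - \<tau>) a c * A i c e) * S $$ (e, l))" by (rule sum.swap)
  also have "\<dots> = (\<Sum>e<n. push_row n E A (t - \<tau>) i r e * S $$ (e, l))"
  proof (intro sum.cong refl)
    fix e
    have "(\<Sum>a<n. r a * (\<Sum>c<n. E (t - \<tau>) a c * A i c e)) = (\<Sum>a<n. \<Sum>c<n. r a * E (t - \<tau>) a c * A i c e)"
      by (simp add: sum_distrib_left mult.assoc)
    also have "\<dots> = (\<Sum>c<n. \<Sum>a<n. r a * E (t - \<tau>) a c * A i c e)" by (rule sum.swap)
    also have "\<dots> = push_row n E A (t - \<tau>) i r e" by (simp add: push_row_def sum_distrib_right)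
    finally have h: "(\<Sum>a<n. r a * (\<Sum>c<n. E (t - \<tau>) a c * A i c e)) = push_row n E A (t - \<tau>) i r e" .
    show "(\<Sum>a<n. r a * (\<Sum>c<n. E (t - \<tau>) a c * A i c e) * S $$ (e, l)) = push_row n E A (t - \<tau>) i r e * S $$ (e, l)"
      unfolding h[symmetric] by (rule sum_distrib_right[symmetric])
  qed
  finally show "(\<Sum>a<n. r a * lpv_state_kernel \<Sigma> iu t ((i, \<tau>) # rest) $$ (a, l))
      = (\<Sum>a<n. push_row n E A (t - \<tau>) i r a * lpv_state_kernel \<Sigma> iu \<tau> rest $$ (a, l))"
    by (simp add: S_def)
qed

text \<open>The half weight of the total time is the product of the half weights of the time
  differences along a word; weighting the output row is therefore the same as weighting every
  propagator.\<close>

lemma push_row_weighted: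
  "push_row n E A (t - \<tau>) i (\<lambda>a. exp (lam * t / 2) * r a) = (\<lambda>e. exp (lam * \<tau> / 2) * push_row n Ew A (t - \<tau>) i r e)"
proof
  fix e
  have "exp (lam * t / 2) = exp (lam * \<tau> / 2) * exp (lam * (t - \<tau>) / 2)"
    by (simp add: exp_add[symmetric] field_simps)
  then have *: "exp (lam * t / 2) * r a * E (t - \<tau>) a c = exp (lam * \<tau> / 2) * (r a * Ew (t - \<tau>) a c)" for a c
    by (simp add: Ew_def)
  show "push_row n E A (t - \<tau>) i (\<lambda>a. exp (lam * t / 2) * r a) e = exp (lam * \<tau> / 2) * push_row n Ew A (t - \<tau>) i r e"
    unfolding push_row_def * by (simp only: sum_distrib_left[symmetric] mult.assoc)
qed

lemma nested_integral_word_norm: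
  assumes iu: "iu \<le> np" and "set is \<subseteq> {1..np}"
  shows "nested_integral (length is) (\<lambda>\<tau>s. ennreal (row_norm_sq iu t (zip is \<tau>s) (\<lambda>a. exp (lam * t / 2) * r a))) t = word_norm iu is t r"
  using assms(2)
proof (induction "is" arbitrary: t r)
  case Nil
  have *: "exp (lam * t / 2) * r a * E t a c = r a * Ew t a c" for a c by (simp add: Ew_def)
  show ?case by (simp add: row_norm_sq_Nil[OF iu] *)
next
  case (Cons i "is")
  have le: "\<forall>x\<in>set (zip is \<tau>s). fst x \<le> np" for \<tau>s :: "real list"
    using Cons.prems by (auto dest!: set_zip_leftD)
  have i: "i \<le> np" using Cons.prems by simp
  have "nested_integral (length is) (\<lambda>\<tau>s. ennreal (row_norm_sq iu t (zip (i # is) (\<tau> # \<tau>s)) (\<lambda>a. exp (lam * t / 2) * r a))) \<tau>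
      = word_norm iu is \<tau> (push_row n Ew A (t - \<tau>) i r)" for \<tau>
    using Cons.IH[of \<tau> "push_row n Ew A (t - \<tau>) i r"] Cons.prems
    by (simp add: row_norm_sq_Cons[OF iu i le] push_row_weighted)
  then show ?case by simp
qed

text \<open>The exponential weight enters the square through its root, as a factor of the output
  row.\<close>

lemma vnorm_lpv_kernel:
  assumes "iu \<le> np" "iy \<le> np" "\<forall>x\<in>set its. fst x \<le> np"
  shows "(vnorm (row (lpv_kernel \<Sigma> iu iy t its) 0))\<^sup>2 * exp (lam * t) = row_norm_sq iu t its (\<lambda>a. exp (lam * t / 2) * C iy a)"
proof -
  define S where "S = lpv_state_kernel \<Sigma> iu t its"
  have S: "S \<in> carrier_mat n nin" unfolding S_def by (rule lpv_state_kernel_carrier[OF sys assms(1,3)])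
  have z: "(0::nat) < 1" by simp
  have "dim_vec (row (lC \<Sigma> iy * S) 0) = nin" using S by simp
  moreover have "vec_index (row (lC \<Sigma> iy * S) 0) l = (\<Sum>a<n. C iy a * S $$ (a, l))" if "l < nin" for l
    using mult_mat_index[OF carriers(3)[OF assms(2)] S z that] carriers(3)[OF assms(2)] S that
    by (simp add: C_def)
  ultimately have "(vnorm (row (lpv_kernel \<Sigma> iu iy t its) 0))\<^sup>2 = (\<Sum>l<nin. (\<Sum>a<n. C iy a * S $$ (a, l))\<^sup>2)"
    unfolding vnorm_sq lpv_kernel_def S_def[symmetric] by simp
  moreover have "(\<Sum>a<n. exp (lam * t / 2) * C iy a * S $$ (a, l))\<^sup>2 = (\<Sum>a<n. C iy a * S $$ (a, l))\<^sup>2 * exp (lam * t)" for l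
  proof -
    have "(\<Sum>a<n. exp (lam * t / 2) * C iy a * S $$ (a, l)) = exp (lam * t / 2) * (\<Sum>a<n. C iy a * S $$ (a, l))"
      by (simp add: sum_distrib_left mult.assoc)
    moreover have "(exp (lam * t / 2))\<^sup>2 = exp (lam * t)" by (simp add: power2_eq_square exp_add[symmetric])
    ultimately show ?thesis by (simp add: power_mult_distrib)
  qed
  ultimately show ?thesis unfolding row_norm_sq_def S_def[symmetric] by (simp add: sum_distrib_right)
qed

lemma nested_integral_kernel:
  assumes "iu \<le> np" "iy \<le> np" "set is \<subseteq> {1..np}"
  shows "nested_integral (length is) (\<lambda>\<tau>s. ennreal ((vnorm (row (lpv_kernel \<Sigma> iu iy t (zip is \<tau>s)) 0))\<^sup>2 * exp (lam * t))) t
     = word_norm iu is t (C iy)"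
proof -
  have "\<forall>x\<in>set (zip is \<tau>s). fst x \<le> np" for \<tau>s :: "real list"
    using assms(3) by (auto dest!: set_zip_leftD)
  then show ?thesis
    using nested_integral_word_norm[OF assms(1,3), of t "C iy"] vnorm_lpv_kernel[OF assms(1,2)] by simp
qed

text \<open>Cutting off the time at \<open>T\<close> and the word length at \<open>k\<close> only
  drops nonnegative terms.\<close>

lemma levels_le_h2_norm_sq:
  "(\<Sum>iy\<le>np. \<Sum>iu\<le>np. \<Sum>j<k. level iu j T (C iy)) \<le> h2_norm_sq np lam \<Sigma>"
  unfolding h2_norm_sq_def
proof (intro sum_mono)
  fix iy iu assume "iy \<in> {..np}" "iu \<in> {..np}"
  then have i: "iu \<le> np" "iy \<le> np" by auto
  let ?F = "\<lambda>t is \<tau>s. ennreal ((vnorm (row (lpv_kernel \<Sigma> iu iy t (zip is \<tau>s)) 0))\<^sup>2 * exp (lam * t))"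
  define h where "h is = (\<integral>\<^sup>+t\<in>{0..}. word_norm iu is t (C iy) \<partial>lborel)" for "is"
  have le: "(\<integral>\<^sup>+t\<in>{0..T}. word_norm iu is t (C iy) \<partial>lborel) \<le> h is" for "is"
    unfolding h_def by (intro nn_integral_mono mult_left_mono) (auto simp: indicator_def)
  have 0: "(\<integral>\<^sup>+t\<in>{0..}. ennreal ((vnorm (row (lpv_kernel \<Sigma> iu iy t []) 0))\<^sup>2 * exp (lam * t)) \<partial>lborel) = h []"
    unfolding h_def using nested_integral_kernel[OF i, of "[]"] by simp
  have S: "(\<Sum>is | set is \<subseteq> {1..np} \<and> length is = Suc j. \<integral>\<^sup>+t\<in>{0..}. nested_integral (Suc j) (?F t is) t \<partial>lborel)
     = (\<Sum>is | set is \<subseteq> {1..np} \<and> length is = Suc j. h is)" for j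
  proof (intro sum.cong refl)
    fix "is" assume "is \<in> {is. set is \<subseteq> {1..np} \<and> length is = Suc j}"
    then have "set is \<subseteq> {1..np}" "length is = Suc j" by auto
    from nested_integral_kernel[OF i this(1)] this(2)
    show "(\<integral>\<^sup>+t\<in>{0..}. nested_integral (Suc j) (?F t is) t \<partial>lborel) = h is" unfolding h_def by (simp del: nested_integral.simps)
  qed
  \<comment> \<open>One more level is added so that the sum splits into the empty word and the
    lengths \<open>Suc j\<close> with \<open>j < k\<close>, as in the definition of the
    norm.\<close>
  have "(\<Sum>j<k. level iu j T (C iy)) \<le> (\<Sum>j<Suc k. level iu j T (C iy))" by (intro sum_mono2) auto
  also have "\<dots> \<le> (\<Sum>j<Suc k. \<Sum>is | set is \<subseteq> {1..np} \<and> length is = j. h is)"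
    unfolding level_def by (intro sum_mono le)
  also have "\<dots> = h [] + (\<Sum>j<k. \<Sum>is | set is \<subseteq> {1..np} \<and> length is = Suc j. h is)"
  proof -
    have "{is. set is \<subseteq> {1..np} \<and> length is = 0} = {[]}" by auto
    then show ?thesis unfolding sum.lessThan_Suc_shift by simp
  qed
  also have "\<dots> \<le> h [] + (\<Sum>j. \<Sum>is | set is \<subseteq> {1..np} \<and> length is = Suc j. h is)"
    by (intro add_left_mono sum_le_suminf) auto
  finally show "(\<Sum>j<k. level iu j T (C iy)) \<le> (\<integral>\<^sup>+t\<in>{0..}. ennreal ((vnorm (row (lpv_kernel \<Sigma> iu iy t []) 0))\<^sup>2 * exp (lam * t)) \<partial>lborel)
     + (\<Sum>k. \<Sum>is | set is \<subseteq> {1..np} \<and> length is = Suc k.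
         (\<integral>\<^sup>+t\<in>{0..}. nested_integral (Suc k) (?F t is) t \<partial>lborel))"
    unfolding 0 S .
qed

lemma h2_norm_sq_le:
  assumes "h2_norm np lam \<Sigma> \<le> ennreal c" "c \<ge> 0"
  shows "h2_norm_sq np lam \<Sigma> \<le> ennreal (c\<^sup>2)"
proof -
  have fin: "h2_norm_sq np lam \<Sigma> \<noteq> \<infinity>"
  proof
    assume "h2_norm_sq np lam \<Sigma> = \<infinity>"
    then show False using assms(1) by (simp add: h2_norm_def top_unique)
  qed
  have "sqrt (enn2real (h2_norm_sq np lam \<Sigma>)) \<le> c"
    using assms fin by (simp add: h2_norm_def)
  then have "enn2real (h2_norm_sq np lam \<Sigma>) \<le> c\<^sup>2"
    by (rule sqrt_le_D)
  moreover have "h2_norm_sq np lam \<Sigma> = ennreal (enn2real (h2_norm_sq np lam \<Sigma>))"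
    using fin by (simp add: ennreal_enn2real_if)
  ultimately show ?thesis by (metis ennreal_leI)
qed

end

text \<open>Boundedness of the input on \<open>{0..T}\<close>, which the data assumption supplies
  beyond square integrability, keeps the integrands in \<open>bdd_meas\<close>.\<close>

definition admissible :: "nat \<Rightarrow> nat \<Rightarrow> real \<Rightarrow> signal \<Rightarrow> signal \<Rightarrow> bool" where
  "admissible np nin T u p \<longleftrightarrow> (\<forall>t. u t \<in> carrier_vec nin) \<and> (\<forall>l<nin. bdd_meas T (\<lambda>t. vec_index (u t) l)) \<and> p \<in> PC_sched np"

lemma admissible_pcoord:
  assumes "admissible np nin T u p" "i \<le> np"
  shows "bdd_meas T (\<lambda>t. pcoord (p t) i)" "\<And>t. t \<in> {0..T} \<Longrightarrow> \<bar>pcoord (p t) i\<bar> \<le> 1"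
proof -
  have p: "p \<in> {0..} \<rightarrow>\<^sub>E sched_cube np" "\<And>i. i < np \<Longrightarrow> piecewise_continuous (\<lambda>t. vec_index (p t) i)"
    using assms(1) by (auto simp: admissible_def PC_sched_def)
  have le: "\<bar>vec_index (p t) i\<bar> \<le> 1" if "t \<in> {0..T}" "i < np" for t i
  proof -
    have "p t \<in> sched_cube np" using p(1) that(1) by auto
    then show ?thesis using that(2) by (auto simp: sched_cube_def abs_le_iff)
  qed
  show b: "\<bar>pcoord (p t) i\<bar> \<le> 1" if "t \<in> {0..T}" for t
    using le[OF that, of "i - 1"] assms(2) by (auto simp: pcoord_def)
  show "bdd_meas T (\<lambda>t. pcoord (p t) i)"
  proof (cases "i = 0")
    case False
    then have "i - 1 < np" using assms(2) by simp
    from piecewise_continuous_bdd_meas[OF p(2)[OF this] le[OF _ this]] show ?thesis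
      using False by (simp add: pcoord_def)
  qed (simp add: pcoord_def)
qed

locale lpv_trajectory = lpv_kernel_setup +
  fixes T :: real and u p :: signal
  assumes T: "T > 0" and adm: "admissible np nin T u p"
begin

definition cA :: "real \<Rightarrow> nat \<Rightarrow> nat \<Rightarrow> real" where "cA \<tau> a b = (\<Sum>i\<le>np. pcoord (p \<tau>) i * A i a b)"
definition cf :: "real \<Rightarrow> nat \<Rightarrow> real" where "cf \<tau> a = (\<Sum>l<nin. (\<Sum>i\<le>np. pcoord (p \<tau>) i * B i a l) * vec_index (u \<tau>) l)"

lemma cA_bdd_meas: "bdd_meas T (\<lambda>\<tau>. cA \<tau> a b)"
  unfolding cA_def by (intro bdd_meas_sum bdd_meas_mult bdd_meas_const admissible_pcoord[OF adm]) auto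

lemma cf_bdd_meas: "bdd_meas T (\<lambda>\<tau>. cf \<tau> a)"
  unfolding cf_def using adm unfolding admissible_def
  by (intro bdd_meas_sum bdd_meas_mult bdd_meas_const admissible_pcoord[OF adm]) auto

lemma rhs_index:
  assumes "\<xi> \<in> carrier_vec n" "a < n"
  shows "vec_index (affine_mat np (lA \<Sigma>) (p t) *\<^sub>v \<xi> + affine_mat np (lB \<Sigma>) (p t) *\<^sub>v u t) a
     = (\<Sum>b<n. cA t a b * vec_index \<xi> b) + cf t a"
  using lpv_rhs_index[OF sys assms(1) _ assms(2), of "u t" "p t"] adm
  by (simp add: admissible_def cA_def cf_def A_def B_def)

text \<open>The output is a description over solutions, so a solution has to be exhibited. The
  integral equation provides absolute continuity, and Lebesgue differentiation the derivative almost
  everywhere.\<close>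

lemma solution_exists: "\<exists>x. lpv_solution np T \<Sigma> u p x"
proof -
  obtain x where xb: "\<And>a. a < n \<Longrightarrow> bdd_meas T (x a)"
    and x: "\<And>a t. a < n \<Longrightarrow> t \<in> {0..T} \<Longrightarrow> x a t = integral {0..t} (\<lambda>\<tau>. (\<Sum>b<n. cA \<tau> a b * x b \<tau>) + cf \<tau> a)"
    by (rule linear_integral_equation_solution[of T n cA cf]) (use T cA_bdd_meas cf_bdd_meas in auto)
  define X where "X t = vec n (\<lambda>a. x a t)" for t
  have Xi: "vec_index (X t) a = x a t" if "a < n" for a t using that by (simp add: X_def)
  have Xc: "X t \<in> carrier_vec n" for t by (simp add: X_def)
  define g where "g a \<tau> = (\<Sum>b<n. cA \<tau> a b * x b \<tau>) + cf \<tau> a" for a \<tau>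
  have g_bdd_meas: "bdd_meas T (g a)" if "a < n" for a
    unfolding g_def[abs_def] by (intro bdd_meas_add bdd_meas_sum bdd_meas_mult cA_bdd_meas cf_bdd_meas xb) auto
  have x': "x a t = integral {0..t} (g a)" if "a < n" "t \<in> {0..T}" for a t
    using x[OF that] by (simp add: g_def[abs_def])
  have ac: "abs_continuous_on 0 T (\<lambda>t. vec_index (X t) a)" if a: "a < n" for a
  proof -
    have "abs_continuous_on 0 T (\<lambda>t. integral {0..t} (g a))"
      by (rule abs_continuous_on_indefinite_integral[OF g_bdd_meas[OF a]])
    then show ?thesis
      by (rule abs_continuous_on_combine[OF _ abs_continuous_on_const[of _ _ 0], of _ _ _ 1])
        (use x'[OF a] Xi[OF a] in auto)
  qed
  have "AE t in lebesgue. \<forall>a\<in>{..<n}. t \<in> {0..T} \<longrightarrow> ((\<lambda>s. integral {0..s} (g a)) has_real_derivative g a t) (at t within {0..T})"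
    by (rule AE_finite_allI) (use AE_indefinite_integral_has_derivative[OF bdd_meas_integrable[OF g_bdd_meas]] in auto)
  then have der: "AE t in lebesgue. t \<in> {0..T} \<longrightarrow>
        (\<forall>a<n. ((\<lambda>s. vec_index (X s) a) has_real_derivative
           vec_index (affine_mat np (lA \<Sigma>) (p t) *\<^sub>v X t + affine_mat np (lB \<Sigma>) (p t) *\<^sub>v u t) a) (at t within {0..T}))"
  proof (rule eventually_mono, intro impI allI)
    fix t a assume d: "\<forall>a\<in>{..<n}. t \<in> {0..T} \<longrightarrow> ((\<lambda>s. integral {0..s} (g a)) has_real_derivative g a t) (at t within {0..T})"
      and t: "t \<in> {0..T}" and a: "a < n"
    have "((\<lambda>s. integral {0..s} (g a)) has_real_derivative g a t) (at t within {0..T})" using d t a by auto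
    then have "((\<lambda>s. vec_index (X s) a) has_real_derivative g a t) (at t within {0..T})"
      by (rule has_field_derivative_transform_within[of _ _ _ _ 1]) (use x'[OF a] Xi[OF a] t in auto)
    then show "((\<lambda>s. vec_index (X s) a) has_real_derivative
           vec_index (affine_mat np (lA \<Sigma>) (p t) *\<^sub>v X t + affine_mat np (lB \<Sigma>) (p t) *\<^sub>v u t) a) (at t within {0..T})"
      unfolding rhs_index[OF Xc a] by (simp add: g_def Xi)
  qed
  have X0: "X 0 = 0\<^sub>v n"
    by (rule eq_vecI) (use Xi x'[of _ 0] T in auto, simp_all add: X_def)
  have "lpv_solution np T \<Sigma> u p X"
    unfolding lpv_solution_def ode_solution_def using Xc ac X0 der by auto
  then show ?thesis by blast
qed

lemma solution_props:
  assumes x: "lpv_solution np T \<Sigma> u p x"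
  shows "\<And>t. t \<in> {0..T} \<Longrightarrow> x t \<in> carrier_vec n"
    "\<And>a. a < n \<Longrightarrow> abs_continuous_on 0 T (\<lambda>t. vec_index (x t) a)"
    "\<And>a. a < n \<Longrightarrow> vec_index (x 0) a = 0"
    "AE t in lebesgue. t \<in> {0..T} \<longrightarrow> (\<forall>a<n. ((\<lambda>s. vec_index (x s) a) has_real_derivative
           (\<Sum>b<n. cA t a b * vec_index (x t) b) + cf t a) (at t within {0..T}))"
    "\<And>a. a < n \<Longrightarrow> bdd_meas T (\<lambda>t. vec_index (x t) a)"
proof -
  note x' = x[unfolded lpv_solution_def ode_solution_def]
  show c: "\<And>t. t \<in> {0..T} \<Longrightarrow> x t \<in> carrier_vec n"
    and ac: "\<And>a. a < n \<Longrightarrow> abs_continuous_on 0 T (\<lambda>t. vec_index (x t) a)"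
    and "\<And>a. a < n \<Longrightarrow> vec_index (x 0) a = 0" using x' by auto
  show "bdd_meas T (\<lambda>t. vec_index (x t) a)" if "a < n" for a
    by (intro bdd_meas_continuous abs_continuous_on_imp_continuous_on ac that)
  have "AE t in lebesgue. t \<in> {0..T} \<longrightarrow> (\<forall>a<n. ((\<lambda>s. vec_index (x s) a) has_real_derivative
      vec_index (affine_mat np (lA \<Sigma>) (p t) *\<^sub>v x t + affine_mat np (lB \<Sigma>) (p t) *\<^sub>v u t) a) (at t within {0..T}))"
    using x' by blast
  then show "AE t in lebesgue. t \<in> {0..T} \<longrightarrow> (\<forall>a<n. ((\<lambda>s. vec_index (x s) a) has_real_derivative
           (\<Sum>b<n. cA t a b * vec_index (x t) b) + cf t a) (at t within {0..T}))"
    by (rule eventually_mono) (use c rhs_index in auto)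
qed

lemma solution_integral_equation:
  assumes x: "lpv_solution np T \<Sigma> u p x" and a: "a < n" and t: "t \<in> {0..T}"
  shows "vec_index (x t) a = integral {0..t} (\<lambda>\<tau>. (\<Sum>b<n. cA \<tau> a b * vec_index (x \<tau>) b) + cf \<tau> a)"
proof -
  have "((\<lambda>\<tau>. (\<Sum>b<n. cA \<tau> a b * vec_index (x \<tau>) b) + cf \<tau> a) has_integral vec_index (x t) a - vec_index (x 0) a) {0..t}"
  proof (rule fundamental_theorem_of_calculus_abs_continuous)
    show "abs_continuous_on 0 t (\<lambda>t. vec_index (x t) a)"
      using abs_continuous_on_subinterval[OF solution_props(2)[OF x a]] t by auto
    show "AE \<tau> in lebesgue. \<tau> \<in> {0..t} \<longrightarrow> ((\<lambda>s. vec_index (x s) a) has_real_derivative (\<Sum>b<n. cA \<tau> a b * vec_index (x \<tau>) b) + cf \<tau> a) (at \<tau> within {0..t})"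
      using solution_props(4)[OF x]
    proof (rule eventually_mono, intro impI)
      fix \<tau> assume d: "\<tau> \<in> {0..T} \<longrightarrow> (\<forall>a<n. ((\<lambda>s. vec_index (x s) a) has_real_derivative (\<Sum>b<n. cA \<tau> a b * vec_index (x \<tau>) b) + cf \<tau> a) (at \<tau> within {0..T}))"
        and \<tau>: "\<tau> \<in> {0..t}"
      show "((\<lambda>s. vec_index (x s) a) has_real_derivative (\<Sum>b<n. cA \<tau> a b * vec_index (x \<tau>) b) + cf \<tau> a) (at \<tau> within {0..t})"
        by (rule DERIV_subset[of _ _ _ "{0..T}"]) (use d \<tau> t a in auto)
    qed
  qed (use t in auto)
  then show ?thesis using solution_props(3)[OF x a] by (simp add: integral_unique)
qed

text \<open>Variation of constants with \<open>A 0\<close> as generator; the terms with index at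
  least 1 are treated as forcing. The result is the fixed-point equation of the iteration
  \<open>S.X\<close>.\<close>

lemma solution_Volterra_equation:
  assumes x: "lpv_solution np T \<Sigma> u p x" and a: "a < n" and t: "t \<in> {0..T}"
  shows "vec_index (x t) a = integral {0..t} (\<lambda>\<tau>. \<Sum>c<n. E (t - \<tau>) a c *
     ((\<Sum>iu\<le>np. \<Sum>l<nin. B iu c l * (pcoord (p \<tau>) iu * vec_index (u \<tau>) l)) + (\<Sum>i\<in>{1..np}. \<Sum>e<n. A i c e * (pcoord (p \<tau>) i * vec_index (x \<tau>) e))))"
proof -
  define v where "v c \<tau> = (\<Sum>iu\<le>np. \<Sum>l<nin. B iu c l * (pcoord (p \<tau>) iu * vec_index (u \<tau>) l)) + (\<Sum>i\<in>{1..np}. \<Sum>e<n. A i c e * (pcoord (p \<tau>) i * vec_index (x \<tau>) e))" for c \<tau>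
  have v: "(\<Sum>b<n. cA \<tau> c b * vec_index (x \<tau>) b) + cf \<tau> c = (\<Sum>d<n. A 0 c d * vec_index (x \<tau>) d) + v c \<tau>" for c \<tau>
  proof -
    \<comment> \<open>\<open>pcoord\<close> is 1 at index 0, so splitting off this index leaves
      \<open>A 0\<close> without a scheduling factor.\<close>
    have np: "{..np} = insert 0 {1..np}" by auto
    have "(\<Sum>b<n. cA \<tau> c b * vec_index (x \<tau>) b) = (\<Sum>b<n. \<Sum>i\<le>np. A i c b * (pcoord (p \<tau>) i * vec_index (x \<tau>) b))"
      by (simp add: cA_def sum_distrib_right sum_distrib_left mult_ac)
    also have "\<dots> = (\<Sum>i\<le>np. \<Sum>b<n. A i c b * (pcoord (p \<tau>) i * vec_index (x \<tau>) b))" by (rule sum.swap)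
    also have "\<dots> = (\<Sum>d<n. A 0 c d * vec_index (x \<tau>) d) + (\<Sum>i\<in>{1..np}. \<Sum>e<n. A i c e * (pcoord (p \<tau>) i * vec_index (x \<tau>) e))"
      unfolding np by (simp add: pcoord_def)
    finally have 1: "(\<Sum>b<n. cA \<tau> c b * vec_index (x \<tau>) b) = (\<Sum>d<n. A 0 c d * vec_index (x \<tau>) d) + (\<Sum>i\<in>{1..np}. \<Sum>e<n. A i c e * (pcoord (p \<tau>) i * vec_index (x \<tau>) e))" .
    have "cf \<tau> c = (\<Sum>l<nin. \<Sum>iu\<le>np. B iu c l * (pcoord (p \<tau>) iu * vec_index (u \<tau>) l))"
      by (simp add: cf_def sum_distrib_right sum_distrib_left mult_ac)
    also have "\<dots> = (\<Sum>iu\<le>np. \<Sum>l<nin. B iu c l * (pcoord (p \<tau>) iu * vec_index (u \<tau>) l))" by (rule sum.swap)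
    finally show ?thesis unfolding 1 v_def by simp
  qed
  have "((\<lambda>\<tau>. \<Sum>c<n. E (t - \<tau>) a c * v c \<tau>) has_integral vec_index (x t) a) {0..t}"
  proof (rule variation_of_constants[where n = n and E = E and A = "A 0" and T = T and x = "\<lambda>a t. vec_index (x t) a" and v = v])
    show "AE t in lebesgue. t \<in> {0..T} \<longrightarrow> (\<forall>c<n. ((\<lambda>t. vec_index (x t) c) has_real_derivative (\<Sum>d<n. A 0 c d * vec_index (x t) d) + v c t) (at t within {0..T}))"
      using solution_props(4)[OF x] unfolding v .
  qed (use E_0 E_deriv solution_props(2,3)[OF x] a t in auto)
  then show ?thesis unfolding v_def by (rule integral_unique[symmetric])
qed

end

text \<open>A copy of lpv_samples.G that does not mention the system, so that the quadratic form Q below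
  is visibly the same for all systems.\<close>

primrec gram :: "nat \<Rightarrow> nat \<Rightarrow> real \<Rightarrow> (nat \<Rightarrow> nat \<Rightarrow> real \<Rightarrow> real) \<Rightarrow> (nat \<Rightarrow> nat \<Rightarrow> real \<Rightarrow> real) \<Rightarrow> nat \<Rightarrow> nat \<Rightarrow> nat \<Rightarrow> real \<Rightarrow> real" where
  "gram np nin lam p u 0 = (\<lambda>j j' t. 0)"
| "gram np nin lam p u (Suc k) = (\<lambda>j j' t. integral {0..t} (\<lambda>\<tau>. exp (- (lam * (t - \<tau>))) *
     ((\<Sum>iu\<le>np. \<Sum>l<nin. (p j iu \<tau> * u j l \<tau>) * (p j' iu \<tau> * u j' l \<tau>)) + (\<Sum>i\<in>{1..np}. p j i \<tau> * (p j' i \<tau> * gram np nin lam p u k j j' \<tau>)))))"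

lemma (in lpv_samples) G_eq_gram: "j < N \<Longrightarrow> j' < N \<Longrightarrow> G k j j' t = gram np nin lam p u k j j' t"
proof (induction k arbitrary: t)
  case (Suc k)
  then show ?case unfolding G_Suc[OF Suc.prems] by simp
qed (simp add: G_def)

locale lpv_sample_trajectories = lpv_kernel_setup +
  fixes T :: real and N :: nat and us ps :: "nat \<Rightarrow> signal"
  assumes T: "T > 0" and lam: "lam \<ge> real np" and adm: "\<And>j. j < N \<Longrightarrow> admissible np nin T (us j) (ps j)"
begin

abbreviation pc :: "nat \<Rightarrow> nat \<Rightarrow> real \<Rightarrow> real" where "pc j i t \<equiv> pcoord (ps j t) i"
abbreviation uc :: "nat \<Rightarrow> nat \<Rightarrow> real \<Rightarrow> real" where "uc j l t \<equiv> vec_index (us j t) l"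

sublocale S: lpv_samples n nin np N T lam A B E pc uc
proof
  show "0 \<le> T" using T by simp
  show "real np \<le> lam" by (rule lam)
  show "continuous_on UNIV (\<lambda>t. E t a c)" if "a < n" "c < n" for a c by (rule E_continuous[OF that])
  show "bdd_meas T (pc j i)" if "j < N" "i \<le> np" for j i by (rule admissible_pcoord(1)[OF adm that(2)]) (rule that(1))
  show "\<bar>pc j i t\<bar> \<le> 1" if "j < N" "i \<le> np" "t \<in> {0..T}" for j i t by (rule admissible_pcoord(2)[OF adm that(2,3)]) (rule that(1))
  show "bdd_meas T (uc j l)" if "j < N" "l < nin" for j l using adm[OF that(1)] that(2) by (simp add: admissible_def)
qed

definition y :: "nat \<Rightarrow> nat \<Rightarrow> real" where
  "y k j = (\<Sum>iy\<le>np. pc j iy T * (\<Sum>a<n. C iy a * S.X k j T a))"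

text \<open>It holds for every solution and therefore also shows that the final state is unique, as
  the description in the output requires.\<close>

lemma solution_limit:
  assumes j: "j < N" and x: "lpv_solution np T \<Sigma> (us j) (ps j) x" and a: "a < n"
  shows "(\<lambda>k. S.X k j T a) \<longlonglongrightarrow> vec_index (x T) a"
proof -
  interpret t: lpv_trajectory np nin \<Sigma> lam T "us j" "ps j"
    by unfold_locales (use T adm[OF j] in auto)
  show ?thesis
    by (rule S.X_tendsto[OF j t.solution_props(5)[OF x] t.solution_Volterra_equation[OF x] a]) (use T in auto)
qed

lemma output_eq:
  assumes j: "j < N" and x: "lpv_solution np T \<Sigma> (us j) (ps j) x"
  shows "lpv_output np T \<Sigma> (us j) (ps j) T = (\<Sum>iy\<le>np. pc j iy T * (\<Sum>a<n. C iy a * vec_index (x T) a))"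
proof -
  interpret t: lpv_trajectory np nin \<Sigma> lam T "us j" "ps j"
    by unfold_locales (use T adm[OF j] in auto)
  have eq: "vec_index (affine_mat np (lC \<Sigma>) (ps j T) *\<^sub>v x' T) 0 = (\<Sum>iy\<le>np. pc j iy T * (\<Sum>a<n. C iy a * vec_index (x T) a))"
    if x': "lpv_solution np T \<Sigma> (us j) (ps j) x'" for x'
  proof -
    have "vec_index (x' T) a = vec_index (x T) a" if "a < n" for a
      using LIMSEQ_unique[OF solution_limit[OF j x' that] solution_limit[OF j x that]] .
    then show ?thesis
      using lpv_output_map_index[OF sys t.solution_props(1)[OF x'], of T "ps j T"] T by (simp add: C_def)
  qed
  show ?thesis unfolding lpv_output_def
    by (rule the_equality) (use x eq in auto)
qed

lemma output_limit:
  assumes j: "j < N"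
  shows "(\<lambda>k. y k j) \<longlonglongrightarrow> lpv_output np T \<Sigma> (us j) (ps j) T"
proof -
  interpret t: lpv_trajectory np nin \<Sigma> lam T "us j" "ps j"
    by unfold_locales (use T adm[OF j] in auto)
  obtain x where x: "lpv_solution np T \<Sigma> (us j) (ps j) x" using t.solution_exists by blast
  show ?thesis unfolding output_eq[OF j x] y_def
    by (intro tendsto_sum tendsto_mult tendsto_const solution_limit[OF j x]) auto
qed

text \<open>The entrywise product of two Gram matrices: that of the scheduling vectors at
  \<open>T\<close>, with leading entry 1, and \<open>gram\<close>. It arises by summing the cross
  terms over the output channels.\<close>

definition Q :: "nat \<Rightarrow> nat \<Rightarrow> nat \<Rightarrow> real" where
  "Q k j j' = (\<Sum>iy\<le>np. pc j iy T * pc j' iy T) * gram np nin lam pc uc k j j' T"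

lemma sum_Q: "(\<Sum>j<N. \<Sum>j'<N. \<sigma> j * \<sigma> j' * Q k j j') = (\<Sum>iy\<le>np. \<Sum>j<N. \<Sum>j'<N. (\<sigma> j * pc j iy T) * (\<sigma> j' * pc j' iy T) * S.G k j j' T)"
proof -
  have "(\<Sum>j<N. \<Sum>j'<N. \<sigma> j * \<sigma> j' * Q k j j') = (\<Sum>j<N. \<Sum>j'<N. \<Sum>iy\<le>np. (\<sigma> j * pc j iy T) * (\<sigma> j' * pc j' iy T) * S.G k j j' T)"
    by (simp add: Q_def S.G_eq_gram sum_distrib_left sum_distrib_right mult_ac)
  also have "\<dots> = (\<Sum>iy\<le>np. \<Sum>j<N. \<Sum>j'<N. (\<sigma> j * pc j iy T) * (\<sigma> j' * pc j' iy T) * S.G k j j' T)"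
    by (rule sum_rotate3)
  finally show ?thesis .
qed

lemma Q_nonneg: "0 \<le> (\<Sum>j<N. \<Sum>j'<N. \<sigma> j * \<sigma> j' * Q k j j')"
  unfolding sum_Q
proof (rule sum_nonneg)
  fix iy
  show "0 \<le> (\<Sum>j<N. \<Sum>j'<N. (\<sigma> j * pc j iy T) * (\<sigma> j' * pc j' iy T) * S.G k j j' T)"
    using S.cross_term_bound[of T 0 "\<lambda>j. \<sigma> j * pc j iy T" "\<lambda>_. 0" k] by simp
qed

text \<open>One factor \<open>real np + 1\<close> counts the output channels, the other comes from
  the energy bound \<open>S.G_diag_le\<close>.\<close>

lemma Q_trace:
  assumes L: "\<And>j. j < N \<Longrightarrow> integral {0..T} (\<lambda>\<tau>. \<Sum>l<nin. (uc j l \<tau>)\<^sup>2) \<le> L\<^sup>2"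
  shows "(\<Sum>j<N. Q k j j) \<le> real N * ((real np + 1) * L)\<^sup>2"
proof -
  have "Q k j j \<le> ((real np + 1) * L)\<^sup>2" if j: "j < N" for j
  proof -
    have 1: "(\<Sum>iy\<le>np. pc j iy T * pc j iy T) \<le> real np + 1"
    proof -
      have "pc j iy T * pc j iy T \<le> 1" if "iy \<le> np" for iy
        using S.p_le[OF j that, of T] T by (simp add: abs_square_le_1 flip: power2_eq_square)
      then have "(\<Sum>iy\<le>np. pc j iy T * pc j iy T) \<le> (\<Sum>iy\<le>np. 1)" by (intro sum_mono) auto
      then show ?thesis by simp
    qed
    have g: "S.G k j j T \<le> (real np + 1) * L\<^sup>2"
      by (rule order_trans[OF S.G_diag_le[OF j _ order_refl] mult_left_mono[OF L[OF j]]]) (use T in auto)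
    have "Q k j j = (\<Sum>iy\<le>np. pc j iy T * pc j iy T) * S.G k j j T" by (simp add: Q_def S.G_eq_gram[OF j j])
    also have "\<dots> \<le> (\<Sum>iy\<le>np. pc j iy T * pc j iy T) * ((real np + 1) * L\<^sup>2)"
      using g by (intro mult_left_mono sum_nonneg) auto
    also have "\<dots> \<le> (real np + 1) * ((real np + 1) * L\<^sup>2)"
      using 1 by (intro mult_right_mono) auto
    finally show ?thesis by (simp add: power2_eq_square mult_ac)
  qed
  then have "(\<Sum>j<N. Q k j j) \<le> (\<Sum>j<N. ((real np + 1) * L)\<^sup>2)" by (intro sum_mono) auto
  then show ?thesis by simp
qed

text \<open>At the rows of the output matrices, the state block is bounded by a partial sum of the
  squared norm.\<close>

lemma state_form_le:
  assumes "h2_norm np lam \<Sigma> \<le> ennreal c" "c \<ge> 0"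
  shows "(\<Sum>iy\<le>np. S.q k T (C iy)) \<le> c\<^sup>2"
proof -
  have Ew: "S.E\<^sub>w = Ew" by (intro ext) (simp add: S.E\<^sub>w_def Ew_def)
  have "ennreal (\<Sum>iy\<le>np. S.q k T (C iy)) = (\<Sum>iy\<le>np. ennreal (S.q k T (C iy)))"
    by (intro sum_ennreal[symmetric] S.q_nonneg) simp
  also have "\<dots> \<le> (\<Sum>iy\<le>np. \<Sum>iu\<le>np. \<Sum>j<k. level iu j T (C iy))"
    using S.q_le_levels[of T k] T unfolding Ew by (intro sum_mono) simp
  also have "\<dots> \<le> ennreal (c\<^sup>2)"
    using levels_le_h2_norm_sq h2_norm_sq_le[OF assms] by (rule order_trans)
  finally show ?thesis by (simp add: ennreal_le_iff)
qed

text \<open>The cross-term bound, summed over the output channels and divided by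
  \<open>2 * s\<close>. The right side is affine in \<open>Q\<close>, so it can be averaged over the
  signs with one value of \<open>s\<close> for all of them.\<close>

lemma correlation_bound:
  assumes c: "h2_norm np lam \<Sigma> \<le> ennreal c" "c \<ge> 0" and s: "s > 0"
  shows "(\<Sum>j<N. \<sigma> j * y k j) \<le> s * c\<^sup>2 / 2 + (\<Sum>j<N. \<Sum>j'<N. \<sigma> j * \<sigma> j' * Q k j j') / (2 * s)"
proof -
  have "(\<Sum>j<N. \<sigma> j * y k j) = (\<Sum>j<N. \<Sum>iy\<le>np. (\<sigma> j * pc j iy T) * (\<Sum>a<n. C iy a * S.X k j T a))"
    by (simp add: y_def sum_distrib_left mult.assoc)
  also have "\<dots> = (\<Sum>iy\<le>np. \<Sum>j<N. (\<sigma> j * pc j iy T) * (\<Sum>a<n. C iy a * S.X k j T a))" by (rule sum.swap)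
  finally have eq: "2 * s * (\<Sum>j<N. \<sigma> j * y k j) = (\<Sum>iy\<le>np. 2 * s * (\<Sum>j<N. (\<sigma> j * pc j iy T) * (\<Sum>a<n. C iy a * S.X k j T a)))"
    by (simp add: sum_distrib_left)
  have "2 * s * (\<Sum>j<N. \<sigma> j * y k j) \<le> (\<Sum>iy\<le>np. s\<^sup>2 * S.q k T (C iy) + (\<Sum>j<N. \<Sum>j'<N. (\<sigma> j * pc j iy T) * (\<sigma> j' * pc j' iy T) * S.G k j j' T))"
    unfolding eq by (intro sum_mono S.cross_term_bound) simp
  also have "\<dots> = s\<^sup>2 * (\<Sum>iy\<le>np. S.q k T (C iy)) + (\<Sum>j<N. \<Sum>j'<N. \<sigma> j * \<sigma> j' * Q k j j')"
    by (simp add: sum.distrib sum_distrib_left sum_Q)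
  also have "\<dots> \<le> s\<^sup>2 * c\<^sup>2 + (\<Sum>j<N. \<Sum>j'<N. \<sigma> j * \<sigma> j' * Q k j j')"
    by (intro add_right_mono mult_left_mono state_form_le c) auto
  finally have "(\<Sum>j<N. \<sigma> j * y k j) \<le> (s\<^sup>2 * c\<^sup>2 + (\<Sum>j<N. \<Sum>j'<N. \<sigma> j * \<sigma> j' * Q k j j')) / (2 * s)"
    using s by (simp add: field_simps)
  also have "\<dots> = s * c\<^sup>2 / 2 + (\<Sum>j<N. \<Sum>j'<N. \<sigma> j * \<sigma> j' * Q k j j') / (2 * s)"
    using s by (simp add: add_divide_distrib power2_eq_square)
  finally show ?thesis .
qed

end

section \<open>Continuity of the output in the system matrices\<close>

lemma Gronwall:
  fixes \<phi> :: "real \<Rightarrow> real"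
  assumes c: "continuous_on {0..T} \<phi>" and k: "k \<ge> 0" and T: "T \<ge> 0"
    and le: "\<And>t. t \<in> {0..T} \<Longrightarrow> \<phi> t \<le> a + k * integral {0..t} \<phi>"
  shows "\<phi> T \<le> a * exp (k * T)"
proof -
  \<comment> \<open>With this integrating factor the hypothesis says that \<open>h\<close> has
    nonpositive derivative.\<close>
  define h where "h t = exp (- (k * t)) * (a + k * integral {0..t} \<phi>)" for t
  have d: "(h has_real_derivative exp (- (k * t)) * k * (\<phi> t - (a + k * integral {0..t} \<phi>))) (at t within {0..T})" if t: "t \<in> {0..T}" for t
  proof -
    have I: "((\<lambda>t. integral {0..t} \<phi>) has_real_derivative \<phi> t) (at t within {0..T})"
      using integral_has_vector_derivative[OF c t] by (simp add: has_real_derivative_iff_has_vector_derivative)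
    have e: "((\<lambda>t. exp (- (k * t))) has_real_derivative - k * exp (- (k * t))) (at t within {0..T})"
      by (auto intro!: derivative_eq_intros)
    have "(h has_real_derivative (- k * exp (- (k * t))) * (a + k * integral {0..t} \<phi>) + (0 + k * \<phi> t) * exp (- (k * t))) (at t within {0..T})"
      unfolding h_def by (intro DERIV_mult e DERIV_add DERIV_const DERIV_cmult I)
    then show ?thesis by (simp add: algebra_simps)
  qed
  have "h T \<le> h 0"
  proof (rule DERIV_nonpos_imp_decreasing_open[OF T])
    fix t assume t: "0 < t" "t < T"
    then have "at t within {0..T} = at t" by (intro at_within_interior) auto
    then have "(h has_real_derivative exp (- (k * t)) * k * (\<phi> t - (a + k * integral {0..t} \<phi>))) (at t)"
      using d[of t] t by simp
    moreover have "exp (- (k * t)) * k * (\<phi> t - (a + k * integral {0..t} \<phi>)) \<le> 0"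
      using le[of t] t k by (intro mult_nonneg_nonpos) auto
    ultimately show "\<exists>y. (h has_real_derivative y) (at t) \<and> y \<le> 0" by blast
  next
    show "continuous_on {0..T} h" by (rule DERIV_continuous_on[OF d])
  qed
  then have "exp (- (k * T)) * (a + k * integral {0..T} \<phi>) \<le> a" by (simp add: h_def)
  then have "a + k * integral {0..T} \<phi> \<le> a * exp (k * T)"
    by (simp add: exp_minus field_simps)
  then show ?thesis using le[of T] T by simp
qed

text \<open>The distance between the trajectories satisfies a Gronwall inequality; its source is the
  perturbation of the matrices along the limit trajectory, and its rate is uniform in
  \<open>m\<close>.\<close>

lemma lpv_output_tendsto:
  assumes sys: "\<And>m. lpv_system np nin (\<Sigma>s m)" "lpv_system np nin \<Sigma>" and nx: "\<And>m. nx (\<Sigma>s m) = nx \<Sigma>"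
    and A: "\<And>i a b. i \<le> np \<Longrightarrow> (\<lambda>m. lA (\<Sigma>s m) i $$ (a, b)) \<longlonglongrightarrow> lA \<Sigma> i $$ (a, b)"
    and B: "\<And>i a b. i \<le> np \<Longrightarrow> (\<lambda>m. lB (\<Sigma>s m) i $$ (a, b)) \<longlonglongrightarrow> lB \<Sigma> i $$ (a, b)"
    and C: "\<And>i a b. i \<le> np \<Longrightarrow> (\<lambda>m. lC (\<Sigma>s m) i $$ (a, b)) \<longlonglongrightarrow> lC \<Sigma> i $$ (a, b)"
    and T: "T > 0" and adm: "admissible np nin T u p"
  shows "(\<lambda>m. lpv_output np T (\<Sigma>s m) u p T) \<longlonglongrightarrow> lpv_output np T \<Sigma> u p T"
proof -
  define n where "n = nx \<Sigma>"
  interpret t: lpv_trajectory np nin \<Sigma> 0 T u p by unfold_locales (use sys T adm in auto)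
  interpret tm: lpv_trajectory np nin "\<Sigma>s m" 0 T u p for m by unfold_locales (use sys T adm in auto)
  note t_cA = t.cA_def[unfolded t.A_def] and t_cf = t.cf_def[unfolded t.B_def]
  note tm_cA = tm.cA_def[unfolded tm.A_def] and tm_cf = tm.cf_def[unfolded tm.B_def]
  obtain x where x: "lpv_solution np T \<Sigma> u p x" using t.solution_exists by blast
  have "\<exists>xs. \<forall>m. lpv_solution np T (\<Sigma>s m) u p (xs m)" using tm.solution_exists by metis
  then obtain xs where xs: "\<And>m. lpv_solution np T (\<Sigma>s m) u p (xs m)" by blast
  have out: "lpv_output np T \<Sigma> u p T = (\<Sum>iy\<le>np. pcoord (p T) iy * (\<Sum>a<n. lC \<Sigma> iy $$ (0, a) * vec_index (x T) a))"
  proof -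
    \<comment> \<open>A one-sample instance supplies the output formula; \<open>real np\<close> is
      the smallest weight that its assumptions permit.\<close>
    interpret s: lpv_sample_trajectories np nin \<Sigma> "real np" T 1 "\<lambda>_. u" "\<lambda>_. p"
      by unfold_locales (use sys T adm in auto)
    show ?thesis using s.output_eq[of 0 x] x by (simp add: s.C_def n_def)
  qed
  have outm: "lpv_output np T (\<Sigma>s m) u p T = (\<Sum>iy\<le>np. pcoord (p T) iy * (\<Sum>a<n. lC (\<Sigma>s m) iy $$ (0, a) * vec_index (xs m T) a))" for m
  proof -
    interpret s: lpv_sample_trajectories np nin "\<Sigma>s m" "real np" T 1 "\<lambda>_. u" "\<lambda>_. p"
      by unfold_locales (use sys T adm in auto)
    show ?thesis using s.output_eq[of 0 "xs m"] xs by (simp add: s.C_def n_def nx)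
  qed
  have "\<exists>K. \<forall>t\<in>{0..T}. \<bar>vec_index (x t) a\<bar> \<le> K" if "a < n" for a
    using t.solution_props(5)[OF x, of a] that unfolding bdd_meas_def n_def by blast
  then obtain Kx where Kx: "\<And>a t. a < n \<Longrightarrow> t\<in>{0..T} \<Longrightarrow> \<bar>vec_index (x t) a\<bar> \<le> Kx a" by metis
  have "\<exists>K. \<forall>t\<in>{0..T}. \<bar>vec_index (u t) l\<bar> \<le> K" if "l < nin" for l
    using adm that unfolding admissible_def bdd_meas_def by blast
  then obtain Ku where Ku: "\<And>l t. l < nin \<Longrightarrow> t\<in>{0..T} \<Longrightarrow> \<bar>vec_index (u t) l\<bar> \<le> Ku l" by metis
  have pb: "\<bar>pcoord (p t) i\<bar> \<le> 1" if "i \<le> np" "t \<in> {0..T}" for i t by (rule admissible_pcoord(2)[OF adm that])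
  define \<eta> where "\<eta> m = (\<Sum>a<n. (\<Sum>b<n. (\<Sum>i\<le>np. \<bar>lA (\<Sigma>s m) i $$ (a, b) - lA \<Sigma> i $$ (a, b)\<bar>) * \<bar>Kx b\<bar>)
      + (\<Sum>l<nin. (\<Sum>i\<le>np. \<bar>lB (\<Sigma>s m) i $$ (a, l) - lB \<Sigma> i $$ (a, l)\<bar>) * \<bar>Ku l\<bar>))" for m
  have \<eta>: "\<eta> \<longlonglongrightarrow> 0"
  proof -
    have "(\<lambda>m. \<eta> m) \<longlonglongrightarrow> (\<Sum>a<n. (\<Sum>b<n. (\<Sum>i\<le>np. \<bar>lA \<Sigma> i $$ (a, b) - lA \<Sigma> i $$ (a, b)\<bar>) * \<bar>Kx b\<bar>)
      + (\<Sum>l<nin. (\<Sum>i\<le>np. \<bar>lB \<Sigma> i $$ (a, l) - lB \<Sigma> i $$ (a, l)\<bar>) * \<bar>Ku l\<bar>))"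
      unfolding \<eta>_def by (intro tendsto_sum tendsto_add tendsto_mult tendsto_const tendsto_rabs tendsto_diff A B) auto
    then show ?thesis by simp
  qed
  \<comment> \<open>Convergent entries are bounded, which makes the Gronwall rate \<open>k\<close>
    independent of \<open>m\<close>.\<close>
  have "\<exists>K. \<forall>m. \<bar>lA (\<Sigma>s m) i $$ (a, b)\<bar> \<le> K" if "i \<le> np" for i a b
  proof -
    have "Bseq (\<lambda>m. lA (\<Sigma>s m) i $$ (a, b))" using A[OF that] by (intro convergent_imp_Bseq convergentI)
    then show ?thesis unfolding Bseq_def by auto
  qed
  then obtain KA where KA: "\<And>i a b m. i \<le> np \<Longrightarrow> \<bar>lA (\<Sigma>s m) i $$ (a, b)\<bar> \<le> KA i a b" by metis
  define k where "k = (\<Sum>a<n. \<Sum>b<n. \<Sum>i\<le>np. \<bar>KA i a b\<bar>)"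
  have k0: "k \<ge> 0" unfolding k_def by (intro sum_nonneg) auto
  define \<phi> where "\<phi> m t = (\<Sum>a<n. \<bar>vec_index (xs m t) a - vec_index (x t) a\<bar>)" for m t
  have \<phi>c: "continuous_on {0..T} (\<phi> m)" for m
    unfolding \<phi>_def
    using abs_continuous_on_imp_continuous_on[OF tm.solution_props(2)[OF xs[of m]]] abs_continuous_on_imp_continuous_on[OF t.solution_props(2)[OF x]]
    by (intro continuous_intros) (auto simp: n_def nx)
  have \<phi>: "\<phi> m t \<le> T * \<eta> m + k * integral {0..t} (\<phi> m)" if t: "t \<in> {0..T}" for m t
  proof -
    define g where "g a \<tau> = ((\<Sum>b<n. tm.cA m \<tau> a b * vec_index (xs m \<tau>) b) + tm.cf m \<tau> a) - ((\<Sum>b<n. t.cA \<tau> a b * vec_index (x \<tau>) b) + t.cf \<tau> a)" for a \<tau>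
    have i1: "(\<lambda>\<tau>. (\<Sum>b<n. tm.cA m \<tau> a b * vec_index (xs m \<tau>) b) + tm.cf m \<tau> a) integrable_on {0..t}" if "a < n" for a
      using t tm.solution_props(5)[OF xs[of m]] that
      by (intro bdd_meas_integrable'[of T] bdd_meas_add bdd_meas_sum bdd_meas_mult tm.cA_bdd_meas tm.cf_bdd_meas) (auto simp: n_def nx)
    have i2: "(\<lambda>\<tau>. (\<Sum>b<n. t.cA \<tau> a b * vec_index (x \<tau>) b) + t.cf \<tau> a) integrable_on {0..t}" if "a < n" for a
      using t t.solution_props(5)[OF x] that
      by (intro bdd_meas_integrable'[of T] bdd_meas_add bdd_meas_sum bdd_meas_mult t.cA_bdd_meas t.cf_bdd_meas) (auto simp: n_def)
    have g: "g a integrable_on {0..t}" if "a < n" for a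
      unfolding g_def[abs_def] by (intro integrable_diff i1 i2 that)
    have gbound: "(\<Sum>a<n. \<bar>g a \<tau>\<bar>) \<le> \<eta> m + k * \<phi> m \<tau>" if "\<tau> \<in> {0..t}" for \<tau>
    proof -
      have \<tau>: "\<tau> \<in> {0..T}" using that t by auto
      define e where "e b = vec_index (xs m \<tau>) b - vec_index (x \<tau>) b" for b
      have dA: "\<bar>tm.cA m \<tau> a b - t.cA \<tau> a b\<bar> \<le> (\<Sum>i\<le>np. \<bar>lA (\<Sigma>s m) i $$ (a, b) - lA \<Sigma> i $$ (a, b)\<bar>)" for a b
        unfolding t_cA tm_cA sum_subtractf[symmetric] right_diff_distrib[symmetric]
        by (rule order_trans[OF sum_abs], rule sum_mono) (use pb \<tau> in \<open>auto simp: abs_mult mult_left_le_one_le\<close>)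
      have cAk: "\<bar>tm.cA m \<tau> a b\<bar> \<le> (\<Sum>i\<le>np. \<bar>KA i a b\<bar>)" for a b
        unfolding tm_cA
      proof (rule order_trans[OF sum_abs], rule sum_mono)
        fix i assume "i \<in> {..np}"
        then have i: "i \<le> np" by simp
        have "\<bar>pcoord (p \<tau>) i\<bar> * \<bar>lA (\<Sigma>s m) i $$ (a, b)\<bar> \<le> 1 * \<bar>KA i a b\<bar>"
          using pb[OF i \<tau>] KA[OF i, of m a b] by (intro mult_mono) auto
        then show "\<bar>pcoord (p \<tau>) i * lA (\<Sigma>s m) i $$ (a, b)\<bar> \<le> \<bar>KA i a b\<bar>" by (simp add: abs_mult)
      qed
      have df: "\<bar>tm.cf m \<tau> a - t.cf \<tau> a\<bar> \<le> (\<Sum>l<nin. (\<Sum>i\<le>np. \<bar>lB (\<Sigma>s m) i $$ (a, l) - lB \<Sigma> i $$ (a, l)\<bar>) * \<bar>Ku l\<bar>)" for a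
        unfolding t_cf tm_cf sum_subtractf[symmetric] left_diff_distrib[symmetric] right_diff_distrib[symmetric]
      proof (rule order_trans[OF sum_abs], rule sum_mono, unfold abs_mult, rule mult_mono)
        fix l assume l: "l \<in> {..<nin}"
        show "\<bar>vec_index (u \<tau>) l\<bar> \<le> \<bar>Ku l\<bar>" using Ku[of l \<tau>] l \<tau> by force
        show "\<bar>\<Sum>i\<le>np. pcoord (p \<tau>) i * (lB (\<Sigma>s m) i $$ (a, l) - lB \<Sigma> i $$ (a, l))\<bar> \<le> (\<Sum>i\<le>np. \<bar>lB (\<Sigma>s m) i $$ (a, l) - lB \<Sigma> i $$ (a, l)\<bar>)"
          by (rule order_trans[OF sum_abs], rule sum_mono) (use pb \<tau> in \<open>auto simp: abs_mult mult_left_le_one_le\<close>)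
      qed (auto intro!: sum_nonneg)
      have ga: "\<bar>g a \<tau>\<bar> \<le> ((\<Sum>b<n. (\<Sum>i\<le>np. \<bar>lA (\<Sigma>s m) i $$ (a, b) - lA \<Sigma> i $$ (a, b)\<bar>) * \<bar>Kx b\<bar>)
          + (\<Sum>l<nin. (\<Sum>i\<le>np. \<bar>lB (\<Sigma>s m) i $$ (a, l) - lB \<Sigma> i $$ (a, l)\<bar>) * \<bar>Ku l\<bar>)) + (\<Sum>b<n. \<Sum>i\<le>np. \<bar>KA i a b\<bar>) * \<phi> m \<tau>" if a: "a < n" for a
      proof -
        \<comment> \<open>The perturbed matrix acts on the difference of the states, the difference
          of the matrices on the limit state, and the forcings are subtracted. The first term is
          left to Gronwall; the other two make up \<open>\<eta>\<close>.\<close>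
        have "g a \<tau> = (\<Sum>b<n. tm.cA m \<tau> a b * e b) + (\<Sum>b<n. (tm.cA m \<tau> a b - t.cA \<tau> a b) * vec_index (x \<tau>) b) + (tm.cf m \<tau> a - t.cf \<tau> a)"
          unfolding g_def e_def by (simp add: sum.distrib sum_subtractf algebra_simps)
        moreover have "\<bar>\<Sum>b<n. (tm.cA m \<tau> a b - t.cA \<tau> a b) * vec_index (x \<tau>) b\<bar> \<le> (\<Sum>b<n. (\<Sum>i\<le>np. \<bar>lA (\<Sigma>s m) i $$ (a, b) - lA \<Sigma> i $$ (a, b)\<bar>) * \<bar>Kx b\<bar>)"
        proof (rule order_trans[OF sum_abs], rule sum_mono, unfold abs_mult, rule mult_mono[OF dA])
          fix b assume "b \<in> {..<n}"
          then show "\<bar>vec_index (x \<tau>) b\<bar> \<le> \<bar>Kx b\<bar>" using Kx[of b \<tau>] \<tau> by force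
        qed (auto intro!: sum_nonneg)
        moreover have "\<bar>\<Sum>b<n. tm.cA m \<tau> a b * e b\<bar> \<le> (\<Sum>b<n. \<Sum>i\<le>np. \<bar>KA i a b\<bar>) * \<phi> m \<tau>"
        proof -
          have "\<bar>\<Sum>b<n. tm.cA m \<tau> a b * e b\<bar> \<le> (\<Sum>b<n. (\<Sum>i\<le>np. \<bar>KA i a b\<bar>) * \<phi> m \<tau>)"
          proof (rule order_trans[OF sum_abs], rule sum_mono, unfold abs_mult, rule mult_mono[OF cAk])
            fix b assume "b \<in> {..<n}"
            then show "\<bar>e b\<bar> \<le> \<phi> m \<tau>" unfolding \<phi>_def e_def by (intro member_le_sum) auto
          qed (auto intro!: sum_nonneg)
          then show ?thesis by (simp add: sum_distrib_right)
        qed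
        ultimately show ?thesis using df[of a] by linarith
      qed
      have "(\<Sum>a<n. \<bar>g a \<tau>\<bar>) \<le> (\<Sum>a<n. ((\<Sum>b<n. (\<Sum>i\<le>np. \<bar>lA (\<Sigma>s m) i $$ (a, b) - lA \<Sigma> i $$ (a, b)\<bar>) * \<bar>Kx b\<bar>)
          + (\<Sum>l<nin. (\<Sum>i\<le>np. \<bar>lB (\<Sigma>s m) i $$ (a, l) - lB \<Sigma> i $$ (a, l)\<bar>) * \<bar>Ku l\<bar>)) + (\<Sum>b<n. \<Sum>i\<le>np. \<bar>KA i a b\<bar>) * \<phi> m \<tau>)"
        by (intro sum_mono ga) auto
      then show ?thesis unfolding \<eta>_def k_def by (simp add: sum.distrib sum_distrib_right)
    qed
    have ea: "\<bar>vec_index (xs m t) a - vec_index (x t) a\<bar> = norm (integral {0..t} (g a))" if a: "a < n" for a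
    proof -
      have "integral {0..t} (g a) = vec_index (xs m t) a - vec_index (x t) a"
        unfolding g_def[abs_def]
        using tm.solution_integral_equation[OF xs[of m], of a t] t.solution_integral_equation[OF x, of a t] t a
        by (subst Henstock_Kurzweil_Integration.integral_diff[OF i1 i2]) (auto simp: n_def nx)
      then show ?thesis by simp
    qed
    have gabs: "(\<lambda>\<tau>. \<bar>g a \<tau>\<bar>) integrable_on {0..t}" if a: "a < n" for a
    proof -
      have "bdd_meas T (g a)" unfolding g_def[abs_def]
        using t.solution_props(5)[OF x] tm.solution_props(5)[OF xs[of m]]
        by (intro bdd_meas_diff bdd_meas_add bdd_meas_sum bdd_meas_mult tm.cA_bdd_meas tm.cf_bdd_meas t.cA_bdd_meas t.cf_bdd_meas) (auto simp: n_def nx)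
      then have "bdd_meas T (\<lambda>\<tau>. \<bar>g a \<tau>\<bar>)" unfolding bdd_meas_def by (auto intro: borel_measurable_abs)
      then show ?thesis using t by (intro bdd_meas_integrable'[of T]) auto
    qed
    have "\<phi> m t \<le> (\<Sum>a<n. integral {0..t} (\<lambda>\<tau>. \<bar>g a \<tau>\<bar>))"
      unfolding \<phi>_def
    proof (rule sum_mono)
      fix a assume "a \<in> {..<n}"
      then have a: "a < n" by simp
      show "\<bar>vec_index (xs m t) a - vec_index (x t) a\<bar> \<le> integral {0..t} (\<lambda>\<tau>. \<bar>g a \<tau>\<bar>)"
        unfolding ea[OF a] by (rule integral_norm_bound_integral[OF g[OF a] gabs[OF a]]) simp
    qed
    also have "\<dots> = integral {0..t} (\<lambda>\<tau>. \<Sum>a<n. \<bar>g a \<tau>\<bar>)"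
      by (rule integral_sum[symmetric]) (use gabs in auto)
    also have "\<dots> \<le> integral {0..t} (\<lambda>\<tau>. \<eta> m + k * \<phi> m \<tau>)"
    proof (rule integral_le)
      show "(\<lambda>\<tau>. \<Sum>a<n. \<bar>g a \<tau>\<bar>) integrable_on {0..t}" using gabs by (intro integrable_sum) auto
      show "(\<lambda>\<tau>. \<eta> m + k * \<phi> m \<tau>) integrable_on {0..t}"
        using t by (intro integrable_continuous_interval continuous_intros continuous_on_subset[OF \<phi>c]) auto
    qed (rule gbound)
    also have "\<dots> = t * \<eta> m + k * integral {0..t} (\<phi> m)"
    proof -
      have "\<phi> m integrable_on {0..t}" using t by (intro integrable_continuous_interval continuous_on_subset[OF \<phi>c]) auto
      moreover have "(\<lambda>\<tau>. k * \<phi> m \<tau>) integrable_on {0..t}"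
        using t by (intro integrable_continuous_interval continuous_intros continuous_on_subset[OF \<phi>c]) auto
      ultimately show ?thesis using t by (subst Henstock_Kurzweil_Integration.integral_add) auto
    qed
    also have "\<dots> \<le> T * \<eta> m + k * integral {0..t} (\<phi> m)"
    proof -
      have "\<eta> m \<ge> 0" unfolding \<eta>_def by (intro sum_nonneg add_nonneg_nonneg mult_nonneg_nonneg) auto
      then show ?thesis using t by (intro add_right_mono mult_right_mono) auto
    qed
    finally show ?thesis .
  qed
  have \<phi>T: "\<phi> m T \<le> T * \<eta> m * exp (k * T)" for m
    by (rule Gronwall[OF \<phi>c k0 _ \<phi>]) (use T in auto)
  have lim: "(\<lambda>m. T * \<eta> m * exp (k * T)) \<longlonglongrightarrow> 0"
    using tendsto_mult[OF tendsto_mult[OF tendsto_const[of T] \<eta>] tendsto_const[of "exp (k * T)"]] by simp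
  have xlim: "(\<lambda>m. vec_index (xs m T) a) \<longlonglongrightarrow> vec_index (x T) a" if a: "a < n" for a
  proof -
    have "\<bar>vec_index (xs m T) a - vec_index (x T) a\<bar> \<le> \<phi> m T" for m
      unfolding \<phi>_def using a by (intro member_le_sum[of a "{..<n}" "\<lambda>a. \<bar>vec_index (xs m T) a - vec_index (x T) a\<bar>"]) auto
    then have "(\<lambda>m. vec_index (xs m T) a - vec_index (x T) a) \<longlonglongrightarrow> 0"
      using order_trans[OF _ \<phi>T] by (intro Lim_null_comparison[OF always_eventually lim]) auto
    then show ?thesis by (rule LIM_zero_cancel)
  qed
  show ?thesis unfolding out outm
    by (intro tendsto_sum tendsto_mult tendsto_const C xlim) auto
qed

section \<open>Generalization bounds\<close>

text \<open>The system and the scheduling map may be selected by the sign vector. Only the scheduling map enters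
  the quadratic form, which is nonnegative, so summing over all scheduling maps costs the factor card \<Phi>.\<close>

lemma lpv_rademacher_bound:
  fixes Sg :: "(nat \<Rightarrow> real) \<Rightarrow> lpv" and ph :: "(nat \<Rightarrow> real) \<Rightarrow> signal \<Rightarrow> signal" and us :: "nat \<Rightarrow> signal"
  assumes \<Phi>: "finite \<Phi>" and T: "T > 0" and lam: "lam \<ge> real np" and N: "N \<ge> 1" and c: "c > 0" and L: "L > 0"
    and Sg: "\<And>\<sigma>. lpv_system np nin (Sg \<sigma>)" "\<And>\<sigma>. h2_norm np lam (Sg \<sigma>) \<le> ennreal c" and ph: "\<And>\<sigma>. ph \<sigma> \<in> \<Phi>"
    and adm: "\<And>j \<phi>. j < N \<Longrightarrow> \<phi> \<in> \<Phi> \<Longrightarrow> admissible np nin T (us j) (\<phi> (us j))"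
    and L2: "\<And>j. j < N \<Longrightarrow> integral {0..T} (\<lambda>\<tau>. \<Sum>l<nin. (vec_index (us j \<tau>) l)\<^sup>2) \<le> L\<^sup>2"
  shows "sign_mean N (\<lambda>\<sigma>. \<Sum>j<N. \<sigma> j * lpv_output np T (Sg \<sigma>) (us j) (ph \<sigma> (us j)) T)
     \<le> real (card \<Phi>) * (c * (sqrt (real N) * ((real np + 1) * L)))"
proof -
  define R where "R = sqrt (real N) * ((real np + 1) * L)"
  have R: "R > 0" using N L by (simp add: R_def)
  have R2: "real N * ((real np + 1) * L)\<^sup>2 = R\<^sup>2" using N by (simp add: R_def power_mult_distrib)
  \<comment> \<open>This choice balances \<open>s * c\<^sup>2 / 2\<close> against
    \<open>R\<^sup>2 / (2 * s)\<close>; both become \<open>c * R / 2\<close>.\<close>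
  define s where "s = R / c"
  have s: "s > 0" using R c by (simp add: s_def)
  define QQ where "QQ \<phi> k j j' = lpv_sample_trajectories.Q np nin lam T us (\<lambda>j. \<phi> (us j)) k j j'" for \<phi> :: "signal \<Rightarrow> signal" and k j j'
  define yy where "yy k \<sigma> j = lpv_sample_trajectories.y np nin (Sg \<sigma>) lam T N us (\<lambda>j. ph \<sigma> (us j)) k j" for k \<sigma> j
  have loc: "lpv_sample_trajectories np nin (Sg \<sigma>) lam T N us (\<lambda>j. \<phi> (us j))" if "\<phi> \<in> \<Phi>" for \<sigma> \<phi>
    by unfold_locales (use Sg T lam adm that in auto)
  have QQ0: "0 \<le> (\<Sum>j<N. \<Sum>j'<N. \<sigma> j * \<sigma> j' * QQ \<phi> k j j')" if "\<phi> \<in> \<Phi>" for \<phi> k and \<sigma> :: "nat \<Rightarrow> real"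
    unfolding QQ_def by (rule lpv_sample_trajectories.Q_nonneg[OF loc[OF that]])
  have QQtr: "(\<Sum>j<N. QQ \<phi> k j j) \<le> R\<^sup>2" if "\<phi> \<in> \<Phi>" for \<phi> k
    unfolding QQ_def R2[symmetric] by (rule lpv_sample_trajectories.Q_trace[OF loc[OF that]]) (rule L2)
  have k: "sign_mean N (\<lambda>\<sigma>. \<Sum>j<N. \<sigma> j * yy k \<sigma> j) \<le> real (card \<Phi>) * (c * R)" for k
  proof -
    have "sign_mean N (\<lambda>\<sigma>. \<Sum>j<N. \<sigma> j * yy k \<sigma> j) \<le> sign_mean N (\<lambda>\<sigma>. \<Sum>\<phi>\<in>\<Phi>. s * c\<^sup>2 / 2 + 1 / (2 * s) * (\<Sum>j<N. \<Sum>j'<N. \<sigma> j * \<sigma> j' * QQ \<phi> k j j'))"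
    proof (rule sign_mean_mono)
      fix \<sigma> :: "nat \<Rightarrow> real"
      have "(\<Sum>j<N. \<sigma> j * yy k \<sigma> j) \<le> s * c\<^sup>2 / 2 + (\<Sum>j<N. \<Sum>j'<N. \<sigma> j * \<sigma> j' * QQ (ph \<sigma>) k j j') / (2 * s)"
        unfolding yy_def QQ_def
        by (rule lpv_sample_trajectories.correlation_bound[OF loc[where \<phi> = "ph \<sigma>", OF ph] Sg(2)]) (use c s in auto)
      also have "\<dots> = s * c\<^sup>2 / 2 + 1 / (2 * s) * (\<Sum>j<N. \<Sum>j'<N. \<sigma> j * \<sigma> j' * QQ (ph \<sigma>) k j j')" by simp
      also have "\<dots> \<le> (\<Sum>\<phi>\<in>\<Phi>. s * c\<^sup>2 / 2 + 1 / (2 * s) * (\<Sum>j<N. \<Sum>j'<N. \<sigma> j * \<sigma> j' * QQ \<phi> k j j'))"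
        by (rule member_le_sum[OF ph _ \<Phi>]) (use s QQ0 in auto)
      finally show "(\<Sum>j<N. \<sigma> j * yy k \<sigma> j) \<le> (\<Sum>\<phi>\<in>\<Phi>. s * c\<^sup>2 / 2 + 1 / (2 * s) * (\<Sum>j<N. \<Sum>j'<N. \<sigma> j * \<sigma> j' * QQ \<phi> k j j'))" .
    qed
    also have "\<dots> = (\<Sum>\<phi>\<in>\<Phi>. s * c\<^sup>2 / 2 + 1 / (2 * s) * (\<Sum>j<N. QQ \<phi> k j j))"
      unfolding sign_mean_sum[where A = \<Phi>] sign_mean_add sign_mean_cmult sign_mean_quadratic by simp
    also have "\<dots> \<le> (\<Sum>\<phi>\<in>\<Phi>. s * c\<^sup>2 / 2 + 1 / (2 * s) * R\<^sup>2)"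
      using s by (intro sum_mono add_left_mono mult_left_mono QQtr) auto
    also have "s * c\<^sup>2 / 2 + 1 / (2 * s) * R\<^sup>2 = c * R"
      using c R by (simp add: s_def power2_eq_square field_simps)
    finally show ?thesis by simp
  qed
  have "(\<lambda>k. sign_mean N (\<lambda>\<sigma>. \<Sum>j<N. \<sigma> j * yy k \<sigma> j)) \<longlonglongrightarrow> sign_mean N (\<lambda>\<sigma>. \<Sum>j<N. \<sigma> j * lpv_output np T (Sg \<sigma>) (us j) (ph \<sigma> (us j)) T)"
    unfolding yy_def
    by (intro sign_mean_tendsto tendsto_sum tendsto_mult tendsto_const lpv_sample_trajectories.output_limit[OF loc[OF ph]]) auto
  then show ?thesis unfolding R_def[symmetric]
    by (rule LIMSEQ_le_const2) (use k in blast)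
qed

text \<open>Symmetrization bounds the mean of the largest deviation, McDiarmid's inequality the
  excess over this mean. The deviations are summed and divided by \<open>real N\<close> only at the
  end, so changing one sample matters by at most \<open>2 * B\<close>.\<close>

theorem (in prob_space) finite_class_generalization:
  fixes f :: "'s \<Rightarrow> 'a \<Rightarrow> real"
  assumes F: "finite F" "F \<noteq> {}" and N: "N \<ge> 1" and \<delta>: "0 < \<delta>" "\<delta> < 1" and B: "B > 0"
    and f: "\<And>S. S \<in> F \<Longrightarrow> f S \<in> borel_measurable M"
    and fB: "\<And>S z. S \<in> F \<Longrightarrow> z \<in> space M \<Longrightarrow> \<bar>f S z\<bar> \<le> B"
    and mean: "AE w in Pi\<^sub>M {..<N} (\<lambda>_. M). sign_mean N (\<lambda>\<sigma>. Max ((\<lambda>S. \<Sum>i<N. \<sigma> i * (2 * f S (w i))) ` F)) \<le> \<rho>"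
  shows "1 - \<delta> \<le> measure (Pi\<^sub>M {..<N} (\<lambda>_. M)) {w \<in> space (Pi\<^sub>M {..<N} (\<lambda>_. M)).
     \<forall>S\<in>F. expectation (f S) - (\<Sum>i<N. f S (w i)) / real N \<le> \<rho> / real N + B * sqrt (2 * ln (2 / \<delta>) / real N)}"
proof -
  let ?P = "Pi\<^sub>M {..<N} (\<lambda>_. M)"
  interpret PP: prob_space ?P by (rule prob_space_PiM_const)
  define g where "g w = Max ((\<lambda>S. \<Sum>i<N. expectation (f S) - f S (w i)) ` F)" for w
  have fw: "(\<lambda>w. f S (w i)) \<in> borel_measurable ?P" if "S \<in> F" "i < N" for S i
    by (rule measurable_compose[OF _ f[OF that(1)]], rule measurable_component_singleton) (use that in auto)
  have fwB: "\<bar>f S (w i)\<bar> \<le> B" if "S \<in> F" "i < N" "w \<in> space ?P" for S i w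
    by (rule fB) (use that in \<open>auto simp: space_PiM PiE_iff\<close>)
  have mB: "\<bar>expectation (f S)\<bar> \<le> B" if S: "S \<in> F" for S
    by (rule abs_expectation_le[OF f[OF S] fB[OF S]])
  have gm: "g \<in> borel_measurable ?P"
    unfolding g_def by (intro borel_measurable_Max_image[OF F] borel_measurable_sum borel_measurable_diff fw) auto
  have gC: "\<bar>g w\<bar> \<le> real N * (2 * B)" if w: "w \<in> space ?P" for w
    unfolding g_def
  proof (rule abs_Max_image_le[OF F])
    fix S assume S: "S \<in> F"
    have "\<bar>\<Sum>i<N. expectation (f S) - f S (w i)\<bar> \<le> (\<Sum>i<N. 2 * B)"
    proof (rule order_trans[OF sum_abs], rule sum_mono)
      fix i assume "i \<in> {..<N}"
      then have "\<bar>f S (w i)\<bar> \<le> B" using fwB[OF S _ w] by auto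
      then show "\<bar>expectation (f S) - f S (w i)\<bar> \<le> 2 * B" using mB[OF S] by linarith
    qed
    then show "\<bar>\<Sum>i<N. expectation (f S) - f S (w i)\<bar> \<le> real N * (2 * B)" by simp
  qed
  have gd: "\<bar>g (w(i := z)) - g w\<bar> \<le> 2 * B" if i: "i < N" and w: "w \<in> space ?P" and z: "z \<in> space M" for i w z
    unfolding g_def
  proof (rule abs_Max_image_diff_le[OF F])
    fix S assume S: "S \<in> F"
    have "(\<Sum>j<N. expectation (f S) - f S ((w(i := z)) j)) - (\<Sum>j<N. expectation (f S) - f S (w j))
       = (\<Sum>j<N. if j = i then f S (w i) - f S z else 0)"
      unfolding sum_subtractf[symmetric] by (intro sum.cong) auto
    also have "\<dots> = f S (w i) - f S z" using i by simp
    finally show "\<bar>(\<Sum>j<N. expectation (f S) - f S ((w(i := z)) j)) - (\<Sum>j<N. expectation (f S) - f S (w j))\<bar> \<le> 2 * B"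
      using fwB[OF S i w] fB[OF S z] by linarith
  qed
  have Eg: "integral\<^sup>L ?P g \<le> \<rho>"
  proof -
    define r where "r w = sign_mean N (\<lambda>\<sigma>. Max ((\<lambda>S. \<Sum>i<N. \<sigma> i * (2 * f S (w i))) ` F))" for w
    have rm: "r \<in> borel_measurable ?P"
      unfolding r_def by (intro sign_mean_measurable borel_measurable_Max_image[OF F] borel_measurable_sum borel_measurable_times fw) auto
    have rC: "\<bar>r w\<bar> \<le> sign_mean N (\<lambda>\<sigma>. \<Sum>i<N. \<bar>\<sigma> i\<bar> * (2 * B))" if w: "w \<in> space ?P" for w
      unfolding r_def
    proof (rule sign_mean_abs_le, rule abs_Max_image_le[OF F])
      fix \<sigma> :: "nat \<Rightarrow> real" and S assume S: "S \<in> F"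
      show "\<bar>\<Sum>i<N. \<sigma> i * (2 * f S (w i))\<bar> \<le> (\<Sum>i<N. \<bar>\<sigma> i\<bar> * (2 * B))"
      proof (rule order_trans[OF sum_abs], rule sum_mono)
        fix i assume "i \<in> {..<N}"
        then have "\<bar>2 * f S (w i)\<bar> \<le> 2 * B" using fwB[OF S _ w, of i] by (simp add: abs_mult)
        then show "\<bar>\<sigma> i * (2 * f S (w i))\<bar> \<le> \<bar>\<sigma> i\<bar> * (2 * B)"
          unfolding abs_mult[of "\<sigma> i"] by (intro mult_left_mono) auto
      qed
    qed
    have ri: "integrable ?P r"
      by (rule PP.integrable_const_bound[OF _ rm]) (use rC in \<open>auto intro!: AE_I2\<close>)
    have "integral\<^sup>L ?P g \<le> integral\<^sup>L ?P r"
      using symmetrization[OF F f fB, where c = "\<lambda>_. 0" and N = N] by (simp add: g_def[abs_def] r_def[abs_def])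
    also have "\<dots> \<le> (\<integral>w. \<rho> \<partial>?P)"
      by (rule integral_mono_AE[OF ri]) (use mean in \<open>auto simp: r_def\<close>)
    finally show ?thesis by (simp add: PP.prob_space)
  qed
  \<comment> \<open>With differences \<open>2 * B\<close> this threshold makes the McDiarmid tail
    equal to \<open>\<delta> / 2\<close>, which is within the permitted
    \<open>\<delta>\<close>.\<close>
  define \<epsilon> where "\<epsilon> = B * sqrt (2 * ln (2 / \<delta>) * real N)"
  have ln: "ln (2 / \<delta>) > 0" using \<delta> by simp
  have \<epsilon>: "\<epsilon> > 0" using B N ln by (simp add: \<epsilon>_def)
  have \<epsilon>2: "\<epsilon>\<^sup>2 = B\<^sup>2 * (2 * ln (2 / \<delta>) * real N)" using ln N by (simp add: \<epsilon>_def power_mult_distrib)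
  let ?bad = "{w \<in> space ?P. \<epsilon> \<le> g w - integral\<^sup>L ?P g}"
  let ?good = "{w \<in> space ?P. \<forall>S\<in>F. expectation (f S) - (\<Sum>i<N. f S (w i)) / real N \<le> \<rho> / real N + B * sqrt (2 * ln (2 / \<delta>) / real N)}"
  have "measure ?P ?bad \<le> exp (- 2 * \<epsilon>\<^sup>2 / (real N * (2 * B)\<^sup>2))"
    by (rule McDiarmid_inequality[OF _ _ \<epsilon> gm gC gd]) (use B N in auto)
  also have "- 2 * \<epsilon>\<^sup>2 / (real N * (2 * B)\<^sup>2) = - ln (2 / \<delta>)"
    unfolding \<epsilon>2 using B N by (simp add: power2_eq_square field_simps)
  also have "exp (- ln (2 / \<delta>)) = \<delta> / 2" using \<delta> by (simp add: exp_minus)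
  finally have bad: "measure ?P ?bad \<le> \<delta>" using \<delta> by simp
  have bad_sets: "?bad \<in> sets ?P" using gm by measurable
  have gs: "?good \<in> sets ?P"
  proof -
    have "{w \<in> space ?P. expectation (f S) - (\<Sum>i<N. f S (w i)) / real N \<le> \<rho> / real N + B * sqrt (2 * ln (2 / \<delta>) / real N)} \<in> sets ?P" if "S \<in> F" for S
    proof -
      have [measurable]: "(\<lambda>w. \<Sum>i<N. f S (w i)) \<in> borel_measurable ?P" by (intro borel_measurable_sum fw that) auto
      show ?thesis by measurable
    qed
    then show ?thesis by (rule sets.sets_Collect_finite_All[OF _ F(1)])
  qed
  have "space ?P - ?bad \<subseteq> ?good"
  proof
    fix w assume w: "w \<in> space ?P - ?bad"
    have "expectation (f S) - (\<Sum>i<N. f S (w i)) / real N \<le> \<rho> / real N + B * sqrt (2 * ln (2 / \<delta>) / real N)" if S: "S \<in> F" for S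
    proof -
      have "(\<Sum>i<N. expectation (f S) - f S (w i)) \<le> g w" unfolding g_def using F S by (intro Max_ge) auto
      also have "\<dots> \<le> \<rho> + \<epsilon>" using w Eg by auto
      finally have "real N * expectation (f S) - (\<Sum>i<N. f S (w i)) \<le> \<rho> + \<epsilon>" by (simp add: sum_subtractf)
      then have "(real N * expectation (f S) - (\<Sum>i<N. f S (w i))) / real N \<le> (\<rho> + \<epsilon>) / real N"
        using N by (intro divide_right_mono) auto
      moreover have "(real N * expectation (f S) - (\<Sum>i<N. f S (w i))) / real N = expectation (f S) - (\<Sum>i<N. f S (w i)) / real N"
        using N by (simp add: diff_divide_distrib)
      moreover have "\<epsilon> / real N = B * sqrt (2 * ln (2 / \<delta>) / real N)"
      proof -
        have "sqrt (2 * ln (2 / \<delta>) * real N) / real N = sqrt (2 * ln (2 / \<delta>) / real N)"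
          using N by (simp add: real_sqrt_mult real_sqrt_divide field_simps)
        then show ?thesis unfolding \<epsilon>_def by (simp only: times_divide_eq_right[symmetric])
      qed
      ultimately show ?thesis by (simp add: add_divide_distrib)
    qed
    then show "w \<in> ?good" using w by auto
  qed
  then have "measure ?P (space ?P - ?bad) \<le> measure ?P ?good"
    by (intro PP.finite_measure_mono gs)
  then show ?thesis using bad PP.prob_compl[OF bad_sets] by simp
qed

text \<open>All matrices of a system are collected in one point of a countable product of lines,
  which is second countable and whose convergence is entrywise.\<close>

definition lpv_entries :: "lpv \<Rightarrow> nat \<times> nat \<times> nat \<times> nat \<Rightarrow> real" where
  "lpv_entries \<Sigma> = (\<lambda>(k, i, a, b).
     if k = 0 then lA \<Sigma> i $$ (a, b) else if k = 1 then lB \<Sigma> i $$ (a, b) else lC \<Sigma> i $$ (a, b))"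

lemma lpv_entries_tendsto:
  assumes "(\<lambda>m. lpv_entries (\<Sigma>s m)) \<longlonglongrightarrow> lpv_entries \<Sigma>"
  shows "(\<lambda>m. lA (\<Sigma>s m) i $$ (a, b)) \<longlonglongrightarrow> lA \<Sigma> i $$ (a, b)"
    "(\<lambda>m. lB (\<Sigma>s m) i $$ (a, b)) \<longlonglongrightarrow> lB \<Sigma> i $$ (a, b)"
    "(\<lambda>m. lC (\<Sigma>s m) i $$ (a, b)) \<longlonglongrightarrow> lC \<Sigma> i $$ (a, b)"
proof -
  have *: "(\<lambda>m. lpv_entries (\<Sigma>s m) x) \<longlonglongrightarrow> lpv_entries \<Sigma> x" for x
    using continuous_on_tendsto_compose[OF continuous_on_product_coordinates[of x] assms] by simp
  show "(\<lambda>m. lA (\<Sigma>s m) i $$ (a, b)) \<longlonglongrightarrow> lA \<Sigma> i $$ (a, b)"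
    "(\<lambda>m. lB (\<Sigma>s m) i $$ (a, b)) \<longlonglongrightarrow> lB \<Sigma> i $$ (a, b)"
    "(\<lambda>m. lC (\<Sigma>s m) i $$ (a, b)) \<longlonglongrightarrow> lC \<Sigma> i $$ (a, b)"
    using *[of "(0, i, a, b)"] *[of "(1, i, a, b)"] *[of "(2, i, a, b)"] by (simp_all add: lpv_entries_def)
qed

text \<open>State dimension and scheduling map sort the systems into countably many classes, and
  each class has a countable dense subset since subsets of a second countable space are separable.
  Approximating systems thus share dimension and scheduling map with their limit, as
  \<open>lpv_output_tendsto\<close> requires.\<close>

lemma countable_dense_systems:
  fixes \<SS> :: "'s set" and Sg :: "'s \<Rightarrow> lpv" and ph :: "'s \<Rightarrow> 'f"
  assumes \<Phi>: "countable \<Phi>" and ph: "\<And>S. S \<in> \<SS> \<Longrightarrow> ph S \<in> \<Phi>"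
  obtains Q where "countable Q" "Q \<subseteq> \<SS>"
    "\<forall>S\<in>\<SS>. \<exists>Ss. (\<forall>m. Ss m \<in> Q \<and> nx (Sg (Ss m)) = nx (Sg S) \<and> ph (Ss m) = ph S)
       \<and> (\<lambda>m. lpv_entries (Sg (Ss m))) \<longlonglongrightarrow> lpv_entries (Sg S)"
proof -
  define cl where "cl n \<phi> = {S\<in>\<SS>. nx (Sg S) = n \<and> ph S = \<phi>}" for n \<phi>
  define en where "en S = lpv_entries (Sg S)" for S
  have "\<exists>Q. countable Q \<and> Q \<subseteq> cl n \<phi> \<and> en ` cl n \<phi> \<subseteq> closure (en ` Q)" for n \<phi>
  proof -
    obtain T where T: "countable T" "T \<subseteq> en ` cl n \<phi>" "en ` cl n \<phi> \<subseteq> closure T"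
      by (rule separable)
    have "\<exists>Q\<subseteq>cl n \<phi>. countable Q \<and> T = en ` Q"
      using T(1,2) by (metis countable_subset_image)
    then show ?thesis using T(3) by blast
  qed
  then obtain Q where Q: "\<And>n \<phi>. countable (Q n \<phi>)" "\<And>n \<phi>. Q n \<phi> \<subseteq> cl n \<phi>" "\<And>n \<phi>. en ` cl n \<phi> \<subseteq> closure (en ` Q n \<phi>)"
    by metis
  show ?thesis
  proof (rule that[of "\<Union>n. \<Union>\<phi>\<in>\<Phi>. Q n \<phi>"])
    show "countable (\<Union>n. \<Union>\<phi>\<in>\<Phi>. Q n \<phi>)" using Q(1) \<Phi> by auto
    show "(\<Union>n. \<Union>\<phi>\<in>\<Phi>. Q n \<phi>) \<subseteq> \<SS>" using Q(2) by (auto simp: cl_def)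
    show "\<forall>S\<in>\<SS>. \<exists>Ss. (\<forall>m. Ss m \<in> (\<Union>n. \<Union>\<phi>\<in>\<Phi>. Q n \<phi>) \<and> nx (Sg (Ss m)) = nx (Sg S) \<and> ph (Ss m) = ph S)
       \<and> (\<lambda>m. lpv_entries (Sg (Ss m))) \<longlonglongrightarrow> lpv_entries (Sg S)"
    proof
    fix S assume S: "S \<in> \<SS>"
    then have "en S \<in> closure (en ` Q (nx (Sg S)) (ph S))"
      using Q(3)[of "nx (Sg S)" "ph S"] by (auto simp: cl_def)
    then obtain e where e: "\<And>m. e m \<in> en ` Q (nx (Sg S)) (ph S)" "e \<longlonglongrightarrow> en S"
      unfolding closure_sequential by auto
    then have "\<forall>m. \<exists>S'\<in>Q (nx (Sg S)) (ph S). e m = en S'" by auto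
    then obtain Ss where Ss: "\<And>m. Ss m \<in> Q (nx (Sg S)) (ph S)" "\<And>m. e m = en (Ss m)" by metis
    have "Ss m \<in> (\<Union>n. \<Union>\<phi>\<in>\<Phi>. Q n \<phi>) \<and> nx (Sg (Ss m)) = nx (Sg S) \<and> ph (Ss m) = ph S" for m
      using Ss(1)[of m] Q(2)[of "nx (Sg S)" "ph S"] ph[OF S] by (auto simp: cl_def)
    moreover have "(\<lambda>m. lpv_entries (Sg (Ss m))) \<longlonglongrightarrow> lpv_entries (Sg S)"
    proof -
      have "e = (\<lambda>m. lpv_entries (Sg (Ss m)))" using Ss(2) by (auto simp: en_def)
      then show ?thesis using e(2) by (simp add: en_def)
    qed
    ultimately show "\<exists>Ss. (\<forall>m. Ss m \<in> (\<Union>n. \<Union>\<phi>\<in>\<Phi>. Q n \<phi>) \<and> nx (Sg (Ss m)) = nx (Sg S) \<and> ph (Ss m) = ph S)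
       \<and> (\<lambda>m. lpv_entries (Sg (Ss m))) \<longlonglongrightarrow> lpv_entries (Sg S)" by blast
    qed
  qed
qed

section \<open>Consequences of the data assumption for single samples\<close>

lemma L2_on_mono: "S \<subseteq> S' \<Longrightarrow> L2_on n S \<subseteq> L2_on n S'"
  unfolding L2_on_def by blast

lemma abs_vec_index_le_vnorm:
  assumes "l < dim_vec v" shows "\<bar>vec_index v l\<bar> \<le> vnorm v"
proof -
  have "(vec_index v l)\<^sup>2 \<le> (vnorm v)\<^sup>2"
    unfolding vnorm_sq using assms by (intro member_le_sum) auto
  moreover have "vnorm v \<ge> 0" unfolding vnorm_def by (simp add: scalar_prod_def sum_nonneg)
  ultimately show ?thesis by (simp add: abs_le_square_iff[symmetric])
qed

lemma bounded_L2_admissible: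
  assumes u: "u \<in> L2_on nin {0..T}" and K: "\<And>t. t \<in> {0..T} \<Longrightarrow> vnorm (u t) \<le> K" and p: "p \<in> PC_sched np"
  shows "admissible np nin T u p"
    and "integral {0..T} (\<lambda>\<tau>. \<Sum>l<nin. (vec_index (u \<tau>) l)\<^sup>2) = (L2_norm_on {0..T} u)\<^sup>2"
proof -
  have c: "\<And>t. u t \<in> carrier_vec nin" and m: "\<And>l. l < nin \<Longrightarrow> (\<lambda>t. vec_index (u t) l) \<in> borel_measurable lebesgue"
    and i: "integrable lebesgue (\<lambda>t. (vnorm (u t))\<^sup>2)"
    using u by (auto simp: L2_on_def)
  have "bdd_meas T (\<lambda>t. vec_index (u t) l)" if l: "l < nin" for l
  proof -
    have "(\<lambda>t. vec_index (u t) l) \<in> borel_measurable (lebesgue_on {0..T})"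
      by (rule measurable_restrict_space1[OF m[OF l]])
    moreover have "\<bar>vec_index (u t) l\<bar> \<le> K" if "t \<in> {0..T}" for t
      using abs_vec_index_le_vnorm[of l "u t"] c[of t] l K[OF that] by auto
    ultimately show ?thesis unfolding bdd_meas_def by blast
  qed
  then show "admissible np nin T u p" using c p by (simp add: admissible_def)
  have "(\<lambda>\<tau>. \<Sum>l<nin. (vec_index (u \<tau>) l)\<^sup>2) = (\<lambda>t. (vnorm (u t))\<^sup>2)"
    by (simp add: vnorm_sq carrier_vecD[OF c])
  moreover have si: "set_integrable lebesgue {0..T} (\<lambda>t. (vnorm (u t))\<^sup>2)"
    unfolding set_integrable_def using i by (intro integrable_mult_indicator) auto
  moreover have "0 \<le> (LINT t:{0..T}|lebesgue. (vnorm (u t))\<^sup>2)"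
    unfolding set_lebesgue_integral_def by (intro Bochner_Integration.integral_nonneg) auto
  ultimately show "integral {0..T} (\<lambda>\<tau>. \<Sum>l<nin. (vec_index (u \<tau>) l)\<^sup>2) = (L2_norm_on {0..T} u)\<^sup>2"
    using set_lebesgue_integral_eq_integral(2)[OF si] by (simp add: L2_norm_on_def)
qed

text \<open>The null set in \<open>loss_le\<close> is common to all systems, so that almost every
  sample serves an uncountable family at once. \<open>meas_gap\<close> renders the implicit
  measurability assumption on the event in question.\<close>

locale learning_problem = D: prob_space D
  for D :: "(signal \<times> real) measure" +
  fixes loss :: "real \<Rightarrow> real \<Rightarrow> real" and T B :: real and \<SS> :: "nlsys set" and N :: nat
  assumes meas_loss: "\<And>\<S>. \<S> \<in> \<SS> \<Longrightarrow> loss_at loss T \<S> \<in> borel_measurable D"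
    and meas_gap: "\<And>r. gap_event D N loss T \<SS> r \<in> sets (iid_sample D N)"
    and loss_le: "AE z in D. \<forall>\<S>\<in>\<SS>. \<bar>loss_at loss T \<S> z\<bar> \<le> B"
    and B: "B \<ge> 0" and N: "N \<ge> 1"
begin

sublocale P: prob_space "iid_sample D N"
  unfolding iid_sample_def by (rule D.prob_space_PiM_const)

lemma AE_sample:
  assumes "AE z in D. Q z"
  shows "AE w in iid_sample D N. \<forall>i<N. Q (w i)"
proof -
  have "AE w in iid_sample D N. \<forall>i\<in>{..<N}. Q (w i)"
    unfolding iid_sample_def
    by (rule AE_finite_allI) (use assms in \<open>auto intro!: AE_PiM_component D.prob_space_axioms\<close>)
  then show ?thesis by (rule eventually_mono) auto
qed

lemma abs_loss_le: "\<S> \<in> \<SS> \<Longrightarrow> AE z in D. \<bar>loss_at loss T \<S> z\<bar> \<le> B"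
  by (rule eventually_mono[OF loss_le]) auto

lemma loss_integrable: "\<S> \<in> \<SS> \<Longrightarrow> integrable D (loss_at loss T \<S>)"
  by (rule D.integrable_const_bound[where B = B]) (use abs_loss_le meas_loss in auto)

text \<open>True risks are at most \<open>B\<close>, and almost surely all empirical risks are at
  least \<open>- B\<close>.\<close>

lemma trivial_gap:
  assumes r: "r \<ge> 2 * B" and \<delta>: "\<delta> > 0"
  shows "1 - \<delta> \<le> measure (iid_sample D N) (gap_event D N loss T \<SS> r)"
proof -
  have tr: "true_risk D loss T \<S> \<le> B" if "\<S> \<in> \<SS>" for \<S>
  proof -
    have "true_risk D loss T \<S> \<le> (\<integral>z. B \<partial>D)"
      unfolding true_risk_def
    proof (intro integral_mono_AE loss_integrable that)
      show "AE z in D. loss_at loss T \<S> z \<le> B"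
        by (rule eventually_mono[OF abs_loss_le[OF that]]) linarith
    qed simp
    then show ?thesis by (simp add: D.prob_space)
  qed
  have "AE w in iid_sample D N. w \<in> gap_event D N loss T \<SS> r"
    using AE_sample[OF loss_le] AE_space
  proof eventually_elim
    case (elim w)
    have "true_risk D loss T \<S> - emp_risk N loss T w \<S> \<le> r" if S: "\<S> \<in> \<SS>" for \<S>
    proof -
      have "(\<Sum>i<N. - B) \<le> (\<Sum>i<N. loss_at loss T \<S> (w i))"
      proof (rule sum_mono)
        fix i assume "i \<in> {..<N}"
        then have "\<bar>loss_at loss T \<S> (w i)\<bar> \<le> B" using elim(1) S by auto
        then show "- B \<le> loss_at loss T \<S> (w i)" by linarith
      qed
      then have "- B \<le> emp_risk N loss T w \<S>" unfolding emp_risk_def using N by (simp add: field_simps)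
      then show ?thesis using tr[OF S] r by linarith
    qed
    then show ?case using elim by (simp add: gap_event_def)
  qed
  then have "measure (iid_sample D N) (gap_event D N loss T \<SS> r) = 1"
    using P.prob_eq_1[OF meas_gap] by simp
  then show ?thesis using \<delta> by simp
qed

lemma gap_measurable:
  assumes "\<S> \<in> \<SS>"
  shows "{w \<in> space (iid_sample D N). true_risk D loss T \<S> - emp_risk N loss T w \<S> \<le> r} \<in> sets (iid_sample D N)"
proof -
  have "(\<lambda>w. loss_at loss T \<S> (w i)) \<in> borel_measurable (iid_sample D N)" if "i < N" for i
    unfolding iid_sample_def
    by (rule measurable_compose[OF _ meas_loss[OF assms]], rule measurable_component_singleton) (use that in auto)
  then have [measurable]: "(\<lambda>w. emp_risk N loss T w \<S>) \<in> borel_measurable (iid_sample D N)"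
    unfolding emp_risk_def by (intro borel_measurable_divide borel_measurable_sum) auto
  show ?thesis by measurable
qed

text \<open>The events for finite prefixes of an enumeration of \<open>Q\<close> decrease, and
  continuity from above gives the bound for all of \<open>Q\<close>. If all sample points are
  \<open>good\<close>, both risks of any system are limits of risks in \<open>Q\<close>, and the
  nonstrict inequality survives.\<close>

lemma gap_from_countable:
  assumes Q: "countable Q" "Q \<subseteq> \<SS>"
    and dense: "AE z in D. good z"
      "\<And>\<S>. \<S> \<in> \<SS> \<Longrightarrow> \<exists>Ss. (\<forall>m. Ss m \<in> Q) \<and> (\<forall>z. good z \<longrightarrow> (\<lambda>m. loss_at loss T (Ss m) z) \<longlonglongrightarrow> loss_at loss T \<S> z)"
    and fin: "\<And>F. finite F \<Longrightarrow> F \<noteq> {} \<Longrightarrow> F \<subseteq> Q \<Longrightarrow>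
        1 - \<delta> \<le> measure (iid_sample D N) {w \<in> space (iid_sample D N). \<forall>\<S>\<in>F. true_risk D loss T \<S> - emp_risk N loss T w \<S> \<le> r}"
    and \<delta>: "\<delta> > 0"
  shows "1 - \<delta> \<le> measure (iid_sample D N) (gap_event D N loss T \<SS> r)"
proof (cases "Q = {}")
  case True
  have "\<SS> = {}"
  proof (rule equals0I)
    fix \<S> assume "\<S> \<in> \<SS>"
    then obtain Ss :: "nat \<Rightarrow> nlsys" where "\<forall>m. Ss m \<in> Q" using dense(2) by blast
    then show False using True by auto
  qed
  then have "gap_event D N loss T \<SS> r = space (iid_sample D N)" by (simp add: gap_event_def)
  then show ?thesis using \<delta> by (simp add: P.prob_space)
next
  case False
  let ?P = "iid_sample D N"
  define q where "q = from_nat_into Q"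
  have q: "range q = Q" unfolding q_def by (rule range_from_nat_into[OF False Q(1)])
  define ok where "ok \<S> w \<longleftrightarrow> true_risk D loss T \<S> - emp_risk N loss T w \<S> \<le> r" for \<S> w
  define A where "A m = {w \<in> space ?P. \<forall>\<S>\<in>q ` {..m}. ok \<S> w}" for m :: nat
  have okm: "{w \<in> space ?P. ok \<S> w} \<in> sets ?P" if "\<S> \<in> \<SS>" for \<S>
    unfolding ok_def by (rule gap_measurable[OF that])
  have qS: "q i \<in> \<SS>" for i using q Q(2) by auto
  have Am: "A m \<in> sets ?P" for m
    unfolding A_def by (rule sets.sets_Collect_finite_All) (use okm qS in auto)
  have lim: "(\<lambda>m. measure ?P (A m)) \<longlonglongrightarrow> measure ?P (\<Inter>m. A m)"
  proof (rule P.finite_Lim_measure_decseq)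
    show "range A \<subseteq> sets ?P" using Am by auto
    show "decseq A" unfolding decseq_def A_def by (auto intro: order_trans)
  qed
  have ge: "1 - \<delta> \<le> measure ?P (A m)" for m
    unfolding A_def ok_def by (rule fin) (use q in auto)
  have "1 - \<delta> \<le> measure ?P (\<Inter>m. A m)"
    by (rule LIMSEQ_le_const[OF lim]) (use ge in blast)
  also have "\<dots> \<le> measure ?P (gap_event D N loss T \<SS> r)"
  proof (rule P.finite_measure_mono_AE[OF _ meas_gap])
    show "AE w in ?P. w \<in> (\<Inter>m. A m) \<longrightarrow> w \<in> gap_event D N loss T \<SS> r"
      using AE_sample[OF dense(1)]
    proof eventually_elim
      case (elim w)
      show ?case
      proof
        assume w: "w \<in> (\<Inter>m. A m)"
        have okq: "ok S w" if SQ: "S \<in> Q" for S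
        proof -
          obtain i where "S = q i" using SQ unfolding q[symmetric] by (rule rangeE)
          then show ?thesis using w by (auto simp: A_def)
        qed
        have "true_risk D loss T \<S> - emp_risk N loss T w \<S> \<le> r" if S: "\<S> \<in> \<SS>" for \<S>
        proof -
          obtain Ss where Ss: "\<And>m. Ss m \<in> Q" "\<And>z. good z \<Longrightarrow> (\<lambda>m. loss_at loss T (Ss m) z) \<longlonglongrightarrow> loss_at loss T \<S> z"
            using dense(2)[OF S] by blast
          have 1: "(\<lambda>m. true_risk D loss T (Ss m)) \<longlonglongrightarrow> true_risk D loss T \<S>"
            unfolding true_risk_def
          proof (rule integral_dominated_convergence[where w = "\<lambda>_. B"])
            show "AE z in D. (\<lambda>m. loss_at loss T (Ss m) z) \<longlonglongrightarrow> loss_at loss T \<S> z"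
              using dense(1) Ss(2) by auto
            show "AE z in D. norm (loss_at loss T (Ss m) z) \<le> B" for m
              using abs_loss_le[of "Ss m"] Ss(1)[of m] Q(2) by auto
          qed (use meas_loss S Ss(1) Q(2) in auto)
          have 2: "(\<lambda>m. emp_risk N loss T w (Ss m)) \<longlonglongrightarrow> emp_risk N loss T w \<S>"
            unfolding emp_risk_def using elim N by (intro tendsto_divide tendsto_sum tendsto_const Ss(2)) auto
          show ?thesis
            by (rule LIMSEQ_le_const2[OF tendsto_diff[OF 1 2]]) (use okq Ss(1) in \<open>auto simp: ok_def\<close>)
        qed
        moreover have "w \<in> space ?P" using w by (auto simp: A_def)
        ultimately show "w \<in> gap_event D N loss T \<SS> r" by (simp add: gap_event_def)
      qed
    qed
  qed
  finally show ?thesis .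
qed

end

lemma embedded_choice:
  assumes T: "T > 0" and emb: "embedded np nin T \<SS> \<LL> \<Phi>"
  shows "\<exists>Sg ph. \<forall>\<S>\<in>\<SS>. Sg \<S> \<in> \<LL> \<and> ph \<S> \<in> \<Phi> \<and>
    (\<forall>u\<in>L2_on nin {0..T}. nl_output T \<S> u T = lpv_output np T (Sg \<S>) u (ph \<S> u) T)"
proof -
  obtain Sg where Sg: "\<forall>\<S>\<in>\<SS>. Sg \<S> \<in> \<LL> \<and> (\<exists>\<phi>\<in>\<Phi>. \<forall>u\<in>L2_on nin {0..T}. \<forall>t\<in>{0..T}.
      nl_output T \<S> u t = lpv_output np T (Sg \<S>) u (\<phi> u) t)"
    using emb unfolding embedded_def Bex_def by (rule bchoice[THEN exE])
  then have "\<forall>\<S>\<in>\<SS>. \<exists>\<phi>. \<phi> \<in> \<Phi> \<and> (\<forall>u\<in>L2_on nin {0..T}. \<forall>t\<in>{0..T}.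
      nl_output T \<S> u t = lpv_output np T (Sg \<S>) u (\<phi> u) t)"
    unfolding Bex_def by (intro ballI) (drule (1) bspec, erule conjunct2)
  then obtain ph where ph: "\<forall>\<S>\<in>\<SS>. ph \<S> \<in> \<Phi> \<and> (\<forall>u\<in>L2_on nin {0..T}. \<forall>t\<in>{0..T}.
      nl_output T \<S> u t = lpv_output np T (Sg \<S>) u (ph \<S> u) t)"
    by (rule bchoice[THEN exE])
  have TT: "T \<in> {0..T}" using T by simp
  show ?thesis
  proof (intro exI ballI conjI)
    fix \<S> assume S: "\<S> \<in> \<SS>"
    show "Sg \<S> \<in> \<LL>" by (rule conjunct1[OF bspec[OF Sg S]])
    show "ph \<S> \<in> \<Phi>" by (rule conjunct1[OF bspec[OF ph S]])
    fix u assume u: "u \<in> L2_on nin {0..T}"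
    show "nl_output T \<S> u T = lpv_output np T (Sg \<S>) u (ph \<S> u) T"
      by (rule bspec[OF bspec[OF conjunct2[OF bspec[OF ph S]] u] TT])
  qed
qed

theorem theorem5p2:
  fixes np nin :: nat
    and T lam K\<^sub>l L\<^sub>u K\<^sub>u c\<^sub>1 c\<^sub>2 B :: real
    and loss :: "real \<Rightarrow> real \<Rightarrow> real"
    and \<LL> :: "lpv set" and \<SS> :: "nlsys set" and \<Phi> :: "(signal \<Rightarrow> signal) set"
    and D :: "(signal \<times> real) measure"
  assumes T: "T > 0"
    and \<LL>: "\<And>\<Sigma>. \<Sigma> \<in> \<LL> \<Longrightarrow> lpv_system np nin \<Sigma>"
    and \<Phi>: "\<Phi> \<subseteq> sched_maps np nin"
    and \<SS>: "\<And>\<S>. \<S> \<in> \<SS> \<Longrightarrow> nl_system nin \<S>"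
    and emb: "embedded np nin T \<SS> \<LL> \<Phi>"
    and D: "prob_space D" "space D \<subseteq> L2_on nin {0..T} \<times> UNIV"
    and meas_loss: "\<And>\<S>. \<S> \<in> \<SS> \<Longrightarrow> loss_at loss T \<S> \<in> borel_measurable D"
    and meas_gap: "\<And>N r. gap_event D N loss T \<SS> r \<in> sets (iid_sample D N)"
    and asm1: "lam \<ge> real np" "\<And>\<Sigma>. \<Sigma> \<in> \<LL> \<Longrightarrow> lpv_lmi np lam \<Sigma>"
    and asm2: "K\<^sub>l-lipschitz_on UNIV (\<lambda>(y, z). loss y z)" "\<And>y. loss y y = 0"
    and asm3_pos: "L\<^sub>u > 0" "K\<^sub>u > 0" "c\<^sub>1 > 0" "c\<^sub>2 > 0"
    and asm3_sys: "(SUP \<Sigma>\<in>\<LL>. h2_norm np lam \<Sigma>) = ennreal c\<^sub>1"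
    and asm3_data: "AE (u, y) in D.
        (\<forall>t\<in>{0..T}. vnorm (u t) \<le> K\<^sub>u) \<and> L2_norm_on {0..T} u \<le> L\<^sub>u \<and> \<bar>y\<bar> < c\<^sub>2"
    and asm4: "finite \<Phi> \<or> (\<forall>T'>0. \<exists>d. has_vc_dim (sched_graphs nin T' \<Phi>) d)"
    and B_bound: "AE (u, y) in D. \<forall>\<Sigma>\<in>\<LL>. \<forall>\<phi>\<in>\<Phi>. \<bar>loss y (lpv_output np T \<Sigma> u (\<phi> u) T)\<bar> \<le> B"
    and B_le: "B \<le> 2 * K\<^sub>l * max c\<^sub>2 (c\<^sub>1 * L\<^sub>u)"
  shows "\<forall>\<delta> N. 0 < \<delta> \<and> \<delta> < 1 \<and> N \<ge> 1 \<longrightarrow>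
    (finite \<Phi> \<longrightarrow>
       measure (iid_sample D N)
         (gap_event D N loss T \<SS> (Rbar_finite (card \<Phi>) np K\<^sub>l c\<^sub>1 L\<^sub>u B N \<delta>)) \<ge> 1 - \<delta>) \<and>
    (\<forall>d. has_vc_dim (sched_graphs nin T \<Phi>) d \<and> d > 0 \<and> ln (2 * exp 1 * real N / real d) \<ge> 0 \<longrightarrow>
       measure (iid_sample D N)
         (gap_event D N loss T \<SS> (Rbar_vc d np K\<^sub>l c\<^sub>1 L\<^sub>u B N \<delta>)) \<ge> 1 - \<delta>)"
proof -
  have K0: "K\<^sub>l \<ge> 0" by (rule lipschitz_on_nonneg[OF asm2(1)])
  have lip: "\<bar>loss y z - loss y z'\<bar> \<le> K\<^sub>l * \<bar>z - z'\<bar>" for y z z'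
    using lipschitz_onD[OF asm2(1), of "(y, z)" "(y, z')"] by (simp add: dist_Pair_Pair dist_real_def)
  obtain Sg ph where rep: "\<forall>\<S>\<in>\<SS>. Sg \<S> \<in> \<LL> \<and> ph \<S> \<in> \<Phi> \<and>
      (\<forall>u\<in>L2_on nin {0..T}. nl_output T \<S> u T = lpv_output np T (Sg \<S>) u (ph \<S> u) T)"
    using embedded_choice[OF T emb] by (elim exE)
  have Sg: "Sg \<S> \<in> \<LL>" and ph: "ph \<S> \<in> \<Phi>" if "\<S> \<in> \<SS>" for \<S>
    by (rule conjunct1[OF bspec[OF rep that]], rule conjunct1[OF conjunct2[OF bspec[OF rep that]]])
  have out: "nl_output T \<S> u T = lpv_output np T (Sg \<S>) u (ph \<S> u) T"
    if S: "\<S> \<in> \<SS>" and u: "u \<in> L2_on nin {0..T}" for \<S> u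
    using bspec[OF rep S] by (elim conjE) (erule bspec[OF _ u])
  have loss_eq: "loss_at loss T \<S> z = loss (snd z) (lpv_output np T (Sg \<S>) (fst z) (ph \<S> (fst z)) T)"
    if "\<S> \<in> \<SS>" "z \<in> space D" for \<S> z
    using out[OF that(1), of "fst z"] D(2) that(2) by (auto simp: loss_at_def split_def)
  \<comment> \<open>One full-measure set for all almost sure properties used below, the loss bound
    being imposed for all systems simultaneously.\<close>
  define good where "good z \<longleftrightarrow> z \<in> space D \<and> (\<forall>t\<in>{0..T}. vnorm (fst z t) \<le> K\<^sub>u) \<and> L2_norm_on {0..T} (fst z) \<le> L\<^sub>u
      \<and> (\<forall>\<S>\<in>\<SS>. \<bar>loss_at loss T \<S> z\<bar> \<le> B)" for z
  have good: "AE z in D. good z"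
    using asm3_data B_bound AE_space
  proof eventually_elim
    case (elim z)
    have "\<bar>loss_at loss T \<S> z\<bar> \<le> B" if "\<S> \<in> \<SS>" for \<S>
      using elim(2) Sg[OF that] ph[OF that] unfolding loss_eq[OF that elim(3)] by (auto simp: split_def)
    then show ?case using elim unfolding good_def by (auto simp: split_def)
  qed
  show ?thesis
  \<comment> \<open>A member of \<open>\<SS>\<close> is the witness for \<open>B \<ge> 0\<close>;
    for the empty family every sample lies in the gap event.\<close>
  proof (cases "\<SS> = {}")
    case True
    have "measure (iid_sample D N) (gap_event D N loss T \<SS> r) = 1" for N r
    proof -
      interpret P: prob_space "iid_sample D N" unfolding iid_sample_def by (rule prob_space.prob_space_PiM_const[OF D(1)])
      have "gap_event D N loss T \<SS> r = space (iid_sample D N)" using True by (simp add: gap_event_def)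
      then show ?thesis by (simp add: P.prob_space)
    qed
    then show ?thesis by simp
  next
    case False
    interpret D: prob_space D by (rule D(1))
    obtain z0 where "good z0"
      using eventually_happens'[OF D.ae_filter_bot good] by (rule exE)
    then have B0: "B \<ge> 0" using False unfolding good_def by (meson abs_ge_zero equals0I order_trans)
    have lp: "learning_problem D loss T B \<SS> N" if "N \<ge> 1" for N
    proof unfold_locales
      show "AE z in D. \<forall>\<S>\<in>\<SS>. \<bar>loss_at loss T \<S> z\<bar> \<le> B"
        by (rule eventually_mono[OF good]) (simp add: good_def)
    qed (use meas_loss meas_gap B0 that in auto)
    have sys: "lpv_system np nin (Sg \<S>)" if "\<S> \<in> \<SS>" for \<S> by (rule \<LL>[OF Sg[OF that]])
    have h2: "h2_norm np lam (Sg \<S>) \<le> ennreal c\<^sub>1" if "\<S> \<in> \<SS>" for \<S>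
      unfolding asm3_sys[symmetric] by (rule SUP_upper[OF Sg[OF that]])
    have adm: "admissible np nin T (fst z) (\<phi> (fst z))"
      and L2: "integral {0..T} (\<lambda>\<tau>. \<Sum>l<nin. (vec_index (fst z \<tau>) l)\<^sup>2) \<le> L\<^sub>u\<^sup>2" if z: "good z" and \<phi>: "\<phi> \<in> \<Phi>" for z \<phi>
    proof -
      have u: "fst z \<in> L2_on nin {0..T}" using z D(2) by (auto simp: good_def)
      have "fst z \<in> L2_on nin {0..}" using u L2_on_mono[of "{0..T}" "{0..}" nin] by auto
      then have p: "\<phi> (fst z) \<in> PC_sched np" using \<phi> \<Phi> by (auto simp: sched_maps_def)
      have vK: "vnorm (fst z t) \<le> K\<^sub>u" if "t \<in> {0..T}" for t using z that by (auto simp: good_def)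
      show "admissible np nin T (fst z) (\<phi> (fst z))" by (rule bounded_L2_admissible(1)[OF u vK p])
      have eq: "integral {0..T} (\<lambda>\<tau>. \<Sum>l<nin. (vec_index (fst z \<tau>) l)\<^sup>2) = (L2_norm_on {0..T} (fst z))\<^sup>2"
        by (rule bounded_L2_admissible(2)[OF u vK p])
      have "0 \<le> L2_norm_on {0..T} (fst z)"
        unfolding L2_norm_on_def set_lebesgue_integral_def
        by (intro real_sqrt_ge_zero Bochner_Integration.integral_nonneg) auto
      then show "integral {0..T} (\<lambda>\<tau>. \<Sum>l<nin. (vec_index (fst z \<tau>) l)\<^sup>2) \<le> L\<^sub>u\<^sup>2"
        unfolding eq using z by (intro power_mono) (auto simp: good_def)
    qed
    have finite_case: "1 - \<delta> \<le> measure (iid_sample D N) (gap_event D N loss T \<SS> (Rbar_finite (card \<Phi>) np K\<^sub>l c\<^sub>1 L\<^sub>u B N \<delta>))"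
      if \<delta>: "0 < \<delta>" "\<delta> < 1" and N: "N \<ge> 1" and fin: "finite \<Phi>" for \<delta> N
    proof -
      interpret learning_problem D loss T B \<SS> N by (rule lp[OF N])
      have ln: "ln (2 / \<delta>) > 0" using \<delta> by simp
      show ?thesis
      \<comment> \<open>McDiarmid's inequality needs a positive bound on the differences. For
        \<open>B = 0\<close> no gap is positive almost surely, and the claimed bound is
        nonnegative.\<close>
      proof (cases "B = 0")
        case True
        show ?thesis
        proof (rule trivial_gap)
          show "Rbar_finite (card \<Phi>) np K\<^sub>l c\<^sub>1 L\<^sub>u B N \<delta> \<ge> 2 * B"
            unfolding Rbar_finite_def using True K0 asm3_pos by simp
        qed fact
      next
        case False
        then have Bpos: "B > 0" using B0 by simp
        \<comment> \<open>The 2 stems from symmetrization, \<open>K\<^sub>l\<close> from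
          contraction, and the rest is the Rademacher bound; dividing by \<open>real N\<close>
          leaves \<open>1 / sqrt (real N)\<close>.\<close>
        define \<rho> where "\<rho> = 2 * K\<^sub>l * (real (card \<Phi>) * (c\<^sub>1 * (sqrt (real N) * ((real np + 1) * L\<^sub>u))))"
        have \<rho>: "\<rho> / real N + B * sqrt (2 * ln (2 / \<delta>) / real N) = Rbar_finite (card \<Phi>) np K\<^sub>l c\<^sub>1 L\<^sub>u B N \<delta>"
        proof -
          have "sqrt (real N) / real N = 1 / sqrt (real N)" using N by (simp add: field_simps)
          moreover have "\<rho> / real N = 2 * real (card \<Phi>) * K\<^sub>l * c\<^sub>1 * L\<^sub>u * (real np + 1) * (sqrt (real N) / real N)"
            by (simp add: \<rho>_def mult_ac)
          ultimately show ?thesis unfolding Rbar_finite_def by simp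
        qed
        obtain Q where Q: "countable Q" "Q \<subseteq> \<SS>"
          and dense: "\<forall>S\<in>\<SS>. \<exists>Ss. (\<forall>m. Ss m \<in> Q \<and> nx (Sg (Ss m)) = nx (Sg S) \<and> ph (Ss m) = ph S)
             \<and> (\<lambda>m. lpv_entries (Sg (Ss m))) \<longlonglongrightarrow> lpv_entries (Sg S)"
          by (rule countable_dense_systems[where Sg = Sg, OF countable_finite[OF fin] ph])
        show ?thesis
        proof (rule gap_from_countable[OF Q good _ _ \<delta>(1)])
          fix \<S> assume S: "\<S> \<in> \<SS>"
          obtain Ss where Ss0: "\<forall>m. Ss m \<in> Q \<and> nx (Sg (Ss m)) = nx (Sg \<S>) \<and> ph (Ss m) = ph \<S>"
            and lim: "(\<lambda>m. lpv_entries (Sg (Ss m))) \<longlonglongrightarrow> lpv_entries (Sg \<S>)"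
            using bspec[OF dense S] by (elim exE conjE)
          have Ss: "Ss m \<in> Q" "nx (Sg (Ss m)) = nx (Sg \<S>)" "ph (Ss m) = ph \<S>" for m
            using spec[OF Ss0, of m] by simp_all
          have "(\<lambda>m. loss_at loss T (Ss m) z) \<longlonglongrightarrow> loss_at loss T \<S> z" if z: "good z" for z
          proof -
            have zs: "z \<in> space D" using z by (simp add: good_def)
            have SsS: "Ss m \<in> \<SS>" for m using Ss(1) Q(2) by auto
            define ym where "ym m = lpv_output np T (Sg (Ss m)) (fst z) (ph \<S> (fst z)) T" for m
            define y where "y = lpv_output np T (Sg \<S>) (fst z) (ph \<S> (fst z)) T"
            have "ym \<longlonglongrightarrow> y"
              unfolding ym_def y_def
              by (rule lpv_output_tendsto[OF sys[OF SsS] sys[OF S] Ss(2) _ _ _ T adm[OF z ph[OF S]]])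
                (use lpv_entries_tendsto[OF lim] in auto)
            then have "(\<lambda>m. K\<^sub>l * \<bar>ym m - y\<bar>) \<longlonglongrightarrow> K\<^sub>l * \<bar>y - y\<bar>" by (intro tendsto_intros)
            then have l0: "(\<lambda>m. K\<^sub>l * \<bar>ym m - y\<bar>) \<longlonglongrightarrow> 0" by simp
            have "(\<lambda>m. loss (snd z) (ym m) - loss (snd z) y) \<longlonglongrightarrow> 0"
              by (rule Lim_null_comparison[OF _ l0], rule always_eventually) (use lip in simp)
            then show ?thesis
              unfolding loss_eq[OF SsS zs] loss_eq[OF S zs] Ss(3) ym_def y_def by (rule LIM_zero_cancel)
          qed
          then show "\<exists>Ss. (\<forall>m. Ss m \<in> Q) \<and> (\<forall>z. good z \<longrightarrow> (\<lambda>m. loss_at loss T (Ss m) z) \<longlonglongrightarrow> loss_at loss T \<S> z)"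
            using Ss(1) by blast
        next
          fix F assume F: "finite F" "F \<noteq> {}" "F \<subseteq> Q"
          have FS: "\<S> \<in> \<SS>" if "\<S> \<in> F" for \<S> using F(3) Q(2) that by auto
          \<comment> \<open>Clipping makes the bound \<open>B\<close> hold everywhere, as the
            concentration argument demands; at \<open>good\<close> samples the loss is
            unchanged.\<close>
          define f where "f \<S> z = max (- B) (min B (loss_at loss T \<S> z))" for \<S> z
          have fg: "f \<S> z = loss_at loss T \<S> z" if "good z" "\<S> \<in> F" for \<S> z
          proof -
            have "\<bar>loss_at loss T \<S> z\<bar> \<le> B" using that FS by (simp add: good_def)
            then show ?thesis unfolding f_def by linarith
          qed
          have fm: "f \<S> \<in> borel_measurable D" if "\<S> \<in> F" for \<S>
            unfolding f_def[abs_def] by (intro borel_measurable_max borel_measurable_min borel_measurable_const meas_loss FS that)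
          have fB: "\<bar>f \<S> z\<bar> \<le> B" for \<S> z unfolding f_def using Bpos by linarith
          have mean: "AE w in Pi\<^sub>M {..<N} (\<lambda>_. D). sign_mean N (\<lambda>\<sigma>. Max ((\<lambda>\<S>. \<Sum>i<N. \<sigma> i * (2 * f \<S> (w i))) ` F)) \<le> \<rho>"
            using AE_sample[OF good] unfolding iid_sample_def
          proof eventually_elim
            case (elim w)
            \<comment> \<open>The scaling absorbs the Lipschitz constant and the 2 of
              symmetrization, so that the contraction principle applies with constant 1.\<close>
            define ys where "ys i \<S> = 2 * K\<^sub>l * lpv_output np T (Sg \<S>) (fst (w i)) (ph \<S> (fst (w i))) T" for i \<S>
            have contr: "\<bar>2 * f \<S> (w i) - 2 * f \<S>' (w i)\<bar> \<le> \<bar>ys i \<S> - ys i \<S>'\<bar>" if i: "i < N" and S: "\<S> \<in> F" "\<S>' \<in> F" for i \<S> \<S>'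
            proof -
              have g: "good (w i)" using elim i by simp
              then have sp: "w i \<in> space D" by (simp add: good_def)
              have "\<bar>f \<S> (w i) - f \<S>' (w i)\<bar> \<le> K\<^sub>l * \<bar>lpv_output np T (Sg \<S>) (fst (w i)) (ph \<S> (fst (w i))) T - lpv_output np T (Sg \<S>') (fst (w i)) (ph \<S>' (fst (w i))) T\<bar>"
                unfolding fg[OF g S(1)] fg[OF g S(2)] loss_eq[OF FS[OF S(1)] sp] loss_eq[OF FS[OF S(2)] sp] by (rule lip)
              moreover have "\<bar>2 * f \<S> (w i) - 2 * f \<S>' (w i)\<bar> = 2 * \<bar>f \<S> (w i) - f \<S>' (w i)\<bar>"
                unfolding right_diff_distrib[symmetric] abs_mult by simp
              moreover have "\<bar>ys i \<S> - ys i \<S>'\<bar> = 2 * (K\<^sub>l * \<bar>lpv_output np T (Sg \<S>) (fst (w i)) (ph \<S> (fst (w i))) T - lpv_output np T (Sg \<S>') (fst (w i)) (ph \<S>' (fst (w i))) T\<bar>)"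
                unfolding ys_def right_diff_distrib[symmetric] abs_mult using K0 by simp
              ultimately show ?thesis by linarith
            qed
            have "\<exists>\<S>\<in>F. Max ((\<lambda>\<S>. \<Sum>i<N. \<sigma> i * ys i \<S>) ` F) = (\<Sum>i<N. \<sigma> i * ys i \<S>)" for \<sigma> :: "nat \<Rightarrow> real"
            proof -
              have "Max ((\<lambda>\<S>. \<Sum>i<N. \<sigma> i * ys i \<S>) ` F) \<in> (\<lambda>\<S>. \<Sum>i<N. \<sigma> i * ys i \<S>) ` F"
                using F by (intro Max_in) auto
              then show ?thesis by auto
            qed
            \<comment> \<open>A maximizer for each sign vector turns the maximum into one system
              selected by the signs, the situation of \<open>lpv_rademacher_bound\<close>.\<close>
            then obtain sel where sel: "\<And>\<sigma>. sel \<sigma> \<in> F" "\<And>\<sigma> :: nat \<Rightarrow> real. Max ((\<lambda>\<S>. \<Sum>i<N. \<sigma> i * ys i \<S>) ` F) = (\<Sum>i<N. \<sigma> i * ys i (sel \<sigma>))"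
              by metis
            have selS: "sel \<sigma> \<in> \<SS>" for \<sigma> using sel(1) FS by auto
            have "sign_mean N (\<lambda>\<sigma>. Max ((\<lambda>\<S>. \<Sum>i<N. \<sigma> i * (2 * f \<S> (w i))) ` F)) \<le> sign_mean N (\<lambda>\<sigma>. Max ((\<lambda>\<S>. \<Sum>i<N. \<sigma> i * ys i \<S>) ` F))"
              using sign_mean_contraction[OF F(1,2) contr, where c = "\<lambda>_. 0"] by simp
            also have "\<dots> = sign_mean N (\<lambda>\<sigma>. 2 * K\<^sub>l * (\<Sum>i<N. \<sigma> i * lpv_output np T (Sg (sel \<sigma>)) (fst (w i)) (ph (sel \<sigma>) (fst (w i))) T))"
              unfolding sel(2) by (simp add: ys_def sum_distrib_left mult_ac)
            also have "\<dots> \<le> \<rho>"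
              unfolding sign_mean_cmult \<rho>_def
            proof (rule mult_left_mono)
              have g: "good (w j)" if "j < N" for j using elim that by simp
              have adm': "admissible np nin T (fst (w j)) (\<phi> (fst (w j)))" if "j < N" "\<phi> \<in> \<Phi>" for j \<phi>
                by (rule adm[OF g[OF that(1)] that(2)])
              have L2': "integral {0..T} (\<lambda>\<tau>. \<Sum>l<nin. (vec_index (fst (w j) \<tau>) l)\<^sup>2) \<le> L\<^sub>u\<^sup>2" if "j < N" for j
                by (rule L2[OF g[OF that] ph[OF selS]])
              show "sign_mean N (\<lambda>\<sigma>. \<Sum>i<N. \<sigma> i * lpv_output np T (Sg (sel \<sigma>)) (fst (w i)) (ph (sel \<sigma>) (fst (w i))) T)
                  \<le> real (card \<Phi>) * (c\<^sub>1 * (sqrt (real N) * ((real np + 1) * L\<^sub>u)))"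
                by (rule lpv_rademacher_bound[OF fin T asm1(1) N asm3_pos(3,1)])
                  (fact sys[OF selS] h2[OF selS] ph[OF selS] adm' L2')+
            qed (use K0 in simp)
            finally show ?case .
          qed
          have "1 - \<delta> \<le> measure (Pi\<^sub>M {..<N} (\<lambda>_. D)) {w \<in> space (Pi\<^sub>M {..<N} (\<lambda>_. D)).
              \<forall>\<S>\<in>F. D.expectation (f \<S>) - (\<Sum>i<N. f \<S> (w i)) / real N \<le> \<rho> / real N + B * sqrt (2 * ln (2 / \<delta>) / real N)}"
            by (rule D.finite_class_generalization[OF F(1,2) N \<delta> Bpos fm fB mean])
          also have "\<dots> \<le> measure (iid_sample D N) {w \<in> space (iid_sample D N). \<forall>\<S>\<in>F. true_risk D loss T \<S> - emp_risk N loss T w \<S> \<le> Rbar_finite (card \<Phi>) np K\<^sub>l c\<^sub>1 L\<^sub>u B N \<delta>}"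
            unfolding \<rho> iid_sample_def[symmetric]
          proof (rule P.finite_measure_mono_AE)
            have risk: "true_risk D loss T \<S> = D.expectation (f \<S>)" if "\<S> \<in> F" for \<S>
              unfolding true_risk_def
              by (rule integral_cong_AE[OF meas_loss[OF FS[OF that]] fm[OF that]], rule eventually_mono[OF good]) (use fg that in auto)
            show "AE w in iid_sample D N. w \<in> {w \<in> space (iid_sample D N). \<forall>\<S>\<in>F. D.expectation (f \<S>) - (\<Sum>i<N. f \<S> (w i)) / real N \<le> Rbar_finite (card \<Phi>) np K\<^sub>l c\<^sub>1 L\<^sub>u B N \<delta>}
                \<longrightarrow> w \<in> {w \<in> space (iid_sample D N). \<forall>\<S>\<in>F. true_risk D loss T \<S> - emp_risk N loss T w \<S> \<le> Rbar_finite (card \<Phi>) np K\<^sub>l c\<^sub>1 L\<^sub>u B N \<delta>}"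
              using AE_sample[OF good]
            proof eventually_elim
              case (elim w)
              have "emp_risk N loss T w \<S> = (\<Sum>i<N. f \<S> (w i)) / real N" if "\<S> \<in> F" for \<S>
                unfolding emp_risk_def by (intro arg_cong2[where f = "(/)"] sum.cong refl fg[symmetric]) (use elim that in auto)
              then show ?case using risk by simp
            qed
            show "{w \<in> space (iid_sample D N). \<forall>\<S>\<in>F. true_risk D loss T \<S> - emp_risk N loss T w \<S> \<le> Rbar_finite (card \<Phi>) np K\<^sub>l c\<^sub>1 L\<^sub>u B N \<delta>} \<in> sets (iid_sample D N)"
              by (rule sets.sets_Collect_finite_All[OF gap_measurable[OF FS] F(1)])
          qed
          finally show "1 - \<delta> \<le> measure (iid_sample D N) {w \<in> space (iid_sample D N). \<forall>\<S>\<in>F. true_risk D loss T \<S> - emp_risk N loss T w \<S> \<le> Rbar_finite (card \<Phi>) np K\<^sub>l c\<^sub>1 L\<^sub>u B N \<delta>}" .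
        qed
      qed
    qed
    have vc_case: "1 - \<delta> \<le> measure (iid_sample D N) (gap_event D N loss T \<SS> (Rbar_vc d np K\<^sub>l c\<^sub>1 L\<^sub>u B N \<delta>))"
      if \<delta>: "0 < \<delta>" "\<delta> < 1" and N: "N \<ge> 1" and d: "ln (2 * exp 1 * real N / real d) \<ge> 0" for \<delta> N d
    proof -
      interpret learning_problem D loss T B \<SS> N by (rule lp[OF N])
      show ?thesis
        \<comment> \<open>The first summand of the bound alone is at least 2 * B, which exceeds every gap.\<close>
      proof (rule trivial_gap[OF _ \<delta>(1)])
        have "1 * (B * 2) \<le> sqrt 2 * (B * (2 + sqrt (ln (2 * exp 1 * real N / real d) * real d)))"
          using B0 d by (intro mult_mono) auto
        moreover have "0 \<le> 2 * K\<^sub>l * c\<^sub>1 * L\<^sub>u * (real np + 1) / sqrt (real N)" using K0 asm3_pos by simp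
        moreover have "0 \<le> B * sqrt (2 * ln (2 / \<delta>) / sqrt (real N))" using B0 \<delta> by simp
        ultimately show "2 * B \<le> Rbar_vc d np K\<^sub>l c\<^sub>1 L\<^sub>u B N \<delta>" unfolding Rbar_vc_def by (simp add: mult.assoc)
      qed
    qed
    show ?thesis by (intro allI impI conjI finite_case vc_case) (elim conjE, assumption)+
  qed
qed

end
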